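(* Suppose $V=U+\phi$ with $V,U,\phi\in C^2(\mathbb{R}^d)$, $\nabla^2U\succeq K I$ for some $K>0$, and $\phi\in L^\infty(\mathbb{R}^d)$. Let $\{\theta_t\}_{t\ge 0}\subset\Theta$ solve the parametric Fokker--Planck equation $\dot\theta_t=-G(\theta_t)^{-1}\nabla_\theta H(\theta_t)$. Then for all $t\ge 0$, $$\mathcal{D}_{\mathrm{KL}}(\rho_{\theta_t}\|\rho_* )\le \frac{\delta_0}{\tilde\lambda_D D^2}\bigl(1-e^{-D\tilde\lambda_D t}\bigr)+\mathcal{D}_{\mathrm{KL}}(\rho_{\theta_0}\|\rho_* )\,e^{-D\tilde\lambda_D t}.$$ Here $\tilde\lambda_D=\frac{K}{D}e^{-\mathrm{osc}(\phi)/D}>0$ with $\mathrm{osc}(\phi)=\sup\phi-\inf\phi$, which is the logarithmic Sobolev constant associated with the potential $\frac1D V$.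
   Context: All integrals are over $\mathbb{R}^d$. Fix a diffusion coefficient $D>0$ and a potential $V:\mathbb{R}^d\to\mathbb{R}$; the Gibbs density is $\rho_*=\frac{1}{Z_D}e^{-V/D}$, $Z_D=\int e^{-V/D}dx$. The Fokker--Planck equation is $\partial_t\rho=\nabla\cdot(\rho\nabla V)+D\Delta\rho$. $\mathcal{D}_{\mathrm{KL}}(\rho\|\rho_* )=\int\rho\log(\rho/\rho_* )dx$. Parametric setting: $\Theta\subset\mathbb{R}^m$ is open and convex; $T_\theta:\mathbb{R}^d\to\mathbb{R}^d$ ($\theta\in\Theta$) are invertible maps with $T_\theta(x)\in C^2(\Theta\times\mathbb{R}^d)$; $p$ is a reference probability measure on $\mathbb{R}^d$ with positive density and finite second moment; $\rho_\theta$ is the density of the pushforward $T_{\theta\sharp}p$. Condition 1: $\int|T_\theta(x)|^2dp(x)<\infty$ for all $\theta\in\Theta$. Condition 2: for each $\theta_*\in\Theta$ there are $r(\theta_* )>0$ and functions $L_1(\cdot|\theta_* ),L_2(\cdot|\theta_* )\in L^1(p)$ with $\|\partial_\theta T_\theta(x)\|_F\le L_1(x|\theta_* )$ and $\|\partial_\theta T_\theta(x)\|_F^2\le L_2(x|\theta_* )$ for all $x$ and all $|\theta-\theta_*|<r(\theta_* )$. For $j=1,\dots,m$, $\psi_j$ (depending on $\theta$) solves $\nabla\cdot(\rho_\theta\nabla\psi_j)=\nabla\cdot(\rho_\theta\,\frac{\partial T_\theta}{\partial\theta_j}\circ T_\theta^{-1})$ with $\lim_{x\to\infty}\rho_\theta(x)\nabla\psi_j(x)=0$.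 The metric tensor $G(\theta)$ is the $m\times m$ matrix $G_{ij}(\theta)=\int\nabla\psi_i(T_\theta(x))\cdot\nabla\psi_j(T_\theta(x))\,dp(x)$, assumed positive definite for every $\theta\in\Theta$. Set $H(\theta)=D\,\mathcal{D}_{\mathrm{KL}}(\rho_\theta\|\rho_* )$. Finally $$\delta_0=\sup_{\theta\in\Theta}\min_{\xi\in\mathbb{R}^m}\int\Bigl|\sum_{k=1}^m\xi_k\nabla\psi_k(x)-\nabla\bigl(V(x)+D\log\rho_\theta(x)\bigr)\Bigr|^2\rho_\theta(x)\,dx.$$ *)

theory Defs
  imports "HOL-Probability.Probability"
begin

definition C2_on :: "'a::real_normed_vector set \<Rightarrow> ('a \<Rightarrow> 'b::real_normed_vector) \<Rightarrow> bool"
  where "C2_on S f \<longleftrightarrow> (\<exists>(f' :: 'a \<Rightarrow> 'a \<Rightarrow>\<^sub>L 'b) (f'' :: 'a \<Rightarrow> 'a \<Rightarrow>\<^sub>L 'a \<Rightarrow>\<^sub>L 'b).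
    (\<forall>x\<in>S. (f has_derivative blinfun_apply (f' x)) (at x)) \<and>
    (\<forall>x\<in>S. (f' has_derivative blinfun_apply (f'' x)) (at x)) \<and>
    continuous_on S f'')"

definition grad :: "(real^'n \<Rightarrow> real) \<Rightarrow> real^'n \<Rightarrow> real^'n"
  where "grad f x = (\<chi> i. frechet_derivative f (at x) (axis i 1))"

definition hessian :: "(real^'n \<Rightarrow> real) \<Rightarrow> real^'n \<Rightarrow> real^'n^'n"
  where "hessian f x = jacobian (grad f) (at x)"

definition loewner_le :: "real^'n^'n \<Rightarrow> real^'n^'n \<Rightarrow> bool"
  where "loewner_le A B \<longleftrightarrow> (\<forall>h. h \<bullet> (A *v h) \<le> h \<bullet> (B *v h))"

definition positive_definite :: "real^'n^'n \<Rightarrow> bool"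
  where "positive_definite A \<longleftrightarrow> transpose A = A \<and> (\<forall>h. h \<noteq> 0 \<longrightarrow> 0 < h \<bullet> (A *v h))"

definition osc :: "('a \<Rightarrow> real) \<Rightarrow> real"
  where "osc f = (SUP x. f x) - (INF x. f x)"

definition gibbs :: "(real^'d \<Rightarrow> real) \<Rightarrow> real \<Rightarrow> real^'d \<Rightarrow> real"
  where "gibbs V D x = exp (- V x / D) / (\<integral>y. exp (- V y / D) \<partial>lborel)"

text \<open>The negative part of \<open>\<rho> log (\<rho> / \<sigma>)\<close> is at most \<open>\<sigma>\<close> when \<open>\<rho>\<close> and \<open>\<sigma>\<close> are probability
  densities, so the only way for the integral not to be finite is to be \<open>+\<infinity>\<close>.  The value is
  extended real to avoid the convention that a divergent Bochner integral is 0.\<close>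

definition KL :: "(real^'d \<Rightarrow> real) \<Rightarrow> (real^'d \<Rightarrow> real) \<Rightarrow> ereal"
  where "KL \<rho> \<sigma> =
    (if integrable lborel (\<lambda>x. \<rho> x * ln (\<rho> x / \<sigma> x))
     then ereal (\<integral>x. \<rho> x * ln (\<rho> x / \<sigma> x) \<partial>lborel) else \<infinity>)"

text \<open>A gradient at \<open>x\<close> of an extended-real function includes finiteness near \<open>x\<close>.\<close>

definition has_gradient :: "(real^'n \<Rightarrow> ereal) \<Rightarrow> real^'n \<Rightarrow> real^'n \<Rightarrow> bool"
  where "has_gradient f g x \<longleftrightarrow>
    (\<forall>\<^sub>F y in nhds x. \<bar>f y\<bar> \<noteq> \<infinity>) \<and> (GDERIV (\<lambda>y. real_of_ereal (f y)) x :> g)"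

text \<open>The \<open>d \<times> m\<close> matrix of partial derivatives of \<open>T\<close> in the parameter at \<open>\<theta>\<close>.
  The library norm on this matrix type is the Frobenius norm.\<close>

definition param_jacobian ::
    "(real^'m \<Rightarrow> real^'d \<Rightarrow> real^'d) \<Rightarrow> real^'m \<Rightarrow> real^'d \<Rightarrow> real^'m^'d"
  where "param_jacobian T \<theta> x = jacobian (\<lambda>\<theta>'. T \<theta>' x) (at \<theta>)"

definition param_velocity ::
    "(real^'m \<Rightarrow> real^'d \<Rightarrow> real^'d) \<Rightarrow> real^'m \<Rightarrow> 'm \<Rightarrow> real^'d \<Rightarrow> real^'d"
  where "param_velocity T \<theta> j y = column j (param_jacobian T \<theta> (inv (T \<theta>) y))"

text \<open>Equality of the divergences of two vector fields in the sense of distributions.\<close>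

definition test_function :: "(real^'d \<Rightarrow> real) \<Rightarrow> bool"
  where "test_function \<eta> \<longleftrightarrow>
    (\<forall>x. \<eta> differentiable (at x)) \<and> continuous_on UNIV (grad \<eta>) \<and> bounded {x. \<eta> x \<noteq> 0}"

definition same_divergence :: "(real^'d \<Rightarrow> real^'d) \<Rightarrow> (real^'d \<Rightarrow> real^'d) \<Rightarrow> bool"
  where "same_divergence F F' \<longleftrightarrow> (\<forall>\<eta>. test_function \<eta> \<longrightarrow>
    integrable lborel (\<lambda>x. F x \<bullet> grad \<eta> x) \<and>
    integrable lborel (\<lambda>x. F' x \<bullet> grad \<eta> x) \<and>
    (\<integral>x. F x \<bullet> grad \<eta> x \<partial>lborel) = (\<integral>x. F' x \<bullet> grad \<eta> x \<partial>lborel))"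

definition solves_potential_eq ::
    "(real^'d \<Rightarrow> real) \<Rightarrow> (real^'d \<Rightarrow> real^'d) \<Rightarrow> (real^'d \<Rightarrow> real) \<Rightarrow> bool"
  where "solves_potential_eq \<rho> v \<psi> \<longleftrightarrow>
    (\<forall>x. \<psi> differentiable (at x)) \<and>
    same_divergence (\<lambda>x. \<rho> x *\<^sub>R grad \<psi> x) (\<lambda>x. \<rho> x *\<^sub>R v x) \<and>
    ((\<lambda>x. \<rho> x *\<^sub>R grad \<psi> x) \<longlongrightarrow> 0) at_infinity"

definition metric_tensor ::
    "(real^'d) measure \<Rightarrow> (real^'m \<Rightarrow> real^'d \<Rightarrow> real^'d) \<Rightarrow> ('m \<Rightarrow> real^'m \<Rightarrow> real^'d \<Rightarrow> real)
      \<Rightarrow> real^'m \<Rightarrow> real^'m^'m"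
  where "metric_tensor p T \<psi> \<theta> =
    (\<chi> i j. \<integral>x. grad (\<psi> i \<theta>) (T \<theta> x) \<bullet> grad (\<psi> j \<theta>) (T \<theta> x) \<partial>p)"

text \<open>Extended valued; the minimum over \<open>\<xi>\<close> is written as an infimum, which is attained since the
  functional is either identically infinite or a quadratic with positive definite leading part.\<close>

definition delta0 ::
    "(real^'m) set \<Rightarrow> (real^'d \<Rightarrow> real) \<Rightarrow> real \<Rightarrow> (real^'m \<Rightarrow> real^'d \<Rightarrow> real)
      \<Rightarrow> ('m \<Rightarrow> real^'m \<Rightarrow> real^'d \<Rightarrow> real) \<Rightarrow> ennreal"
  where "delta0 \<Theta> V D \<rho> \<psi> =
    (SUP \<theta>\<in>\<Theta>. INF \<xi> :: real^'m.
      \<integral>\<^sup>+x. ennreal ((norm ((\<Sum>k\<in>UNIV. \<xi> $ k *\<^sub>R grad (\<psi> k \<theta>) x)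
                     - grad (\<lambda>y. V y + D * ln (\<rho> \<theta> y)) x))\<^sup>2 * \<rho> \<theta> x) \<partial>lborel)"

definition free_energy ::
    "(real^'d \<Rightarrow> real) \<Rightarrow> real \<Rightarrow> (real^'m \<Rightarrow> real^'d \<Rightarrow> real) \<Rightarrow> real^'m \<Rightarrow> ereal"
  where "free_energy V D \<rho> \<theta> = ereal D * KL (\<rho> \<theta>) (gibbs V D)"

definition solves_parametric_FP ::
    "(real^'m) set \<Rightarrow> (real^'m \<Rightarrow> real^'m^'m) \<Rightarrow> (real^'m \<Rightarrow> ereal) \<Rightarrow> (real \<Rightarrow> real^'m) \<Rightarrow> bool"
  where "solves_parametric_FP \<Theta> G H \<theta> \<longleftrightarrow>
    (\<forall>t\<ge>0. \<theta> t \<in> \<Theta> \<and>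
      (\<exists>g. has_gradient H g (\<theta> t) \<and>
        (\<theta> has_vector_derivative - (matrix_inv (G (\<theta> t)) *v g)) (at t within {0..})))"

definition lsi_const :: "real \<Rightarrow> real \<Rightarrow> ('a \<Rightarrow> real) \<Rightarrow> real"
  where "lsi_const K D \<phi> = K / D * exp (- osc \<phi> / D)"

end

theory Submission
 imports Defs
begin

text \<open>
Put \<open>f = ln (\<rho> / \<rho>\<^sub>*)\<close>, so that \<open>D * grad f\<close> is the gradient of \<open>V + D ln \<rho>\<close>, and let \<open>u\<close> be the
relative entropy along the flow.  Formally the gradient of the entropy in parameter space has the
components \<open>a\<^sub>j = \<integral> grad f \<bullet> v\<^sub>j \<rho>\<close>, where \<open>v\<^sub>j\<close> is the velocity of the \<open>j\<close>-th parameter.  Since \<open>v\<^sub>j\<close>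
and \<open>grad \<psi>\<^sub>j\<close> have the same weak divergence, \<open>a\<^sub>j\<close> is also the inner product of \<open>grad f\<close> with
\<open>grad \<psi>\<^sub>j\<close>, and \<open>a \<bullet> G\<inverse> a\<close> is the squared length of the projection of \<open>grad f\<close> to the span of the
\<open>grad \<psi>\<^sub>j\<close>.  By definition the defect \<open>\<delta>\<^sub>0 / D\<^sup>2\<close> bounds the squared distance to that span, hence
\<open>u' = - D * (a \<bullet> G\<inverse> a) \<le> \<delta>\<^sub>0 / D - D * I\<close> with the Fisher information \<open>I = \<integral> |grad f|\<^sup>2 \<rho>\<close>.  The logarithmic
Sobolev inequality \<open>\<Lambda> u \<le> I\<close> closes this differential inequality (\<open>exponential_relaxation\<close>).

Three points need work.  The logarithmic Sobolev inequality for \<open>\<rho>\<^sub>*\<close> is derived from the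
Prekopa--Leindler inequality (\<open>log_sobolev_convex\<close>), a bounded perturbation of the potential
(\<open>log_sobolev_gibbs\<close>), and truncation of the relative density (\<open>log_sobolev_density\<close>).

The formula for the gradient of the entropy (\<open>entropy_gradient\<close>) cannot be obtained by differentiating
under the integral, because \<open>\<rho>\<close> is differentiable in space without any continuity of its gradient and
\<open>ln \<rho>\<close> has no uniform integrability.  The entropy is replaced by convex, compactly supported
regularisations, which are bounded below by their tangents; the tangents are integrals of fixed
functions against the moving density and obey the continuity equation (\<open>right_quotient\<close>).  As the
entropy is assumed to have a gradient, one-sided bounds in the directions \<open>e\<close> and \<open>- e\<close> suffice.

Passing to the limit in these bounds requires local boundedness of the Fisher information in the
parameter (\<open>fisher_information_bounded\<close>), which follows from finiteness of \<open>\<delta>\<^sub>0\<close> and positive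
definiteness of \<open>G\<close> by compactness.  The test functions of the weak equations are
extended to differentiable functions of finite energy in \<open>weak_divergence_extends\<close>.
\<close>

lemmas borel_of_cont = borel_measurable_continuous_onI
 and integrable_bd = Bochner_Integration.integrable_bound and integral_cg = Bochner_Integration.integral_cong

section \<open>Gradients and integration by parts\<close>

lemma grad_has_derivative:
 fixes f :: "real^'n => real"
 assumes "f differentiable (at x)"
 shows "(f has_derivative (%h. grad f x \<bullet> h)) (at x)"
proof -
 let ?f' = "frechet_derivative f (at x)"
 have d: "(f has_derivative ?f') (at x)"
  using assms by (simp add: frechet_derivative_works)
 then have lin: "linear ?f'"
  by (simp add: has_derivative_linear)
 have "?f' h = grad f x \<bullet> h" for h
 proof -
  have "?f' h = ?f' (\<Sum>i\<in>UNIV. h $ i *\<^sub>R axis i 1)"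
   by (simp add: basis_expansion flip: scalar_mult_eq_scaleR)
  also have "... = (\<Sum>i\<in>UNIV. h $ i * ?f' (axis i 1))"
   using lin by (simp add: linear_sum linear_scale o_def)
  also have "... = grad f x \<bullet> h"
   by (simp add: grad_def inner_vec_def mult.commute)
  finally show ?thesis .
 qed
 then have "?f' = (%h. grad f x \<bullet> h)" by auto
 with d show ?thesis by simp
qed

lemma grad_eqI:
 fixes f :: "real^'n => real"
 assumes "(f has_derivative (%h. g \<bullet> h)) (at x)"
 shows "grad f x = g"
proof -
 have "frechet_derivative f (at x) = (%h. g \<bullet> h)"
  using frechet_derivative_at[OF assms] by simp
 then show ?thesis
  by (simp add: grad_def vec_eq_iff inner_axis)
qed

lemma diff_imp_cont:
 fixes f :: "real^'n => real"
 assumes "!!x. f differentiable (at x)"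
 shows "continuous_on UNIV f"
 by (meson assms continuous_at_imp_continuous_on differentiable_imp_continuous_within)

lemma grad_mult:
 fixes f g :: "real^'n => real"
 assumes "f differentiable (at x)" "g differentiable (at x)"
 shows "grad (%y. f y * g y) x = f x *\<^sub>R grad g x + g x *\<^sub>R grad f x"
 by (rule grad_eqI)
   (auto intro!: derivative_eq_intros grad_has_derivative assms simp: fun_eq_iff algebra_simps)

lemma grad_compose_real:
 fixes f :: "real^'n => real"
 assumes "f differentiable (at x)" "(\<phi> has_real_derivative d) (at (f x))"
 shows "((%y. \<phi> (f y)) has_derivative (%h. (d *\<^sub>R grad f x) \<bullet> h)) (at x)"
  and "grad (%y. \<phi> (f y)) x = d *\<^sub>R grad f x"
  and "(%y. \<phi> (f y)) differentiable (at x)"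
proof -
 have "((%y. \<phi> (f y)) has_derivative (%h. d * (grad f x \<bullet> h))) (at x)"
  using has_derivative_compose[OF grad_has_derivative[OF assms(1)]
    assms(2)[unfolded has_field_derivative_def]] by simp
 then show *: "((%y. \<phi> (f y)) has_derivative (%h. (d *\<^sub>R grad f x) \<bullet> h)) (at x)"
  by simp
 show "grad (%y. \<phi> (f y)) x = d *\<^sub>R grad f x"
  by (rule grad_eqI[OF *])
 show "(%y. \<phi> (f y)) differentiable (at x)"
  using * differentiableI by blast
qed

lemma grad_line_derivative:
 fixes f :: "real^'n => real"
 assumes "f differentiable (at (y + t *\<^sub>R b))"
 shows "((%t. f (y + t *\<^sub>R b)) has_vector_derivative (grad f (y + t *\<^sub>R b) \<bullet> b)) (at t within S)"
proof -
 have "((%t. y + t *\<^sub>R b) has_derivative (%h. h *\<^sub>R b)) (at t within S)"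
  by (auto intro!: derivative_eq_intros)
 from has_derivative_compose[OF this, OF grad_has_derivative[OF assms]]
 show ?thesis
  by (simp add: has_vector_derivative_def)
qed

lemma grad_measurable [measurable]:
 fixes f :: "real^'n => real"
 assumes "!!x. f differentiable (at x)"
 shows "grad f \<in> borel_measurable borel"
proof (subst borel_measurable_euclidean_space, intro ballI)
 fix b :: "real^'n"
 assume "b \<in> Basis"
 have [measurable]: "f \<in> borel_measurable borel"
  using diff_imp_cont[OF assms] by (rule borel_of_cont)
 show "(%x. grad f x \<bullet> b) \<in> borel_measurable borel"
 proof (rule borel_measurable_LIMSEQ_real)
  fix x
  have "((%t. f (x + t *\<^sub>R b)) has_real_derivative (grad f x \<bullet> b)) (at 0)"
   using grad_line_derivative[of f x 0 b UNIV] assms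
   by (simp add: has_real_derivative_iff_has_vector_derivative)
  then have "((%h. (f (x + h *\<^sub>R b) - f x) / h) \<longlongrightarrow> grad f x \<bullet> b) (at 0)"
   by (simp add: DERIV_def)
  then show "(%n. (f (x + inverse (real (Suc n)) *\<^sub>R b) - f x) / inverse (real (Suc n)))
    \<longlonglongrightarrow> grad f x \<bullet> b"
   by (rule filterlim_compose)
    (use LIMSEQ_inverse_real_of_nat in \<open>auto simp: filterlim_at intro!: always_eventually\<close>)
 next
  fix n :: nat
  show "(%x. (f (x + inverse (real (Suc n)) *\<^sub>R b) - f x) / inverse (real (Suc n)))
    \<in> borel_measurable borel"
   by measurable
 qed
qed

text \<open>Integrating the fundamental theorem of calculus over all translates of a unit segment
 in direction \<open>b\<close> gives the result without slicing the space by coordinates, and the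
 Henstock--Kurzweil form of that theorem needs no continuity of the derivative.\<close>

lemma integral_directional_derivative_eq_0:
 fixes w :: "real^'n => real"
 assumes diff: "!!x. w differentiable (at x)"
  and w: "integrable lborel w"
  and w': "integrable lborel (%x. grad w x \<bullet> b)"
 shows "(LINT x|lborel. grad w x \<bullet> b) = 0"
proof -
 define u where "u = (%x. grad w x \<bullet> b)"
 have [measurable]: "u \<in> borel_measurable borel" "w \<in> borel_measurable borel"
  using w' w unfolding u_def by simp_all
 define k where "k = (%(s::real, y). indicator {0..1} s * u (y + s *\<^sub>R b))"
 have [measurable]: "k \<in> borel_measurable (lborel \<Otimes>\<^sub>M lborel)"
  unfolding k_def by measurable
 have shift: "(\<integral>\<^sup>+y. ennreal (norm (u (y + s *\<^sub>R b))) \<partial>lborel) = (\<integral>\<^sup>+y. ennreal (norm (u y)) \<partial>lborel)" for s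
  using nn_integral_distr[of "(+) (s *\<^sub>R b)" lborel borel "%y. ennreal (norm (u y))"]
   lborel_distr_plus[of "s *\<^sub>R b"] by (simp add: add.commute)
 have shift_int: "(LINT y|lborel. u (y + s *\<^sub>R b)) = (LINT y|lborel. u y)" for s
  using integral_distr[of "(+) (s *\<^sub>R b)" lborel borel u]
   lborel_distr_plus[of "s *\<^sub>R b"] by (simp add: add.commute)
 have fin: "(\<integral>\<^sup>+y. ennreal (norm (u y)) \<partial>lborel) < \<infinity>"
  using w' unfolding u_def integrable_iff_bounded by simp
 have kint: "integrable (lborel \<Otimes>\<^sub>M lborel) k"
 proof (rule integrableI_bounded)
  have "(\<integral>\<^sup>+z. ennreal (norm (k z)) \<partial>(lborel \<Otimes>\<^sub>M lborel))
    = (\<integral>\<^sup>+s. (\<integral>\<^sup>+y. indicator {0..1} s * ennreal (norm (u (y + s *\<^sub>R b))) \<partial>lborel) \<partial>lborel)"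
   by (subst lborel.nn_integral_fst[symmetric])
    (auto simp: k_def abs_mult ennreal_mult'' split: split_indicator intro!: nn_integral_cong)
  also have "... = (\<integral>\<^sup>+s. indicator {0..1} s * (\<integral>\<^sup>+y. ennreal (norm (u y)) \<partial>lborel) \<partial>(lborel::real measure))"
   using shift by (intro nn_integral_cong) (simp add: nn_integral_cmult)
  also have "... = (\<integral>\<^sup>+y. ennreal (norm (u y)) \<partial>lborel)"
   by (subst nn_integral_multc) auto
  finally show "(\<integral>\<^sup>+z. ennreal (norm (k z)) \<partial>(lborel \<Otimes>\<^sub>M lborel)) < \<infinity>"
   using fin by simp
 qed simp
 have slice: "AE y in lborel. (LINT s|lborel. k (s, y)) = w (y + b) - w y"
 proof -
  have "AE y in lborel. integrable lborel (%s. k (s, y))"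
   using lborel_pair.AE_integrable_snd[OF kint[unfolded k_def]]
   by (simp add: k_def)
  then show ?thesis
  proof (rule AE_mp, intro AE_I2 impI)
   fix y assume i: "integrable lborel (%s. k (s, y))"
   have si: "set_integrable lborel {0..1} (%s. u (y + s *\<^sub>R b))"
    using i by (simp add: set_integrable_def k_def)
   have "((%s. u (y + s *\<^sub>R b)) has_integral (w (y + 1 *\<^sub>R b) - w (y + 0 *\<^sub>R b))) {0..1}"
    unfolding u_def
    by (rule fundamental_theorem_of_calculus) (auto intro!: grad_line_derivative diff)
   moreover have "(LINT s|lborel. k (s, y)) = (LINT s:{0..1}|lborel. u (y + s *\<^sub>R b))"
    by (simp add: set_lebesgue_integral_def k_def)
   ultimately show "(LINT s|lborel. k (s, y)) = w (y + b) - w y"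
    using set_borel_integral_eq_integral(2)[OF si] by (simp add: integral_unique)
  qed
 qed
 have "(LINT y|lborel. w (y + b)) = (LINT y|lborel. w y)" and wb: "integrable lborel (%y. w (y + b))"
  using integral_distr[of "(+) b" lborel borel w] integrable_distr_eq[of "(+) b" lborel borel w] w
   lborel_distr_plus[of b] by (simp_all add: add.commute)
 then have "0 = (LINT y|lborel. w (y + b) - w y)"
  using w by simp
 also have "... = (LINT y|lborel. (LINT s|lborel. k (s, y)))"
 proof (rule integral_cong_AE)
  show "AE y in lborel. w (y + b) - w y = (LINT s|lborel. k (s, y))"
   using slice by eventually_elim simp
 qed measurable
 also have "... = (LINT s|lborel. (LINT y|lborel. k (s, y)))"
  using lborel_pair.Fubini_integral[of "%s y. k (s, y)"] kint by simp
 also have "... = (\<integral>s. indicator {0..1} s * (LINT y|lborel. u y) \<partial>(lborel::real measure))"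
  by (simp add: k_def shift_int)
 also have "... = (LINT y|lborel. u y)"
  by simp
 finally show ?thesis by (simp add: u_def)
qed

lemma integrable_bounded_support:
 fixes f :: "'a::euclidean_space => 'b::{banach,second_countable_topology}"
 assumes f: "f \<in> borel_measurable borel"
  and b: "!!x. norm (f x) <= C" and s: "!!x. norm x > R ==> f x = 0"
 shows "integrable lborel f"
proof (rule integrable_bd)
 show "integrable lborel (%x::'a. C * indicat_real (cball 0 R) x)"
  using emeasure_bounded_finite[of "cball (0::'a) R"]
  by (intro integrable_mult_right integrable_real_indicator) auto
 show "AE x in lborel. norm (f x) <= norm (C * indicat_real (cball 0 R) x)"
 proof (intro AE_I2)
  fix x :: 'a
  show "norm (f x) <= norm (C * indicat_real (cball 0 R) x)"
   using b[of x] s[of x] norm_ge_zero[of "f x"] by (auto split: split_indicator)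
 qed
qed (use f in simp)

lemma integrable_cont_bdd:
 fixes f :: "'a::euclidean_space => 'b::{banach,second_countable_topology}"
 assumes f: "continuous_on UNIV f"
  and s: "!!x. norm x > R ==> f x = 0"
 shows "integrable lborel f" "\<exists>C. \<forall>x. norm (f x) <= C"
proof -
 have "compact (f ` cball 0 R)"
  by (intro compact_continuous_image continuous_on_subset[OF f]) auto
 then have "bounded (f ` cball 0 R)"
  by (rule compact_imp_bounded)
 then obtain C where C: "!!x. x \<in> cball 0 R ==> norm (f x) <= C"
  unfolding bounded_iff by (metis imageI)
 have *: "norm (f x) <= max C 0" for x
  using C[of x] s[of x] by (cases "norm x <= R") auto
 then show "\<exists>C. \<forall>x. norm (f x) <= C" by blast
 show "integrable lborel f"
  by (rule integrable_bounded_support[OF borel_of_cont[OF f] * s])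
qed

lemma integral_by_parts_bounded_support:
 fixes f q :: "real^'n => real"
 assumes f: "!!x. f differentiable (at x)" and f': "!!R. integrable lborel (%x. indicator (cball 0 R) x *\<^sub>R grad f x)"
  and q: "!!x. q differentiable (at x)" and q': "continuous_on UNIV (grad q)"
  and s: "!!x. norm x > R ==> q x = 0" "!!x. norm x > R ==> grad q x = 0"
 shows "integrable lborel (%x. q x * (grad f x \<bullet> b))"
  and "(LINT x|lborel. q x * (grad f x \<bullet> b)) = - (LINT x|lborel. f x * (grad q x \<bullet> b))"
proof -
 have cf: "continuous_on UNIV f" and cq: "continuous_on UNIV q"
  using diff_imp_cont f q by blast+
 have [measurable]: "q \<in> borel_measurable borel" "grad f \<in> borel_measurable borel"
  using borel_of_cont[OF cq] grad_measurable[OF f] by simp_all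
 obtain C where C: "!!x. norm (q x) <= C"
  using integrable_cont_bdd(2)[OF cq s(1)] by blast
 have i1: "integrable lborel (%x. q x *\<^sub>R grad f x)"
 proof (rule integrable_bd)
  show "integrable lborel (%x. C *\<^sub>R (indicator (cball 0 R) x *\<^sub>R grad f x))"
   using f'[of R] by (intro integrable_scaleR_right) simp
  show "AE x in lborel. norm (q x *\<^sub>R grad f x) <= norm (C *\<^sub>R indicat_real (cball 0 R) x *\<^sub>R grad f x)"
  proof (intro AE_I2)
   fix x
   have "norm (q x) <= \<bar>C\<bar>" using C[of x] by linarith
   then show "norm (q x *\<^sub>R grad f x) <= norm (C *\<^sub>R indicat_real (cball 0 R) x *\<^sub>R grad f x)"
    using s(1)[of x] by (cases "norm x <= R") (auto intro!: mult_right_mono)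
  qed
 qed measurable
 have eq: "q x * (grad f x \<bullet> b) = (q x *\<^sub>R grad f x) \<bullet> b" for x by simp
 show i1': "integrable lborel (%x. q x * (grad f x \<bullet> b))"
  unfolding eq using i1 by (intro integrable_inner_left) simp
 have i2: "integrable lborel (%x. f x * (grad q x \<bullet> b))"
  by (rule integrable_cont_bdd(1)[where R=R], intro continuous_intros cf q')
    (simp add: s)
 have i3: "integrable lborel (%x. q x * f x)"
  by (rule integrable_cont_bdd(1)[where R=R], intro continuous_intros cf cq)
    (simp add: s)
 have g: "grad (%y. q y * f y) x \<bullet> b = q x * (grad f x \<bullet> b) + f x * (grad q x \<bullet> b)" for x
  by (simp add: grad_mult f q inner_add_left)
 have "(LINT x|lborel. grad (%y. q y * f y) x \<bullet> b) = 0"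
 proof (rule integral_directional_derivative_eq_0)
  show "integrable lborel (%x. grad (%y. q y * f y) x \<bullet> b)"
   unfolding g using i1' i2 by simp
 qed (use i3 in \<open>auto intro!: differentiable_mult f q\<close>)
 then show "(LINT x|lborel. q x * (grad f x \<bullet> b)) = - (LINT x|lborel. f x * (grad q x \<bullet> b))"
  using i1' i2 by (simp add: g)
qed

section \<open>Translations in the square integrable functions\<close>

lemma cball_in_borel [measurable]: "cball (x::'a::euclidean_space) r \<in> sets borel"
 by simp

text \<open>Regularity of Lebesgue measure gives continuous approximations of indicators, which are then cut off to a bounded set.\<close>

lemma L2_approx_continuous:
 fixes u :: "'a::euclidean_space => real"
 assumes u[measurable]: "u \<in> borel_measurable borel"
  and supp: "!!x. norm x > R ==> u x = 0"
  and L2: "integrable lborel (%x. (u x)\<^sup>2)" and "\<epsilon> > 0"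
 shows "\<exists>\<phi>. continuous_on UNIV \<phi> & (\<forall>x. norm x > R + 1 --> \<phi> x = 0) &
  integrable lborel (%x. (u x - \<phi> x)\<^sup>2) & (LINT x|lborel. (u x - \<phi> x)\<^sup>2) < \<epsilon>"
proof -
 define cl where "cl = (%(M::real) s. max (- M) (min M s))"
 have cl_eq: "\<bar>s\<bar> <= M ==> cl M s = s" for M s by (auto simp: cl_def)
 have cl_le: "M >= 0 ==> \<bar>cl M s\<bar> <= M" for M s by (auto simp: cl_def)
 have cl_diff: "M >= 0 ==> \<bar>s - cl M s\<bar> <= \<bar>s\<bar>" for M s by (auto simp: cl_def)
 have cl_cont: "continuous_on UNIV (cl M)" for M
  unfolding cl_def by (intro continuous_intros)
 have [measurable]: "cl M \<in> borel_measurable borel" for M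
  by (rule borel_of_cont[OF cl_cont])
 have "(%n. LINT x|lborel. (u x - cl (real n) (u x))\<^sup>2) \<longlonglongrightarrow> (\<integral>x. (0::real) \<partial>(lborel::'a measure))"
 proof (rule integral_dominated_convergence[where w="%x. (u x)\<^sup>2"])
  show "AE x in lborel. (%n. (u x - cl (real n) (u x))\<^sup>2) \<longlonglongrightarrow> 0"
  proof (rule AE_I2, rule tendsto_eventually)
   fix x
   show "\<forall>\<^sub>F n in sequentially. (u x - cl (real n) (u x))\<^sup>2 = 0"
    using eventually_ge_at_top[of "nat \<lceil>\<bar>u x\<bar>\<rceil>"]
    by eventually_elim (simp add: cl_eq)
  qed
  show "AE x in lborel. norm ((u x - cl (real n) (u x))\<^sup>2) <= (u x)\<^sup>2" for n
   using cl_diff[of "real n"] by (auto simp: abs_le_square_iff)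
 qed (use L2 in simp_all)
 then have "\<forall>\<^sub>F n in sequentially. (LINT x|lborel. (u x - cl (real n) (u x))\<^sup>2) < \<epsilon> / 4"
  using \<open>\<epsilon> > 0\<close> by (intro order_tendstoD) auto
 then obtain M where M: "(LINT x|lborel. (u x - cl (real M) (u x))\<^sup>2) < \<epsilon> / 4"
  by (auto simp: eventually_sequentially)
 have iM: "integrable lborel (%x. (u x - cl (real M) (u x))\<^sup>2)"
  by (rule integrable_bd[OF L2])
    (use cl_diff[of "real M"] in \<open>auto simp: abs_le_square_iff\<close>)
 have "u \<in> borel_measurable lebesgue"
  using u by (simp add: measurable_completion)
 then have "u measurable_on UNIV"
  by (simp add: lebesgue_measurable_imp_measurable_on)
 then obtain N g where N: "negligible N" and g: "!!n. continuous_on UNIV (g n)"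
  and gl: "!!x. x \<notin> N ==> (%n::nat. g n x) \<longlonglongrightarrow> u x"
  by (auto simp: measurable_on_def)
 have [measurable]: "g n \<in> borel_measurable borel" for n
  by (rule borel_of_cont[OF g])
 define \<psi> where "\<psi> = (%x::'a. max 0 (min 1 (R + 1 - norm x)))"
 have \<psi>c: "continuous_on UNIV \<psi>"
  unfolding \<psi>_def by (intro continuous_intros)
 have [measurable]: "\<psi> \<in> borel_measurable borel"
  by (rule borel_of_cont[OF \<psi>c])
 have \<psi>1: "\<bar>\<psi> x\<bar> <= 1" "\<psi> x * u x = u x" "norm x > R + 1 ==> \<psi> x = 0"
   "\<psi> x * cl (real M) (u x) = cl (real M) (u x)" for x
  using supp[of x] by (auto simp: \<psi>_def cl_def)
 define \<phi> where "\<phi> = (%n x. \<psi> x * cl (real M) (g n x))"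
 have \<phi>c: "continuous_on UNIV (\<phi> n)" for n
  unfolding \<phi>_def
  by (intro continuous_intros \<psi>c continuous_on_compose2[OF cl_cont g]) auto
 have \<phi>0: "norm x > R + 1 ==> \<phi> n x = 0" for n x
  by (simp add: \<phi>_def \<psi>1)
 have AE: "AE x in lborel. x \<notin> N"
 proof -
  have "AE x in lebesgue. x \<notin> N"
   using N negligible_iff_null_sets AE_not_in by blast
  then show ?thesis
   by (simp add: AE_completion_iff)
 qed
 have bd: "\<bar>cl (real M) (u x) - \<phi> n x\<bar> <= 2 * real M" for n x
 proof -
  have "\<bar>\<phi> n x\<bar> <= 1 * real M"
   unfolding \<phi>_def abs_mult using \<psi>1(1)[of x] cl_le[of "real M"] by (intro mult_mono) auto
  then show ?thesis using cl_le[of "real M" "u x"] by linarith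
 qed
 have dom: "integrable lborel (%x::'a. (2 * real M)\<^sup>2 * indicator (cball 0 (R+1)) x)"
  using emeasure_bounded_finite[of "cball (0::'a) (R+1)"]
  by (intro integrable_mult_right integrable_real_indicator) auto
 have dle: "norm ((cl (real M) (u x) - \<phi> n x)\<^sup>2) <= (2 * real M)\<^sup>2 * indicator (cball 0 (R+1)) x" for n x
 proof (cases "norm x <= R + 1")
  case True
  then show ?thesis using power_mono[OF bd[of x n], of 2] by simp
 next
  case False
  then have "cl (real M) (u x) = 0" "\<phi> n x = 0"
   using \<psi>1(4)[of x] \<psi>1(3)[of x] \<phi>0[of x n] by auto
  then show ?thesis by simp
 qed
 have [measurable]: "\<phi> n \<in> borel_measurable borel" for n
  by (rule borel_of_cont[OF \<phi>c])
 have "(%n. LINT x|lborel. (cl (real M) (u x) - \<phi> n x)\<^sup>2) \<longlonglongrightarrow> (\<integral>x. (0::real) \<partial>(lborel::'a measure))"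
 proof (rule integral_dominated_convergence[OF _ _ dom])
  show "AE x in lborel. (%n. (cl (real M) (u x) - \<phi> n x)\<^sup>2) \<longlonglongrightarrow> 0"
   using AE
  proof eventually_elim
   case (elim x)
   have "isCont (cl (real M)) (u x)"
    using cl_cont by (simp add: continuous_on_eq_continuous_at)
   then have "(%n. cl (real M) (g n x)) \<longlonglongrightarrow> cl (real M) (u x)"
    using gl[OF elim] isCont_tendsto_compose by blast
   then have "(%n. (cl (real M) (u x) - \<psi> x * cl (real M) (g n x))\<^sup>2)
    \<longlonglongrightarrow> (cl (real M) (u x) - \<psi> x * cl (real M) (u x))\<^sup>2"
    by (intro tendsto_intros)
   then show ?case by (simp add: \<phi>_def \<psi>1)
  qed
 qed (use dle in auto)
 then have "\<forall>\<^sub>F n in sequentially. (LINT x|lborel. (cl (real M) (u x) - \<phi> n x)\<^sup>2) < \<epsilon> / 4"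
  using \<open>\<epsilon> > 0\<close> by (intro order_tendstoD) auto
 then obtain n where n: "(LINT x|lborel. (cl (real M) (u x) - \<phi> n x)\<^sup>2) < \<epsilon> / 4"
  by (auto simp: eventually_sequentially)
 have in': "integrable lborel (%x. (cl (real M) (u x) - \<phi> n x)\<^sup>2)"
  by (rule integrable_bd[OF dom]) (use dle[of _ n] in auto)
 have sq: "(u x - \<phi> n x)\<^sup>2 <= 2 * (u x - cl (real M) (u x))\<^sup>2 + 2 * (cl (real M) (u x) - \<phi> n x)\<^sup>2" for x
  using sum_squares_bound[of "u x - cl (real M) (u x)" "cl (real M) (u x) - \<phi> n x"]
  by (simp add: power2_eq_square algebra_simps)
 have isum: "integrable lborel (%x. 2 * (u x - cl (real M) (u x))\<^sup>2 + 2 * (cl (real M) (u x) - \<phi> n x)\<^sup>2)"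
  using iM in' by simp
 have i: "integrable lborel (%x. (u x - \<phi> n x)\<^sup>2)"
  by (rule integrable_bd[OF isum]) (use sq in auto)
 have "(LINT x|lborel. (u x - \<phi> n x)\<^sup>2)
   <= (LINT x|lborel. 2 * (u x - cl (real M) (u x))\<^sup>2 + 2 * (cl (real M) (u x) - \<phi> n x)\<^sup>2)"
  by (rule integral_mono[OF i isum sq])
 also have "... < \<epsilon>"
  using M n iM in' by simp
 finally show ?thesis
  using \<phi>c \<phi>0 i by blast
qed

lemma continuous_compact_support_uniform:
 fixes \<phi> :: "'a::euclidean_space => 'b::real_normed_vector"
 assumes c: "continuous_on UNIV \<phi>" and s: "!!x. norm x > R ==> \<phi> x = 0" and "\<epsilon> > 0"
 obtains \<delta> where "\<delta> > 0" "\<delta> <= 1" "!!x y. norm (x - y) < \<delta> ==> norm (\<phi> x - \<phi> y) < \<epsilon>"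
proof -
 have "uniformly_continuous_on (cball 0 (R+1)) \<phi>"
  using c by (intro compact_uniformly_continuous) (auto intro: continuous_on_subset[OF c])
 then obtain d where d: "d > 0" "!!x y. x \<in> cball 0 (R+1) ==> y \<in> cball 0 (R+1) ==> dist y x < d
   ==> dist (\<phi> y) (\<phi> x) < \<epsilon>"
  unfolding uniformly_continuous_on_def using \<open>\<epsilon> > 0\<close> by blast
 show ?thesis
 proof (rule that[of "min d 1"])
  fix x y :: 'a assume xy: "norm (x - y) < min d 1"
  have tri: "norm x <= norm y + norm (x - y)" "norm y <= norm x + norm (x - y)"
   by (metis add.commute diff_add_cancel norm_triangle_ineq)
    (metis add.commute diff_add_cancel norm_triangle_ineq norm_minus_commute)
  show "norm (\<phi> x - \<phi> y) < \<epsilon>"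
  proof (cases "norm x <= R + 1 & norm y <= R + 1")
   case True
   then show ?thesis using d(2)[of y x] xy by (auto simp: dist_norm)
  next
   case False
   then have "norm x > R" "norm y > R" using tri xy by auto
   then show ?thesis using s \<open>\<epsilon> > 0\<close> by auto
  qed
 qed (use d in auto)
qed

lemma nn_integral_translate:
 fixes f :: "'a::euclidean_space => ennreal"
 assumes [measurable]: "f \<in> borel_measurable borel"
 shows "(\<integral>\<^sup>+y. f (y - z) \<partial>lborel) = (\<integral>\<^sup>+y. f y \<partial>lborel)"
 using nn_integral_distr[of "(+) (-z)" lborel borel f] lborel_distr_plus[of "-z"]
 by simp

text \<open>Uniform continuity settles the case of a continuous function of bounded support, and such functions are dense.\<close>

lemma L2_translation_continuous:
 fixes u :: "'a::euclidean_space => real"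
 assumes u[measurable]: "u \<in> borel_measurable borel"
  and supp: "!!x. norm x > R ==> u x = 0"
  and L2: "integrable lborel (%x. (u x)\<^sup>2)" and "\<epsilon> > 0"
 shows "\<exists>\<delta>>0. \<forall>z. norm z < \<delta> --> (\<integral>\<^sup>+y. ennreal ((u (y - z) - u y)\<^sup>2) \<partial>lborel) <= ennreal \<epsilon>"
proof -
 have e12: "\<epsilon> / 12 > 0" using \<open>\<epsilon> > 0\<close> by simp
 obtain \<phi> where c: "continuous_on UNIV \<phi>" and \<phi>0: "!!x. norm x > R + 1 ==> \<phi> x = 0"
  and ii: "integrable lborel (%x. (u x - \<phi> x)\<^sup>2)" and il: "(LINT x|lborel. (u x - \<phi> x)\<^sup>2) < \<epsilon> / 12"
  using L2_approx_continuous[OF u supp L2 e12] by auto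
 have [measurable]: "\<phi> \<in> borel_measurable borel"
  by (rule borel_of_cont[OF c])
 define m where "m = measure lborel (cball (0::'a) (R + 2))"
 have m0: "m >= 0" by (simp add: m_def)
 define e where "e = sqrt (\<epsilon> / (6 * (m + 1)))"
 have e: "e > 0" "3 * e\<^sup>2 * m <= \<epsilon> / 2"
 proof -
  show "e > 0" using \<open>\<epsilon> > 0\<close> m0 by (simp add: e_def)
  have "e\<^sup>2 = \<epsilon> / (6 * (m + 1))"
   using \<open>\<epsilon> > 0\<close> m0 by (simp add: e_def)
  then have "6 * e\<^sup>2 + 6 * e\<^sup>2 * m = \<epsilon>"
   using m0 by (simp add: field_simps)
  then show "3 * e\<^sup>2 * m <= \<epsilon> / 2"
   using zero_le_power2[of e] by linarith
 qed
 obtain \<delta> where \<delta>: "\<delta> > 0" "\<delta> <= 1" "!!x y. norm (x - y) < \<delta> ==> \<bar>\<phi> x - \<phi> y\<bar> < e"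
  using continuous_compact_support_uniform[OF c \<phi>0 e(1), unfolded real_norm_def] by blast
 show ?thesis
 proof (intro exI[of _ \<delta>] conjI allI impI)
  fix z :: 'a assume z: "norm z < \<delta>"
  have fin: "emeasure lborel (cball (0::'a) (R+2)) = ennreal m"
   unfolding m_def using emeasure_bounded_finite[of "cball (0::'a) (R+2)"]
   by (simp add: emeasure_eq_ennreal_measure)
  have I: "(\<integral>\<^sup>+y. ennreal ((u y - \<phi> y)\<^sup>2) \<partial>lborel) <= ennreal (\<epsilon>/12)"
   using ii il by (subst nn_integral_eq_integral) (auto intro!: ennreal_leI)
  have pw: "ennreal ((u (y - z) - u y)\<^sup>2) <= 3 * ennreal ((u (y - z) - \<phi> (y - z))\<^sup>2)
    + (3 * ennreal ((u y - \<phi> y)\<^sup>2) + ennreal (3 * e\<^sup>2) * indicator (cball 0 (R+2)) y)" for y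
  proof -
   have h: "(\<phi> (y - z) - \<phi> y)\<^sup>2 <= e\<^sup>2 * indicator (cball 0 (R+2)) y"
   proof (cases "norm y <= R + 2")
    case True
    have "\<bar>\<phi> (y - z) - \<phi> y\<bar> <= e" using \<delta>(3)[of "y - z" y] z by auto
    then show ?thesis using True power_mono[of "\<bar>\<phi> (y - z) - \<phi> y\<bar>" e 2] by simp
   next
    case False
    moreover have "norm y <= norm (y - z) + norm z"
    by (metis diff_add_cancel norm_triangle_ineq)
    ultimately have "norm (y - z) > R + 1" "norm y > R + 1" using z \<delta>(2) by auto
    then show ?thesis using \<phi>0 by auto
   qed
   have sq3: "(a + b + c)\<^sup>2 <= 3 * a\<^sup>2 + 3 * b\<^sup>2 + 3 * c\<^sup>2" for a b c :: real
    using sum_squares_bound[of a b] sum_squares_bound[of b c] sum_squares_bound[of a c]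
    by (simp add: power2_eq_square algebra_simps)
   have "(u (y - z) - u y)\<^sup>2 = ((u (y - z) - \<phi> (y - z)) + (\<phi> y - u y) + (\<phi> (y - z) - \<phi> y))\<^sup>2"
    by simp
   also have "... <= 3 * (u (y - z) - \<phi> (y - z))\<^sup>2 + 3 * (\<phi> y - u y)\<^sup>2 + 3 * (\<phi> (y - z) - \<phi> y)\<^sup>2"
    by (rule sq3)
   also have "... <= 3 * (u (y - z) - \<phi> (y - z))\<^sup>2 + 3 * (u y - \<phi> y)\<^sup>2
    + 3 * (e\<^sup>2 * indicator (cball 0 (R+2)) y)"
    using h by (simp add: power2_commute)
   finally have "ennreal ((u (y - z) - u y)\<^sup>2)
    <= ennreal (3 * (u (y - z) - \<phi> (y - z))\<^sup>2 + (3 * (u y - \<phi> y)\<^sup>2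
    + 3 * e\<^sup>2 * indicator (cball 0 (R+2)) y))"
    by (intro ennreal_leI) simp
   also have "... = 3 * ennreal ((u (y - z) - \<phi> (y - z))\<^sup>2)
    + (3 * ennreal ((u y - \<phi> y)\<^sup>2) + ennreal (3 * e\<^sup>2) * indicator (cball 0 (R+2)) y)"
    by (simp add: ennreal_plus ennreal_mult'' ennreal_indicator[symmetric])
   finally show ?thesis .
  qed
  have "(\<integral>\<^sup>+y. ennreal ((u (y - z) - u y)\<^sup>2) \<partial>lborel)
   <= (\<integral>\<^sup>+y. 3 * ennreal ((u (y - z) - \<phi> (y - z))\<^sup>2)
    + (3 * ennreal ((u y - \<phi> y)\<^sup>2) + ennreal (3 * e\<^sup>2) * indicator (cball 0 (R+2)) y) \<partial>lborel)"
   by (intro nn_integral_mono pw)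
  also have "... = 3 * (\<integral>\<^sup>+y. ennreal ((u (y - z) - \<phi> (y - z))\<^sup>2) \<partial>lborel)
    + (3 * (\<integral>\<^sup>+y. ennreal ((u y - \<phi> y)\<^sup>2) \<partial>lborel) + ennreal (3 * e\<^sup>2) * ennreal m)"
  proof -
   have "(\<integral>\<^sup>+y. ennreal (3 * e\<^sup>2) * indicator (cball (0::'a) (R+2)) y \<partial>lborel) = ennreal (3 * e\<^sup>2) * ennreal m"
    by (subst nn_integral_cmult_indicator) (simp_all add: fin)
   then show ?thesis
    by (simp add: nn_integral_add nn_integral_cmult)
  qed
  also have "... = 6 * (\<integral>\<^sup>+y. ennreal ((u y - \<phi> y)\<^sup>2) \<partial>lborel) + ennreal (3 * e\<^sup>2 * m)"
   by (subst nn_integral_translate[of "%y. ennreal ((u y - \<phi> y)\<^sup>2)" z])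
    (simp_all add: ennreal_mult' m0 flip: add.assoc distrib_right)
  also have "... <= 6 * ennreal (\<epsilon>/12) + ennreal (\<epsilon>/2)"
   using I e(2) by (intro add_mono mult_left_mono ennreal_leI) auto
  also have "... = ennreal (6 * (\<epsilon>/12) + \<epsilon>/2)"
   using \<open>\<epsilon> > 0\<close> ennreal_mult''[of "\<epsilon>/12" 6] by (subst ennreal_plus) simp_all
  also have "... = ennreal \<epsilon>" by simp
  finally show "(\<integral>\<^sup>+y. ennreal ((u (y - z) - u y)\<^sup>2) \<partial>lborel) <= ennreal \<epsilon>" .
 qed (use \<delta> in auto)
qed

section \<open>Test functions and convolution\<close>

lemma pos_part_power_derivative:
 assumes "n >= 1"
 shows "((%s::real. max 0 s ^ Suc n) has_real_derivative real (Suc n) * max 0 s ^ n) (at s)"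
proof -
 consider "s < 0" | "s > 0" | "s = 0" by linarith
 then show ?thesis
 proof cases
  case 1
  have "((%s::real. 0) has_real_derivative 0) (at s)" by simp
  then have "((%s::real. max 0 s ^ Suc n) has_real_derivative 0) (at s)"
   by (rule has_field_derivative_transform_within_open[where S="{..<0}"]) (use 1 in auto)
  then show ?thesis using 1 assms by (simp add: zero_power)
 next
  case 2
  have "((%s::real. s ^ Suc n) has_real_derivative real (Suc n) * s ^ n) (at s)"
   using DERIV_pow[of "Suc n" s] by simp
  then have "((%s::real. max 0 s ^ Suc n) has_real_derivative real (Suc n) * s ^ n) (at s)"
   by (rule has_field_derivative_transform_within_open[where S="{0<..}"]) (use 2 in auto)
  then show ?thesis using 2 by simp
 next
  case 3
  have "((%h::real. \<bar>h\<bar> ^ n) \<longlongrightarrow> \<bar>0\<bar> ^ n) (at 0)"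
   by (intro tendsto_intros)
  moreover have z: "\<bar>0::real\<bar> ^ n = 0" using assms by (simp add: zero_power)
  ultimately have lim: "((%h::real. \<bar>h\<bar> ^ n) \<longlongrightarrow> 0) (at 0)"
   by (simp only: z)
  have "((%h::real. max 0 h ^ Suc n / h) \<longlongrightarrow> 0) (at 0)"
  proof (rule Lim_null_comparison[OF _ lim], rule always_eventually, rule allI)
   fix h :: real
   show "norm (max 0 h ^ Suc n / h) <= \<bar>h\<bar> ^ n"
    by (cases "h > 0") auto
  qed
  then show ?thesis
   using 3 assms by (simp add: DERIV_def zero_power)
 qed
qed

definition bump :: "real => real^'n => real"
 where "bump R x = max 0 (1 - (x \<bullet> x) / R\<^sup>2) ^ 3"

lemma pos_part_quadratic_has_derivative:
 fixes x :: "'a::real_inner"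
 assumes "n >= 1"
 shows "((%x. max 0 (1 - (x \<bullet> x) / c) ^ Suc n) has_derivative
  (%h. ((- 2 / c * real (Suc n) * max 0 (1 - (x \<bullet> x) / c) ^ n) *\<^sub>R x) \<bullet> h)) (at x)"
proof -
 have d: "((%x::'a. 1 - (x \<bullet> x) / c) has_derivative (%h. (- 2 / c) * (x \<bullet> h))) (at x)"
  by (auto intro!: derivative_eq_intros simp: inner_commute fun_eq_iff divide_inverse algebra_simps)
 have p: "((%s::real. max 0 s ^ Suc n) has_derivative (%h. real (Suc n) * max 0 (1 - (x \<bullet> x) / c) ^ n * h))
   (at (1 - (x \<bullet> x) / c))"
  using pos_part_power_derivative[OF assms, of "1 - (x \<bullet> x) / c"] by (simp only: has_field_derivative_def)
 show ?thesis
  by (rule has_derivative_eq_rhs[OF has_derivative_compose[OF d p]]) (simp add: fun_eq_iff del: of_nat_Suc)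
qed

lemma bump_has_derivative:
 "(bump R has_derivative (%h. ((- 6 / R\<^sup>2 * max 0 (1 - (x \<bullet> x) / R\<^sup>2) ^ 2) *\<^sub>R x) \<bullet> h)) (at x)"
proof -
 have h: "1 <= (2::nat)" by simp
 have e: "Suc 2 = 3" "- 2 / R\<^sup>2 * real 3 * m = - 6 / R\<^sup>2 * m" for m by simp_all
 show ?thesis
  unfolding bump_def[abs_def]
  using pos_part_quadratic_has_derivative[OF h, where c="R\<^sup>2" and x=x] by (simp only: e)
qed

lemma grad_bump: "grad (bump R) x = (- 6 / R\<^sup>2 * max 0 (1 - (x \<bullet> x) / R\<^sup>2) ^ 2) *\<^sub>R x"
 by (rule grad_eqI[OF bump_has_derivative])

lemma bump_differentiable: "bump R differentiable (at x)"
 using bump_has_derivative differentiableI by blast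

lemma bump_continuous: "continuous_on UNIV (bump R)"
 by (rule diff_imp_cont[OF bump_differentiable])

lemma grad_bump_continuous: "continuous_on UNIV (grad (bump R))"
proof -
 have "continuous_on UNIV (%x::real^'a. (- 6 / R\<^sup>2 * max 0 (1 - (x \<bullet> x) / R\<^sup>2) ^ 2) *\<^sub>R x)"
  by (cases "R = 0") (auto intro!: continuous_intros)
 then show ?thesis by (simp add: grad_bump[abs_def])
qed

lemma bump_nonneg: "0 <= bump R x" and bump_le_1: "bump R x <= 1"
 by (auto simp: bump_def intro!: power_le_one)

lemma norm_le_imp_inner_le: "norm (x::'a::real_inner) <= R ==> x \<bullet> x <= R\<^sup>2"
 by (simp add: dot_square_norm power_mono)

lemma bump_outside: "norm x >= R ==> R > 0 ==> bump R x = 0"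
 using power_mono[of R "norm x" 2] by (simp add: bump_def dot_square_norm field_simps max_def)

lemma norm_grad_bump: 
 assumes "R > 0" shows "norm (grad (bump R) x) <= 6 / R"
proof (cases "norm x <= R")
 case True
 have "max 0 (1 - (x \<bullet> x) / R\<^sup>2) ^ 2 <= 1"
  by (intro power_le_one) auto
 then have "6 / R\<^sup>2 * max 0 (1 - (x \<bullet> x) / R\<^sup>2) ^ 2 * norm x <= 6 / R\<^sup>2 * 1 * R"
  using True assms by (intro mult_mono mult_left_mono) auto
 also have "... = 6 / R" using assms by (simp add: power2_eq_square)
 finally show ?thesis by (simp add: grad_bump abs_mult)
next
 case False
 then have "(x \<bullet> x) / R\<^sup>2 >= 1"
  using power_mono[of R "norm x" 2] assms by (simp add: dot_square_norm field_simps)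
 then show ?thesis using assms by (simp add: grad_bump)
qed

lemma bump_tendsto_1:
 assumes "filterlim R at_top F" "(f \<longlongrightarrow> y) F"
 shows "((%n. bump (R n) (f n)) \<longlongrightarrow> 1) F"
proof -
 have "((%n. (f n \<bullet> f n) / (R n)\<^sup>2) \<longlongrightarrow> 0) F"
  by (rule real_tendsto_divide_at_top[OF tendsto_inner[OF assms(2,2)]
    filterlim_pow_at_top[OF _ assms(1)]]) simp
 then have "((%n. max 0 (1 - (f n \<bullet> f n) / (R n)\<^sup>2) ^ 3) \<longlongrightarrow> max 0 (1 - 0) ^ 3) F"
  by (intro tendsto_intros)
 then show ?thesis by (simp add: bump_def)
qed

lemma grad_bump_component_has_derivative:
 "((%x. grad (bump R) x \<bullet> b) has_derivative (%h. ((- 6 / R\<^sup>2) *\<^sub>R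
   (max 0 (1 - (x \<bullet> x) / R\<^sup>2) ^ 2 *\<^sub>R b - (4 / R\<^sup>2 * max 0 (1 - (x \<bullet> x) / R\<^sup>2) * (x \<bullet> b)) *\<^sub>R x)) \<bullet> h)) (at x)"
proof -
 have "((%x::real^'a. max 0 (1 - (x \<bullet> x) / R\<^sup>2) ^ 2) has_derivative
   (%h. ((- 4 / R\<^sup>2 * max 0 (1 - (x \<bullet> x) / R\<^sup>2)) *\<^sub>R x) \<bullet> h)) (at x)"
  using pos_part_quadratic_has_derivative[of 1 "R\<^sup>2" x] by (simp add: numeral_2_eq_2)
 note D = has_derivative_mult[OF has_derivative_mult[OF has_derivative_const[of "- 6 / R\<^sup>2"] this]
    has_derivative_inner_left[OF has_derivative_ident, of b]]
 show ?thesis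
  unfolding grad_bump inner_scaleR_left
  by (rule has_derivative_eq_rhs[OF D])
    (simp add: fun_eq_iff inner_diff_left inner_commute divide_inverse algebra_simps)
qed

text \<open>Test functions of class \<open>C\<^sup>2\<close>: the second order is what lets a derivative be moved off a
 density of which only differentiability is known.\<close>

definition test2 :: "real => (real^'n => real) => bool"
 where "test2 R q \<longleftrightarrow> (\<forall>x. q differentiable (at x)) & continuous_on UNIV (grad q) &
  (\<forall>b x. (%y. grad q y \<bullet> b) differentiable (at x)) &
  (\<forall>b. continuous_on UNIV (grad (%y. grad q y \<bullet> b))) & (\<forall>x. norm x > R --> q x = 0)"

lemma test2_bump: "R > 0 ==> test2 R (bump R)"
 unfolding test2_def
proof (intro conjI allI impI)
 fix b :: "real^'a"
 have *: "grad (%x. grad (bump R) x \<bullet> b) = (%x. (- 6 / R\<^sup>2) *\<^sub>R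
   (max 0 (1 - (x \<bullet> x) / R\<^sup>2) ^ 2 *\<^sub>R b - (4 / R\<^sup>2 * max 0 (1 - (x \<bullet> x) / R\<^sup>2) * (x \<bullet> b)) *\<^sub>R x))"
  by (intro ext grad_eqI grad_bump_component_has_derivative)
 show "continuous_on UNIV (grad (%y. grad (bump R) y \<bullet> b))"
  unfolding * by (cases "R = 0") (auto intro!: continuous_intros)
 show "(%y. grad (bump R) y \<bullet> b) differentiable (at x)" for x
  using grad_bump_component_has_derivative differentiableI by blast
qed (auto simp: bump_differentiable grad_bump_continuous bump_outside)

lemma grad_zero_outside:
 fixes q :: "real^'n => real"
 assumes "!!x. norm x > R ==> q x = 0" "norm x > R"
 shows "grad q x = 0"
proof (rule grad_eqI)
 have "((%x::real^'n. 0::real) has_derivative (%h. 0 \<bullet> h)) (at x)" by simp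
 then show "(q has_derivative (%h. 0 \<bullet> h)) (at x)"
  by (rule has_derivative_transform_within_open[where s="- cball 0 R"]) (use assms in auto)
qed

lemma lborel_integral_eq_integral_cbox:
 fixes f :: "'a::euclidean_space => 'b::euclidean_space"
 assumes f: "continuous_on UNIV f" and s: "!!x. norm x > R ==> f x = 0" and a: "cball 0 R \<subseteq> cbox (-a) a"
 shows "(LINT x|lborel. f x) = integral (cbox (-a) a) f"
proof -
 have "(f has_integral (LINT x|lborel. f x)) UNIV"
  by (rule has_integral_integral_lborel[OF integrable_cont_bdd(1)[OF f s]])
 moreover have "(%x. if x \<in> cbox (-a) a then f x else 0) = f"
 proof
  fix x show "(if x \<in> cbox (-a) a then f x else 0) = f x"
   using a s[of x] by (cases "norm x <= R") auto
 qed
 ultimately have "(f has_integral (LINT x|lborel. f x)) (cbox (-a) a)"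
  using has_integral_restrict_UNIV[of "cbox (-a) a" f "LINT x|lborel. f x"] by simp
 then show ?thesis by (simp add: integral_unique)
qed

definition conv :: "(real^'n => real) => (real^'n => real) => real^'n => real"
 where "conv g \<kappa> y = (LINT z|lborel. g z * \<kappa> (y - z))"

context
 fixes g :: "real^'n => real" and R :: real
 assumes g: "continuous_on UNIV g" and g0: "!!x. norm x > R ==> g x = 0"
begin

lemma conv_continuous:
 assumes k: "continuous_on UNIV \<kappa>"
 shows "continuous_on UNIV (conv g \<kappa>)"
proof -
 obtain a :: "real^'n" where a: "cball 0 R \<subseteq> cbox (-a) a"
  using bounded_subset_cbox_symmetric[OF bounded_cball] by blast
 have "conv g \<kappa> y = integral (cbox (-a) a) (%z. g z * \<kappa> (y - z))" for y
  unfolding conv_def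
  by (rule lborel_integral_eq_integral_cbox[OF _ _ a])
    (auto intro!: continuous_intros g continuous_on_compose2[OF k] simp: g0)
 moreover have "continuous_on UNIV (%y. integral (cbox (-a) a) (%z. g z * \<kappa> (y - z)))"
  by (rule integral_continuous_on_param)
    (auto simp: split_beta intro!: continuous_intros continuous_on_compose2[OF g] continuous_on_compose2[OF k])
 ultimately show ?thesis by (simp add: fun_eq_iff[symmetric] cong: continuous_on_cong)
qed

lemma conv_has_derivative:
 assumes k: "!!x. \<kappa> differentiable (at x)" and k': "continuous_on UNIV (grad \<kappa>)"
 shows "(conv g \<kappa> has_derivative (%h. (LINT z|lborel. g z *\<^sub>R grad \<kappa> (y - z)) \<bullet> h)) (at y)"
proof -
 obtain a :: "real^'n" where a: "cball 0 R \<subseteq> cbox (-a) a"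
  using bounded_subset_cbox_symmetric[OF bounded_cball] by blast
 note kc = diff_imp_cont[OF k]
 let ?fx = "%y z. blinfun_inner_right (g z *\<^sub>R grad \<kappa> (y - z))"
 have eq: "conv g \<kappa> = (%y. integral (cbox (-a) a) (%z. g z * \<kappa> (y - z)))"
  unfolding conv_def[abs_def]
  by (intro ext lborel_integral_eq_integral_cbox[OF _ _ a])
    (auto intro!: continuous_intros g continuous_on_compose2[OF kc] simp: g0)
 have gc: "continuous_on UNIV (%z. g z *\<^sub>R grad \<kappa> (y - z))" for y
  by (auto intro!: continuous_intros g continuous_on_compose2[OF k'])
 have "((%y. integral (cbox (-a) a) (%z. g z * \<kappa> (y - z))) has_derivative
   blinfun_apply (integral (cbox (-a) a) (?fx y))) (at y within UNIV)"
 proof (rule leibniz_rule)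
  fix x z :: "real^'n"
  have "((%x. x - z) has_derivative (%h. h)) (at x)"
   by (auto intro!: derivative_eq_intros)
  from has_derivative_compose[OF this, OF grad_has_derivative[OF k]]
  have "((%x. g z * \<kappa> (x - z)) has_derivative (%h. g z * (grad \<kappa> (x - z) \<bullet> h))) (at x)"
   by (rule has_derivative_mult_right)
  then show "((%x. g z * \<kappa> (x - z)) has_derivative blinfun_apply (?fx x z)) (at x within UNIV)"
   by (simp add: blinfun_inner_right.rep_eq inner_scaleR_left[abs_def])
 next
  fix x :: "real^'n"
  show "(%z. g z * \<kappa> (x - z)) integrable_on cbox (- a) a"
   by (intro integrable_continuous continuous_intros continuous_on_compose2[OF kc] continuous_on_compose2[OF g]) auto
 next
  show "continuous_on (UNIV \<times> cbox (- a) a) (%(x, t). ?fx x t)"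
   by (auto simp: split_beta intro!: continuous_intros continuous_on_compose2[OF g] continuous_on_compose2[OF k']
    bounded_linear.continuous_on[OF bounded_linear_blinfun_inner_right])
 qed auto
 moreover have "integral (cbox (-a) a) (?fx y)
   = blinfun_inner_right (integral (cbox (-a) a) (%z. g z *\<^sub>R grad \<kappa> (y - z)))"
  using integral_linear[OF integrable_continuous[OF continuous_on_subset[OF gc subset_UNIV]] bounded_linear_blinfun_inner_right]
  by (simp add: o_def)
 moreover have "integral (cbox (-a) a) (%z. g z *\<^sub>R grad \<kappa> (y - z)) = (LINT z|lborel. g z *\<^sub>R grad \<kappa> (y - z))"
  by (rule lborel_integral_eq_integral_cbox[OF gc _ a, symmetric]) (simp add: g0)
 ultimately show ?thesis
  unfolding eq by (simp add: blinfun_inner_right.rep_eq)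
qed

lemma grad_conv_component:
 assumes k: "!!x. \<kappa> differentiable (at x)" and k': "continuous_on UNIV (grad \<kappa>)"
 shows "grad (conv g \<kappa>) y \<bullet> b = conv g (%x. grad \<kappa> x \<bullet> b) y"
proof -
 have "integrable lborel (%z. g z *\<^sub>R grad \<kappa> (y - z))"
  by (rule integrable_cont_bdd(1)[where R=R])
    (auto intro!: continuous_intros g continuous_on_compose2[OF k'] simp: g0)
 then show ?thesis
  by (simp add: grad_eqI[OF conv_has_derivative[OF k k']] conv_def flip: integral_inner_left)
qed

lemma conv_support:
 assumes k: "!!x. norm x > r ==> \<kappa> x = 0" and y: "norm y > R + r"
 shows "conv g \<kappa> y = 0"
proof -
 have "g z * \<kappa> (y - z) = 0" for z
 proof (cases "norm z > R")
  case False
  have "norm y <= norm z + norm (y - z)"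
   by (metis add.commute diff_add_cancel norm_triangle_ineq)
  then have "norm (y - z) > r" using False y by auto
  then show ?thesis using k by simp
 qed (simp add: g0)
 then show ?thesis unfolding conv_def by (simp only: Bochner_Integration.integral_zero)
qed

lemma test2_conv:
 assumes k: "test2 r \<kappa>"
 shows "test2 (R + r) (conv g \<kappa>)"
 unfolding test2_def
proof (intro conjI allI impI)
 have k1: "\<kappa> differentiable (at x)" "continuous_on UNIV (grad \<kappa>)"
  "(%y. grad \<kappa> y \<bullet> b) differentiable (at x)" "continuous_on UNIV (grad (%y. grad \<kappa> y \<bullet> b))" for x b
  using k by (auto simp: test2_def)
 note gcomp = grad_conv_component[OF k1(1,2)]
 show "conv g \<kappa> differentiable (at x)" for x
  using conv_has_derivative[OF k1(1,2)] differentiableI by blast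
 have c1: "continuous_on UNIV (%y. grad (conv g \<kappa>) y \<bullet> b)" for b
  unfolding gcomp
  by (intro conv_continuous) (intro continuous_intros k1)
 then show "continuous_on UNIV (grad (conv g \<kappa>))"
  by (intro continuous_on_componentwise[THEN iffD2]) blast
 show "(%y. grad (conv g \<kappa>) y \<bullet> b) differentiable (at x)" for b x
  unfolding gcomp using conv_has_derivative[OF k1(3,4)] differentiableI by (metis (no_types, lifting) ext)
 have "continuous_on UNIV (%y. grad (conv g (%x. grad \<kappa> x \<bullet> b)) y \<bullet> c)" for b c
  unfolding grad_conv_component[OF k1(3,4)]
  by (intro conv_continuous) (intro continuous_intros k1)
 then show "continuous_on UNIV (grad (%y. grad (conv g \<kappa>) y \<bullet> b))" for b
  unfolding gcomp by (intro continuous_on_componentwise[THEN iffD2]) blast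
 show "conv g \<kappa> x = 0" if "norm x > R + r" for x
  using k that by (intro conv_support) (auto simp: test2_def)
qed

end

lemma conv_grad_component:
 fixes g :: "real^'n => real"
 assumes g: "!!x. g differentiable (at x)" and g0: "!!x. norm x > R ==> g x = 0"
  and g': "integrable lborel (grad g)" and k: "test2 r \<kappa>"
 shows "grad (conv g \<kappa>) y \<bullet> b = (LINT z|lborel. \<kappa> (y - z) * (grad g z \<bullet> b))"
proof -
 note gc = diff_imp_cont[OF g]
 have k1: "!!x. \<kappa> differentiable (at x)" "continuous_on UNIV (grad \<kappa>)" "!!x. norm x > r ==> \<kappa> x = 0"
  using k by (auto simp: test2_def)
 have d: "((%z. \<kappa> (y - z)) has_derivative (%h. (- grad \<kappa> (y - z)) \<bullet> h)) (at z)" for z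
 proof -
  have "((%z. y - z) has_derivative (%h. - h)) (at z)"
   by (auto intro!: derivative_eq_intros)
  from has_derivative_compose[OF this, OF grad_has_derivative[OF k1(1)]]
  show ?thesis by simp
 qed
 have gq: "grad (%z. \<kappa> (y - z)) = (%z. - grad \<kappa> (y - z))"
  by (intro ext grad_eqI d)
 have z: "norm z > norm y + r ==> \<kappa> (y - z) = 0" for z
 proof -
  assume a: "norm z > norm y + r"
  have "norm z <= norm y + norm (y - z)"
   by (metis add.commute diff_add_cancel norm_minus_commute norm_triangle_ineq)
  then show ?thesis using a k1(3) by auto
 qed
 have "(LINT z|lborel. \<kappa> (y - z) * (grad g z \<bullet> b)) = - (LINT z|lborel. g z * (grad (%z. \<kappa> (y - z)) z \<bullet> b))"
 proof (rule integral_by_parts_bounded_support(2)[where R="norm y + r"])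
  show "integrable lborel (%x. indicat_real (cball 0 R) x *\<^sub>R grad g x)" for R
   using g' by (intro integrable_mult_indicator) auto
  show "(%z. \<kappa> (y - z)) differentiable (at x)" for x
   using d differentiableI by blast
  show "continuous_on UNIV (grad (%z. \<kappa> (y - z)))"
   unfolding gq by (auto intro!: continuous_intros continuous_on_compose2[OF k1(2)])
  show "grad (%z. \<kappa> (y - z)) x = 0" if "norm x > norm y + r" for x
   by (rule grad_zero_outside[OF z that])
 qed (use g z in auto)
 also have "... = conv g (%x. grad \<kappa> x \<bullet> b) y"
  by (simp add: gq conv_def)
 also have "... = grad (conv g \<kappa>) y \<bullet> b"
  by (rule grad_conv_component[OF gc g0 k1(1,2), symmetric])
 finally show ?thesis by simp
qed

section \<open>Approximation by twice differentiable test functions\<close>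

lemma test2_scale:
 assumes "test2 R q" shows "test2 R (%x. c * q x)"
proof -
 have q: "q differentiable (at x)" "(%y. grad q y \<bullet> b) differentiable (at x)" for x b
  using assms by (auto simp: test2_def)
 have s: "grad (%x. c * h x) x = c *\<^sub>R grad h x" if "h differentiable (at x)" for h :: "real^'a => real" and x
  by (rule grad_eqI) (auto intro!: derivative_eq_intros grad_has_derivative that)
 have g: "grad (%x. c * q x) = (%x. c *\<^sub>R grad q x)"
  using s[OF q(1)] by blast
 have g2: "grad (%x. grad (%x. c * q x) x \<bullet> b) = (%x. c *\<^sub>R grad (%x. grad q x \<bullet> b) x)" for b
  using s[OF q(2)] by (simp add: g fun_eq_iff)
 show ?thesis
  using assms unfolding test2_def g2 unfolding g
  by (auto intro!: continuous_intros)
qed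

lemma mollifier_exists:
 assumes r: "r > 0"
 shows "\<exists>\<eta>::real^'n => real. test2 r \<eta> & (\<forall>x. \<eta> x >= 0) & integrable lborel \<eta> & (LINT x|lborel. \<eta> x) = 1"
proof -
 have ib: "integrable lborel (bump r :: real^'n => real)"
  by (rule integrable_cont_bdd(1)[where R=r]) (auto simp: bump_continuous bump_outside r)
 define c where "c = (\<integral>x. bump r x \<partial>(lborel :: (real^'n) measure))"
 have fin: "emeasure lborel (ball (0::real^'n) (r/2)) < \<infinity>"
  using emeasure_bounded_finite[of "ball (0::real^'n) (r/2)"] by simp
 have i2: "integrable lborel (%x::real^'n. (27/64) * indicator (ball 0 (r/2)) x :: real)"
  using fin by (intro integrable_mult_right integrable_real_indicator) auto
 have "(27/64) * indicator (ball 0 (r/2)) x <= bump r x" for x :: "real^'n"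
 proof (cases "norm x < r/2")
  case True
  then have "x \<bullet> x <= (r/2)\<^sup>2" by (intro norm_le_imp_inner_le) simp
  then have "3/4 <= 1 - (x \<bullet> x) / r\<^sup>2" using r by (simp add: field_simps)
  then have "3/4 <= max 0 (1 - (x \<bullet> x) / r\<^sup>2)" by (rule order_trans[OF _ max.cobounded2])
  then have "(3/4)^3 <= max 0 (1 - (x \<bullet> x) / r\<^sup>2) ^ 3" by (rule power_mono) simp
  then show ?thesis using True by (simp add: bump_def power_divide)
 qed (simp add: bump_nonneg)
 then have "(\<integral>x. (27/64) * indicator (ball 0 (r/2)) x \<partial>(lborel :: (real^'n) measure)) <= c"
  unfolding c_def using i2 ib by (intro integral_mono)
 moreover have "(\<integral>x. (27/64) * indicator (ball 0 (r/2)) x \<partial>(lborel :: (real^'n) measure))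
   = (27/64) * measure lborel (ball (0::real^'n) (r/2))"
  using fin by simp
 moreover have "measure lborel (ball (0::real^'n) (r/2)) > 0"
  using content_ball_pos[of "r/2" "0::real^'n"] r by simp
 ultimately have c: "c > 0" by linarith
 show ?thesis
  by (rule exI[of _ "%x. (1/c) * bump r x"])
    (use c ib in \<open>auto simp: bump_nonneg c_def[symmetric] intro!: test2_scale[OF test2_bump[OF r], of "1/c", simplified]\<close>)
qed

lemma integral_reflect:
 fixes h :: "'a::euclidean_space => 'b::{banach, second_countable_topology}"
 assumes [measurable]: "h \<in> borel_measurable borel"
 shows "(LINT z|lborel. h (y - z)) = (LINT z|lborel. h z)"
  and "integrable lborel (%z. h (y - z)) \<longleftrightarrow> integrable lborel h"
proof -
 have d: "distr lborel borel ((%z. y - z) :: 'a => 'a) = lborel"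
  using lborel_affine[of "-1" y] by (simp add: density_1)
 show "(LINT z|lborel. h (y - z)) = (LINT z|lborel. h z)"
  using integral_distr[of "%z. y - z" lborel borel h] d by simp
 show "integrable lborel (%z. h (y - z)) \<longleftrightarrow> integrable lborel h"
  using integrable_distr_eq[of "%z. y - z" lborel borel h] d by simp
qed

lemma square_mean_le:
 fixes X \<eta> :: "'a => real"
 assumes [measurable]: "X \<in> borel_measurable M" and \<eta>: "integrable M \<eta>" "!!x. \<eta> x >= 0" "(LINT x|M. \<eta> x) = 1"
  and X: "integrable M (%x. X x * \<eta> x)"
 shows "ennreal ((LINT x|M. X x * \<eta> x)\<^sup>2) <= (\<integral>\<^sup>+x. ennreal ((X x)\<^sup>2) * ennreal (\<eta> x) \<partial>M)"
proof (cases "(\<integral>\<^sup>+x. ennreal ((X x)\<^sup>2) * ennreal (\<eta> x) \<partial>M) = \<infinity>")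
 case False
 have [measurable]: "\<eta> \<in> borel_measurable M" using \<eta>(1) by simp
 have eq: "ennreal ((X x)\<^sup>2) * ennreal (\<eta> x) = ennreal ((X x)\<^sup>2 * \<eta> x)" for x
  by (simp add: ennreal_mult \<eta>(2))
 have i: "integrable M (%x. (X x)\<^sup>2 * \<eta> x)"
  using False by (intro integrableI_bounded) (auto simp: eq \<eta>(2) abs_mult top.not_eq_extremum)
 define A where "A = (LINT x|M. X x * \<eta> x)"
 have "0 <= (LINT x|M. (X x - A)\<^sup>2 * \<eta> x)"
  by (intro integral_nonneg_AE) (simp add: \<eta>(2))
 also have "... = (LINT x|M. (X x)\<^sup>2 * \<eta> x - 2 * A * (X x * \<eta> x) + A\<^sup>2 * \<eta> x)"
  by (intro integral_cg) (auto simp: power2_eq_square algebra_simps)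
 also have "... = (LINT x|M. (X x)\<^sup>2 * \<eta> x) - A\<^sup>2"
  using i X \<eta>(1) by (simp add: \<eta>(3) A_def[symmetric] power2_eq_square)
 finally have "A\<^sup>2 <= (LINT x|M. (X x)\<^sup>2 * \<eta> x)" by simp
 moreover have "(\<integral>\<^sup>+x. ennreal ((X x)\<^sup>2) * ennreal (\<eta> x) \<partial>M) = ennreal (LINT x|M. (X x)\<^sup>2 * \<eta> x)"
  unfolding eq by (rule nn_integral_eq_integral[OF i]) (simp add: \<eta>(2))
 ultimately show ?thesis
  by (simp add: A_def ennreal_leI)
qed simp

lemma integrable_of_L2_bounded_support:
 fixes v :: "'a::euclidean_space => 'b::{banach, second_countable_topology}"
 assumes [measurable]: "v \<in> borel_measurable borel"
  and s: "!!x. norm x > R ==> v x = 0" and i: "integrable lborel (%x. (norm (v x))\<^sup>2)"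
 shows "integrable lborel v"
proof (rule integrable_bd)
 show "integrable lborel (%x. indicat_real (cball 0 R) x + (norm (v x))\<^sup>2)"
  using i emeasure_bounded_finite[of "cball (0::'a) R"]
  by (intro Bochner_Integration.integrable_add integrable_real_indicator) auto
 show "AE x in lborel. norm (v x) <= norm (indicat_real (cball 0 R) x + (norm (v x))\<^sup>2)"
 proof (rule AE_I2)
  fix x
  have "norm (v x) <= 1 + (norm (v x))\<^sup>2"
   using sum_squares_bound[of 1 "norm (v x)"] by simp (smt (verit) norm_ge_zero)
  then show "norm (v x) <= norm (indicat_real (cball 0 R) x + (norm (v x))\<^sup>2)"
   using s[of x] by (cases "norm x <= R") auto
 qed
qed simp

lemma norm_sq_eq_sum_Basis: "(norm (v::'a::euclidean_space))\<^sup>2 = (\<Sum>b\<in>Basis. (v \<bullet> b)\<^sup>2)"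
 unfolding power2_norm_eq_inner by (subst euclidean_inner) (simp add: power2_eq_square)

text \<open>Mollification.  The error of the gradient is an average of translation errors, so it is
 small in \<open>L\<^sup>2\<close> by continuity of translations; continuity of the gradient is never used.\<close>

lemma approx_by_test2:
 fixes g :: "real^'n => real"
 assumes g: "!!x. g differentiable (at x)" and g0: "!!x. norm x > R ==> g x = 0"
  and L2: "integrable lborel (%x. (norm (grad g x))\<^sup>2)" and "\<epsilon> > 0"
 shows "\<exists>q. test2 (R + 1) q & (\<forall>x. \<bar>q x - g x\<bar> <= \<epsilon>) &
  (\<integral>\<^sup>+x. ennreal ((norm (grad q x - grad g x))\<^sup>2) \<partial>lborel) <= ennreal \<epsilon>"
proof -
 note gc = diff_imp_cont[OF g]
 have [measurable]: "grad g \<in> borel_measurable borel" "g \<in> borel_measurable borel"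
  using grad_measurable[OF g] borel_of_cont[OF gc] by auto
 have gg0: "norm x > R ==> grad g x = 0" for x
  by (rule grad_zero_outside[OF g0])
 have ig: "integrable lborel (grad g)"
  by (rule integrable_of_L2_bounded_support[OF _ gg0 L2]) auto
 define N where "N = real (card (Basis :: (real^'n) set))"
 have N: "N > 0" by (simp add: N_def)
 define P where "P = (%b \<delta>. \<delta> > 0 & (\<forall>z. norm z < \<delta> -->
  (\<integral>\<^sup>+y. ennreal ((grad g (y - z) \<bullet> b - grad g y \<bullet> b)\<^sup>2) \<partial>lborel) <= ennreal (\<epsilon> / N)))"
 have "\<forall>b\<in>Basis. \<exists>\<delta>. P b \<delta>"
 proof
  fix b :: "real^'n" assume b: "b \<in> Basis"
  have "integrable lborel (%x. (grad g x \<bullet> b)\<^sup>2)"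
  proof (rule integrable_bd[OF L2])
   show "AE x in lborel. norm ((grad g x \<bullet> b)\<^sup>2) <= norm ((norm (grad g x))\<^sup>2)"
    using Basis_le_norm[OF b] by (intro AE_I2) (simp add: power2_le_iff_abs_le)
  qed measurable
  moreover have "\<epsilon> / N > 0" using \<open>\<epsilon> > 0\<close> N by simp
  ultimately show "\<exists>\<delta>. P b \<delta>"
   unfolding P_def using L2_translation_continuous[of "%x. grad g x \<bullet> b" R "\<epsilon> / N"] gg0 by simp
 qed
 from bchoice[OF this] obtain \<delta> where P: "\<forall>b\<in>Basis. P b (\<delta> b)" ..
 then have \<delta>: "!!b. b \<in> Basis ==> \<delta> b > 0"
  and \<delta>2: "!!b z. b \<in> Basis ==> norm z < \<delta> b ==>
   (\<integral>\<^sup>+y. ennreal ((grad g (y - z) \<bullet> b - grad g y \<bullet> b)\<^sup>2) \<partial>lborel) <= ennreal (\<epsilon> / N)"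
  by (auto simp: P_def)
 obtain d where d: "d > 0" "d <= 1" "!!x y. norm (x - y) < d ==> \<bar>g x - g y\<bar> < \<epsilon>"
  using continuous_compact_support_uniform[OF gc g0 \<open>\<epsilon> > 0\<close>, unfolded real_norm_def] by blast
 define m where "m = Min (\<delta> ` Basis)"
 have m: "m > 0" "b \<in> Basis ==> m <= \<delta> b" for b
  using \<delta> by (auto simp: m_def)
 define r where "r = min d m / 2"
 have r: "r > 0" "r < d" "r < m" "r <= 1" using d m by (auto simp: r_def)
 obtain \<eta> :: "real^'n => real" where \<eta>: "test2 r \<eta>" and \<eta>0: "!!x. \<eta> x >= 0" and i\<eta>: "integrable lborel \<eta>"
  and \<eta>1: "(LINT x|lborel. \<eta> x) = 1"
  using mollifier_exists[OF r(1)] by blast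
 have \<eta>s: "!!x. norm x > r ==> \<eta> x = 0" and \<eta>c: "continuous_on UNIV \<eta>"
  using \<eta> diff_imp_cont[of \<eta>] by (auto simp: test2_def)
 have [measurable]: "\<eta> \<in> borel_measurable borel" using i\<eta> by simp
 obtain C where C: "!!x. norm (\<eta> x) <= C"
  using integrable_cont_bdd(2)[OF \<eta>c \<eta>s] by blast
 define q where "q = conv g \<eta>"
 have t: "test2 (R + r) q"
  unfolding q_def by (rule test2_conv[OF gc g0 \<eta>])
 have t1: "test2 (R + 1) q"
  using t r(4) by (auto simp: test2_def)
 have bnd: "\<bar>q y - g y\<bar> <= \<epsilon>" for y
 proof -
  have q: "q y = (LINT x|lborel. g (y - x) * \<eta> x)"
   unfolding q_def conv_def
   using integral_reflect(1)[of "%x. g (y - x) * \<eta> x" y] by simp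
  have i: "integrable lborel (%x. g (y - x) * \<eta> x)"
   by (rule integrable_cont_bdd(1)[where R=r])
    (auto intro!: continuous_intros continuous_on_compose2[OF gc] \<eta>c simp: \<eta>s)
  have "q y - g y = (LINT x|lborel. g (y - x) * \<eta> x - g y * \<eta> x)"
   using i i\<eta> by (simp add: q \<eta>1)
  also have "\<bar>...\<bar> <= (LINT x|lborel. \<bar>g (y - x) * \<eta> x - g y * \<eta> x\<bar>)"
   by (rule integral_abs_bound)
  also have "... <= (LINT x|lborel. \<epsilon> * \<eta> x)"
  proof (rule integral_mono)
   fix x
   show "\<bar>g (y - x) * \<eta> x - g y * \<eta> x\<bar> <= \<epsilon> * \<eta> x"
   proof (cases "norm x > r")
    case False
    then have "\<bar>g (y - x) - g y\<bar> <= \<epsilon>" using d(3)[of "y - x" y] r(2) by auto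
    then show ?thesis
    using mult_right_mono[of "\<bar>g (y - x) - g y\<bar>" \<epsilon> "\<eta> x"] \<eta>0[of x]
    by (simp add: abs_mult flip: left_diff_distrib)
   qed (simp add: \<eta>s)
  qed (use i i\<eta> in auto)
  also have "... = \<epsilon>" by (simp add: \<eta>1)
  finally show ?thesis .
 qed
 have comp: "(\<integral>\<^sup>+y. ennreal (((grad q y - grad g y) \<bullet> b)\<^sup>2) \<partial>lborel) <= ennreal (\<epsilon> / N)"
  if b: "b \<in> Basis" for b
 proof -
  let ?u = "%y. grad g y \<bullet> b"
  have pw: "ennreal (((grad q y - grad g y) \<bullet> b)\<^sup>2)
    <= (\<integral>\<^sup>+x. ennreal ((?u (y - x) - ?u y)\<^sup>2) * ennreal (\<eta> x) \<partial>lborel)" for y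
  proof -
   have iu: "integrable lborel (%x. ?u (y - x) * \<eta> x)"
   proof (rule integrable_bd)
    show "integrable lborel (%x. C * ?u (y - x))"
    using integral_reflect(2)[of ?u y] ig by (intro integrable_mult_right) auto
    show "AE x in lborel. norm (grad g (y - x) \<bullet> b * \<eta> x) <= norm (C * (grad g (y - x) \<bullet> b))"
    proof (rule AE_I2)
    fix x
    have "\<bar>\<eta> x\<bar> <= \<bar>C\<bar>" using C[of x] by simp
    then show "norm (grad g (y - x) \<bullet> b * \<eta> x) <= norm (C * (grad g (y - x) \<bullet> b))"
    by (simp add: abs_mult mult.commute[of "\<bar>C\<bar>"] mult_left_mono)
    qed
   qed measurable
   have "grad q y \<bullet> b = (LINT z|lborel. \<eta> (y - z) * ?u z)"
    unfolding q_def by (rule conv_grad_component[OF g g0 ig \<eta>])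
   also have "... = (LINT x|lborel. ?u (y - x) * \<eta> x)"
    using integral_reflect(1)[of "%x. ?u (y - x) * \<eta> x" y] by (simp add: mult.commute)
   finally have "(grad q y - grad g y) \<bullet> b = (LINT x|lborel. (?u (y - x) - ?u y) * \<eta> x)"
    using iu i\<eta> by (simp add: inner_diff_left left_diff_distrib \<eta>1)
   moreover have "integrable lborel (%x. (?u (y - x) - ?u y) * \<eta> x)"
    using iu i\<eta> by (simp add: left_diff_distrib)
   ultimately show ?thesis
    using square_mean_le[of "%x. ?u (y - x) - ?u y" lborel \<eta>] i\<eta> \<eta>0 \<eta>1 by simp
  qed
  have "(\<integral>\<^sup>+y. ennreal (((grad q y - grad g y) \<bullet> b)\<^sup>2) \<partial>lborel)
   <= (\<integral>\<^sup>+y. (\<integral>\<^sup>+x. ennreal ((?u (y - x) - ?u y)\<^sup>2) * ennreal (\<eta> x) \<partial>lborel) \<partial>lborel)"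
   by (intro nn_integral_mono pw)
  also have "... = (\<integral>\<^sup>+x. (\<integral>\<^sup>+y. ennreal ((?u (y - x) - ?u y)\<^sup>2) * ennreal (\<eta> x) \<partial>lborel) \<partial>lborel)"
   by (rule lborel_pair.Fubini') measurable
  also have "... = (\<integral>\<^sup>+x. (\<integral>\<^sup>+y. ennreal ((?u (y - x) - ?u y)\<^sup>2) \<partial>lborel) * ennreal (\<eta> x) \<partial>lborel)"
   by (intro nn_integral_cong nn_integral_multc) measurable
  also have "... <= (\<integral>\<^sup>+x. ennreal (\<epsilon> / N) * ennreal (\<eta> x) \<partial>lborel)"
  proof (rule nn_integral_mono)
   fix x
   show "(\<integral>\<^sup>+y. ennreal ((?u (y - x) - ?u y)\<^sup>2) \<partial>lborel) * ennreal (\<eta> x) <= ennreal (\<epsilon> / N) * ennreal (\<eta> x)"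
   proof (cases "norm x > r")
    case False
    then have "norm x < \<delta> b" using r(3) m(2)[OF b] by auto
    from \<delta>2[OF b this] show ?thesis by (intro mult_right_mono) auto
   qed (simp add: \<eta>s)
  qed
  also have "... = ennreal (\<epsilon> / N) * (\<integral>\<^sup>+x. ennreal (\<eta> x) \<partial>lborel)"
   by (rule nn_integral_cmult) measurable
  also have "... = ennreal (\<epsilon> / N)"
   using nn_integral_eq_integral[OF i\<eta>] \<eta>0 \<eta>1 by simp
  finally show ?thesis .
 qed
 have [measurable]: "grad q \<in> borel_measurable borel"
  using t by (intro grad_measurable) (auto simp: test2_def)
 have "(\<integral>\<^sup>+x. ennreal ((norm (grad q x - grad g x))\<^sup>2) \<partial>lborel)
   = (\<Sum>b\<in>Basis. \<integral>\<^sup>+x. ennreal (((grad q x - grad g x) \<bullet> b)\<^sup>2) \<partial>lborel)"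
  by (subst nn_integral_sum[symmetric]) (auto simp: norm_sq_eq_sum_Basis sum_ennreal)
 also have "... <= (\<Sum>b\<in>(Basis :: (real^'n) set). ennreal (\<epsilon> / N))"
  by (intro sum_mono comp)
 also have "... = ennreal (N * (\<epsilon> / N))"
  by (simp add: N_def ennreal_mult'' ennreal_of_nat_eq_real_of_nat \<open>\<epsilon> > 0\<close> less_imp_le flip: ennreal_mult')
 also have "... = ennreal \<epsilon>" using N by simp
 finally show ?thesis using t1 bnd by blast
qed

section \<open>Weak divergence equations\<close>

lemma cauchy_schwarz_integral:
 fixes f g :: "'a => real"
 assumes [measurable]: "f \<in> borel_measurable M" "g \<in> borel_measurable M"
  and f: "integrable M (%x. (f x)\<^sup>2)" and g: "integrable M (%x. (g x)\<^sup>2)"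
 shows "integrable M (%x. f x * g x)"
  and "\<bar>LINT x|M. f x * g x\<bar> <= sqrt (LINT x|M. (f x)\<^sup>2) * sqrt (LINT x|M. (g x)\<^sup>2)"
proof -
 have le: "\<bar>f x * g x\<bar> <= (f x)\<^sup>2 + (g x)\<^sup>2" for x
  using sum_squares_bound[of "\<bar>f x\<bar>" "\<bar>g x\<bar>"] mult_nonneg_nonneg[OF abs_ge_zero[of "f x"] abs_ge_zero[of "g x"]]
  unfolding abs_mult power2_abs by linarith
 show i: "integrable M (%x. f x * g x)"
  by (rule integrable_bd[OF Bochner_Integration.integrable_add[OF f g]]) (use le in auto)
 define F G A where "F = (LINT x|M. (f x)\<^sup>2)" and "G = (LINT x|M. (g x)\<^sup>2)" and "A = (LINT x|M. f x * g x)"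
 have FG: "F >= 0" "G >= 0" by (auto simp: F_def G_def)
 have q: "0 <= s\<^sup>2 * F - 2 * s * t * A + t\<^sup>2 * G" for s t
 proof -
  have "0 <= (LINT x|M. (s * f x - t * g x)\<^sup>2)" by simp
  also have "... = (LINT x|M. s\<^sup>2 * (f x)\<^sup>2 - 2 * s * t * (f x * g x) + t\<^sup>2 * (g x)\<^sup>2)"
   by (intro integral_cg) (auto simp: power2_eq_square algebra_simps)
  also have "... = s\<^sup>2 * F - 2 * s * t * A + t\<^sup>2 * G"
   using i f g by (simp add: F_def G_def A_def)
  finally show ?thesis .
 qed
 have "A\<^sup>2 <= F * G"
 proof (cases "G = 0")
  case True
  show ?thesis
  proof (cases "A = 0")
   case False
   have "0 <= F - 2 * ((F + 1) / (2 * A)) * A"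
    using q[of 1 "(F + 1) / (2 * A)"] True by simp
   then show ?thesis using False by simp
  qed (simp add: FG)
 next
  case False
  have "0 <= G * (F * G - A\<^sup>2)"
   using q[of G A] by (simp add: power2_eq_square algebra_simps)
  then show ?thesis using False FG by (simp add: zero_le_mult_iff)
 qed
 then have "sqrt (A\<^sup>2) <= sqrt (F * G)" by (rule real_sqrt_le_mono)
 then show "\<bar>A\<bar> <= sqrt F * sqrt G" by (simp add: real_sqrt_mult)
qed

lemma cauchy_schwarz_integral_inner:
 fixes f g :: "'a => 'b::euclidean_space"
 assumes [measurable]: "f \<in> borel_measurable M" "g \<in> borel_measurable M"
  and f: "integrable M (%x. (norm (f x))\<^sup>2)" and g: "integrable M (%x. (norm (g x))\<^sup>2)"
 shows "integrable M (%x. f x \<bullet> g x)"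
  and "\<bar>LINT x|M. f x \<bullet> g x\<bar> <= sqrt (LINT x|M. (norm (f x))\<^sup>2) * sqrt (LINT x|M. (norm (g x))\<^sup>2)"
proof -
 have n: "integrable M (%x. norm (f x) * norm (g x))"
  and b: "\<bar>LINT x|M. norm (f x) * norm (g x)\<bar> <= sqrt (LINT x|M. (norm (f x))\<^sup>2) * sqrt (LINT x|M. (norm (g x))\<^sup>2)"
  using cauchy_schwarz_integral[of "%x. norm (f x)" M "%x. norm (g x)"] f g by auto
 show i: "integrable M (%x. f x \<bullet> g x)"
  by (rule integrable_bd[OF n]) (auto intro!: Cauchy_Schwarz_ineq2)
 have "\<bar>LINT x|M. f x \<bullet> g x\<bar> <= (LINT x|M. \<bar>f x \<bullet> g x\<bar>)"
  by (rule integral_abs_bound)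
 also have "... <= (LINT x|M. norm (f x) * norm (g x))"
  using i n by (intro integral_mono) (auto intro: Cauchy_Schwarz_ineq2)
 also have "... <= sqrt (LINT x|M. (norm (f x))\<^sup>2) * sqrt (LINT x|M. (norm (g x))\<^sup>2)"
  using b by linarith
 finally show "\<bar>LINT x|M. f x \<bullet> g x\<bar> <= sqrt (LINT x|M. (norm (f x))\<^sup>2) * sqrt (LINT x|M. (norm (g x))\<^sup>2)" .
qed

lemma integrable_norm_sq_add:
 fixes f g :: "'a => 'b::euclidean_space"
 assumes [measurable]: "f \<in> borel_measurable M" "g \<in> borel_measurable M"
  and f: "integrable M (%x. (norm (f x))\<^sup>2)" and g: "integrable M (%x. (norm (g x))\<^sup>2)"
 shows "integrable M (%x. (norm (f x + g x))\<^sup>2)" "integrable M (%x. (norm (f x - g x))\<^sup>2)"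
proof -
 have "(norm (f x + g x))\<^sup>2 = (norm (f x))\<^sup>2 + 2 * (f x \<bullet> g x) + (norm (g x))\<^sup>2"
  "(norm (f x - g x))\<^sup>2 = (norm (f x))\<^sup>2 - 2 * (f x \<bullet> g x) + (norm (g x))\<^sup>2" for x
  by (simp_all add: power2_norm_eq_inner inner_add_left inner_add_right inner_diff_left inner_diff_right inner_commute)
 then show "integrable M (%x. (norm (f x + g x))\<^sup>2)" "integrable M (%x. (norm (f x - g x))\<^sup>2)"
  using cauchy_schwarz_integral_inner(1)[of f M g] f g by auto
qed

lemma nn_integral_sq_finite_imp_integrable:
 assumes [measurable]: "f \<in> borel_measurable M"
  and "(\<integral>\<^sup>+x. ennreal ((norm (f x :: 'b::euclidean_space))\<^sup>2) \<partial>M) <= ennreal C" "C >= 0"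
 shows "integrable M (%x. (norm (f x))\<^sup>2)" "(LINT x|M. (norm (f x))\<^sup>2) <= C"
proof -
 show i: "integrable M (%x. (norm (f x))\<^sup>2)"
  using assms(2) by (intro integrableI_bounded) (auto simp: order.strict_trans1)
 show "(LINT x|M. (norm (f x))\<^sup>2) <= C"
  using assms(2,3) nn_integral_eq_integral[OF i] by simp
qed

text \<open>A cutoff that keeps the sign, does not increase the slope, and only loses a gradient
 of order \<open>1/n\<close>: the radius \<open>n\<^sup>2\<close> of the bump beats the height \<open>n\<close> of the truncation.\<close>

definition trunc :: "nat => (real^'n => real) => real^'n => real"
 where "trunc n f x = bump ((real n)\<^sup>2) x * (real n * arctan (f x / real n))"

lemma trunc_props:
 fixes f :: "real^'n => real"
 assumes f: "!!x. f differentiable (at x)" and n: "n > 0"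
 shows "trunc n f differentiable (at x)"
  and "grad (trunc n f) x = (bump ((real n)\<^sup>2) x / (1 + (f x / real n)\<^sup>2)) *\<^sub>R grad f x
    + (real n * arctan (f x / real n)) *\<^sub>R grad (bump ((real n)\<^sup>2)) x"
  and "norm (grad (trunc n f) x) <= norm (grad f x) + 12 / real n"
  and "norm x > (real n)\<^sup>2 ==> trunc n f x = 0"
  and "\<bar>trunc n f x\<bar> <= \<bar>f x\<bar>"
  and "f x >= 0 ==> trunc n f x >= 0"
proof -
 have "((%s. real n * arctan (s / real n)) has_real_derivative real n * (inverse (1 + (f x / real n)\<^sup>2) * (1 / real n))) (at (f x))"
  by (intro derivative_eq_intros) (auto simp: n)
 then have d: "((%s. real n * arctan (s / real n)) has_real_derivative 1 / (1 + (f x / real n)\<^sup>2)) (at (f x))"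
 proof (rule DERIV_cong)
  have "real n * (c * (1 / real n)) = c" for c using n by simp
  then show "real n * (inverse (1 + (f x / real n)\<^sup>2) * (1 / real n)) = 1 / (1 + (f x / real n)\<^sup>2)"
   by (simp only: inverse_eq_divide)
 qed
 note c = grad_compose_real[OF f d]
 show "trunc n f differentiable (at x)"
  unfolding trunc_def[abs_def] by (intro differentiable_mult bump_differentiable c)
 show g: "grad (trunc n f) x = (bump ((real n)\<^sup>2) x / (1 + (f x / real n)\<^sup>2)) *\<^sub>R grad f x
    + (real n * arctan (f x / real n)) *\<^sub>R grad (bump ((real n)\<^sup>2)) x"
  unfolding trunc_def[abs_def] by (subst grad_mult[OF bump_differentiable c(3)]) (simp add: c(2))
 have at: "\<bar>arctan s\<bar> <= 2" for s
  using arctan_bounded[of s] pi_less_4 by (auto simp: abs_if)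
 have "bump ((real n)\<^sup>2) x / (1 + (f x / real n)\<^sup>2) <= 1"
 proof -
  have "bump ((real n)\<^sup>2) x <= 1 * (1 + (f x / real n)\<^sup>2)"
   by (rule order_trans[OF bump_le_1]) simp
  moreover have "0 < 1 + (f x / real n)\<^sup>2" by (intro add_pos_nonneg) auto
  ultimately show ?thesis by (simp only: pos_divide_le_eq)
 qed
 then have "norm ((bump ((real n)\<^sup>2) x / (1 + (f x / real n)\<^sup>2)) *\<^sub>R grad f x) <= 1 * norm (grad f x)"
  unfolding norm_scaleR using bump_nonneg[of "(real n)\<^sup>2" x] by (intro mult_right_mono) auto
 moreover have "norm ((real n * arctan (f x / real n)) *\<^sub>R grad (bump ((real n)\<^sup>2)) x) <= (real n * 2) * (6 / (real n)\<^sup>2)"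
  unfolding norm_scaleR using at n norm_grad_bump[of "(real n)\<^sup>2" x]
  by (intro mult_mono) (auto simp: abs_mult intro!: mult_left_mono)
 moreover have "(real n * 2) * (6 / (real n)\<^sup>2) = 12 / real n"
  using n by (simp add: power2_eq_square)
 ultimately show "norm (grad (trunc n f) x) <= norm (grad f x) + 12 / real n"
  unfolding g by (intro order_trans[OF norm_triangle_ineq]) linarith
 show "norm x > (real n)\<^sup>2 ==> trunc n f x = 0"
  using n by (simp add: trunc_def bump_outside)
 have "real n * \<bar>arctan (f x / real n)\<bar> <= real n * \<bar>f x / real n\<bar>"
  by (intro mult_left_mono abs_arctan_le) auto
 also have "... = \<bar>f x\<bar>" using n by simp
 finally have "bump ((real n)\<^sup>2) x * (real n * \<bar>arctan (f x / real n)\<bar>) <= 1 * \<bar>f x\<bar>"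
  using bump_le_1[of "(real n)\<^sup>2" x] bump_nonneg by (intro mult_mono) auto
 then show "\<bar>trunc n f x\<bar> <= \<bar>f x\<bar>"
  by (simp add: trunc_def abs_mult bump_nonneg)
 show "f x >= 0 ==> trunc n f x >= 0"
  by (simp add: trunc_def bump_nonneg)
qed

lemma square_at_top: "filterlim (%n. (real n)\<^sup>2) at_top sequentially"
 by (rule filterlim_pow_at_top[OF _ filterlim_real_sequentially]) simp

text \<open>At a fixed point the bump tends to 1 and \<open>n arctan (s / n)\<close> to \<open>s\<close>.\<close>

lemma trunc_tendsto:
 fixes f :: "real^'n => real"
 assumes f: "!!x. f differentiable (at x)"
 shows "(%n. grad (trunc n f) x) \<longlonglongrightarrow> grad f x"
  and "(%n. trunc n f x) \<longlonglongrightarrow> f x"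
proof -
 have b: "(%n. bump ((real n)\<^sup>2) x) \<longlonglongrightarrow> 1"
  by (rule bump_tendsto_1[OF square_at_top tendsto_const])
 have z: "(%n. f x / real n) \<longlonglongrightarrow> 0"
  by (rule real_tendsto_divide_at_top[OF tendsto_const filterlim_real_sequentially])
 have "(%n. (bump ((real n)\<^sup>2) x / (1 + (f x / real n)\<^sup>2)) *\<^sub>R grad f x) \<longlonglongrightarrow> (1 / (1 + 0\<^sup>2)) *\<^sub>R grad f x"
  by (intro tendsto_intros b z) auto
 moreover have "(%n. (real n * arctan (f x / real n)) *\<^sub>R grad (bump ((real n)\<^sup>2)) x) \<longlonglongrightarrow> 0"
 proof (rule Lim_null_comparison)
  show "(%n. 12 / real n) \<longlonglongrightarrow> 0"
   by (rule real_tendsto_divide_at_top[OF tendsto_const filterlim_real_sequentially])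
  show "\<forall>\<^sub>F n in sequentially. norm ((real n * arctan (f x / real n)) *\<^sub>R grad (bump ((real n)\<^sup>2)) x) <= 12 / real n"
   using eventually_gt_at_top[of 0]
  proof eventually_elim
   case (elim n)
   have at: "\<bar>arctan s\<bar> <= 2" for s
    using arctan_bounded[of s] pi_less_4 by (auto simp: abs_if)
   have "norm ((real n * arctan (f x / real n)) *\<^sub>R grad (bump ((real n)\<^sup>2)) x) <= (real n * 2) * (6 / (real n)\<^sup>2)"
    unfolding norm_scaleR using at elim norm_grad_bump[of "(real n)\<^sup>2" x]
    by (intro mult_mono) (auto simp: abs_mult intro!: mult_left_mono)
   also have "... = 12 / real n"
    using elim by (simp add: power2_eq_square)
   finally show ?case .
  qed
 qed
 ultimately have "(%n. (bump ((real n)\<^sup>2) x / (1 + (f x / real n)\<^sup>2)) *\<^sub>R grad f x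
   + (real n * arctan (f x / real n)) *\<^sub>R grad (bump ((real n)\<^sup>2)) x) \<longlonglongrightarrow> (1 / (1 + 0\<^sup>2)) *\<^sub>R grad f x + 0"
  by (rule tendsto_add)
 then have "(%n. (bump ((real n)\<^sup>2) x / (1 + (f x / real n)\<^sup>2)) *\<^sub>R grad f x
   + (real n * arctan (f x / real n)) *\<^sub>R grad (bump ((real n)\<^sup>2)) x) \<longlonglongrightarrow> grad f x" by simp
 then show "(%n. grad (trunc n f) x) \<longlonglongrightarrow> grad f x"
 proof (rule Lim_transform_eventually)
  show "\<forall>\<^sub>F n in sequentially. (bump ((real n)\<^sup>2) x / (1 + (f x / real n)\<^sup>2)) *\<^sub>R grad f x
   + (real n * arctan (f x / real n)) *\<^sub>R grad (bump ((real n)\<^sup>2)) x = grad (trunc n f) x"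
   using eventually_gt_at_top[of 0] by eventually_elim (simp add: trunc_props(2)[OF f])
 qed
 have lim: "(%n. real n * arctan (f x / real n)) \<longlonglongrightarrow> f x"
 proof -
  have "((%s. arctan (f x * s)) has_real_derivative (inverse (1 + (f x * 0)\<^sup>2) * (f x * 1))) (at 0)"
   by (intro derivative_eq_intros) auto
  then have "((%h. arctan (f x * h) / h) \<longlongrightarrow> f x) (at 0)"
   by (simp add: DERIV_def)
  then have "(%n. arctan (f x * inverse (real (Suc n))) / inverse (real (Suc n))) \<longlonglongrightarrow> f x"
   by (rule filterlim_compose)
    (use LIMSEQ_inverse_real_of_nat in \<open>auto simp: filterlim_at intro!: always_eventually\<close>)
  then have "(%n. real (Suc n) * arctan (f x / real (Suc n))) \<longlonglongrightarrow> f x"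
   by (simp add: divide_inverse mult.commute)
  then show ?thesis by (rule LIMSEQ_imp_Suc)
 qed
 have "(%n. bump ((real n)\<^sup>2) x * (real n * arctan (f x / real n))) \<longlonglongrightarrow> 1 * f x"
  by (intro tendsto_mult b lim)
 then show "(%n. trunc n f x) \<longlonglongrightarrow> f x"
  by (simp add: trunc_def)
qed

lemma trunc_L2:
 fixes f :: "real^'n => real"
 assumes f: "!!x. f differentiable (at x)" and M: "finite_measure M" "sets M = sets borel"
  and i: "integrable M (%x. (norm (grad f x))\<^sup>2)" and n: "n > 0"
 shows "integrable M (%x. (norm (grad (trunc n f) x))\<^sup>2)"
  and "(norm (grad (trunc n f) x))\<^sup>2 <= 2 * (norm (grad f x))\<^sup>2 + 288"
proof -
 interpret finite_measure M by fact
 have [measurable]: "grad (trunc n f) \<in> borel_measurable M"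
  using grad_measurable[OF trunc_props(1)[OF f n]] M(2) by (simp cong: measurable_cong_sets)
 show le: "(norm (grad (trunc n f) x))\<^sup>2 <= 2 * (norm (grad f x))\<^sup>2 + 288" for x
 proof -
  have "12 / real n <= 12" using n by (simp add: divide_le_eq)
  then have "norm (grad (trunc n f) x) <= norm (grad f x) + 12"
   using trunc_props(3)[OF f n, of x] by linarith
  then have "(norm (grad (trunc n f) x))\<^sup>2 <= (norm (grad f x) + 12)\<^sup>2"
   by (intro power_mono) auto
  also have "... <= 2 * (norm (grad f x))\<^sup>2 + 288"
   using sum_squares_bound[of "norm (grad f x)" 12] by (simp add: power2_eq_square algebra_simps)
  finally show ?thesis .
 qed
 show "integrable M (%x. (norm (grad (trunc n f) x))\<^sup>2)"
 proof (rule integrable_bd)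
  show "integrable M (%x. 2 * (norm (grad f x))\<^sup>2 + 288)" using i by simp
  show "AE x in M. norm ((norm (grad (trunc n f) x))\<^sup>2) <= norm (2 * (norm (grad f x))\<^sup>2 + 288)"
   using le by auto
 qed measurable
qed

text \<open>On a bounded set a continuous positive density is bounded away from 0.\<close>

lemma integrable_lborel_of_density:
 fixes \<rho> :: "real^'n => real"
 assumes c: "continuous_on UNIV \<rho>" and pos: "!!x. \<rho> x > 0"
  and [measurable]: "h \<in> borel_measurable borel" and h0: "!!x. norm x > R ==> h x = (0::real)"
  and i: "integrable (density lborel (%x. ennreal (\<rho> x))) h"
 shows "integrable lborel h"
proof -
 have [measurable]: "\<rho> \<in> borel_measurable borel"
  by (rule borel_of_cont[OF c])
 have i': "integrable lborel (%x. \<rho> x * h x)"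
  using i pos by (subst (asm) integrable_real_density) (auto simp: less_imp_le)
 obtain m where m: "m > 0" "!!x. norm x <= R ==> m <= \<rho> x"
 proof (cases "cball (0::real^'n) R = {}")
  case False
  obtain x0 where x0: "x0 \<in> cball 0 R" "!!x. x \<in> cball 0 R ==> \<rho> x0 <= \<rho> x"
   using continuous_attains_inf[OF compact_cball False continuous_on_subset[OF c subset_UNIV]] by blast
  show ?thesis using that[of "\<rho> x0"] pos x0 by auto
 next
  case True
  have "\<not> norm x <= R" for x :: "real^'n" using True by (metis mem_cball_0 empty_iff)
  then show ?thesis using that[of 1] by auto
 qed
 show ?thesis
 proof (rule integrable_bd)
  show "integrable lborel (%x. (1/m) * (\<rho> x * h x))" using i' by (intro integrable_mult_right) auto
  show "AE x in lborel. norm (h x) <= norm ((1/m) * (\<rho> x * h x))"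
  proof (rule AE_I2)
   fix x
   show "norm (h x) <= norm ((1/m) * (\<rho> x * h x))"
   proof (cases "norm x <= R")
    case True
    then have "m * \<bar>h x\<bar> <= \<rho> x * \<bar>h x\<bar>" using m by (intro mult_right_mono) auto
    then show ?thesis using m(1) pos[of x] by (simp add: abs_mult field_simps)
   qed (simp add: h0)
  qed
 qed simp
qed

lemma approx_by_test2_density:
 fixes g \<rho> :: "real^'n => real"
 assumes c: "continuous_on UNIV \<rho>" and pos: "!!x. \<rho> x > 0"
  and g: "!!x. g differentiable (at x)" and g0: "!!x. norm x > R ==> g x = 0"
  and L2: "integrable (density lborel (%x. ennreal (\<rho> x))) (%x. (norm (grad g x))\<^sup>2)" and "\<epsilon> > 0"
 shows "\<exists>q. test2 (R + 1) q & (\<forall>x. \<bar>q x - g x\<bar> <= \<epsilon>) &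
  integrable (density lborel (%x. ennreal (\<rho> x))) (%x. (norm (grad q x - grad g x))\<^sup>2) &
  (LINT x|density lborel (%x. ennreal (\<rho> x)). (norm (grad q x - grad g x))\<^sup>2) <= \<epsilon>"
proof -
 let ?M = "density lborel (%x. ennreal (\<rho> x))"
 have [measurable]: "\<rho> \<in> borel_measurable borel"
  by (rule borel_of_cont[OF c])
 have gm[measurable]: "grad g \<in> borel_measurable borel" by (rule grad_measurable[OF g])
 have gg0: "norm x > R ==> grad g x = 0" for x
  by (rule grad_zero_outside[OF g0])
 have L2': "integrable lborel (%x. (norm (grad g x))\<^sup>2)"
  by (rule integrable_lborel_of_density[OF c pos _ _ L2, where R=R]) (auto simp: gg0)
 have "bounded (\<rho> ` cball 0 (R + 1))"
  by (intro compact_imp_bounded compact_continuous_image continuous_on_subset[OF c]) auto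
 then obtain B where B: "!!x. x \<in> cball 0 (R + 1) ==> norm (\<rho> x) <= B"
  unfolding bounded_iff by (metis imageI)
 define B' where "B' = max B 1"
 have B': "B' >= 1" "!!x. norm x <= R + 1 ==> \<rho> x <= B'"
  using B by (force simp: B'_def)+
 define e where "e = \<epsilon> / B'"
 have e: "e > 0" "e <= \<epsilon>" "B' * e = \<epsilon>" using B'(1) \<open>\<epsilon> > 0\<close> by (auto simp: e_def field_simps)
 obtain q where q: "test2 (R + 1) q" "!!x. \<bar>q x - g x\<bar> <= e"
  and qi: "(\<integral>\<^sup>+x. ennreal ((norm (grad q x - grad g x))\<^sup>2) \<partial>lborel) <= ennreal e"
  using approx_by_test2[OF g g0 L2' e(1)] by blast
 have qm[measurable]: "grad q \<in> borel_measurable borel"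
  using q(1) by (intro grad_measurable) (auto simp: test2_def)
 have q0: "norm x > R + 1 ==> grad q x = 0" for x
  using q(1) by (intro grad_zero_outside[of "R + 1"]) (auto simp: test2_def)
 have "(\<integral>\<^sup>+x. ennreal ((norm (grad q x - grad g x))\<^sup>2) \<partial>?M)
   = (\<integral>\<^sup>+x. ennreal (\<rho> x) * ennreal ((norm (grad q x - grad g x))\<^sup>2) \<partial>lborel)"
  by (rule nn_integral_density) measurable
 also have "... <= (\<integral>\<^sup>+x. ennreal B' * ennreal ((norm (grad q x - grad g x))\<^sup>2) \<partial>lborel)"
 proof (rule nn_integral_mono)
  fix x
  show "ennreal (\<rho> x) * ennreal ((norm (grad q x - grad g x))\<^sup>2) <= ennreal B' * ennreal ((norm (grad q x - grad g x))\<^sup>2)"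
  proof (cases "norm x <= R + 1")
   case True
   then show ?thesis using B'(2) by (intro mult_right_mono ennreal_leI) auto
  qed (simp add: q0 gg0)
 qed
 also have "... = ennreal B' * (\<integral>\<^sup>+x. ennreal ((norm (grad q x - grad g x))\<^sup>2) \<partial>lborel)"
  by (rule nn_integral_cmult) measurable
 also have "... <= ennreal B' * ennreal e" by (intro mult_left_mono qi) auto
 also have "... = ennreal \<epsilon>" using B'(1) e by (simp flip: ennreal_mult)
 finally have fin: "(\<integral>\<^sup>+x. ennreal ((norm (grad q x - grad g x))\<^sup>2) \<partial>?M) <= ennreal \<epsilon>" .
 have m: "(%x. grad q x - grad g x) \<in> borel_measurable ?M" by measurable
 show ?thesis
  using q(1) order_trans[OF q(2) e(2)] nn_integral_sq_finite_imp_integrable[OF m fin] \<open>\<epsilon> > 0\<close> by auto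
qed

text \<open>Truncation at height \<open>n\<close> and radius \<open>n\<^sup>2\<close> changes the gradient little in energy, and the truncated
 function is approximated by test functions in the weighted energy norm.\<close>

lemma weak_divergence_extends:
 fixes f \<rho> :: "real^'n => real" and z :: "real^'n => real^'n"
 defines "M \<equiv> density lborel (%x. ennreal (\<rho> x))"
 assumes c: "continuous_on UNIV \<rho>" and pos: "!!x. \<rho> x > 0" and fin: "finite_measure M"
  and z[measurable]: "z \<in> borel_measurable borel" and zi: "integrable M (%x. (norm (z x))\<^sup>2)"
  and eq: "!!R q. test2 R q ==> (LINT x|M. z x \<bullet> grad q x) = 0"
  and f: "!!x. f differentiable (at x)" and fi: "integrable M (%x. (norm (grad f x))\<^sup>2)"
 shows "(LINT x|M. z x \<bullet> grad f x) = 0"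
proof -
 have sets[measurable_cong]: "sets M = sets borel" by (simp add: M_def)
 have fm[measurable]: "grad f \<in> borel_measurable borel" by (rule grad_measurable[OF f])
 have step: "(LINT x|M. z x \<bullet> grad (trunc n f) x) = 0" if n: "n > 0" for n
 proof -
  let ?g = "trunc n f"
  have gm[measurable]: "grad ?g \<in> borel_measurable borel" by (rule grad_measurable[OF trunc_props(1)[OF f n]])
  note gi = trunc_L2(1)[OF f fin sets fi n]
  let ?Z = "sqrt (LINT x|M. (norm (z x))\<^sup>2)"
  have b: "\<bar>LINT x|M. z x \<bullet> grad ?g x\<bar> <= ?Z * sqrt e" if e: "e > 0" for e
  proof -
   obtain q where q: "test2 ((real n)\<^sup>2 + 1) q" and qi: "integrable M (%x. (norm (grad q x - grad ?g x))\<^sup>2)"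
    and qe: "(LINT x|M. (norm (grad q x - grad ?g x))\<^sup>2) <= e"
    using approx_by_test2_density[OF c pos trunc_props(1)[OF f n] trunc_props(4)[OF f n] gi[unfolded M_def] e]
    unfolding M_def by blast
   have qm[measurable]: "grad q \<in> borel_measurable borel"
    using q by (intro grad_measurable) (auto simp: test2_def)
   have i1: "integrable M (%x. z x \<bullet> grad ?g x)"
    by (rule cauchy_schwarz_integral_inner(1)[OF _ _ zi gi]) measurable
   have i2: "integrable M (%x. z x \<bullet> (grad q x - grad ?g x))"
    by (rule cauchy_schwarz_integral_inner(1)[OF _ _ zi qi]) measurable
   have "(LINT x|M. z x \<bullet> grad q x) = (LINT x|M. z x \<bullet> grad ?g x + z x \<bullet> (grad q x - grad ?g x))"
    by (simp add: inner_diff_right)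
   also have "... = (LINT x|M. z x \<bullet> grad ?g x) + (LINT x|M. z x \<bullet> (grad q x - grad ?g x))"
    by (rule Bochner_Integration.integral_add[OF i1 i2])
   finally have "\<bar>LINT x|M. z x \<bullet> grad ?g x\<bar> = \<bar>LINT x|M. z x \<bullet> (grad q x - grad ?g x)\<bar>"
    using eq[OF q] by linarith
   also have "... <= ?Z * sqrt (LINT x|M. (norm (grad q x - grad ?g x))\<^sup>2)"
    by (rule cauchy_schwarz_integral_inner(2)[OF _ _ zi qi]) measurable
   also have "... <= ?Z * sqrt e"
    using qe by (intro mult_left_mono) auto
   finally show ?thesis .
  qed
  have "((%e. ?Z * sqrt e) \<longlongrightarrow> ?Z * sqrt 0) (at_right 0)"
   by (intro tendsto_intros)
  then have lim: "((%e. ?Z * sqrt e) \<longlongrightarrow> 0) (at_right 0)" by simp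
  have "\<bar>LINT x|M. z x \<bullet> grad ?g x\<bar> <= 0"
   by (rule tendsto_le[OF _ lim tendsto_const])
    (auto simp: eventually_at_right_less intro!: eventually_mono[OF eventually_at_right_less[of 0]] b)
  then show ?thesis by simp
 qed
 have zf: "integrable M (%x. (norm (z x))\<^sup>2 + (2 * (norm (grad f x))\<^sup>2 + 288))"
 proof -
  interpret finite_measure M by (rule fin)
  show ?thesis using zi fi by simp
 qed
 have "(%n. LINT x|M. z x \<bullet> grad (trunc (Suc n) f) x) \<longlonglongrightarrow> (LINT x|M. z x \<bullet> grad f x)"
 proof (rule integral_dominated_convergence[OF _ _ zf])
  show "(%x. z x \<bullet> grad (trunc (Suc n) f) x) \<in> borel_measurable M" for n
   using grad_measurable[OF trunc_props(1)[OF f, of "Suc n"]] by simp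
  show "AE x in M. (%n. z x \<bullet> grad (trunc (Suc n) f) x) \<longlonglongrightarrow> z x \<bullet> grad f x"
   by (intro AE_I2 tendsto_inner tendsto_const LIMSEQ_Suc trunc_tendsto(1) f)
  show "AE x in M. norm (z x \<bullet> grad (trunc (Suc n) f) x) <= (norm (z x))\<^sup>2 + (2 * (norm (grad f x))\<^sup>2 + 288)" for n
  proof (rule AE_I2)
   fix x
   have "norm (z x \<bullet> grad (trunc (Suc n) f) x) <= norm (z x) * norm (grad (trunc (Suc n) f) x)"
    by (simp add: Cauchy_Schwarz_ineq2)
   also have "... <= (norm (z x))\<^sup>2 + (norm (grad (trunc (Suc n) f) x))\<^sup>2"
    using sum_squares_bound[of "norm (z x)" "norm (grad (trunc (Suc n) f) x)"]
    mult_nonneg_nonneg[OF norm_ge_zero[of "z x"] norm_ge_zero[of "grad (trunc (Suc n) f) x"]] by linarith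
   also have "... <= (norm (z x))\<^sup>2 + (2 * (norm (grad f x))\<^sup>2 + 288)"
    using trunc_L2(2)[OF f fin sets fi, of "Suc n" x] by simp
   finally show "norm (z x \<bullet> grad (trunc (Suc n) f) x) <= (norm (z x))\<^sup>2 + (2 * (norm (grad f x))\<^sup>2 + 288)" .
  qed
 qed measurable
 moreover have "(LINT x|M. z x \<bullet> grad (trunc (Suc n) f) x) = 0" for n
  by (rule step) simp
 ultimately show ?thesis by (simp add: LIMSEQ_const_iff)
qed

section \<open>The Prekopa--Leindler inequality\<close>

lemma weighted_amgm:
 fixes x y s t :: real
 assumes "x >= 0" "y >= 0" "s > 0" "t > 0" "t + s = 1"
 shows "x powr t * y powr s <= t * x + s * y"
proof (cases "x = 0 \<or> y = 0")
 case True
 then show ?thesis using assms by auto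
next
 case False
 then have xy: "x > 0" "y > 0" using assms by auto
 define m where "m = t * x + s * y"
 have m: "m > 0" using xy assms by (auto simp: m_def intro: add_pos_pos)
 have "t * ln (x / m) + s * ln (y / m) <= t * (x / m - 1) + s * (y / m - 1)"
  using xy m assms by (intro add_mono mult_left_mono ln_le_minus_one) auto
 also have "... = (t * x + s * y) / m - (t + s)" by (simp add: field_simps add_divide_distrib)
 also have "... = 0" using m assms by (simp add: m_def)
 finally have "t * (ln x - ln m) + s * (ln y - ln m) <= 0"
  using xy m by (simp add: ln_div)
 then have "t * ln x + s * ln y <= (t + s) * ln m" by (simp add: algebra_simps)
 then have "exp (t * ln x + s * ln y) <= exp (ln m)" using assms by simp
 then show ?thesis using xy m by (simp add: powr_def exp_add m_def)
qed

lemma emeasure_lborel_affine_image: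
 fixes K :: "real set"
 assumes "compact K" "c > 0"
 shows "emeasure lborel ((%x. a + c * x) ` K) = ennreal c * emeasure lborel K"
proof -
 let ?I = "(%x. a + c * x) ` K"
 have "compact ?I"
  by (intro compact_continuous_image continuous_intros assms)
 then have [measurable]: "?I \<in> sets borel" "K \<in> sets borel" using assms by (auto intro: borel_compact)
 have "emeasure lborel ?I = (\<integral>\<^sup>+y. indicator ?I y \<partial>lborel)"
  by simp
 also have "... = ennreal \<bar>c\<bar> * (\<integral>\<^sup>+x. indicator ?I (a + c * x) \<partial>lborel)"
  by (rule nn_integral_real_affine) (use assms in auto)
 also have "(\<integral>\<^sup>+x. indicator ?I (a + c * x) \<partial>lborel) = (\<integral>\<^sup>+x. indicator K x \<partial>lborel)"
  using assms(2) by (intro nn_integral_cong) (auto split: split_indicator)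
 finally show ?thesis using assms(2) by simp
qed

lemma brunn_minkowski_compact:
 fixes K L H :: "real set"
 assumes "compact K" "compact L" "K ~= {}" "L ~= {}" "s > 0" "t > 0" and H: "H \<in> sets borel"
  and sub: "!!x y. x \<in> K ==> y \<in> L ==> t * x + s * y \<in> H"
 shows "ennreal t * emeasure lborel K + ennreal s * emeasure lborel L <= emeasure lborel H"
proof -
 obtain k where k: "k \<in> K" "!!x. x \<in> K ==> x <= k"
  using compact_attains_sup[OF assms(1,3)] by blast
 obtain l where l: "l \<in> L" "!!y. y \<in> L ==> l <= y"
  using compact_attains_inf[OF assms(2,4)] by blast
 \<comment> \<open>The translates of \<open>t K\<close> and \<open>s L\<close> by an extremal point of the other set overlap in one point.\<close>
 let ?A = "(%x. s * l + t * x) ` K" and ?B = "(%y. t * k + s * y) ` L"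
 have c: "compact ?A" "compact ?B"
  by (intro compact_continuous_image continuous_intros assms)+
 then have m: "?A \<in> sets lborel" "?B \<in> sets lborel" by (auto intro: borel_compact)
 have "?A \<inter> ?B \<subseteq> {t * k + s * l}"
 proof
  fix z assume "z \<in> ?A \<inter> ?B"
  then obtain x y where z: "x \<in> K" "y \<in> L" "z = s * l + t * x" "z = t * k + s * y" by auto
  have "t * x <= t * k" "s * l <= s * y"
   using k l z assms by (auto intro!: mult_left_mono)
  then have "z = t * k + s * l" using z by linarith
  then show "z \<in> {t * k + s * l}" by simp
 qed
 then have "emeasure lborel (?A \<inter> ?B) <= emeasure lborel {t * k + s * l}"
  by (intro emeasure_mono) auto
 then have 0: "emeasure lborel (?A \<inter> ?B) = 0" by simp
 have "ennreal t * emeasure lborel K + ennreal s * emeasure lborel L = emeasure lborel ?A + emeasure lborel ?B"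
  using emeasure_lborel_affine_image[of K t] emeasure_lborel_affine_image[of L s] assms by simp
 also have "... = emeasure lborel (?A \<union> ?B)"
 proof -
  have "?A \<inter> ?B \<in> null_sets lborel" using 0 m by (intro null_setsI) auto
  moreover have "emeasure lborel (?A \<union> ?B) = emeasure lborel (?A \<union> (?B - ?A \<inter> ?B))"
   by (rule arg_cong[of _ _ "emeasure lborel"]) auto
  ultimately show ?thesis
   using m by (subst (asm) plus_emeasure[symmetric, of ?A lborel "?B - ?A \<inter> ?B"])
    (auto simp: emeasure_Diff_null_set)
 qed
 also have "... <= emeasure lborel H"
  using sub k l H by (intro emeasure_mono) (auto simp: add.commute)
 finally show ?thesis .
qed

lemma brunn_minkowski_real:
 fixes A B H :: "real set"
 assumes A: "A \<in> sets borel" "bounded A" "A ~= {}" and B: "B \<in> sets borel" "bounded B" "B ~= {}"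
  and st: "s > 0" "t > 0" and H: "H \<in> sets borel"
  and sub: "!!x y. x \<in> A ==> y \<in> B ==> t * x + s * y \<in> H"
 shows "ennreal t * emeasure lborel A + ennreal s * emeasure lborel B <= emeasure lborel H"
proof (rule ennreal_le_epsilon)
 fix e :: real assume e: "0 < e"
 have inner: "\<exists>K. compact K & K ~= {} & K \<subseteq> S & emeasure lborel S <= emeasure lborel K + ennreal d"
  if S: "S \<in> sets borel" "bounded S" "S ~= {}" and d: "d > 0" for S :: "real set" and d
 proof -
  obtain a where a: "a \<in> S" using S by auto
  have "S \<in> sets lborel" using S(1) by simp
  then have Sl: "S \<in> sets lebesgue" by (rule sets_completionI_sets)
  obtain T where T: "closed T" "T \<subseteq> S" "emeasure lebesgue (S - T) < ennreal d"
   by (rule sets_lebesgue_inner_closed[OF Sl d])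
  let ?K = "insert a T"
  have K: "compact ?K"
   using T S(2) a by (intro compact_eq_bounded_closed[THEN iffD2]) (auto intro: bounded_subset)
  have [measurable]: "T \<in> sets borel" using T by auto
  have "emeasure lborel S = emeasure lborel (T \<union> (S - T))"
   using T by (intro arg_cong[of _ _ "emeasure lborel"]) auto
  also have "... <= emeasure lborel T + emeasure lborel (S - T)"
   using S by (intro emeasure_subadditive) auto
  also have "... <= emeasure lborel ?K + ennreal d"
   using T S by (intro add_mono emeasure_mono) (auto simp: less_imp_le)
  finally show ?thesis using K T a by (intro exI[of _ ?K]) auto
 qed
 define d where "d = e / (t + s)"
 have d: "d > 0" using e st by (simp add: d_def)
 obtain K where K: "compact K" "K ~= {}" "K \<subseteq> A" "emeasure lborel A <= emeasure lborel K + ennreal d"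
  using inner[OF A d] by blast
 obtain L where L: "compact L" "L ~= {}" "L \<subseteq> B" "emeasure lborel B <= emeasure lborel L + ennreal d"
  using inner[OF B d] by blast
 have "ennreal t * emeasure lborel A + ennreal s * emeasure lborel B
  <= ennreal t * (emeasure lborel K + ennreal d) + ennreal s * (emeasure lborel L + ennreal d)"
  using K L by (intro add_mono mult_left_mono) auto
 also have "... = (ennreal t * emeasure lborel K + ennreal s * emeasure lborel L) + ennreal (t * d + s * d)"
  using st d by (simp add: distrib_left ennreal_mult algebra_simps)
 also have "t * d + s * d = (t + s) * d" by (simp add: distrib_right)
 also have "... = e"
  using st by (simp add: d_def)
 also have "ennreal t * emeasure lborel K + ennreal s * emeasure lborel L <= emeasure lborel H"
  using sub K L st H by (intro brunn_minkowski_compact) auto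
 finally show "ennreal t * emeasure lborel A + ennreal s * emeasure lborel B <= emeasure lborel H + ennreal e"
  by (simp add: add_right_mono)
qed

lemma layer_cake:
 fixes F :: "real => real"
 assumes [measurable]: "F \<in> borel_measurable borel"
 shows "(\<integral>\<^sup>+x. ennreal (min 1 (F x)) \<partial>lborel) = (\<integral>\<^sup>+l. indicator {0<..<1} l * emeasure lborel {x. F x > l} \<partial>lborel)"
proof -
 have "ennreal (min 1 (F x)) = (\<integral>\<^sup>+l. indicator {0<..<1} l * indicator {x. F x > l} x \<partial>lborel)" for x
 proof -
  have "(\<integral>\<^sup>+l. indicator {0<..<1} l * indicator {x. F x > l} x \<partial>lborel) = (\<integral>\<^sup>+l. indicator {0<..<min 1 (F x)} l \<partial>lborel)"
   by (intro nn_integral_cong) (auto split: split_indicator)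
  also have "... = emeasure lborel {0<..<min 1 (F x)}" by simp
  also have "... = ennreal (min 1 (F x))"
   by (cases "F x >= 0") (auto simp: ennreal_neg min_def)
  finally show ?thesis by simp
 qed
 then have "(\<integral>\<^sup>+x. ennreal (min 1 (F x)) \<partial>lborel)
  = (\<integral>\<^sup>+x. (\<integral>\<^sup>+l. indicator {0<..<1} l * indicator {x. F x > l} x \<partial>lborel) \<partial>lborel)" by simp
 also have "... = (\<integral>\<^sup>+l. (\<integral>\<^sup>+x. indicator {0<..<1} l * indicator {x. F x > l} x \<partial>lborel) \<partial>lborel)"
  by (rule lborel_pair.Fubini') measurable
 also have "... = (\<integral>\<^sup>+l. indicator {0<..<1} l * emeasure lborel {x. F x > l} \<partial>lborel)"
  by (intro nn_integral_cong) (simp add: nn_integral_cmult)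
 finally show ?thesis .
qed

lemma emeasure_superlevel_measurable:
 fixes F :: "real => real"
 assumes [measurable]: "F \<in> borel_measurable borel"
 shows "(%l. emeasure lborel {x. F x > l}) \<in> borel_measurable lborel"
proof -
 have "(%l. \<integral>\<^sup>+x. indicator {x. F x > l} x \<partial>lborel) \<in> borel_measurable lborel" by measurable
 then show ?thesis by simp
qed

definition cube_fun :: "real => real => (real => real) => bool"
 where "cube_fun C R f \<longleftrightarrow> f \<in> borel_measurable borel & (\<forall>x. 0 <= f x & f x <= C) & (\<forall>x. \<bar>x\<bar> > R --> f x = 0)"

lemma cube_fun_integrable: "cube_fun C R f ==> integrable lborel f"
 unfolding cube_fun_def by (intro integrable_bounded_support[where C=C and R=R]) auto

lemma prekopa_leindler_real:
 assumes f: "cube_fun C R f" and g: "cube_fun C R g" and h: "cube_fun C R h"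
  and st: "s > 0" "t > 0" "t + s = 1"
  and le: "!!x y. f x powr t * g y powr s <= h (t * x + s * y)"
 shows "(LINT x|lborel. f x) powr t * (LINT x|lborel. g x) powr s <= (LINT x|lborel. h x)"
proof -
 have [measurable]: "f \<in> borel_measurable borel" "g \<in> borel_measurable borel" "h \<in> borel_measurable borel"
  using f g h by (auto simp: cube_fun_def)
 have nn: "f x >= 0" "g x >= 0" "h x >= 0" "f x <= C" "g x <= C" for x
  using f g h by (auto simp: cube_fun_def)
 note int = cube_fun_integrable[OF f] cube_fun_integrable[OF g] cube_fun_integrable[OF h]
 define a where "a = (SUP x. f x)"
 define b where "b = (SUP x. g x)"
 have bdd: "bdd_above (range f)" "bdd_above (range g)" using nn by (auto intro!: bdd_aboveI2)
 have fa: "f x <= a" and gb: "g x <= b" for x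
  unfolding a_def b_def by (auto intro: cSUP_upper bdd)
 have ih: "(LINT x|lborel. h x) >= 0" by (intro integral_nonneg_AE) (simp add: nn)
 show ?thesis
 proof (cases "a > 0 & b > 0")
  case False
  then have "(\<forall>x. f x = 0) \<or> (\<forall>x. g x = 0)"
   using nn fa gb by (meson order.antisym order.trans not_le)
  then show ?thesis using ih st by auto
 next
  case True
  then have a: "a > 0" and b: "b > 0" by auto
  define c where "c = a powr t * b powr s"
  have c: "c > 0" using a b by (simp add: c_def)
  have lev: "ennreal t * emeasure lborel {x. f x / a > l} + ennreal s * emeasure lborel {x. g x / b > l}
    <= emeasure lborel {x. h x / c > l}" if l: "0 < l" "l < 1" for l
  proof (rule brunn_minkowski_real)
   have "l * a < a" using a l by simp
   then obtain x where "f x > l * a" unfolding a_def using less_cSUP_iff[OF _ bdd(1)] a_def by blast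
   then show "{x. l < f x / a} ~= {}" using a by (auto simp: field_simps)
   have "l * b < b" using b l by simp
   then obtain y where "g y > l * b" unfolding b_def using less_cSUP_iff[OF _ bdd(2)] b_def by blast
   then show "{x. l < g x / b} ~= {}" using b by (auto simp: field_simps)
   have sf: "f x = 0" "g x = 0" if "\<bar>x\<bar> > R" for x using f g that by (auto simp: cube_fun_def)
   have "\<bar>x\<bar> <= R" if "l < f x / a" for x
    using sf(1)[of x] that l by (cases "\<bar>x\<bar> <= R") auto
   moreover have "\<bar>x\<bar> <= R" if "l < g x / b" for x
    using sf(2)[of x] that l by (cases "\<bar>x\<bar> <= R") auto
   ultimately have "{x. l < f x / a} \<subseteq> cball 0 R" "{x. l < g x / b} \<subseteq> cball 0 R"
    by auto
   then show "bounded {x. l < f x / a}" "bounded {x. l < g x / b}"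
    by (meson bounded_cball bounded_subset)+
   fix x y assume x: "x \<in> {x. l < f x / a}" and y: "y \<in> {x. l < g x / b}"
   have "l * a < f x" "l * b < g y" using x y a b by (auto simp: field_simps)
   moreover have "0 < l * a" "0 < l * b" using l a b by auto
   ultimately have "(l * a) powr t * (l * b) powr s < f x powr t * g y powr s"
    using st by (intro mult_strict_mono powr_less_mono2) (auto simp: less_imp_le)
   also have "(l * a) powr t * (l * b) powr s = (l powr t * l powr s) * c"
    using l a b by (simp add: powr_mult c_def)
   also have "l powr t * l powr s = l" using l st by (simp flip: powr_add)
   finally have "l * c < h (t * x + s * y)" using le[of x y] by linarith
   then show "t * x + s * y \<in> {x. l < h x / c}" using c by (simp add: field_simps)
  qed (use st in measurable)
  have min1: "(\<integral>\<^sup>+x. ennreal (f x / a) \<partial>lborel) = (\<integral>\<^sup>+x. ennreal (min 1 (f x / a)) \<partial>lborel)"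
   "(\<integral>\<^sup>+x. ennreal (g x / b) \<partial>lborel) = (\<integral>\<^sup>+x. ennreal (min 1 (g x / b)) \<partial>lborel)"
   using fa gb a b by (auto intro!: nn_integral_cong arg_cong[of _ _ ennreal] min_absorb2[symmetric] simp: divide_le_eq_1_pos)
  have lc: "(\<integral>\<^sup>+x. ennreal (min 1 (f x / a)) \<partial>lborel) = (\<integral>\<^sup>+l. indicator {0<..<1} l * emeasure lborel {x. f x / a > l} \<partial>lborel)"
   "(\<integral>\<^sup>+x. ennreal (min 1 (g x / b)) \<partial>lborel) = (\<integral>\<^sup>+l. indicator {0<..<1} l * emeasure lborel {x. g x / b > l} \<partial>lborel)"
   by (rule layer_cake; measurable)+
  have "ennreal t * (\<integral>\<^sup>+x. ennreal (f x / a) \<partial>lborel) + ennreal s * (\<integral>\<^sup>+x. ennreal (g x / b) \<partial>lborel)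
   = (\<integral>\<^sup>+l. indicator {0<..<1} l * (ennreal t * emeasure lborel {x. f x / a > l} + ennreal s * emeasure lborel {x. g x / b > l}) \<partial>lborel)"
   unfolding min1 lc
  proof -
   have A: "(%l. indicator {0<..<1} l * emeasure lborel {x. f x / a > l}) \<in> borel_measurable lborel"
    using emeasure_superlevel_measurable[of "%x. f x / a"] by measurable
   have B: "(%l. indicator {0<..<1} l * emeasure lborel {x. g x / b > l}) \<in> borel_measurable lborel"
    using emeasure_superlevel_measurable[of "%x. g x / b"] by measurable
   show "ennreal t * (\<integral>\<^sup>+l. indicator {0<..<1} l * emeasure lborel {x. f x / a > l} \<partial>lborel)
    + ennreal s * (\<integral>\<^sup>+l. indicator {0<..<1} l * emeasure lborel {x. g x / b > l} \<partial>lborel)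
    = (\<integral>\<^sup>+l. indicator {0<..<1} l * (ennreal t * emeasure lborel {x. f x / a > l} + ennreal s * emeasure lborel {x. g x / b > l}) \<partial>lborel)"
    using A B by (subst nn_integral_cmult[symmetric], simp, subst nn_integral_cmult[symmetric], simp,
    subst nn_integral_add[symmetric]) (auto intro!: nn_integral_cong simp: distrib_left mult_ac)
  qed
  also have "... <= (\<integral>\<^sup>+l. indicator {0<..<1} l * emeasure lborel {x. h x / c > l} \<partial>lborel)"
   using lev by (intro nn_integral_mono) (auto split: split_indicator)
  also have "... = (\<integral>\<^sup>+x. ennreal (min 1 (h x / c)) \<partial>lborel)"
   by (rule layer_cake[symmetric]) measurable
  also have "... <= (\<integral>\<^sup>+x. ennreal (h x / c) \<partial>lborel)"
   by (intro nn_integral_mono ennreal_leI) auto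
  also have "... = ennreal ((LINT x|lborel. h x) / c)"
   using int c nn by (subst nn_integral_eq_integral) auto
  also have "(\<integral>\<^sup>+x. ennreal (f x / a) \<partial>lborel) = ennreal ((LINT x|lborel. f x) / a)"
   using int a nn by (subst nn_integral_eq_integral) auto
  also have "(\<integral>\<^sup>+x. ennreal (g x / b) \<partial>lborel) = ennreal ((LINT x|lborel. g x) / b)"
   using int b nn by (subst nn_integral_eq_integral) auto
  finally have "ennreal (t * ((LINT x|lborel. f x) / a) + s * ((LINT x|lborel. g x) / b)) <= ennreal ((LINT x|lborel. h x) / c)"
   using st a b nn
   by (simp add: ennreal_mult ennreal_plus integral_nonneg_AE divide_nonneg_pos del: times_divide_eq_right)
  then have *: "t * ((LINT x|lborel. f x) / a) + s * ((LINT x|lborel. g x) / b) <= (LINT x|lborel. h x) / c"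
   using ih c by (simp add: ennreal_le_iff)
  have i0: "(LINT x|lborel. f x) >= 0" "(LINT x|lborel. g x) >= 0"
   by (auto intro!: integral_nonneg_AE simp: nn)
  have "((LINT x|lborel. f x) / a) powr t * ((LINT x|lborel. g x) / b) powr s <= (LINT x|lborel. h x) / c"
   using weighted_amgm[of "(LINT x|lborel. f x) / a" "(LINT x|lborel. g x) / b" s t] st i0 a b * by simp
  moreover have "((LINT x|lborel. f x) / a) powr t * ((LINT x|lborel. g x) / b) powr s
    = ((LINT x|lborel. f x) powr t * (LINT x|lborel. g x) powr s) / c"
   using i0 a b by (simp add: powr_divide c_def)
  ultimately show ?thesis using c by (simp add: divide_le_cancel)
 qed
qed

abbreviation lebPi :: "'i set => ('i => real) measure"
 where "lebPi I \<equiv> Pi\<^sub>M I (%_. lborel)"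

definition cube_fun_Pi :: "real => real => 'i set => (('i => real) => real) => bool"
 where "cube_fun_Pi C R I u \<longleftrightarrow> u \<in> borel_measurable (lebPi I) &
  (\<forall>x\<in>space (lebPi I). 0 <= u x & u x <= C & ((\<exists>i\<in>I. \<bar>x i\<bar> > R) --> u x = 0))"

lemma emeasure_cube_Pi:
 assumes "finite I"
 shows "emeasure (lebPi I) (Pi\<^sub>E I (%_. {-R..R})) < \<infinity>"
proof -
 interpret product_sigma_finite "%_::'a. lborel :: real measure" by standard
 have "emeasure (lebPi I) (Pi\<^sub>E I (%_. {-R..R})) = (\<Prod>i\<in>I. emeasure lborel {-R..R})"
  using assms by (intro emeasure_PiM) auto
 also have "... = ennreal (\<Prod>i\<in>I. if -R <= R then R - -R else 0)"
  by (subst prod_ennreal[symmetric]) (auto simp: emeasure_lborel_Icc_eq)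
 finally show ?thesis by simp
qed

lemma cube_fun_Pi_integrable:
 assumes "finite I" and u: "cube_fun_Pi C R I u"
 shows "integrable (lebPi I) u"
  and "(LINT x|lebPi I. u x) <= C * measure (lebPi I) (Pi\<^sub>E I (%_. {-R..R}))"
  and "0 <= (LINT x|lebPi I. u x)"
proof -
 let ?K = "Pi\<^sub>E I (%_. {-R..R})"
 have K: "?K \<in> sets (lebPi I)" using assms(1) by (intro sets_PiM_I_finite) auto
 have i: "integrable (lebPi I) (%x. C * indicator ?K x)"
  using emeasure_cube_Pi[OF assms(1), of R] K by (intro integrable_mult_right integrable_real_indicator) auto
 have le: "0 <= u x" "u x <= C * indicator ?K x" if sp: "x \<in> space (lebPi I)" for x
 proof -
  show "0 <= u x" using u that by (auto simp: cube_fun_Pi_def)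
  show "u x <= C * indicator ?K x"
  proof (cases "x \<in> ?K")
   case True then show ?thesis using u that by (auto simp: cube_fun_Pi_def)
  next
   case False
   then obtain j where "j \<in> I" "\<not> (-R <= x j & x j <= R)"
    using sp by (auto simp: space_PiM PiE_def Pi_def)
   then have "\<bar>x j\<bar> > R" by auto
   then have "u x = 0" using u that \<open>j \<in> I\<close> by (auto simp: cube_fun_Pi_def)
   then show ?thesis using False by simp
  qed
 qed
 show iu: "integrable (lebPi I) u"
 proof (rule integrable_bd[OF i])
  show "u \<in> borel_measurable (lebPi I)" using u by (simp add: cube_fun_Pi_def)
  show "AE x in lebPi I. norm (u x) <= norm (C * indicator ?K x)"
  proof (rule AE_I2)
   fix x assume "x \<in> space (lebPi I)"
   from le[OF this] show "norm (u x) <= norm (C * indicator ?K x)" by simp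
  qed
 qed
 have "(LINT x|lebPi I. u x) <= (LINT x|lebPi I. C * indicator ?K x)"
  using le by (intro integral_mono iu i) auto
 also have "... = C * measure (lebPi I) ?K"
  using K by (simp add: sets.Int_space_eq2)
 finally show "(LINT x|lebPi I. u x) <= C * measure (lebPi I) ?K" .
 show "0 <= (LINT x|lebPi I. u x)"
  using le by (intro integral_nonneg_AE AE_I2) auto
qed

lemma cube_fun_Pi_slice:
 assumes I: "finite I" "i \<notin> I" and u: "cube_fun_Pi C R (insert i I) u"
 defines "v \<equiv> %a. LINT x|lebPi I. u (x(i := a))"
 shows "cube_fun_Pi C R I (%x. u (x(i := a)))"
  and "cube_fun (C * measure (lebPi I) (Pi\<^sub>E I (%_. {-R..R}))) R v"
  and "(LINT x|lebPi (insert i I). u x) = (LINT a|lborel. v a)"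
proof -
 interpret product_sigma_finite "%_::'a. lborel :: real measure" by standard
 interpret IP: finite_product_sigma_finite "%_::'a. lborel :: real measure" I by standard (use I in auto)
 have um: "u \<in> borel_measurable (lebPi (insert i I))" using u by (simp add: cube_fun_Pi_def)
 have pm: "(%(a, x). u (x(i := a))) \<in> borel_measurable (lborel \<Otimes>\<^sub>M lebPi I)"
 proof -
  have "(%(a, x). x(i := a)) \<in> measurable (lborel \<Otimes>\<^sub>M lebPi I) (lebPi (insert i I))"
   unfolding split_beta by (intro measurable_fun_upd[where J=I]) auto
  from measurable_compose[OF this um] show ?thesis by (simp add: split_beta)
 qed
 have sp: "x \<in> space (lebPi I) ==> x(i := a) \<in> space (lebPi (insert i I))" for x a
  by (auto simp: space_PiM PiE_def extensional_def)
 show s: "cube_fun_Pi C R I (%x. u (x(i := a)))" for a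
  unfolding cube_fun_Pi_def
 proof (intro conjI ballI impI)
  show "(%x. u (x(i := a))) \<in> borel_measurable (lebPi I)"
   using measurable_compose[OF measurable_Pair1' pm, of a] by simp
  fix x assume x: "x \<in> space (lebPi I)"
  note h = u[unfolded cube_fun_Pi_def, THEN conjunct2, rule_format, OF sp[OF x, of a]]
  show "0 <= u (x(i := a))" "u (x(i := a)) <= C" using h by auto
  show "\<exists>j\<in>I. R < \<bar>x j\<bar> ==> u (x(i := a)) = 0"
  proof -
   assume "\<exists>j\<in>I. R < \<bar>x j\<bar>"
   then obtain j where "j \<in> I" "R < \<bar>x j\<bar>" by blast
   then have "j \<in> insert i I" "R < \<bar>(x(i := a)) j\<bar>" using I by auto
   then show ?thesis using h by blast
  qed
 qed
 note si = cube_fun_Pi_integrable[OF I(1) s]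
 show cv: "cube_fun (C * measure (lebPi I) (Pi\<^sub>E I (%_. {-R..R}))) R v"
  unfolding cube_fun_def
 proof (intro conjI allI impI)
  show "v \<in> borel_measurable borel"
   unfolding v_def using IP.borel_measurable_lebesgue_integral[OF pm] by simp
  show "0 <= v a" "v a <= C * measure (lebPi I) (Pi\<^sub>E I (%_. {-R..R}))" for a
   unfolding v_def using si by auto
  fix a assume a: "R < \<bar>a\<bar>"
  have "u (x(i := a)) = 0" if "x \<in> space (lebPi I)" for x
   using u[unfolded cube_fun_Pi_def, THEN conjunct2, rule_format, OF sp[OF that, of a]] a by auto
  then have "v a = (LINT x|lebPi I. 0)"
   unfolding v_def by (intro integral_cg) auto
  then show "v a = 0" by simp
 qed
 have u0: "AE x in lebPi (insert i I). 0 <= u x"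
  using u by (auto simp: cube_fun_Pi_def)
 have "ennreal (LINT x|lebPi (insert i I). u x) = (\<integral>\<^sup>+x. ennreal (u x) \<partial>lebPi (insert i I))"
  using I by (intro nn_integral_eq_integral[symmetric] cube_fun_Pi_integrable(1)[OF _ u] u0) auto
 also have "... = (\<integral>\<^sup>+a. (\<integral>\<^sup>+x. ennreal (u (x(i := a))) \<partial>lebPi I) \<partial>lborel)"
  using um by (intro product_nn_integral_insert_rev I) auto
 also have "... = (\<integral>\<^sup>+a. ennreal (v a) \<partial>lborel)"
 proof (rule nn_integral_cong)
  fix a
  show "(\<integral>\<^sup>+x. ennreal (u (x(i := a))) \<partial>lebPi I) = ennreal (v a)"
   unfolding v_def using s[of a] by (intro nn_integral_eq_integral si) (auto simp: cube_fun_Pi_def)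
 qed
 also have "... = ennreal (LINT a|lborel. v a)"
  using cv by (intro nn_integral_eq_integral cube_fun_integrable[OF cv]) (auto simp: cube_fun_def)
 finally show "(LINT x|lebPi (insert i I). u x) = (LINT a|lborel. v a)"
 proof (subst (asm) ennreal_inj)
  show "0 <= (LINT x|lebPi (insert i I). u x)"
   using I by (intro cube_fun_Pi_integrable(3)[OF _ u]) simp
  show "0 <= (LINT a|lborel. v a)"
   using cv by (intro integral_nonneg_AE AE_I2) (simp add: cube_fun_def)
 qed
qed

lemma prekopa_leindler_Pi:
 assumes "finite I" and st: "s > 0" "t > 0" "t + s = 1"
  and "cube_fun_Pi C R I u" "cube_fun_Pi C R I v" "cube_fun_Pi C R I w"
  and "!!x y. x \<in> space (lebPi I) ==> y \<in> space (lebPi I) ==>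
   u x powr t * v y powr s <= w (\<lambda>i\<in>I. t * x i + s * y i)"
 shows "(LINT x|lebPi I. u x) powr t * (LINT x|lebPi I. v x) powr s <= (LINT x|lebPi I. w x)"
 using assms(1,5-)
proof (induction I arbitrary: C u v w rule: finite_induct)
 case empty
 interpret product_sigma_finite "%_::'a. lborel :: real measure" by standard
 have e: "(\<integral>x. f x \<partial>lebPi {}) = f (%_. undefined)" for f :: "('a => real) => real"
  by (simp add: PiM_empty lebesgue_integral_count_space_finite)
 have "(\<lambda>i\<in>{}. t * (%_. undefined) i + s * (%_. undefined) i) = (%_. undefined :: real)" by auto
 then show ?case
  using empty(4)[of "%_. undefined" "%_. undefined"] by (simp add: e space_PiM)
next
 case (insert i I)
 note sl = cube_fun_Pi_slice[OF insert(1,2)]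
 show ?case
  unfolding sl(3)[OF insert(4)] sl(3)[OF insert(5)] sl(3)[OF insert(6)]
 proof (rule prekopa_leindler_real[OF sl(2)[OF insert(4)] sl(2)[OF insert(5)] sl(2)[OF insert(6)] st])
  fix a b
  show "(LINT x|lebPi I. u (x(i := a))) powr t * (LINT x|lebPi I. v (x(i := b))) powr s
   <= (LINT x|lebPi I. w (x(i := t * a + s * b)))"
  proof (rule insert.IH[OF sl(1)[OF insert(4)] sl(1)[OF insert(5)] sl(1)[OF insert(6)]])
   fix x y assume xy: "x \<in> space (lebPi I)" "y \<in> space (lebPi I)"
   have sp: "x(i := a) \<in> space (lebPi (insert i I))" "y(i := b) \<in> space (lebPi (insert i I))"
    using xy by (auto simp: space_PiM PiE_def extensional_def)
   have "(\<lambda>j\<in>insert i I. t * (x(i := a)) j + s * (y(i := b)) j) = (\<lambda>j\<in>I. t * x j + s * y j)(i := t * a + s * b)"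
    using insert(2) by (auto simp: fun_eq_iff restrict_def)
   then show "u (x(i := a)) powr t * v (y(i := b)) powr s <= w ((\<lambda>j\<in>I. t * x j + s * y j)(i := t * a + s * b))"
    using insert(7)[OF sp] by (simp only:)
  qed
 qed
qed

text \<open>Bounded support keeps every marginal finite, so that powers of integrals stay real.\<close>

lemma prekopa_leindler:
 fixes u v w :: "'a::euclidean_space => real"
 assumes st: "s > 0" "t > 0" "t + s = 1"
  and m: "u \<in> borel_measurable borel" "v \<in> borel_measurable borel" "w \<in> borel_measurable borel"
  and b: "!!x. 0 <= u x & u x <= C" "!!x. 0 <= v x & v x <= C" "!!x. 0 <= w x & w x <= C"
  and z: "!!x b. b \<in> Basis ==> \<bar>x \<bullet> b\<bar> > R ==> u x = 0 & v x = 0 & w x = 0"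
  and le: "!!x y. u x powr t * v y powr s <= w (t *\<^sub>R x + s *\<^sub>R y)"
 shows "(LINT x|lborel. u x) powr t * (LINT x|lborel. v x) powr s <= (LINT x|lborel. w x)"
proof -
 let ?S = "%x. \<Sum>b\<in>(Basis::'a set). x b *\<^sub>R b"
 have Sm: "?S \<in> measurable (lebPi Basis) borel" by measurable
 have int: "(LINT x|lborel. f x) = (\<integral>x. f (?S x) \<partial>lebPi (Basis::'a set))" if "f \<in> borel_measurable borel" for f :: "'a => real"
  unfolding lborel_def[where 'a='a] lborel_eq_real[symmetric] by (rule integral_distr[OF Sm that])
 have cf: "cube_fun_Pi C R (Basis::'a set) (%x. f (?S x))" if "f \<in> borel_measurable borel" "!!x. 0 <= f x & f x <= C"
   "!!x b. b \<in> Basis ==> \<bar>x \<bullet> b\<bar> > R ==> f x = 0" for f :: "'a => real"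
  unfolding cube_fun_Pi_def
 proof (intro conjI ballI impI)
  show "(%x. f (?S x)) \<in> borel_measurable (lebPi Basis)"
   using measurable_compose[OF Sm that(1)] by simp
  fix x assume "\<exists>b\<in>(Basis::'a set). R < \<bar>x b\<bar>"
  then obtain b where b: "b \<in> (Basis::'a set)" "R < \<bar>x b\<bar>" by blast
  then show "f (?S x) = 0" using that(3)[of b "?S x"] by simp
 qed (use that in auto)
 show ?thesis
  unfolding int[OF m(1)] int[OF m(2)] int[OF m(3)]
 proof (rule prekopa_leindler_Pi[OF finite_Basis st cf cf cf])
  fix x y :: "'a => real"
  have "?S (\<lambda>i\<in>Basis. t * x i + s * y i) = t *\<^sub>R ?S x + s *\<^sub>R ?S y"
   by (simp add: scaleR_sum_right scaleR_add_left sum.distrib)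
  then show "u (?S x) powr t * v (?S y) powr s <= w (?S (\<lambda>i\<in>Basis. t * x i + s * y i))"
   using le by simp
 qed (use m b z in auto)
qed

section \<open>The logarithmic Sobolev inequality\<close>

lemma integral_pos_lborel:
 fixes f :: "'a::euclidean_space => real"
 assumes "integrable lborel f" "!!x. f x > 0"
 shows "(LINT x|lborel. f x) > 0"
proof (rule ccontr)
 assume "\<not> ?thesis"
 moreover have "(LINT x|lborel. f x) >= 0"
  using assms(2) by (intro integral_nonneg_AE) (simp add: less_imp_le)
 ultimately have "(LINT x|lborel. f x) = 0" by linarith
 then have "AE x in lborel. f x = 0"
  using integral_nonneg_eq_0_iff_AE[OF assms(1)] assms(2) by (simp add: less_imp_le)
 then have "AE x in (lborel::'a measure). False"
  by eventually_elim (use assms(2) in \<open>simp add: less_le\<close>)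
 then have "emeasure lborel (space (lborel::'a measure)) = 0"
  by (simp only: eventually_False ae_filter_eq_bot_iff)
 then show False by (simp add: emeasure_lborel_UNIV)
qed

lemma grad_mvt:
 fixes h :: "real^'n => real"
 assumes "!!x. h differentiable (at x)"
 shows "\<exists>r. 0 < r & r < 1 & h x - h z = grad h (z + r *\<^sub>R (x - z)) \<bullet> (x - z)"
proof -
 have "\<exists>r. 0 < r & r < 1 & h (z + 1 *\<^sub>R (x - z)) - h (z + 0 *\<^sub>R (x - z)) = (1 - 0) * (grad h (z + r *\<^sub>R (x - z)) \<bullet> (x - z))"
  by (rule MVT2) (use grad_line_derivative[of h z _ "x - z" UNIV] assms in
    \<open>auto simp: has_real_derivative_iff_has_vector_derivative\<close>)
 then show ?thesis by simp
qed

lemma integrable_exp_perturb: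
 fixes U h :: "real^'n => real"
 assumes U: "continuous_on UNIV U" "integrable lborel (%x. exp (- U x))"
  and h: "continuous_on UNIV h" "!!x. \<bar>h x\<bar> <= H" and f: "f \<in> borel_measurable borel" "!!x. \<bar>f x\<bar> <= F"
 shows "integrable lborel (%x. f x * exp (h x - U x) :: real)"
proof (rule integrable_bd)
 have [measurable]: "U \<in> borel_measurable borel" "h \<in> borel_measurable borel" "f \<in> borel_measurable borel"
  using borel_of_cont[OF U(1)] borel_of_cont[OF h(1)] f by auto
 show "(%x. f x * exp (h x - U x)) \<in> borel_measurable lborel" by measurable
 show "integrable lborel (%x. F * exp H * exp (- U x))" using U(2) by simp
 show "AE x in lborel. norm (f x * exp (h x - U x)) <= norm (F * exp H * exp (- U x))"
 proof (rule AE_I2)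
  fix x
  have "exp (h x) <= exp H" using h(2)[of x] by simp
  moreover have "0 <= F" using f(2)[of x] by linarith
  ultimately have "\<bar>f x\<bar> * exp (h x) * exp (- U x) <= F * exp H * exp (- U x)"
   using f(2)[of x] by (intro mult_right_mono mult_mono) auto
  then show "norm (f x * exp (h x - U x)) <= norm (F * exp H * exp (- U x))"
   using \<open>0 <= F\<close> by (simp add: abs_mult exp_diff exp_minus divide_inverse mult_ac)
 qed
qed

lemma prekopa_leindler_exp:
 fixes U h q :: "real^'n => real"
 assumes U: "continuous_on UNIV U" "integrable lborel (%x. exp (- U x))"
  and conv: "!!x y. U (t *\<^sub>R x + s *\<^sub>R y) <= t * U x + s * U y - K / 2 * t * s * (norm (x - y))\<^sup>2"
  and st: "s > 0" "t > 0" "t + s = 1"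
  and h: "continuous_on UNIV h" "!!x. \<bar>h x\<bar> <= H" and q: "continuous_on UNIV q" "!!x. \<bar>q x\<bar> <= Q"
  and le: "!!x z. h x - K * t / (2 * s) * (norm (x - z))\<^sup>2 <= q z"
 shows "t * ln (LINT x|lborel. exp (h x / t - U x)) + s * ln (LINT x|lborel. exp (- U x))
  <= ln (LINT x|lborel. exp (q x - U x))"
proof -
 let ?B = "%n. cbox (- (real n *\<^sub>R One)) (real n *\<^sub>R One) :: (real^'n) set"
 let ?u = "%x. exp (h x / t - U x)" and ?v = "%x. exp (- U x)" and ?w = "%x. exp (q x - U x)"
 have c: "continuous_on UNIV ?u" "continuous_on UNIV ?v" "continuous_on UNIV ?w"
  using st by (auto intro!: continuous_intros U h q)
 have ht: "\<bar>h x / t\<bar> <= H / t" for x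
  using h(2)[of x] st by (simp add: divide_right_mono)
 have cht: "continuous_on UNIV (%x. h x / t)" using st by (intro continuous_intros h) auto
 have i: "integrable lborel ?u" "integrable lborel ?v" "integrable lborel ?w"
  using integrable_exp_perturb[OF U cht ht, of "%_. 1" 1] integrable_exp_perturb[OF U q, of "%_. 1" 1] U(2) by auto
 have lim: "(%n. LINT x|lborel. indicator (?B n) x * f x) \<longlonglongrightarrow> (LINT x|lborel. f x)"
  if fi: "integrable lborel f" for f :: "real^'n => real"
 proof (rule integral_dominated_convergence[where w="%x. \<bar>f x\<bar>"])
  show "AE x in lborel. (%n. indicator (?B n) x * f x) \<longlonglongrightarrow> f x"
  proof (rule AE_I2, rule tendsto_eventually)
   fix x :: "real^'n"
   show "\<forall>\<^sub>F n in sequentially. indicator (?B n) x * f x = f x"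
    using eventually_ge_at_top[of "nat \<lceil>norm x\<rceil>"]
   proof eventually_elim
    case (elim n)
    then have n: "norm x <= real n" by linarith
    have "\<bar>x \<bullet> b\<bar> <= real n" if "b \<in> Basis" for b
    using Basis_le_norm[OF that, of x] n by linarith
    then have "x \<in> ?B n" by (auto simp: mem_box abs_le_iff) (smt (verit, best))
    then show ?case by simp
   qed
  qed
 qed (use fi in \<open>auto split: split_indicator\<close>)
 have fin: "(LINT x|lborel. indicator (?B n) x * ?u x) powr t * (LINT x|lborel. indicator (?B n) x * ?v x) powr s
   <= (LINT x|lborel. indicator (?B n) x * ?w x)" for n
 proof -
  have bd: "\<exists>C. \<forall>x\<in>?B n. f x <= C" if "continuous_on UNIV f" for f :: "real^'n => real"
  proof -
   have "bounded (f ` ?B n)"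
    by (intro compact_imp_bounded compact_continuous_image continuous_on_subset[OF that]) auto
   then obtain C where "\<forall>y\<in>f ` ?B n. norm y <= C" unfolding bounded_iff by metis
   then show ?thesis by (intro exI[of _ C]) (auto simp: abs_le_iff)
  qed
  obtain C1 C2 C3 where C: "\<forall>x\<in>?B n. ?u x <= C1" "\<forall>x\<in>?B n. ?v x <= C2" "\<forall>x\<in>?B n. ?w x <= C3"
   using bd[OF c(1)] bd[OF c(2)] bd[OF c(3)] by blast
  define C where "C = max 0 (max C1 (max C2 C3))"
  have C': "0 <= indicator (?B n) x * ?u x & indicator (?B n) x * ?u x <= C"
   "0 <= indicator (?B n) x * ?v x & indicator (?B n) x * ?v x <= C"
   "0 <= indicator (?B n) x * ?w x & indicator (?B n) x * ?w x <= C" for x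
   using C by (auto simp: C_def le_max_iff_disj split: split_indicator)
  show ?thesis
  proof (rule prekopa_leindler[OF st _ _ _ C', where R="real n"])
   show "(%x. indicator (?B n) x * ?u x) \<in> borel_measurable borel"
    "(%x. indicator (?B n) x * ?v x) \<in> borel_measurable borel"
    "(%x. indicator (?B n) x * ?w x) \<in> borel_measurable borel"
    using borel_of_cont[OF c(1)] borel_of_cont[OF c(2)]
    borel_of_cont[OF c(3)] by (auto intro!: borel_measurable_times)
   fix x b :: "real^'n" assume b: "b \<in> Basis" "real n < \<bar>x \<bullet> b\<bar>"
   then have "x \<notin> ?B n" by (auto simp: mem_box abs_less_iff not_le intro!: bexI[of _ b])
   then show "indicator (?B n) x * ?u x = 0 & indicator (?B n) x * ?v x = 0 & indicator (?B n) x * ?w x = 0"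
    by simp
  next
   fix x y :: "real^'n"
   show "(indicator (?B n) x * ?u x) powr t * (indicator (?B n) y * ?v y) powr s
    <= indicator (?B n) (t *\<^sub>R x + s *\<^sub>R y) * ?w (t *\<^sub>R x + s *\<^sub>R y)"
   proof (cases "x \<in> ?B n & y \<in> ?B n")
    case True
    have z: "t *\<^sub>R x + s *\<^sub>R y \<in> ?B n"
    using True st by (intro convexD[OF convex_box(1)]) auto
    define z where "z = t *\<^sub>R x + s *\<^sub>R y"
    have "s *\<^sub>R (x - y) = x - z"
    proof -
    have "x - z = (t + s) *\<^sub>R x - z" using st by simp
    then show ?thesis by (simp add: z_def algebra_simps)
    qed
    then have "norm (x - z) = s * norm (x - y)" using st by (metis abs_of_pos norm_scaleR)
    then have "K * t / (2 * s) * (norm (x - z))\<^sup>2 = K / 2 * t * s * (norm (x - y))\<^sup>2"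
    using st by (simp add: power_mult_distrib power2_eq_square)
    then have "h x - t * U x - s * U y <= q z - U z"
    using le[of x z] conv[of x y] by (simp add: z_def)
    moreover have "?u x powr t * ?v y powr s = exp (h x - t * U x - s * U y)"
    using st by (simp add: powr_def algebra_simps flip: exp_add)
    ultimately show ?thesis using True z by (simp add: z_def)
   qed (use st in auto)
  qed
 qed
 have pos: "0 < (LINT x|lborel. ?u x)" "0 < (LINT x|lborel. ?v x)" "0 < (LINT x|lborel. ?w x)"
  by (intro integral_pos_lborel i, simp)+
 have "(%n. (LINT x|lborel. indicator (?B n) x * ?u x) powr t * (LINT x|lborel. indicator (?B n) x * ?v x) powr s)
   \<longlonglongrightarrow> (LINT x|lborel. ?u x) powr t * (LINT x|lborel. ?v x) powr s"
  by (intro tendsto_mult tendsto_powr lim i tendsto_const) (use pos in auto)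
 then have "(LINT x|lborel. ?u x) powr t * (LINT x|lborel. ?v x) powr s <= (LINT x|lborel. ?w x)"
  by (rule LIMSEQ_le[OF _ lim[OF i(3)]]) (use fin in blast)
 then have "ln ((LINT x|lborel. ?u x) powr t * (LINT x|lborel. ?v x) powr s) <= ln (LINT x|lborel. ?w x)"
  using pos by (subst ln_le_cancel_iff) auto
 then show ?thesis using pos by (simp add: ln_mult ln_powr)
qed

text \<open>Bobkov and Ledoux: the Prekopa--Leindler inequality for the pair \<open>h / t\<close>, \<open>0\<close> with \<open>t\<close> near 1
 contains the logarithmic Sobolev inequality to first order in \<open>s = 1 - t\<close>.  The factor \<open>1/K\<close>,
 twice the optimal one, allows a fixed small \<open>s\<close> instead of a limit.\<close>

lemma log_sobolev_convex:
 fixes U h :: "real^'n => real"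
 assumes K: "K > 0" and U: "continuous_on UNIV U" "integrable lborel (%x. exp (- U x))"
  and conv: "!!x y t s. t > 0 ==> s > 0 ==> t + s = 1 ==>
   U (t *\<^sub>R x + s *\<^sub>R y) <= t * U x + s * U y - K / 2 * t * s * (norm (x - y))\<^sup>2"
  and h: "!!x. h differentiable (at x)" and h': "continuous_on UNIV (grad h)"
  and const: "!!x. norm x > R ==> h x = h0"
 defines "A \<equiv> LINT x|lborel. exp (h x - U x)" and "Z \<equiv> LINT x|lborel. exp (- U x)"
 shows "(LINT x|lborel. h x * exp (h x - U x)) - A * ln (A / Z)
  <= 1 / K * (LINT x|lborel. (norm (grad h x))\<^sup>2 * exp (h x - U x))"
proof -
 have hc: "continuous_on UNIV h" by (rule diff_imp_cont[OF h])
 have g0: "norm x > R ==> grad h x = 0" for x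
 proof -
  assume "norm x > R"
  have "grad (%x. h x - h0) x = 0"
   by (rule grad_zero_outside[of R]) (use const \<open>norm x > R\<close> in auto)
  moreover have "grad (%x. h x - h0) x = grad h x"
   by (rule grad_eqI) (auto intro!: derivative_eq_intros grad_has_derivative h)
  ultimately show ?thesis by simp
 qed
 have "\<exists>H. \<forall>x. norm (h x - h0) <= H"
  by (rule integrable_cont_bdd(2)[of _ R]) (auto intro!: continuous_intros hc simp: const)
 then obtain H0 where H0: "!!x. \<bar>h x - h0\<bar> <= H0" by auto
 define H where "H = H0 + \<bar>h0\<bar>"
 have H: "\<bar>h x\<bar> <= H" for x using H0[of x] unfolding H_def by linarith
 have H_nn: "H >= 0" using H[of 0] by linarith
 obtain B where B: "!!x. norm (grad h x) <= B"
  using integrable_cont_bdd(2)[OF h' g0] by blast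
 have B_nn: "B >= 0" using order_trans[OF norm_ge_zero B] .
 have [measurable]: "h \<in> borel_measurable borel" "grad h \<in> borel_measurable borel"
  by (auto intro: borel_of_cont hc h')
 define W where "W = (LINT x|lborel. (norm (grad h x))\<^sup>2 * exp (h x - U x))"
 define E where "E = (LINT x|lborel. h x * exp (h x - U x))"
 note ie = integrable_exp_perturb[OF U hc H]
 have iA: "integrable lborel (%x. exp (h x - U x))" using ie[of "%_. 1" 1] by simp
 have iE: "integrable lborel (%x. h x * exp (h x - U x))" by (rule ie[OF _ H]) simp
 have iW: "integrable lborel (%x. (norm (grad h x))\<^sup>2 * exp (h x - U x))"
  by (rule ie[where F="B\<^sup>2"]) (use B in \<open>auto intro!: power_mono\<close>)
 have A: "A > 0" unfolding A_def by (rule integral_pos_lborel[OF iA]) simp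
 have Z: "Z > 0" unfolding Z_def by (rule integral_pos_lborel[OF U(2)]) simp
 have main: "E - A * ln (A / Z) <= 1 / K * (W + (2 * B + 1) * A * \<omega>)" if \<omega>: "0 < \<omega>" "\<omega> <= 1" for \<omega>
 proof -
  obtain \<delta> where \<delta>: "\<delta> > 0" "!!x y. norm (x - y) < \<delta> ==> norm (grad h x - grad h y) < \<omega>"
   using continuous_compact_support_uniform[OF h' g0 \<omega>(1)] by blast
  define s where "s = min (1/4) (min (K / (3 * (B + 1)\<^sup>2)) (K * \<delta>\<^sup>2 / (8 * (H + 1))))"
  define t where "t = 1 - s"
  have s0: "s > 0"
   using K \<delta>(1) B_nn H_nn by (simp add: s_def)
  have s: "s <= 1/4" "s <= K / (3 * (B + 1)\<^sup>2)" "s <= K * \<delta>\<^sup>2 / (8 * (H + 1))"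
   by (simp_all only: s_def min_le_iff_disj order_refl simp_thms)
  have t: "t >= 3/4" "t > 0" "t + s = 1" using s by (auto simp: t_def)
  define c where "c = 1 / (2 * K * t)"
  have c: "c > 0" "c <= 2 / (3 * K)"
   using K t by (auto simp: c_def field_simps)
  define G where "G = (%x. norm (grad h x) + \<omega>)"
  have G: "0 <= G x" "G x <= B + 1" for x
   using B[of x] \<omega> by (auto simp: G_def intro: add_mono)
  have Gc: "continuous_on UNIV G" unfolding G_def by (intro continuous_intros h')
  define q where "q = (%x. h x + s * c * (G x)\<^sup>2)"
  have qc: "continuous_on UNIV q" unfolding q_def by (intro continuous_intros hc Gc)
  have sc: "s * c * (B + 1)\<^sup>2 <= 1/3"
  proof -
   have "s * c * (B + 1)\<^sup>2 <= K / (3 * (B + 1)\<^sup>2) * (2 / (3 * K)) * (B + 1)\<^sup>2"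
    using s c s0 K by (intro mult_right_mono mult_mono) auto
   also have "... = 2/9" using K B_nn by (simp add: field_simps)
   finally show ?thesis by simp
  qed
  have scG: "0 <= s * c * (G x)\<^sup>2" "s * c * (G x)\<^sup>2 <= 1/3" for x
  proof -
   show "0 <= s * c * (G x)\<^sup>2" using s0 c by simp
   have "s * c * (G x)\<^sup>2 <= s * c * (B + 1)\<^sup>2"
    using s0 c G[of x] by (intro mult_left_mono power_mono) auto
   then show "s * c * (G x)\<^sup>2 <= 1/3" using sc by linarith
  qed
  have q: "\<bar>q x\<bar> <= H + 1" for x
   using H[of x] scG[of x] unfolding q_def by linarith
  have le: "h x - K * t / (2 * s) * (norm (x - z))\<^sup>2 <= q z" for x z
  proof (cases "norm (x - z) < \<delta>")
   case True
   obtain r where r: "0 < r" "r < 1" "h x - h z = grad h (z + r *\<^sub>R (x - z)) \<bullet> (x - z)"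
    using grad_mvt[OF h] by blast
   have "norm (z + r *\<^sub>R (x - z) - z) <= 1 * norm (x - z)"
    using r by (simp add: mult_left_le_one_le)
   then have "norm (grad h (z + r *\<^sub>R (x - z)) - grad h z) < \<omega>"
    using True by (intro \<delta>(2)) auto
   then have "norm (grad h (z + r *\<^sub>R (x - z))) <= G z"
    unfolding G_def by (smt (verit) norm_triangle_sub)
   then have "norm (grad h (z + r *\<^sub>R (x - z))) * norm (x - z) <= G z * norm (x - z)"
    by (intro mult_right_mono) auto
   then have "h x - h z <= G z * norm (x - z)"
    using r(3) norm_cauchy_schwarz[of "grad h (z + r *\<^sub>R (x - z))" "x - z"] by linarith
   also have "... <= K * t / (2 * s) * (norm (x - z))\<^sup>2 + s * c * (G z)\<^sup>2"
   proof -
    define a where "a = K * t / (2 * s)"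
    have a: "a > 0" using K t s0 by (simp add: a_def)
    have sca: "s * c = 1 / (4 * a)" using K t s0 by (simp add: a_def c_def field_simps)
    have "0 <= (2 * a * norm (x - z) - G z)\<^sup>2 / (4 * a)" using a by simp
    also have "... = a * (norm (x - z))\<^sup>2 + (1 / (4 * a)) * (G z)\<^sup>2 - G z * norm (x - z)"
    using a by (simp add: field_simps power2_eq_square)
    finally show ?thesis by (simp add: sca a_def[symmetric])
   qed
   finally show ?thesis by (simp add: q_def)
  next
   case False
   have "2 * H <= K * t / (2 * s) * \<delta>\<^sup>2"
   proof -
    have "s * (8 * (H + 1)) <= K * \<delta>\<^sup>2" using s(3) H_nn by (simp add: pos_le_divide_eq)
    from mult_mono[OF this t(1)] have "s * (8 * (H + 1)) * (3/4) <= K * \<delta>\<^sup>2 * t" using K by simp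
    moreover have "s * H >= 0" using s0 H_nn by simp
    ultimately have "4 * s * H <= K * \<delta>\<^sup>2 * t" using s0 by (simp add: algebra_simps)
    then show ?thesis using s0 by (simp add: field_simps)
   qed
   also have "... <= K * t / (2 * s) * (norm (x - z))\<^sup>2"
    using False \<delta>(1) K t s0 by (intro mult_left_mono power_mono) auto
   finally have "h x - K * t / (2 * s) * (norm (x - z))\<^sup>2 <= h z"
    using H[of x] H[of z] by linarith
   then show ?thesis using scG(1)[of z] by (simp add: q_def)
  qed
  have PL: "t * ln (LINT x|lborel. exp (h x / t - U x)) + s * ln Z <= ln (LINT x|lborel. exp (q x - U x))"
   unfolding Z_def
   by (rule prekopa_leindler_exp[OF U conv[OF t(2) s0 t(3)] s0 t(2,3) hc H qc q le])
  \<comment> \<open>Jensen's inequality for the exponential and the probability density \<open>exp (h - U) / A\<close>.\<close>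
  have P: "A * exp (s / t * (E / A)) <= (LINT x|lborel. exp (h x / t - U x))"
  proof -
   define m where "m = s / t * (E / A)"
   have st: "1 / t - 1 = s / t" using t by (simp add: field_simps)
   have pw: "exp m * ((1 - m) * exp (h x - U x) + s / t * (h x * exp (h x - U x))) <= exp (h x / t - U x)" for x
   proof -
    have "1 + (s / t * h x - m) <= exp (s / t * h x - m)" by (rule exp_ge_add_one_self)
    then have "exp m * exp (h x - U x) * (1 + (s / t * h x - m)) <= exp m * exp (h x - U x) * exp (s / t * h x - m)"
    by (intro mult_left_mono) auto
    also have "... = exp (h x / t - U x)"
    proof -
    have "m + (h x - U x) + (s / t * h x - m) = h x / t - U x"
    proof -
    have eq: "1 / t = 1 + s / t" using st by simp
    have "h x / t = (1 / t) * h x" by simp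
    also have "... = h x + s / t * h x" by (simp only: eq distrib_right mult_1)
    finally show ?thesis by simp
    qed
    then show ?thesis by (simp flip: exp_add)
    qed
    finally show ?thesis by (simp add: algebra_simps)
   qed
   have ht: "\<bar>h x / t\<bar> <= H / t" for x
    using H[of x] t by (simp add: divide_right_mono)
   have cht: "continuous_on UNIV (%x. h x / t)" using t by (intro continuous_intros hc) auto
   have iP: "integrable lborel (%x. exp (h x / t - U x))"
    using integrable_exp_perturb[OF U cht ht, of "%_. 1" 1] by simp
   have "(LINT x|lborel. exp m * ((1 - m) * exp (h x - U x) + s / t * (h x * exp (h x - U x))))
    <= (LINT x|lborel. exp (h x / t - U x))"
    by (intro integral_mono iP pw) (use iA iE in auto)
   also have "(LINT x|lborel. exp m * ((1 - m) * exp (h x - U x) + s / t * (h x * exp (h x - U x))))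
    = exp m * ((1 - m) * A + s / t * E)"
    using iA iE by (simp add: A_def E_def)
   also have "(1 - m) * A + s / t * E = A"
    using A by (simp add: m_def algebra_simps)
   finally show ?thesis by (simp add: m_def mult.commute)
  qed
  have Q: "(LINT x|lborel. exp (q x - U x)) <= A + s / K * (W + (2 * B + 1) * A * \<omega>)"
  proof -
   have pw: "exp (q x - U x) <= exp (h x - U x)
    + s / K * ((norm (grad h x))\<^sup>2 * exp (h x - U x) + (2 * B + 1) * \<omega> * exp (h x - U x))" for x
   proof -
    define y where "y = s * c * (G x)\<^sup>2"
    have y: "0 <= y" "y <= 1/3" using scG[of x] by (auto simp: y_def)
    have "exp y <= 1 + y + y\<^sup>2" using y by (intro exp_bound) auto
    also have "... <= 1 + 3/2 * y"
    proof -
    have "y * y <= 1/3 * y" using y by (intro mult_right_mono) auto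
    then show ?thesis using y by (simp add: power2_eq_square)
    qed
    also have "3/2 * y <= s / K * (G x)\<^sup>2"
    proof -
    have "3/2 * c <= 1 / K" using c K by (simp add: field_simps)
    then have "(s * (G x)\<^sup>2) * (3/2 * c) <= (s * (G x)\<^sup>2) * (1 / K)"
    using s0 by (intro mult_left_mono) auto
    then show ?thesis by (simp add: y_def mult_ac)
    qed
    also have "s / K * (G x)\<^sup>2 <= s / K * ((norm (grad h x))\<^sup>2 + (2 * B + 1) * \<omega>)"
    proof (rule mult_left_mono)
    have "(G x)\<^sup>2 = (norm (grad h x))\<^sup>2 + (2 * norm (grad h x) + \<omega>) * \<omega>"
    by (simp add: G_def power2_eq_square algebra_simps)
    also have "(2 * norm (grad h x) + \<omega>) * \<omega> <= (2 * B + 1) * \<omega>"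
    using B[of x] \<omega> by (intro mult_right_mono add_mono mult_left_mono) auto
    finally show "(G x)\<^sup>2 <= (norm (grad h x))\<^sup>2 + (2 * B + 1) * \<omega>" by simp
    qed (use s0 K in simp)
    finally have "exp y <= 1 + s / K * ((norm (grad h x))\<^sup>2 + (2 * B + 1) * \<omega>)"
    by simp
    then have "exp y * exp (h x - U x) <= (1 + s / K * ((norm (grad h x))\<^sup>2 + (2 * B + 1) * \<omega>)) * exp (h x - U x)"
    by (intro mult_right_mono) auto
    moreover have "exp y * exp (h x - U x) = exp (q x - U x)"
    by (simp add: q_def y_def algebra_simps flip: exp_add)
    ultimately show ?thesis by (simp add: algebra_simps)
   qed
   have iQ: "integrable lborel (%x. exp (q x - U x))"
    using integrable_exp_perturb[OF U qc q, of "%_. 1" 1] by simp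
   have "(LINT x|lborel. exp (q x - U x)) <= (LINT x|lborel. exp (h x - U x)
    + s / K * ((norm (grad h x))\<^sup>2 * exp (h x - U x) + (2 * B + 1) * \<omega> * exp (h x - U x)))"
    by (intro integral_mono iQ pw) (use iA iW in auto)
   also have "... = A + s / K * (W + (2 * B + 1) * A * \<omega>)"
    using iA iW by (simp add: A_def W_def algebra_simps)
   finally show ?thesis .
  qed
  have W0: "W >= 0" unfolding W_def by (intro integral_nonneg_AE) auto
  define Y where "Y = W + (2 * B + 1) * A * \<omega>"
  have Y: "Y >= 0" using W0 B_nn A \<omega> by (simp add: Y_def)
  have "t * ln (A * exp (s / t * (E / A))) <= t * ln (LINT x|lborel. exp (h x / t - U x))"
   using P A t by (intro mult_left_mono) (auto intro!: ln_mono mult_pos_pos)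
  moreover have "t * ln (A * exp (s / t * (E / A))) = t * ln A + s * (E / A)"
   using A t by (simp add: ln_mult distrib_left)
  ultimately have 1: "t * ln A + s * (E / A) + s * ln Z <= ln (LINT x|lborel. exp (q x - U x))"
   using PL by linarith
  have q0: "0 < (LINT x|lborel. exp (q x - U x))"
   using integrable_exp_perturb[OF U qc q, of "%_. 1" 1] by (intro integral_pos_lborel) auto
  have "A * (1 + s / K * (Y / A)) = A + s / K * Y" using A by (simp add: distrib_left)
  then have "(LINT x|lborel. exp (q x - U x)) <= A * (1 + s / K * (Y / A))"
   using Q by (simp only: Y_def)
  then have "ln (LINT x|lborel. exp (q x - U x)) <= ln (A * (1 + s / K * (Y / A)))"
   using q0 by (subst ln_le_cancel_iff) auto
  also have "... = ln A + ln (1 + s / K * (Y / A))"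
  proof (rule ln_mult_pos)
   show "0 < 1 + s / K * (Y / A)" using A Y s0 K by (intro add_pos_nonneg) auto
  qed (rule A)
  also have "ln (1 + s / K * (Y / A)) <= s / K * (Y / A)"
   using A Y s0 K by (intro ln_add_one_self_le_self) auto
  finally have "t * ln A + s * (E / A) + s * ln Z <= ln A + s / K * (Y / A)" using 1 by linarith
  then have "s * (E / A - ln A + ln Z) <= s * (1 / K * (Y / A))"
   by (simp add: t_def algebra_simps)
  then have "E / A - ln A + ln Z <= 1 / K * (Y / A)" using s0 by (simp only: mult_le_cancel_left_pos)
  then have "A * (E / A - ln A + ln Z) <= A * (1 / K * (Y / A))" using A by (intro mult_left_mono) auto
  moreover have "A * (E / A - ln A + ln Z) = E - A * (ln A - ln Z)" using A by (simp add: algebra_simps)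
  moreover have "A * (1 / K * (Y / A)) = 1 / K * Y" using A by simp
  moreover have "ln (A / Z) = ln A - ln Z" using A Z by (rule ln_divide_pos)
  ultimately show ?thesis by (simp only: Y_def)
 qed
 have "((%\<omega>. 1 / K * (W + (2 * B + 1) * A * \<omega>)) \<longlongrightarrow> 1 / K * (W + (2 * B + 1) * A * 0)) (at_right 0)"
  by (intro tendsto_intros)
 then have "E - A * ln (A / Z) <= 1 / K * (W + (2 * B + 1) * A * 0)"
 proof (rule tendsto_lowerbound)
  show "\<forall>\<^sub>F \<omega> in at_right 0. E - A * ln (A / Z) <= 1 / K * (W + (2 * B + 1) * A * \<omega>)"
  proof (rule eventually_mono[OF eventually_at_right_real])
   show "(0::real) < 1" by simp
   fix \<omega> :: real assume "\<omega> \<in> {0<..<1}"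
   then show "E - A * ln (A / Z) <= 1 / K * (W + (2 * B + 1) * A * \<omega>)"
    by (intro main) auto
  qed
 qed simp
 then show ?thesis by (simp add: E_def W_def)
qed

lemma tangent_xlnx:
 assumes "a > 0" "c > (0::real)"
 shows "0 <= a * ln a - a * ln c - a + c"
proof -
 have "a * ln (c / a) <= a * (c / a - 1)"
  using assms by (intro mult_left_mono ln_le_minus_one) auto
 also have "a * (c / a - 1) = c - a" using assms by (simp add: right_diff_distrib)
 finally show ?thesis using assms by (simp add: ln_div algebra_simps)
qed

text \<open>Holley and Stroock: the entropy of \<open>f\<close> is the minimum over \<open>c\<close> of the integral of the
 nonnegative function \<open>f ln f - f ln c - f + c\<close>, hence monotone in the measure.\<close>

lemma log_sobolev_perturbed:
 fixes U \<phi> h :: "real^'n => real"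
 assumes K: "K > 0" and U: "continuous_on UNIV U" "integrable lborel (%x. exp (- U x))"
  and conv: "!!x y t s. t > 0 ==> s > 0 ==> t + s = 1 ==>
   U (t *\<^sub>R x + s *\<^sub>R y) <= t * U x + s * U y - K / 2 * t * s * (norm (x - y))\<^sup>2"
  and \<phi>: "continuous_on UNIV \<phi>" "!!x. lo <= \<phi> x" "!!x. \<phi> x <= hi"
  and h: "!!x. h differentiable (at x)" and h': "continuous_on UNIV (grad h)"
  and const: "!!x. norm x > R ==> h x = h0"
 defines "V \<equiv> %x. U x + \<phi> x"
 defines "A \<equiv> LINT x|lborel. exp (h x - V x)" and "Z \<equiv> LINT x|lborel. exp (- V x)"
 shows "(LINT x|lborel. h x * exp (h x - V x)) - A * ln (A / Z)
  <= exp (hi - lo) / K * (LINT x|lborel. (norm (grad h x))\<^sup>2 * exp (h x - V x))"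
proof -
 have hc: "continuous_on UNIV h" by (rule diff_imp_cont[OF h])
 have g0: "norm x > R ==> grad h x = 0" for x
 proof -
  assume "norm x > R"
  have "grad (%x. h x - h0) x = 0"
   by (rule grad_zero_outside[of R]) (use const \<open>norm x > R\<close> in auto)
  moreover have "grad (%x. h x - h0) x = grad h x"
   by (rule grad_eqI) (auto intro!: derivative_eq_intros grad_has_derivative h)
  ultimately show ?thesis by simp
 qed
 have "\<exists>H. \<forall>x. norm (h x - h0) <= H"
  by (rule integrable_cont_bdd(2)[of _ R]) (auto intro!: continuous_intros hc simp: const)
 then obtain H0 where H0: "!!x. \<bar>h x - h0\<bar> <= H0" by auto
 define H where "H = H0 + \<bar>h0\<bar>"
 have H: "\<bar>h x\<bar> <= H" for x using H0[of x] unfolding H_def by linarith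
 obtain B where B: "!!x. norm (grad h x) <= B"
  using integrable_cont_bdd(2)[OF h' g0] by blast
 have [measurable]: "h \<in> borel_measurable borel" "grad h \<in> borel_measurable borel"
  by (auto intro: borel_of_cont hc h')
 have Vc: "continuous_on UNIV V" unfolding V_def by (intro continuous_intros U \<phi>)
 define F where "F = max \<bar>lo\<bar> \<bar>hi\<bar>"
 have F: "\<bar>- \<phi> x\<bar> <= F" for x using \<phi>(2,3)[of x] unfolding F_def by linarith
 have Veq: "- \<phi> x - U x = - V x" for x by (simp add: V_def)
 have Vi: "integrable lborel (%x. exp (- V x))"
  using integrable_exp_perturb[where h="%x. - \<phi> x" and f="%_. 1" and F=1, OF U _ F] \<phi>(1)
  by (simp add: Veq continuous_on_minus)
 note iU = integrable_exp_perturb[OF U hc H] and iV = integrable_exp_perturb[OF Vc Vi hc H]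
 have e1: "integrable lborel (%x. exp (h x - U x))" "integrable lborel (%x. exp (h x - V x))"
  using iU[where f="%_. 1" and F=1] iV[where f="%_. 1" and F=1] by simp_all
 have e2: "integrable lborel (%x. h x * exp (h x - U x))" "integrable lborel (%x. h x * exp (h x - V x))"
  using iU[OF _ H] iV[OF _ H] by simp_all
 have e3: "integrable lborel (%x. (norm (grad h x))\<^sup>2 * exp (h x - U x))"
  "integrable lborel (%x. (norm (grad h x))\<^sup>2 * exp (h x - V x))"
  by (rule iU[where F="B\<^sup>2"] iV[where F="B\<^sup>2"]; use B in \<open>auto intro!: power_mono\<close>)+
 define AU where "AU = (LINT x|lborel. exp (h x - U x))"
 define ZU where "ZU = (LINT x|lborel. exp (- U x))"
 have pos: "A > 0" "Z > 0" "AU > 0" "ZU > 0"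
  unfolding A_def Z_def AU_def ZU_def by (rule integral_pos_lborel; use e1 Vi U in simp)+
 define c where "c = AU / ZU"
 have c: "c > 0" using pos by (simp add: c_def)
 define k where "k = (%x. exp (h x) * h x - exp (h x) * ln c - exp (h x) + c)"
 have k0: "k x >= 0" for x
  using tangent_xlnx[of "exp (h x)" c] c by (simp add: k_def)
 have kU: "k x * exp (- U x) = h x * exp (h x - U x) - (ln c + 1) * exp (h x - U x) + c * exp (- U x)" for x
  by (simp add: k_def exp_diff exp_minus divide_inverse algebra_simps)
 have kV: "k x * exp (- V x) = h x * exp (h x - V x) - (ln c + 1) * exp (h x - V x) + c * exp (- V x)" for x
  by (simp add: k_def exp_diff exp_minus divide_inverse algebra_simps)
 have ik: "integrable lborel (%x. k x * exp (- U x))" "integrable lborel (%x. k x * exp (- V x))"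
  unfolding kU kV using e1 e2 U(2) Vi by simp_all
 have IU: "(LINT x|lborel. k x * exp (- U x)) = (LINT x|lborel. h x * exp (h x - U x)) - AU * ln (AU / ZU)"
 proof -
  have "(LINT x|lborel. k x * exp (- U x)) = (LINT x|lborel. h x * exp (h x - U x)) - (ln c + 1) * AU + c * ZU"
   unfolding kU using e1 e2 U(2) by (simp add: AU_def ZU_def)
  moreover have "c * ZU = AU" using pos by (simp add: c_def)
  ultimately show ?thesis by (simp add: c_def algebra_simps)
 qed
 have IV: "(LINT x|lborel. h x * exp (h x - V x)) - A * ln (A / Z) <= (LINT x|lborel. k x * exp (- V x))"
 proof -
  have "(LINT x|lborel. k x * exp (- V x)) = (LINT x|lborel. h x * exp (h x - V x)) - (ln c + 1) * A + c * Z"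
   unfolding kV using e1 e2 Vi by (simp add: A_def Z_def)
  moreover have "0 <= Z * (A / Z * ln (A / Z) - A / Z * ln c - A / Z + c)"
   using tangent_xlnx[of "A / Z" c] pos c by (intro mult_nonneg_nonneg) auto
  moreover have "Z * (A / Z * ln (A / Z) - A / Z * ln c - A / Z + c) = A * ln (A / Z) - A * ln c - A + c * Z"
   using pos by (simp add: algebra_simps)
  ultimately show ?thesis by (simp add: algebra_simps)
 qed
 have lo: "exp (- V x) <= exp (- lo) * exp (- U x)" and hi: "exp (h x - U x) <= exp hi * exp (h x - V x)" for x
  using \<phi>(2,3)[of x] by (simp_all add: V_def flip: exp_add)
 have "(LINT x|lborel. k x * exp (- V x)) <= (LINT x|lborel. exp (- lo) * (k x * exp (- U x)))"
 proof (rule integral_mono)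
  fix x
  show "k x * exp (- V x) <= exp (- lo) * (k x * exp (- U x))"
   using mult_left_mono[OF lo k0[of x], of x] by (simp add: mult_ac)
 qed (use ik in auto)
 also have "... = exp (- lo) * ((LINT x|lborel. h x * exp (h x - U x)) - AU * ln (AU / ZU))"
  using ik by (simp add: IU)
 also have "... <= exp (- lo) * (1 / K * (LINT x|lborel. (norm (grad h x))\<^sup>2 * exp (h x - U x)))"
  unfolding AU_def ZU_def
  by (intro mult_left_mono log_sobolev_convex[OF K U conv h h' const]) auto
 also have "(LINT x|lborel. (norm (grad h x))\<^sup>2 * exp (h x - U x))
   <= (LINT x|lborel. exp hi * ((norm (grad h x))\<^sup>2 * exp (h x - V x)))"
 proof (rule integral_mono)
  fix x
  show "(norm (grad h x))\<^sup>2 * exp (h x - U x) <= exp hi * ((norm (grad h x))\<^sup>2 * exp (h x - V x))"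
   using mult_left_mono[OF hi, of "(norm (grad h x))\<^sup>2" x] by (simp add: mult_ac)
 qed (use e3 in auto)
 also have "... = exp hi * (LINT x|lborel. (norm (grad h x))\<^sup>2 * exp (h x - V x))"
  using e3 by simp
 finally have "(LINT x|lborel. k x * exp (- V x))
   <= exp (- lo) * (1 / K * (exp hi * (LINT x|lborel. (norm (grad h x))\<^sup>2 * exp (h x - V x))))"
  using K by (simp add: mult_left_mono divide_right_mono)
 also have "... = exp (hi - lo) / K * (LINT x|lborel. (norm (grad h x))\<^sup>2 * exp (h x - V x))"
  by (simp add: exp_diff exp_minus divide_inverse)
 finally show ?thesis using IV by linarith
qed

text \<open>The inequality for a probability density \<open>m\<close>, on functions that are constant near infinity.\<close>

definition log_sobolev :: "(real^'n => real) => real => bool"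
 where "log_sobolev m C \<longleftrightarrow> (\<forall>h h0 R. (\<forall>x. h differentiable (at x)) --> continuous_on UNIV (grad h) -->
  (\<forall>x. norm x > R --> h x = h0) -->
  (LINT x|density lborel (%x. ennreal (m x)). h x * exp (h x))
   - (LINT x|density lborel (%x. ennreal (m x)). exp (h x)) * ln (LINT x|density lborel (%x. ennreal (m x)). exp (h x))
  <= C * (LINT x|density lborel (%x. ennreal (m x)). (norm (grad h x))\<^sup>2 * exp (h x)))"

lemma log_sobolev_gibbs:
 fixes U \<phi> V :: "real^'n => real"
 assumes D: "D > 0" and K: "K > 0" and U: "continuous_on UNIV U" "integrable lborel (%x. exp (- U x / D))"
  and conv: "!!x y t s. t > 0 ==> s > 0 ==> t + s = 1 ==>
   U (t *\<^sub>R x + s *\<^sub>R y) <= t * U x + s * U y - K / 2 * t * s * (norm (x - y))\<^sup>2"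
  and \<phi>: "continuous_on UNIV \<phi>" "bounded (range \<phi>)" and V: "!!x. V x = U x + \<phi> x"
 shows "integrable lborel (%x. exp (- V x / D))" "(LINT x|lborel. exp (- V x / D)) > 0"
  and "log_sobolev (gibbs V D) (1 / lsi_const K D \<phi>)"
proof -
 define lo hi where "lo = (INF x. \<phi> x)" and "hi = (SUP x. \<phi> x)"
 have bdd: "bdd_above (range \<phi>)" "bdd_below (range \<phi>)"
  using bounded_imp_bdd_above[OF \<phi>(2)] bounded_imp_bdd_below[OF \<phi>(2)] by auto
 have lh: "lo <= \<phi> x" "\<phi> x <= hi" for x
  unfolding lo_def hi_def using cINF_lower[OF bdd(2)] cSUP_upper[OF _ bdd(1)] by simp_all
 have Ud: "- (a / D) = - a / D" for a by (rule minus_divide_left)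
 have U': "continuous_on UNIV (%x. U x / D)" "integrable lborel (%x. exp (- (U x / D)))"
  using U(2) by (simp_all only: Ud) (intro continuous_intros U, use D in simp)
 have \<phi>': "continuous_on UNIV (%x. \<phi> x / D)" "lo / D <= \<phi> x / D" "\<phi> x / D <= hi / D" for x
  using \<phi>(1) lh D by (auto intro!: continuous_intros divide_right_mono)
 have Vd: "U x / D + \<phi> x / D = V x / D" for x by (simp add: V add_divide_distrib)
 define F where "F = max \<bar>lo / D\<bar> \<bar>hi / D\<bar>"
 have F: "\<bar>- (\<phi> x / D)\<bar> <= F" for x using \<phi>'(2,3)[of x] unfolding F_def by linarith
 have "- (\<phi> x / D) - U x / D = - V x / D" for x by (simp add: V diff_divide_distrib add_divide_distrib)
 then show Vi: "integrable lborel (%x. exp (- V x / D))"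
  using integrable_exp_perturb[where h="%x. - (\<phi> x / D)" and f="%_. 1" and F=1, OF U' _ F] \<phi>'(1)
  by (simp add: continuous_on_minus)
 show Z: "(LINT x|lborel. exp (- V x / D)) > 0"
  by (rule integral_pos_lborel[OF Vi]) simp
 define Z where "Z = (LINT x|lborel. exp (- V x / D))"
 have Z0: "Z > 0" using Z by (simp add: Z_def)
 have conv': "U (t *\<^sub>R x + s *\<^sub>R y) / D <= t * (U x / D) + s * (U y / D) - (K / D) / 2 * t * s * (norm (x - y))\<^sup>2"
  if "t > 0" "s > 0" "t + s = 1" for x y t s
  using divide_right_mono[OF conv[OF that, of x y], of D] D
  by (simp add: add_divide_distrib diff_divide_distrib mult_ac)
 have Vc: "continuous_on UNIV V" unfolding V by (intro continuous_intros U \<phi>)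
 have [measurable]: "V \<in> borel_measurable borel" by (rule borel_of_cont[OF Vc])
 have g: "gibbs V D x = exp (- V x / D) / Z" for x by (simp add: gibbs_def Z_def)
 have gm: "gibbs V D \<in> borel_measurable borel" unfolding g by measurable
 have gi: "(LINT x|density lborel (%x. ennreal (gibbs V D x)). f x) = (LINT x|lborel. f x * exp (- V x / D)) / Z"
  if "f \<in> borel_measurable borel" for f :: "real^'n => real"
  using that gm Z0 by (subst integral_real_density) (auto simp: g mult.commute)
 show "log_sobolev (gibbs V D) (1 / lsi_const K D \<phi>)"
  unfolding log_sobolev_def
 proof (intro allI impI)
  fix h :: "real^'n => real" and h0 R
  assume h: "\<forall>x. h differentiable (at x)" and h': "continuous_on UNIV (grad h)" and c: "\<forall>x. norm x > R --> h x = h0"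
  have [measurable]: "h \<in> borel_measurable borel" "grad h \<in> borel_measurable borel"
   using diff_imp_cont[of h] h h' by (simp_all add: borel_of_cont)
  define A where "A = (LINT x|lborel. exp (h x - V x / D))"
  have "(LINT x|lborel. h x * exp (h x - V x / D)) - A * ln (A / Z)
   <= exp (hi / D - lo / D) / (K / D) * (LINT x|lborel. (norm (grad h x))\<^sup>2 * exp (h x - V x / D))"
  proof -
   have KD: "K / D > 0" using K D by simp
   have hh: "h differentiable (at x)" for x using h by (rule spec)
   have cc: "h x = h0" if "norm x > R" for x using c[rule_format, OF that] .
   have "(LINT x|lborel. h x * exp (h x - (U x / D + \<phi> x / D)))
    - (LINT x|lborel. exp (h x - (U x / D + \<phi> x / D))) * ln ((LINT x|lborel. exp (h x - (U x / D + \<phi> x / D)))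
    / (LINT x|lborel. exp (- (U x / D + \<phi> x / D))))
    <= exp (hi / D - lo / D) / (K / D) * (LINT x|lborel. (norm (grad h x))\<^sup>2 * exp (h x - (U x / D + \<phi> x / D)))"
    by (rule log_sobolev_perturbed[where U="%x. U x / D" and \<phi>="%x. \<phi> x / D" and K="K / D" and lo="lo / D" and hi="hi / D" and h=h and R=R])
    (fact KD U' conv' \<phi>' hh h' cc)+
   then show ?thesis
    by (simp only: Vd A_def Z_def Ud)
  qed
  moreover have "exp (hi / D - lo / D) / (K / D) = 1 / lsi_const K D \<phi>"
  proof -
   have "lsi_const K D \<phi> = K / D * exp (- (hi - lo) / D)"
    by (simp only: lsi_const_def osc_def lo_def hi_def)
   also have "- (hi - lo) / D = - (hi / D - lo / D)"
    by (simp only: diff_divide_distrib minus_divide_left[symmetric])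
   finally have l: "lsi_const K D \<phi> = K / D * inverse (exp (hi / D - lo / D))"
    by (simp only: exp_minus)
   have "e / (K / D) = 1 / (K / D * inverse e)" if "e > 0" for e :: real
    using that K D by (simp add: field_simps)
   from this[OF exp_gt_zero] show ?thesis by (simp only: l)
  qed
  ultimately have "(LINT x|lborel. h x * exp (h x - V x / D)) - A * ln (A / Z)
   <= 1 / lsi_const K D \<phi> * (LINT x|lborel. (norm (grad h x))\<^sup>2 * exp (h x - V x / D))"
   by (simp only:)
  then have *: "((LINT x|lborel. h x * exp (h x - V x / D)) - A * ln (A / Z)) / Z
   <= (1 / lsi_const K D \<phi> * (LINT x|lborel. (norm (grad h x))\<^sup>2 * exp (h x - V x / D))) / Z"
   using Z0 by (intro divide_right_mono) auto
  have e: "exp (h x) * exp (- V x / D) = exp (h x - V x / D)" for x by (simp flip: exp_add)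
  have m1: "(%x. h x * exp (h x)) \<in> borel_measurable borel" "(%x. exp (h x)) \<in> borel_measurable borel"
   "(%x. (norm (grad h x))\<^sup>2 * exp (h x)) \<in> borel_measurable borel" by measurable
  show "(LINT x|density lborel (%x. ennreal (gibbs V D x)). h x * exp (h x))
   - (LINT x|density lborel (%x. ennreal (gibbs V D x)). exp (h x)) * ln (LINT x|density lborel (%x. ennreal (gibbs V D x)). exp (h x))
   <= 1 / lsi_const K D \<phi> * (LINT x|density lborel (%x. ennreal (gibbs V D x)). (norm (grad h x))\<^sup>2 * exp (h x))"
   using * unfolding gi[OF m1(1)] gi[OF m1(2)] gi[OF m1(3)] mult.assoc e A_def[symmetric]
   by (simp add: diff_divide_distrib)
 qed
qed

section \<open>The logarithmic Sobolev inequality for densities\<close>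

lemma norm_add_sq_le:
 fixes a b :: "'a::real_inner"
 assumes "\<eta> > 0"
 shows "(norm (a + b))\<^sup>2 <= (1 + \<eta>) * (norm a)\<^sup>2 + (1 + 1 / \<eta>) * (norm b)\<^sup>2"
proof -
 have "norm (a + b) <= norm a + norm b" by (rule norm_triangle_ineq)
 then have "(norm (a + b))\<^sup>2 <= (norm a + norm b)\<^sup>2" by (intro power_mono) auto
 also have "... <= (1 + \<eta>) * (norm a)\<^sup>2 + (1 + 1 / \<eta>) * (norm b)\<^sup>2"
 proof -
  have "0 <= (\<eta> * norm a - norm b)\<^sup>2 / \<eta>" using assms by simp
  also have "... = \<eta> * (norm a)\<^sup>2 - 2 * norm a * norm b + (norm b)\<^sup>2 / \<eta>"
   using assms by (simp add: power2_eq_square field_simps)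
  finally show ?thesis by (simp add: power2_eq_square algebra_simps)
 qed
 finally show ?thesis .
qed

text \<open>The inequality for \<open>(\<epsilon> + u)\<^sup>2\<close>; the shift by \<open>\<epsilon>\<close> keeps the logarithm differentiable where \<open>u\<close> vanishes.\<close>

lemma log_sobolev_square:
 fixes m u :: "real^'n => real"
 defines "M \<equiv> density lborel (%x. ennreal (m x))"
 assumes LS: "log_sobolev m C" and C: "C >= 0" and P: "prob_space M"
  and m: "continuous_on UNIV m" "!!x. m x > 0"
  and u: "!!x. u differentiable (at x)" "!!x. u x >= 0" "!!x. norm x > R ==> u x = 0"
  and L2: "integrable M (%x. (norm (grad u x))\<^sup>2)" and \<epsilon>: "\<epsilon> > 0"
 defines "H \<equiv> %x. 2 * ln (\<epsilon> + u x)"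
 shows "(LINT x|M. H x * exp (H x)) - (LINT x|M. exp (H x)) * ln (LINT x|M. exp (H x))
  <= 4 * C * (LINT x|M. (norm (grad u x))\<^sup>2)"
proof -
 interpret prob_space M by fact
 have sets[measurable_cong]: "sets M = sets borel" by (simp add: M_def)
 have uc: "continuous_on UNIV u" by (rule diff_imp_cont[OF u(1)])
 have [measurable]: "u \<in> borel_measurable borel" "grad u \<in> borel_measurable borel"
  using borel_of_cont[OF uc] grad_measurable[OF u(1)] by auto
 obtain B where B: "!!x. norm (u x) <= B"
  using integrable_cont_bdd(2)[OF uc u(3)] by blast
 have f0: "\<epsilon> + u x > 0" for x using u(2)[of x] \<epsilon> by linarith
 have eH: "exp (H x) = (\<epsilon> + u x)\<^sup>2" for x
  using f0[of x] by (simp add: H_def exp_double)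
 define F where "F = (\<epsilon> + B)\<^sup>2"
 have eHF: "exp (H x) <= F" for x
  unfolding eH F_def using B[of x] f0[of x] by (intro power_mono) auto
 have F0: "F > 0" using eHF[of 0] exp_gt_zero[of "H 0"] by linarith
 define h1 where "h1 = (%x. 2 * ln (\<epsilon> + u x) - 2 * ln \<epsilon>)"
 have H1: "H x = h1 x + 2 * ln \<epsilon>" for x by (simp add: H_def h1_def)
 have d: "((%s. 2 * ln (\<epsilon> + s) - 2 * ln \<epsilon>) has_real_derivative 2 / (\<epsilon> + u x)) (at (u x))" for x
  using f0[of x] by (auto intro!: derivative_eq_intros)
 have h1d: "h1 differentiable (at x)" and h1g: "grad h1 x = (2 / (\<epsilon> + u x)) *\<^sub>R grad u x" for x
  unfolding h1_def using grad_compose_real(2,3)[OF u(1) d] by auto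
 have h10: "norm x > R ==> h1 x = 0" for x using u(3) by (simp add: h1_def)
 have hm[measurable]: "h1 \<in> borel_measurable borel" "grad h1 \<in> borel_measurable borel" "H \<in> borel_measurable borel"
  using grad_measurable[OF h1d] borel_of_cont[OF diff_imp_cont[OF h1d]]
  unfolding H1[abs_def] by auto
 have h1L2: "integrable M (%x. (norm (grad h1 x))\<^sup>2)"
 proof (rule integrable_bd)
  show "integrable M (%x. (2 / \<epsilon>)\<^sup>2 * (norm (grad u x))\<^sup>2)" using L2 by simp
  show "AE x in M. norm ((norm (grad h1 x))\<^sup>2) <= norm ((2 / \<epsilon>)\<^sup>2 * (norm (grad u x))\<^sup>2)"
  proof (rule AE_I2)
   fix x
   have "2 / (\<epsilon> + u x) <= 2 / \<epsilon>" using u(2)[of x] \<epsilon> by (intro divide_left_mono) auto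
   then have "norm (grad h1 x) <= 2 / \<epsilon> * norm (grad u x)"
    using f0[of x] mult_right_mono[OF _ norm_ge_zero[of "grad u x"], of "2 / (\<epsilon> + u x)" "2 / \<epsilon>"] by (simp add: h1g)
   then have "(norm (grad h1 x))\<^sup>2 <= (2 / \<epsilon> * norm (grad u x))\<^sup>2" by (intro power_mono) auto
   then have "(norm (grad h1 x))\<^sup>2 <= (2 / \<epsilon>)\<^sup>2 * (norm (grad u x))\<^sup>2"
    by (simp only: power_mult_distrib)
   then show "norm ((norm (grad h1 x))\<^sup>2) <= norm ((2 / \<epsilon>)\<^sup>2 * (norm (grad u x))\<^sup>2)"
    by (simp only: real_norm_def abs_mult abs_power2 abs_norm_cancel)
  qed
 qed measurable
 define \<eta> where "\<eta> = (%k::nat. inverse (real (Suc k)))"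
 have \<eta>: "\<eta> k > 0" "\<eta> k <= 1" for k by (auto simp: \<eta>_def inverse_le_1_iff)
 have \<eta>0: "\<eta> \<longlonglongrightarrow> 0" unfolding \<eta>_def by (rule LIMSEQ_inverse_real_of_nat)
 define ok where "ok = (%k q. test2 (R + 1) q & (\<forall>x. \<bar>q x - h1 x\<bar> <= (\<eta> k)\<^sup>2) &
  integrable M (%x. (norm (grad q x - grad h1 x))\<^sup>2) & (LINT x|M. (norm (grad q x - grad h1 x))\<^sup>2) <= (\<eta> k)\<^sup>2)"
 have "\<forall>k. \<exists>q. ok k q"
 proof
  fix k
  have "(\<eta> k)\<^sup>2 > 0" using \<eta>[of k] by simp
  from approx_by_test2_density[OF m h1d h10 h1L2[unfolded M_def] this]
  show "\<exists>q. ok k q" by (simp only: ok_def M_def)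
 qed
 from choice[OF this] obtain q where "\<forall>k. ok k (q k)" ..
 then have q: "!!k. test2 (R + 1) (q k)" "!!k x. \<bar>q k x - h1 x\<bar> <= (\<eta> k)\<^sup>2"
  "!!k. integrable M (%x. (norm (grad (q k) x - grad h1 x))\<^sup>2)"
  "!!k. (LINT x|M. (norm (grad (q k) x - grad h1 x))\<^sup>2) <= (\<eta> k)\<^sup>2"
  by (auto simp: ok_def)
 define h where "h = (%k x. q k x + 2 * ln \<epsilon>)"
 have qd: "q k differentiable (at x)" and qg: "continuous_on UNIV (grad (q k))" for k x
  using q(1)[of k] by (auto simp: test2_def)
 have hd: "h k differentiable (at x)" for k x unfolding h_def by (intro differentiable_add qd) simp
 have hg: "grad (h k) x = grad (q k) x" for k x
  unfolding h_def by (rule grad_eqI) (auto intro!: derivative_eq_intros grad_has_derivative qd)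
 have qm[measurable]: "h k \<in> borel_measurable borel" "grad (q k) \<in> borel_measurable borel" for k
  using borel_of_cont[OF diff_imp_cont[OF hd]] grad_measurable[OF qd] by auto
 have hH: "\<bar>h k x - H x\<bar> <= (\<eta> k)\<^sup>2" for k x using q(2)[of k x] by (simp add: h_def H1)
 have \<eta>sq: "(\<eta> k)\<^sup>2 <= 1" for k using \<eta>[of k] by (intro power_le_one) auto
 have hlim: "(%k. h k x) \<longlonglongrightarrow> H x" for x
 proof -
  have "(%k. h k x - H x) \<longlonglongrightarrow> 0"
  proof (rule Lim_null_comparison)
   show "\<forall>\<^sub>F k in sequentially. norm (h k x - H x) <= (\<eta> k)\<^sup>2" using hH by auto
   show "(%k. (\<eta> k)\<^sup>2) \<longlonglongrightarrow> 0" using tendsto_power[OF \<eta>0, of 2] by simp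
  qed
  then show ?thesis by (simp add: LIM_zero_iff)
 qed
 define HB where "HB = \<bar>2 * ln \<epsilon>\<bar> + \<bar>2 * ln (\<epsilon> + B)\<bar>"
 have HB: "\<bar>H x\<bar> <= HB" for x
 proof -
  have "ln \<epsilon> <= ln (\<epsilon> + u x)" "ln (\<epsilon> + u x) <= ln (\<epsilon> + B)"
   using u(2)[of x] B[of x] \<epsilon> by (auto intro!: ln_mono)
  then show ?thesis unfolding H_def HB_def by linarith
 qed
 have hb: "\<bar>h k x\<bar> <= HB + 1" for k x using hH[of k x] HB[of x] \<eta>sq[of k] by linarith
 have eb: "exp (h k x) <= exp (HB + 1)" for k x using hb[of k x] by auto
 have L1: "(%k. LINT x|M. h k x * exp (h k x)) \<longlonglongrightarrow> (LINT x|M. H x * exp (H x))"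
 proof (rule integral_dominated_convergence[where w="%_. (HB + 1) * exp (HB + 1)"])
  show "AE x in M. (%k. h k x * exp (h k x)) \<longlonglongrightarrow> H x * exp (H x)"
   by (intro AE_I2 tendsto_intros hlim)
  show "AE x in M. norm (h k x * exp (h k x)) <= (HB + 1) * exp (HB + 1)" for k
   using hb eb order_trans[OF abs_ge_zero hb] by (auto simp: abs_mult intro!: mult_mono)
 qed simp_all
 have L2': "(%k. LINT x|M. exp (h k x)) \<longlonglongrightarrow> (LINT x|M. exp (H x))"
 proof (rule integral_dominated_convergence[where w="%_. exp (HB + 1)"])
  show "AE x in M. (%k. exp (h k x)) \<longlonglongrightarrow> exp (H x)"
   by (intro AE_I2 tendsto_intros hlim)
  show "AE x in M. norm (exp (h k x)) <= exp (HB + 1)" for k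
   using eb by auto
 qed simp_all
 have iH: "integrable M (%x. exp (H x))"
  by (rule integrable_const_bound[where B=F]) (use eHF in auto)
 have A0: "0 < (LINT x|M. exp (H x))"
 proof -
  have lb: "- HB <= H x" for x using HB[of x] by linarith
  have "(LINT x|M. exp (- HB)) <= (LINT x|M. exp (H x))"
   by (intro integral_mono iH) (simp_all add: lb)
  then have "exp (- HB) <= (LINT x|M. exp (H x))" by (simp add: prob_space)
  then show ?thesis by (rule less_le_trans[OF exp_gt_zero])
 qed
 define I where "I = (LINT x|M. (norm (grad u x))\<^sup>2)"
 have step: "(LINT x|M. h k x * exp (h k x)) - (LINT x|M. exp (h k x)) * ln (LINT x|M. exp (h k x))
   <= C * (exp ((\<eta> k)\<^sup>2) * ((1 + \<eta> k) * (4 * I) + F * ((\<eta> k)\<^sup>2 + \<eta> k)))" for k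
 proof -
  have "(LINT x|M. h k x * exp (h k x)) - (LINT x|M. exp (h k x)) * ln (LINT x|M. exp (h k x))
   <= C * (LINT x|M. (norm (grad (h k) x))\<^sup>2 * exp (h k x))"
  proof -
   have "\<forall>x. norm x > R + 1 --> h k x = 2 * ln \<epsilon>" using q(1)[of k] by (auto simp: test2_def h_def)
   moreover have "continuous_on UNIV (grad (h k))" using qg[of k] hg[of k] by (simp add: fun_eq_iff[symmetric] cong: continuous_on_cong)
   ultimately show ?thesis
    using LS[unfolded log_sobolev_def M_def[symmetric], rule_format, of "h k" "R + 1" "2 * ln \<epsilon>"] hd by blast
  qed
  also have "(LINT x|M. (norm (grad (h k) x))\<^sup>2 * exp (h k x))
   <= (LINT x|M. exp ((\<eta> k)\<^sup>2) * ((1 + \<eta> k) * (4 * (norm (grad u x))\<^sup>2) + (1 + 1 / \<eta> k) * (F * (norm (grad (q k) x - grad h1 x))\<^sup>2)))"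
  proof (rule integral_mono')
   show "integrable M (%x. exp ((\<eta> k)\<^sup>2) * ((1 + \<eta> k) * (4 * (norm (grad u x))\<^sup>2) + (1 + 1 / \<eta> k) * (F * (norm (grad (q k) x - grad h1 x))\<^sup>2)))"
    using L2 q(3)[of k] by simp
   fix x
   let ?r = "grad (q k) x - grad h1 x"
   have 1: "exp (h k x) <= exp ((\<eta> k)\<^sup>2) * exp (H x)"
    using hH[of k x] by (simp add: abs_le_iff flip: exp_add)
   have 2: "(norm (grad (q k) x))\<^sup>2 <= (1 + \<eta> k) * (norm (grad h1 x))\<^sup>2 + (1 + 1 / \<eta> k) * (norm ?r)\<^sup>2"
    using norm_add_sq_le[OF \<eta>(1)[of k], where a="grad h1 x" and b="?r"] by simp
   have 3: "exp (H x) * (norm (grad h1 x))\<^sup>2 = 4 * (norm (grad u x))\<^sup>2"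
    using f0[of x] by (simp add: eH h1g power_mult_distrib power_divide)
   have "(norm (grad (h k) x))\<^sup>2 * exp (h k x)
    <= ((1 + \<eta> k) * (norm (grad h1 x))\<^sup>2 + (1 + 1 / \<eta> k) * (norm ?r)\<^sup>2) * (exp ((\<eta> k)\<^sup>2) * exp (H x))"
    unfolding hg using 1 2 \<eta>[of k] by (intro mult_mono) (auto intro!: add_nonneg_nonneg)
   also have "... = exp ((\<eta> k)\<^sup>2) * ((1 + \<eta> k) * (exp (H x) * (norm (grad h1 x))\<^sup>2) + (1 + 1 / \<eta> k) * (exp (H x) * (norm ?r)\<^sup>2))"
    by (simp add: algebra_simps)
   also have "... <= exp ((\<eta> k)\<^sup>2) * ((1 + \<eta> k) * (4 * (norm (grad u x))\<^sup>2) + (1 + 1 / \<eta> k) * (F * (norm ?r)\<^sup>2))"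
    unfolding 3 using eHF[of x] \<eta>[of k] by (intro mult_left_mono add_mono mult_right_mono) auto
   finally show "(norm (grad (h k) x))\<^sup>2 * exp (h k x)
    <= exp ((\<eta> k)\<^sup>2) * ((1 + \<eta> k) * (4 * (norm (grad u x))\<^sup>2) + (1 + 1 / \<eta> k) * (F * (norm ?r)\<^sup>2))" .
  qed (use \<eta>(1)[of k] F0 in \<open>intro mult_nonneg_nonneg add_nonneg_nonneg; simp\<close>)
  also have "... = exp ((\<eta> k)\<^sup>2) * ((1 + \<eta> k) * (4 * I) + (1 + 1 / \<eta> k) * (F * (LINT x|M. (norm (grad (q k) x - grad h1 x))\<^sup>2)))"
   using L2 q(3)[of k] by (simp add: I_def)
  also have "... <= exp ((\<eta> k)\<^sup>2) * ((1 + \<eta> k) * (4 * I) + (1 + 1 / \<eta> k) * (F * (\<eta> k)\<^sup>2))"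
   using q(4)[of k] F0 \<eta>[of k] by (intro mult_left_mono add_left_mono) auto
  also have "(1 + 1 / \<eta> k) * (F * (\<eta> k)\<^sup>2) = F * ((\<eta> k)\<^sup>2 + \<eta> k)"
   using \<eta>[of k] by (simp add: power2_eq_square field_simps)
  finally show ?thesis using C by (simp add: mult_left_mono)
 qed
 have "(%k. (LINT x|M. h k x * exp (h k x)) - (LINT x|M. exp (h k x)) * ln (LINT x|M. exp (h k x)))
  \<longlonglongrightarrow> (LINT x|M. H x * exp (H x)) - (LINT x|M. exp (H x)) * ln (LINT x|M. exp (H x))"
  using A0 by (intro tendsto_intros L1 L2') auto
 moreover have "(%k. C * (exp ((\<eta> k)\<^sup>2) * ((1 + \<eta> k) * (4 * I) + F * ((\<eta> k)\<^sup>2 + \<eta> k))))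
  \<longlonglongrightarrow> C * (exp (0\<^sup>2) * ((1 + 0) * (4 * I) + F * (0\<^sup>2 + 0)))"
  by (intro tendsto_intros \<eta>0)
 ultimately have "(LINT x|M. H x * exp (H x)) - (LINT x|M. exp (H x)) * ln (LINT x|M. exp (H x))
   <= C * (exp (0\<^sup>2) * ((1 + 0) * (4 * I) + F * (0\<^sup>2 + 0)))"
  by (rule LIMSEQ_le) (use step in blast)
 then show ?thesis by (simp add: I_def mult_ac)
qed

lemma abs_xlnx_bound:
 fixes s g :: real
 assumes "0 < s" "s <= 1 + g" "g > 0"
 shows "\<bar>s\<^sup>2 * ln (s\<^sup>2)\<bar> <= 13 + 12 * g\<^sup>2 + 4 * \<bar>g\<^sup>2 * ln (g\<^sup>2)\<bar>"
proof (cases "s\<^sup>2 <= 1")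
 case True
 define y where "y = s\<^sup>2"
 have y: "0 < y" "y <= 1" using True assms by (auto simp: y_def)
 have "ln (1 / y) <= 1 / y - 1" using y by (intro ln_le_minus_one) auto
 then have "y * (- ln y) <= y * (1 / y - 1)"
  using y by (intro mult_left_mono) (auto simp: ln_div)
 also have "... <= 1" using y by (simp add: right_diff_distrib)
 finally have "\<bar>y * ln y\<bar> <= 1" using y by (simp add: abs_mult)
 moreover have "0 <= g\<^sup>2" "0 <= \<bar>g\<^sup>2 * ln (g\<^sup>2)\<bar>" by auto
 ultimately show ?thesis unfolding y_def by linarith
next
 case False
 define G where "G = (1 + g)\<^sup>2"
 have sG: "1 < s\<^sup>2" "s\<^sup>2 <= G" using False assms by (auto simp: G_def intro!: power_mono)
 have "\<bar>s\<^sup>2 * ln (s\<^sup>2)\<bar> = s\<^sup>2 * ln (s\<^sup>2)" using sG by simp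
 also have "... <= G * ln G" using sG by (intro mult_mono ln_mono) auto
 also have "... <= 12 + 12 * g\<^sup>2 + 4 * \<bar>g\<^sup>2 * ln (g\<^sup>2)\<bar>"
 proof (cases "g <= 1")
  case True
  have "G <= 2\<^sup>2" unfolding G_def using True assms by (intro power_mono) auto
  then have "G * ln G <= 4 * 3"
   using sG ln_le_minus_one[of G] by (intro mult_mono) auto
  then show ?thesis using zero_le_power2[of g] abs_ge_zero[of "g\<^sup>2 * ln (g\<^sup>2)"] by linarith
 next
  case False
  have "G <= (2 * g)\<^sup>2" unfolding G_def using False by (intro power_mono) auto
  then have G4: "G <= 4 * g\<^sup>2" by (simp add: power_mult_distrib)
  have g1: "g\<^sup>2 > 1" using False by simp
  have "ln G <= ln (4 * g\<^sup>2)" using G4 sG by (intro ln_mono) auto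
  also have "... = ln 4 + ln (g\<^sup>2)" using g1 by (intro ln_mult_pos) auto
  also have "... <= 3 + ln (g\<^sup>2)" using ln_le_minus_one[of "4::real"] by simp
  finally have "G * ln G <= 4 * g\<^sup>2 * (3 + ln (g\<^sup>2))" using G4 sG g1 by (intro mult_mono) auto
  also have "... = 12 * g\<^sup>2 + 4 * (g\<^sup>2 * ln (g\<^sup>2))" by (simp add: algebra_simps)
  also have "... <= 12 + 12 * g\<^sup>2 + 4 * \<bar>g\<^sup>2 * ln (g\<^sup>2)\<bar>"
   using abs_ge_self[of "g\<^sup>2 * ln (g\<^sup>2)"] by linarith
  finally show ?thesis .
 qed
 finally show ?thesis by simp
qed

text \<open>Cutting off the square root of the relative density keeps its Dirichlet integral under
 control; cutting off the logarithm would not.\<close>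

lemma log_sobolev_density:
 fixes m \<rho> :: "real^'n => real"
 defines "f \<equiv> %x. ln (\<rho> x / m x)"
 assumes LS: "log_sobolev m C" and C: "C >= 0"
  and m: "continuous_on UNIV m" "!!x. m x > 0" "integrable lborel m" "(LINT x|lborel. m x) = 1"
  and \<rho>: "continuous_on UNIV \<rho>" "!!x. \<rho> x > 0" "integrable lborel \<rho>" "(LINT x|lborel. \<rho> x) = 1"
  and f: "!!x. f differentiable (at x)" and KL: "integrable lborel (%x. \<rho> x * f x)"
  and I: "integrable lborel (%x. \<rho> x * (norm (grad f x))\<^sup>2)"
 shows "(LINT x|lborel. \<rho> x * f x) <= C * (LINT x|lborel. \<rho> x * (norm (grad f x))\<^sup>2)"
proof -
 define M where "M = density lborel (%x. ennreal (m x))"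
 have sets[measurable_cong]: "sets M = sets borel" by (simp add: M_def)
 have mm[measurable]: "m \<in> borel_measurable borel" "\<rho> \<in> borel_measurable borel"
  using borel_of_cont[OF m(1)] borel_of_cont[OF \<rho>(1)] by auto
 have P: "prob_space M"
 proof
  show "emeasure M (space M) = 1"
   using nn_integral_eq_integral[OF m(3)] m(2,4) by (simp add: M_def emeasure_density less_imp_le)
 qed
 interpret prob_space M by (rule P)
 have inti: "integrable M k \<longleftrightarrow> integrable lborel (%x. m x * k x)"
  and intg: "(LINT x|M. k x) = (LINT x|lborel. m x * k x)" if "k \<in> borel_measurable borel" for k :: "real^'n => real"
  unfolding M_def using that m(2) by (auto simp: integrable_real_density integral_real_density less_imp_le)
 define g where "g = (%x. exp (f x / 2))"
 have "((%s. exp (s / 2)) has_real_derivative exp (f x / 2) / 2) (at (f x))" for x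
  by (auto intro!: derivative_eq_intros)
 note gc = grad_compose_real[OF f this]
 have gd: "g differentiable (at x)" and gg: "grad g x = (g x / 2) *\<^sub>R grad f x" for x
  using gc(2,3) by (auto simp: g_def)
 have g0: "g x > 0" for x by (simp add: g_def)
 have g2: "(g x)\<^sup>2 = \<rho> x / m x" "ln ((g x)\<^sup>2) = f x" for x
 proof -
  have "(g x)\<^sup>2 = exp (f x)" by (simp add: g_def exp_double[symmetric])
  moreover have "exp (f x) = \<rho> x / m x" using m(2) \<rho>(2) by (simp add: f_def)
  ultimately show "(g x)\<^sup>2 = \<rho> x / m x" "ln ((g x)\<^sup>2) = f x" by (simp_all add: f_def)
 qed
 have [measurable]: "f \<in> borel_measurable borel" "grad f \<in> borel_measurable borel" "g \<in> borel_measurable borel" "grad g \<in> borel_measurable borel"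
  using grad_measurable[OF f] grad_measurable[OF gd] borel_of_cont[OF diff_imp_cont[OF f]]
   borel_of_cont[OF diff_imp_cont[OF gd]] by auto
 have mne: "m x ~= 0" for x using m(2)[of x] by simp
 have ig2: "integrable M (%x. (g x)\<^sup>2)" and eg2: "(LINT x|M. (g x)\<^sup>2) = 1"
  using \<rho>(3,4) by (simp_all add: inti intg g2 mne)
 have igl: "integrable M (%x. (g x)\<^sup>2 * ln ((g x)\<^sup>2))"
  and egl: "(LINT x|M. (g x)\<^sup>2 * ln ((g x)\<^sup>2)) = (LINT x|lborel. \<rho> x * f x)"
 proof -
  have gl: "m x * ((g x)\<^sup>2 * ln ((g x)\<^sup>2)) = \<rho> x * f x" for x
   unfolding g2(2) by (simp add: g2(1) mne)
  have gm: "(%x. (g x)\<^sup>2 * ln ((g x)\<^sup>2)) \<in> borel_measurable borel" by measurable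
  show "integrable M (%x. (g x)\<^sup>2 * ln ((g x)\<^sup>2))"
   using KL by (simp only: inti[OF gm] gl)
  show "(LINT x|M. (g x)\<^sup>2 * ln ((g x)\<^sup>2)) = (LINT x|lborel. \<rho> x * f x)"
   by (simp only: intg[OF gm] gl)
 qed
 have ngg: "m x * (norm (grad g x))\<^sup>2 = 1/4 * (\<rho> x * (norm (grad f x))\<^sup>2)" for x
  using g2(1)[of x] mne[of x] g0[of x] by (simp add: gg power_mult_distrib power_divide)
 have igg: "integrable M (%x. (norm (grad g x))\<^sup>2)"
  and egg: "(LINT x|M. (norm (grad g x))\<^sup>2) = 1/4 * (LINT x|lborel. \<rho> x * (norm (grad f x))\<^sup>2)"
  using I by (subst inti intg; simp add: ngg)+
 define \<eta> where "\<eta> = (%k::nat. inverse (real (Suc k)))"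
 have \<eta>: "\<eta> k > 0" "\<eta> k <= 1" for k by (auto simp: \<eta>_def inverse_le_1_iff)
 have \<eta>0: "\<eta> \<longlonglongrightarrow> 0" unfolding \<eta>_def by (rule LIMSEQ_inverse_real_of_nat)
 define u where "u = (%k. trunc (Suc k) g)"
 have u: "u k differentiable (at x)" "u k x >= 0" "norm x > (real (Suc k))\<^sup>2 ==> u k x = 0" "u k x <= g x" for k x
  using trunc_props[OF gd, of "Suc k" x] g0[of x] by (auto simp: u_def)
 have ul: "(%k. u k x) \<longlonglongrightarrow> g x" "(%k. grad (u k) x) \<longlonglongrightarrow> grad g x" for x
  unfolding u_def by (intro LIMSEQ_Suc trunc_tendsto gd)+
 have uL2: "integrable M (%x. (norm (grad (u k) x))\<^sup>2)" "(norm (grad (u k) x))\<^sup>2 <= 2 * (norm (grad g x))\<^sup>2 + 288" for k x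
  unfolding u_def using trunc_L2[OF gd finite_measure_axioms sets igg] by auto
 have [measurable]: "u k \<in> borel_measurable borel" "grad (u k) \<in> borel_measurable borel" for k
  using grad_measurable[OF u(1)] borel_of_cont[OF diff_imp_cont[OF u(1)]] by auto
 define s where "s = (%k x. \<eta> k + u k x)"
 have s: "0 < s k x" "s k x <= 1 + g x" for k x
  using u(2,4)[of k x] \<eta>[of k] unfolding s_def by linarith+
 have sm[measurable]: "s k \<in> borel_measurable borel" for k unfolding s_def by measurable
 have sl: "(%k. s k x) \<longlonglongrightarrow> g x" for x
  using tendsto_add[OF \<eta>0 ul(1)] by (simp add: s_def)
 have es: "exp (2 * ln (s k x)) = (s k x)\<^sup>2" "2 * ln (s k x) = ln ((s k x)\<^sup>2)" for k x
  using s(1)[of k x] by (simp_all add: exp_double ln_realpow)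
 have step: "(LINT x|M. (s k x)\<^sup>2 * ln ((s k x)\<^sup>2)) - (LINT x|M. (s k x)\<^sup>2) * ln (LINT x|M. (s k x)\<^sup>2)
   <= 4 * C * (LINT x|M. (norm (grad (u k) x))\<^sup>2)" for k
 proof -
  have sd: "\<eta> k + u k x = s k x" for x by (simp only: s_def)
  have e: "2 * ln (s k x) * (s k x)\<^sup>2 = (s k x)\<^sup>2 * ln ((s k x)\<^sup>2)" for x
   by (subst es(2)) (rule mult.commute)
  have u3: "u k x = 0" if "norm x > (real (Suc k))\<^sup>2" for x
   using u(3)[OF that] .
  show ?thesis
   using log_sobolev_square[where u="u k" and R="(real (Suc k))\<^sup>2" and \<epsilon>="\<eta> k",
    OF LS C P[unfolded M_def] m(1,2) u(1) u(2) u3 uL2(1)[unfolded M_def] \<eta>(1)]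
   unfolding M_def[symmetric] sd es(1) e .
 qed
 have L1: "(%k. LINT x|M. (s k x)\<^sup>2 * ln ((s k x)\<^sup>2)) \<longlonglongrightarrow> (LINT x|M. (g x)\<^sup>2 * ln ((g x)\<^sup>2))"
 proof (rule integral_dominated_convergence[where w="%x. 13 + 12 * (g x)\<^sup>2 + 4 * \<bar>(g x)\<^sup>2 * ln ((g x)\<^sup>2)\<bar>"])
  show "integrable M (%x. 13 + 12 * (g x)\<^sup>2 + 4 * \<bar>(g x)\<^sup>2 * ln ((g x)\<^sup>2)\<bar>)"
   using ig2 igl by (intro Bochner_Integration.integrable_add integrable_mult_right integrable_abs) auto
  show "AE x in M. (%k. (s k x)\<^sup>2 * ln ((s k x)\<^sup>2)) \<longlonglongrightarrow> (g x)\<^sup>2 * ln ((g x)\<^sup>2)"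
   using g0 by (intro AE_I2 tendsto_intros sl) (simp add: less_imp_neq[symmetric])
  show "AE x in M. norm ((s k x)\<^sup>2 * ln ((s k x)\<^sup>2)) <= 13 + 12 * (g x)\<^sup>2 + 4 * \<bar>(g x)\<^sup>2 * ln ((g x)\<^sup>2)\<bar>" for k
   using abs_xlnx_bound[OF s g0] by (intro AE_I2) (simp only: real_norm_def)
 qed measurable
 have L2: "(%k. LINT x|M. (s k x)\<^sup>2) \<longlonglongrightarrow> (LINT x|M. (g x)\<^sup>2)"
 proof (rule integral_dominated_convergence[where w="%x. 2 + 2 * (g x)\<^sup>2"])
  show "AE x in M. (%k. (s k x)\<^sup>2) \<longlonglongrightarrow> (g x)\<^sup>2" by (intro AE_I2 tendsto_intros sl)
  show "AE x in M. norm ((s k x)\<^sup>2) <= 2 + 2 * (g x)\<^sup>2" for k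
  proof (rule AE_I2)
   fix x
   have "(s k x)\<^sup>2 <= (1 + g x)\<^sup>2" using s[of k x] by (intro power_mono) auto
   also have "... <= 2 + 2 * (g x)\<^sup>2" using sum_squares_bound[of 1 "g x"] by (simp add: power2_eq_square algebra_simps)
   finally show "norm ((s k x)\<^sup>2) <= 2 + 2 * (g x)\<^sup>2" by simp
  qed
 qed (use ig2 in simp_all)
 have L3: "(%k. LINT x|M. (norm (grad (u k) x))\<^sup>2) \<longlonglongrightarrow> (LINT x|M. (norm (grad g x))\<^sup>2)"
 proof (rule integral_dominated_convergence[where w="%x. 2 * (norm (grad g x))\<^sup>2 + 288"])
  show "AE x in M. (%k. (norm (grad (u k) x))\<^sup>2) \<longlonglongrightarrow> (norm (grad g x))\<^sup>2"
   by (intro AE_I2 tendsto_intros ul)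
 qed (use igg uL2(2) in simp_all)
 have "(%k. (LINT x|M. (s k x)\<^sup>2 * ln ((s k x)\<^sup>2)) - (LINT x|M. (s k x)\<^sup>2) * ln (LINT x|M. (s k x)\<^sup>2))
   \<longlonglongrightarrow> (LINT x|M. (g x)\<^sup>2 * ln ((g x)\<^sup>2)) - (LINT x|M. (g x)\<^sup>2) * ln (LINT x|M. (g x)\<^sup>2)"
  by (intro tendsto_intros L1 L2) (simp add: eg2)
 moreover have "(%k. 4 * C * (LINT x|M. (norm (grad (u k) x))\<^sup>2)) \<longlonglongrightarrow> 4 * C * (LINT x|M. (norm (grad g x))\<^sup>2)"
  by (intro tendsto_intros L3)
 ultimately have "(LINT x|M. (g x)\<^sup>2 * ln ((g x)\<^sup>2)) - (LINT x|M. (g x)\<^sup>2) * ln (LINT x|M. (g x)\<^sup>2)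
   <= 4 * C * (LINT x|M. (norm (grad g x))\<^sup>2)"
  by (rule LIMSEQ_le) (use step in blast)
 then show ?thesis by (simp add: eg2 egl egg)
qed

section \<open>Change of variables\<close>

text \<open>The change of variables theorem is about an index type that is well-ordered.  The copy
 \<open>'n idx\<close> of an arbitrary finite index type carries such an order.\<close>

typedef (overloaded) ('n::finite) idx = "{..<CARD('n)}"
 by (rule exI[of _ 0]) simp

instantiation idx :: (finite) wellorder
begin

definition less_eq_idx :: "'a idx => 'a idx => bool" where "x <= y \<longleftrightarrow> Rep_idx x <= Rep_idx y"
definition less_idx :: "'a idx => 'a idx => bool" where "x < y \<longleftrightarrow> Rep_idx x < Rep_idx y"

instance
proof
 fix x y z :: "'a idx" and P :: "'a idx => bool" and a
 show "x < y \<longleftrightarrow> x <= y & \<not> y <= x" by (auto simp: less_eq_idx_def less_idx_def)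
 show "x <= x" by (simp add: less_eq_idx_def)
 show "x <= y ==> y <= z ==> x <= z" by (simp add: less_eq_idx_def)
 show "x <= y ==> y <= x ==> x = y" by (simp add: less_eq_idx_def Rep_idx_inject)
 show "x <= y \<or> y <= x" by (auto simp: less_eq_idx_def)
 show "P a" if step: "!!x. (!!y. y < x ==> P y) ==> P x"
 proof (induction a rule: measure_induct_rule[where f=Rep_idx])
  case (less x)
  show "P x"
  proof (rule step)
   fix y assume "y < x"
   then show "P y" by (intro less) (simp add: less_idx_def)
  qed
 qed
qed

end

instance idx :: (finite) finite
proof
 have "finite (Abs_idx ` {..<CARD('a)} :: 'a idx set)" by simp
 moreover have "(UNIV :: 'a idx set) = Abs_idx ` {..<CARD('a)}"
  using Abs_idx_cases by auto
 ultimately show "finite (UNIV :: 'a idx set)" by simp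
qed

lemma idx_bij: "\<exists>\<sigma> :: 'n::finite idx => 'n. bij \<sigma>"
proof -
 have "CARD('n idx) = CARD('n)"
  using type_definition.card[OF type_definition_idx[where 'n='n]] by simp
 then show ?thesis
  using finite_same_card_bij[of "UNIV :: 'n idx set" "UNIV :: 'n set"] by auto
qed

definition reindex :: "('i => 'j) => real^'j => real^'i"
 where "reindex \<sigma> x = (\<chi> i. x $ \<sigma> i)"

lemma linear_reindex: "linear (reindex \<sigma>)"
 by (rule linearI) (auto simp: reindex_def vec_eq_iff)

lemma reindex_inv: "bij \<sigma> ==> reindex (inv \<sigma>) (reindex \<sigma> x) = x" "bij \<sigma> ==> reindex \<sigma> (reindex (inv \<sigma>) y) = y"
 by (auto simp: reindex_def vec_eq_iff bij_is_surj surj_f_inv_f bij_is_inj inv_f_f)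

lemma prod_Basis_vec: "(\<Prod>b\<in>Basis. (x::real^'n) \<bullet> b) = (\<Prod>i\<in>UNIV. x $ i)"
proof -
 have B: "(Basis :: (real^'n) set) = range (%i. axis i 1)" by (auto simp: Basis_vec_def)
 have "inj (%i::'n. axis i (1::real))" by (auto simp: inj_def axis_eq_axis)
 then show ?thesis
  unfolding B by (subst prod.reindex) (auto simp: inner_axis)
qed

lemma distr_reindex:
 fixes \<sigma> :: "'i::finite => 'j::finite"
 assumes \<sigma>: "bij \<sigma>"
 shows "distr lborel borel (reindex \<sigma>) = lborel"
proof (rule lborel_eqI[symmetric])
 fix l u :: "real^'i"
 assume lu: "!!b. b \<in> Basis ==> l \<bullet> b <= u \<bullet> b"
 have m: "reindex \<sigma> \<in> borel_measurable borel"
  by (intro borel_of_cont linear_continuous_on linear_conv_bounded_linear[THEN iffD1] linear_reindex)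
 have lu': "l $ i <= u $ i" for i
  using lu[of "axis i 1"] by (simp add: inner_axis)
 have "reindex \<sigma> -` box l u = box (reindex (inv \<sigma>) l) (reindex (inv \<sigma>) u)"
 proof (rule set_eqI)
  fix x
  have "x \<in> reindex \<sigma> -` box l u \<longleftrightarrow> (\<forall>i. l $ i < x $ \<sigma> i & x $ \<sigma> i < u $ i)"
   by (simp add: mem_box_cart reindex_def)
  also have "... \<longleftrightarrow> (\<forall>j. l $ inv \<sigma> j < x $ j & x $ j < u $ inv \<sigma> j)"
  proof -
   have "\<sigma> (inv \<sigma> j) = j" "inv \<sigma> (\<sigma> i) = i" for i j
    using \<sigma> by (simp_all add: bij_is_surj surj_f_inv_f bij_is_inj inv_f_f)
   then show ?thesis by metis
  qed
  also have "... \<longleftrightarrow> x \<in> box (reindex (inv \<sigma>) l) (reindex (inv \<sigma>) u)"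
   by (simp add: mem_box_cart reindex_def)
  finally show "x \<in> reindex \<sigma> -` box l u \<longleftrightarrow> x \<in> box (reindex (inv \<sigma>) l) (reindex (inv \<sigma>) u)" .
 qed
 then have "emeasure (distr lborel borel (reindex \<sigma>)) (box l u)
   = emeasure lborel (box (reindex (inv \<sigma>) l) (reindex (inv \<sigma>) u))"
  using m by (simp add: emeasure_distr)
 also have "... = (\<Prod>b\<in>Basis. (reindex (inv \<sigma>) u - reindex (inv \<sigma>) l) \<bullet> b)"
  using lu' by (intro emeasure_lborel_box) (auto simp: Basis_vec_def inner_axis reindex_def)
 also have "... = (\<Prod>j\<in>UNIV. (u - l) $ inv \<sigma> j)"
  by (simp add: prod_Basis_vec reindex_def)
 also have "... = (\<Prod>i\<in>UNIV. (u - l) $ i)"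
  using prod.reindex_bij_betw[OF bij_imp_bij_inv[OF \<sigma>], of "%i. (u - l) $ i"] by simp
 also have "... = (\<Prod>b\<in>Basis. (u - l) \<bullet> b)" by (simp add: prod_Basis_vec)
 finally show "emeasure (distr lborel borel (reindex \<sigma>)) (box l u) = ennreal (\<Prod>b\<in>Basis. (u - l) \<bullet> b)" .
qed simp

lemma integrable_reindex:
 fixes f :: "real^'i => real" and \<sigma> :: "'i::finite => 'j::finite"
 assumes \<sigma>: "bij \<sigma>" and [measurable]: "f \<in> borel_measurable borel"
 shows "integrable lborel (%x. f (reindex \<sigma> x)) \<longleftrightarrow> integrable lborel f"
  and "(LINT x|lborel. f (reindex \<sigma> x)) = (LINT y|lborel. f y)"
proof -
 have m: "reindex \<sigma> \<in> measurable lborel borel"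
  using borel_of_cont[OF linear_continuous_on[OF linear_conv_bounded_linear[THEN iffD1, OF linear_reindex]], of \<sigma>] by simp
 show "integrable lborel (%x. f (reindex \<sigma> x)) \<longleftrightarrow> integrable lborel f"
  using integrable_distr_eq[OF m, of f] by (simp add: distr_reindex[OF \<sigma>])
 show "(LINT x|lborel. f (reindex \<sigma> x)) = (LINT y|lborel. f y)"
  using integral_distr[OF m, of f] by (simp add: distr_reindex[OF \<sigma>])
qed

definition idx_map :: "'n::finite idx => 'n"
 where "idx_map = (SOME \<sigma>. bij \<sigma>)"

lemma bij_idx_map: "bij idx_map"
 unfolding idx_map_def using idx_bij by (rule someI_ex)

text \<open>The absolute value of the determinant of a linear map of \<open>real^'n\<close>, for any finite \<open>'n\<close>.\<close>

definition jac :: "(real^'n => real^'n) => real"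
 where "jac A = \<bar>det (matrix (%h::real^'n idx. reindex idx_map (A (reindex (inv idx_map) h))))\<bar>"

text \<open>If \<open>a\<close> exceeded \<open>b\<close> at a point it would do so on a ball, where the integrals would differ.\<close>

lemma continuous_le_of_integral_cball:
 fixes a b :: "'a::euclidean_space => real"
 assumes ca: "continuous_on UNIV a" and cb: "continuous_on UNIV b"
  and eq: "!!y r. integral (cball y r) a = integral (cball y r) b"
 shows "a y <= b y"
proof (rule ccontr)
 assume "\<not> a y <= b y"
 define e where "e = (a y - b y) / 2"
 have e: "e > 0" using \<open>\<not> a y <= b y\<close> by (simp add: e_def)
 have "continuous_on UNIV (%x. a x - b x)" by (intro continuous_intros ca cb)
 then have "isCont (%x. a x - b x) y" by (simp add: continuous_on_eq_continuous_at)
 then obtain d where d: "d > 0" "!!x. dist x y < d ==> dist (a x - b x) (a y - b y) < e"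
  unfolding continuous_at_eps_delta using e by blast
 define S where "S = cball y (d / 2)"
 have gt: "e <= a x - b x" if "x \<in> S" for x
 proof -
  have "dist x y < d" using that d(1) by (simp add: S_def dist_commute)
  from d(2)[OF this] have "\<bar>(a x - b x) - (a y - b y)\<bar> < e" by (simp only: dist_real_def)
  moreover have "a y - b y = 2 * e" by (simp add: e_def)
  ultimately show ?thesis by linarith
 qed
 have S: "S \<in> lmeasurable" by (simp add: S_def)
 have int: "f integrable_on S" if "continuous_on UNIV f" for f :: "'a => real"
 proof -
  have "integrable lborel (%x. indicator S x *\<^sub>R f x)"
   unfolding S_def by (rule borel_integrable_compact[OF compact_cball continuous_on_subset[OF that subset_UNIV]])
  then have "set_integrable lborel S f" by (simp add: set_integrable_def)
  then show ?thesis using set_borel_integral_eq_integral(1) by blast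
 qed
 have "measure lebesgue S * e = integral S (%_. e)"
  using S by (simp add: lmeasure_integral flip: integral_mult_left)
 also have "... <= integral S (%x. a x - b x)"
  using gt by (intro integral_le int continuous_intros ca cb) auto
 also have "... = integral S a - integral S b"
  by (intro Henstock_Kurzweil_Integration.integral_diff int ca cb)
 also have "... = 0" using eq by (simp add: S_def)
 finally have "measure lebesgue S <= 0" using e by (simp add: mult_le_0_iff)
 moreover have "measure lebesgue S > 0"
  using content_cball_pos[of "d / 2" y] d(1) by (simp add: S_def)
 ultimately show False by simp
qed

text \<open>The density is compared with the one of the change of variables formula on all balls; continuity turns equality of the integrals into equality at every point.\<close>

lemma pushforward_density_jacobian:
 fixes S :: "real^'n => real^'n" and p0 r :: "real^'n => real"
 assumes p: "prob_space p" "p = density lborel (%x. ennreal (p0 x))" and p0: "continuous_on UNIV p0" "!!x. p0 x > 0"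
  and S: "bij S" "!!x. (S has_derivative S' x) (at x)"
  and J: "continuous_on UNIV (%x. jac (S' x))"
  and dist: "distributed p lborel S (%y. ennreal (r y))" and r: "continuous_on UNIV r"
 shows "r (S x) * jac (S' x) = p0 x" and "r (S x) > 0"
proof -
 let ?\<sigma> = "idx_map :: 'n idx => 'n"
 let ?\<Phi> = "reindex ?\<sigma> :: real^'n => real^'n idx" and ?\<Psi> = "reindex (inv ?\<sigma>) :: real^'n idx => real^'n"
 define r1 where "r1 = (%y. max 0 (r y))"
 have r1c: "continuous_on UNIV r1" unfolding r1_def by (intro continuous_intros r)
 have r10: "r1 y >= 0" for y by (simp add: r1_def)
 have er: "ennreal (r y) = ennreal (r1 y)" for y by (simp add: r1_def max_def ennreal_neg)
 have \<sigma>: "bij ?\<sigma>" by (rule bij_idx_map)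
 note \<sigma>' = bij_imp_bij_inv[OF \<sigma>]
 have bl: "bounded_linear ?\<Phi>" "bounded_linear ?\<Psi>"
  using linear_reindex linear_conv_bounded_linear by blast+
 have \<Phi>\<Psi>: "?\<Phi> (?\<Psi> y) = y" "?\<Psi> (?\<Phi> x) = x" for x y by (rule reindex_inv(2)[OF \<sigma>] reindex_inv(1)[OF \<sigma>])+
 have \<Psi>c: "continuous_on A ?\<Psi>" and \<Phi>c: "continuous_on B ?\<Phi>" for A B
  using bl by (auto intro: linear_continuous_on)
 have Sc: "continuous_on UNIV S"
  using S(2) by (meson continuous_at_imp_continuous_on has_derivative_continuous)
 define g where "g = (%y. ?\<Phi> (S (?\<Psi> y)))"
 define g' where "g' = (%y h. ?\<Phi> (S' (?\<Psi> y) (?\<Psi> h)))"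
 have gd: "(g has_derivative g' y) (at y within A)" for y A
  unfolding g_def g'_def
  by (rule has_derivative_at_withinI,
    rule bounded_linear.has_derivative[OF bl(1)],
    rule has_derivative_compose[OF bounded_linear_imp_has_derivative[OF bl(2)] S(2)])
 have ginj: "inj_on g A" for A
  by (rule inj_onI) (metis S(1) \<Phi>\<Psi> bij_is_inj g_def inj_eq)
 have gc: "continuous_on A g" for A
  using gd by (meson has_derivative_continuous continuous_on_eq_continuous_within)
 define a where "a = (%y. jac (S' (?\<Psi> y)) * r1 (S (?\<Psi> y)))"
 define b where "b = (%y. p0 (?\<Psi> y))"
 have ca: "continuous_on UNIV a"
  unfolding a_def
  by (intro continuous_intros continuous_on_compose2[OF J \<Psi>c] continuous_on_compose2[OF r1c]
    continuous_on_compose2[OF Sc \<Psi>c]) auto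
 have cb: "continuous_on UNIV b"
  unfolding b_def by (intro continuous_on_compose2[OF p0(1) \<Psi>c]) auto
 have meas[measurable]: "p0 \<in> borel_measurable borel" "r1 \<in> borel_measurable borel" "?\<Psi> \<in> borel_measurable borel"
  by (rule borel_of_cont[OF p0(1)] borel_of_cont[OF r1c]
    borel_of_cont[OF \<Psi>c])+
 have hk: "(%y. k (?\<Psi> y)) absolutely_integrable_on L &
   integral L (%y. k (?\<Psi> y)) = (LINT x|lborel. k x * indicator (?\<Psi> ` L) x)"
  if L: "compact L" and k: "continuous_on UNIV k" for L and k :: "real^'n => real"
 proof -
  have kc: "continuous_on L (%y. k (?\<Psi> y))" by (intro continuous_on_compose2[OF k \<Psi>c]) auto
  have i: "integrable lborel (%y. indicator L y *\<^sub>R k (?\<Psi> y))"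
   by (rule borel_integrable_compact[OF L kc])
  then have s: "set_integrable lborel L (%y. k (?\<Psi> y))" by (simp add: set_integrable_def)
  have abs: "(%y. k (?\<Psi> y)) absolutely_integrable_on L"
   using s unfolding set_integrable_def by (simp add: integrable_completion)
  have cpt: "compact (?\<Psi> ` L)" by (intro compact_continuous_image \<Psi>c L)
  have ind: "indicator (?\<Psi> ` L) (?\<Psi> y) = (indicator L y :: real)" for y
   by (auto split: split_indicator) (metis \<Phi>\<Psi>(1))
  have km: "(%x. k x * indicator (?\<Psi> ` L) x) \<in> borel_measurable borel"
   using borel_of_cont[OF k] borel_compact[OF cpt] by measurable
  have "integral L (%y. k (?\<Psi> y)) = (LINT y|lborel. indicator L y *\<^sub>R k (?\<Psi> y))"
   using set_borel_integral_eq_integral(2)[OF s] by (simp add: set_lebesgue_integral_def)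
  also have "... = (LINT y|lborel. k (?\<Psi> y) * indicator (?\<Psi> ` L) (?\<Psi> y))"
   by (simp add: ind mult.commute)
  also have "... = (LINT x|lborel. k x * indicator (?\<Psi> ` L) x)"
   by (rule integrable_reindex(2)[OF \<sigma>' km])
  finally show ?thesis using abs by blast
 qed
 have eq: "integral (cball y0 e) a = integral (cball y0 e) b" for y0 e
 proof -
  let ?K = "cball y0 e"
  let ?B = "?\<Psi> ` ?K"
  have Kc: "compact ?K" "compact (g ` ?K)" by (auto intro!: compact_continuous_image gc)
  have gK: "?\<Psi> ` g ` ?K = S ` ?B" by (simp only: image_image g_def \<Phi>\<Psi>)
  have cB: "compact ?B" by (intro compact_continuous_image \<Psi>c compact_cball)
  have cSB: "compact (S ` ?B)" by (intro compact_continuous_image continuous_on_subset[OF Sc] cB) auto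
  have mB: "?B \<in> sets borel" "S ` ?B \<in> sets borel" using borel_compact cB cSB by auto
  let ?v = "%y. (vec (r1 (?\<Psi> y)) :: real^1)"
  have h1: "?v absolutely_integrable_on g ` ?K" "integral (g ` ?K) ?v = vec (LINT x|lborel. r1 x * indicator (S ` ?B) x)"
   using hk[OF Kc(2) r1c] unfolding gK
   by (auto simp: absolutely_integrable_on_1_iff integral_on_1_eq o_def vec_eq_iff)
  have "(%x. \<bar>det (matrix (g' x))\<bar> *\<^sub>R ?v (g x)) absolutely_integrable_on ?K &
   integral ?K (%x. \<bar>det (matrix (g' x))\<bar> *\<^sub>R ?v (g x)) = vec (LINT x|lborel. r1 x * indicator (S ` ?B) x)"
   using has_absolute_integral_change_of_variables[of ?K g g' ?v, OF _ gd ginj] h1 by auto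
  then have "integral ?K (%x. (\<bar>det (matrix (g' x))\<bar> *\<^sub>R ?v (g x)) $ 1) = (LINT x|lborel. r1 x * indicator (S ` ?B) x)"
   by (simp add: integral_on_1_eq vec_eq_iff)
  moreover have "(\<bar>det (matrix (g' x))\<bar> *\<^sub>R ?v (g x)) $ 1 = a x" for x
   by (simp add: a_def jac_def g'_def g_def \<Phi>\<Psi>)
  ultimately have 1: "integral ?K a = (LINT x|lborel. r1 x * indicator (S ` ?B) x)" by simp
  have 2: "integral ?K b = (LINT x|lborel. p0 x * indicator ?B x)"
   unfolding b_def using hk[OF Kc(1) p0(1)] by blast
  have "(LINT x|lborel. r1 x * indicator (S ` ?B) x) = enn2real (\<integral>\<^sup>+x. ennreal (r x) * indicator (S ` ?B) x \<partial>lborel)"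
   using mB by (subst integral_eq_nn_integral) (auto simp: r10 er ennreal_mult' ennreal_indicator)
  also have "(\<integral>\<^sup>+x. ennreal (r x) * indicator (S ` ?B) x \<partial>lborel) = emeasure p (S -` (S ` ?B) \<inter> space p)"
   using mB by (intro distributed_emeasure[OF dist, symmetric]) auto
  also have "S -` (S ` ?B) \<inter> space p = ?B"
   using inj_vimage_image_eq[OF bij_is_inj[OF S(1)], of ?B] by (simp add: p(2))
  also have "emeasure p ?B = (\<integral>\<^sup>+x. ennreal (p0 x) * indicator ?B x \<partial>lborel)"
   unfolding p(2) using mB by (intro emeasure_density) auto
  also have "enn2real ... = (LINT x|lborel. p0 x * indicator ?B x)"
   using mB p0(2) by (subst integral_eq_nn_integral) (auto simp: less_imp_le ennreal_mult' ennreal_indicator)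
  finally show ?thesis using 1 2 by simp
 qed
 have "a y = b y" for y
  by (rule antisym; rule continuous_le_of_integral_cball) (use ca cb eq in auto)
 from this[of "?\<Phi> x"] have *: "jac (S' x) * r1 (S x) = p0 x"
  by (simp add: a_def b_def \<Phi>\<Psi>)
 moreover have "jac (S' x) >= 0" by (simp add: jac_def)
 ultimately have "r1 (S x) > 0"
  using p0(2)[of x] r10[of "S x"] by (metis less_le mult_zero_right)
 then show "r (S x) > 0" by (simp add: r1_def)
 then show "r (S x) * jac (S' x) = p0 x" using * by (simp add: r1_def mult.commute)
qed

section \<open>A regularised entropy\<close>

lemma approx_continuous_by_test2:
 fixes g :: "real^'n => real"
 assumes gc: "continuous_on UNIV g" and g0: "!!x. norm x > R ==> g x = 0" and \<epsilon>: "\<epsilon> > 0"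
 shows "\<exists>q. test2 (R + 1) q & (\<forall>x. \<bar>q x - g x\<bar> <= \<epsilon>)"
proof -
 have [measurable]: "g \<in> borel_measurable borel" by (rule borel_of_cont[OF gc])
 obtain d where d: "d > 0" "d <= 1" "!!x y. norm (x - y) < d ==> \<bar>g x - g y\<bar> < \<epsilon>"
  using continuous_compact_support_uniform[OF gc g0 \<epsilon>, unfolded real_norm_def] by blast
 define r where "r = d / 2"
 have r: "r > 0" "r < d" "r <= 1" using d by (auto simp: r_def)
 obtain \<eta> :: "real^'n => real" where \<eta>: "test2 r \<eta>" and \<eta>0: "!!x. \<eta> x >= 0" and i\<eta>: "integrable lborel \<eta>"
  and \<eta>1: "(LINT x|lborel. \<eta> x) = 1"
  using mollifier_exists[OF r(1)] by blast
 have \<eta>s: "!!x. norm x > r ==> \<eta> x = 0" and \<eta>c: "continuous_on UNIV \<eta>"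
  using \<eta> diff_imp_cont[of \<eta>] by (auto simp: test2_def)
 have [measurable]: "\<eta> \<in> borel_measurable borel" using i\<eta> by simp
 have "test2 (R + r) (conv g \<eta>)" by (rule test2_conv[OF gc g0 \<eta>])
 then have t: "test2 (R + 1) (conv g \<eta>)" using r(3) by (auto simp: test2_def)
 have "\<bar>conv g \<eta> y - g y\<bar> <= \<epsilon>" for y
 proof -
  have q: "conv g \<eta> y = (LINT x|lborel. g (y - x) * \<eta> x)"
   unfolding conv_def using integral_reflect(1)[of "%x. g (y - x) * \<eta> x" y] by simp
  have i: "integrable lborel (%x. g (y - x) * \<eta> x)"
   by (rule integrable_cont_bdd(1)[where R=r])
    (auto intro!: continuous_intros continuous_on_compose2[OF gc] \<eta>c simp: \<eta>s)
  have "conv g \<eta> y - g y = (LINT x|lborel. g (y - x) * \<eta> x - g y * \<eta> x)"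
   using i i\<eta> by (simp add: q \<eta>1)
  also have "\<bar>...\<bar> <= (LINT x|lborel. \<bar>g (y - x) * \<eta> x - g y * \<eta> x\<bar>)"
   by (rule integral_abs_bound)
  also have "... <= (LINT x|lborel. \<epsilon> * \<eta> x)"
  proof (rule integral_mono)
   fix x
   show "\<bar>g (y - x) * \<eta> x - g y * \<eta> x\<bar> <= \<epsilon> * \<eta> x"
   proof (cases "norm x > r")
    case False
    then have "\<bar>g (y - x) - g y\<bar> <= \<epsilon>" using d(3)[of "y - x" y] r(2) by auto
    then show ?thesis
    using mult_right_mono[of "\<bar>g (y - x) - g y\<bar>" \<epsilon> "\<eta> x"] \<eta>0[of x]
    by (simp add: abs_mult flip: left_diff_distrib)
   qed (simp add: \<eta>s)
  qed (use i i\<eta> in auto)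
  also have "... = \<epsilon>" by (simp add: \<eta>1)
  finally show ?thesis .
 qed
 then show ?thesis using t by blast
qed

text \<open>Continuous induction along the interval.\<close>

lemma growth_of_right_quotients:
 fixes f :: "real => real"
 assumes c: "continuous_on {0..b} f" and b: "0 <= b"
  and loc: "!!s. 0 <= s ==> s < b ==> \<exists>\<delta>>0. \<forall>h. 0 < h & h < \<delta> & s + h <= b --> c * h <= f (s + h) - f s"
 shows "c * b <= f b - f 0"
proof -
 define k where "k = (%s. f s - c * s)"
 have kc: "continuous_on {0..b} k" unfolding k_def by (intro continuous_intros c)
 define S where "S = {s \<in> {0..b}. k 0 <= k s}"
 have S1: "compact S"
 proof -
  have "S = {0..b} \<inter> k -` {k 0..}" by (auto simp: S_def)
  then have "closed S" using continuous_closed_preimage[OF kc, of "{k 0..}"] by simp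
  moreover have "bounded S" by (rule bounded_subset[of "{0..b}"]) (auto simp: S_def)
  ultimately show ?thesis by (simp add: compact_eq_bounded_closed)
 qed
 have S2: "S ~= {}" using b by (auto simp: S_def)
 obtain t where t: "t \<in> S" "!!s. s \<in> S ==> s <= t"
  using compact_attains_sup[OF S1 S2] by auto
 have "t = b"
 proof (rule ccontr)
  assume "t ~= b"
  then have tb: "0 <= t" "t < b" using t(1) by (auto simp: S_def)
  from loc[OF tb] obtain \<delta> where \<delta>: "\<delta> > 0" "\<forall>h. 0 < h & h < \<delta> & t + h <= b --> c * h <= f (t + h) - f t" by blast
  define h where "h = min (\<delta> / 2) (b - t)"
  have h: "0 < h" "h < \<delta>" "t + h <= b" using \<delta>(1) tb by (auto simp: h_def min_def)
  then have "k t <= k (t + h)" using \<delta>(2) by (auto simp: k_def algebra_simps)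
  then have "t + h \<in> S" using t(1) h tb by (auto simp: S_def)
  then show False using t(2)[of "t + h"] h by simp
 qed
 then show ?thesis using t(1) by (simp add: S_def k_def)
qed

text \<open>A convex regularisation of \<open>r ln r - r\<close> whose derivative \<open>ln ((r + d) / (1 + d r))\<close> is bounded by \<open>- ln d\<close>.\<close>

definition reg :: "real => real => real"
 where "reg d r = (r + d) * ln (r + d) - (1 / d + r) * ln (1 + d * r)"

definition reg' :: "real => real => real"
 where "reg' d r = ln (r + d) - ln (1 + d * r)"

lemma reg_has_derivative:
 assumes "0 < d" "0 < r"
 shows "(reg d has_real_derivative reg' d r) (at r)"
proof -
 have p: "r + d > 0" "1 + d * r > 0" using assms by (auto intro: add_pos_pos)
 have D: "(reg d has_real_derivative ((1 * ln (r + d) + (r + d) * (1 / (r + d))) -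
   (1 * ln (1 + d * r) + (1 / d + r) * (d * 1 / (1 + d * r))))) (at r)"
  unfolding reg_def [abs_def] using p by (auto intro!: derivative_eq_intros)
 have e1: "(1 / d + r) * (d * 1 / (1 + d * r)) = 1"
 proof -
  have e: "(1 / d + r) * d = 1 + d * r" using assms by (simp add: distrib_right)
  have "(1 / d + r) * (d * 1 / (1 + d * r)) = (1 / d + r) * d / (1 + d * r)" by simp
  also have "... = (1 + d * r) / (1 + d * r)" by (simp only: e)
  also have "... = 1" using p by simp
  finally show ?thesis .
 qed
 have e2: "(r + d) * (1 / (r + d)) = 1" using p by simp
 show ?thesis by (rule DERIV_cong[OF D], unfold e1 e2 reg'_def, linarith)
qed

lemma reg'_mono:
 assumes "0 < d" "d <= 1" "0 < r" "r <= s"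
 shows "reg' d r <= reg' d s"
proof -
 have p: "r + d > 0" "1 + d * r > 0" "s + d > 0" "1 + d * s > 0" using assms by (auto intro: add_pos_pos)
 have "(r + d) * (1 + d * s) <= (s + d) * (1 + d * r)"
 proof -
  have "(s + d) * (1 + d * r) - (r + d) * (1 + d * s) = (s - r) * (1 - d * d)" by (simp add: algebra_simps)
  moreover have "d * d <= 1" using assms by (simp add: mult_le_one)
  moreover have "0 <= (s - r) * (1 - d * d)"
   using assms \<open>d * d <= 1\<close> by (intro mult_nonneg_nonneg) auto
  ultimately show ?thesis by linarith
 qed
 then have "ln ((r + d) * (1 + d * s)) <= ln ((s + d) * (1 + d * r))"
  using p by (subst ln_le_cancel_iff) auto
 then show ?thesis using p by (simp add: reg'_def ln_mult_pos)
qed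

text \<open>Convexity of the regularised entropy in the density ratio.\<close>

lemma reg_tangent:
 assumes d: "0 < d" "d <= 1" and r: "0 < r" "0 < s"
 shows "reg' d r * (s - r) <= reg d s - reg d r"
proof (cases "r = s")
 case False
 then consider "r < s" | "s < r" by linarith
 then show ?thesis
 proof cases
  case 1
  obtain z where z: "r < z" "z < s" "reg d s - reg d r = (s - r) * reg' d z"
   using MVT2[OF 1, of "reg d" "reg' d"] reg_has_derivative[OF d(1)] r by auto
  then show ?thesis
   using reg'_mono[OF d r(1), of z] mult_left_mono[of "reg' d r" "reg' d z" "s - r"] by (simp add: mult.commute)
 next
  case 2
  obtain z where z: "s < z" "z < r" "reg d r - reg d s = (r - s) * reg' d z"
   using MVT2[OF 2, of "reg d" "reg' d"] reg_has_derivative[OF d(1)] r by auto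
  have "reg' d z <= reg' d r" using z r by (intro reg'_mono d) auto
  then have "(r - s) * reg' d z <= (r - s) * reg' d r" using 2 by (intro mult_left_mono) auto
  then show ?thesis using z(3) by (simp add: algebra_simps)
 qed
qed simp

lemma reg'_bound:
 assumes "0 < d" "d <= 1" "0 < r"
 shows "\<bar>reg' d r\<bar> <= - ln d"
proof -
 have p: "r + d > 0" "1 + d * r > 0" using assms by (auto intro: add_pos_pos)
 have dr: "d * r <= r" using assms by simp
 have dd: "d * d * r <= r" using assms mult_le_one[of d d] by (simp add: mult_left_le_one_le)
 have "d * (r + d) <= 1 + d * r" using assms mult_le_one[of d d] by (simp add: distrib_left)
 then have "ln (d * (r + d)) <= ln (1 + d * r)" using p assms by (subst ln_le_cancel_iff) auto
 then have 1: "ln d + ln (r + d) <= ln (1 + d * r)" using p assms by (simp add: ln_mult_pos)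
 have "d * (1 + d * r) <= r + d" using dd by (simp add: distrib_left mult.assoc)
 then have "ln (d * (1 + d * r)) <= ln (r + d)" using p assms by (subst ln_le_cancel_iff) auto
 then have "ln d + ln (1 + d * r) <= ln (r + d)" using p assms by (simp add: ln_mult_pos)
 with 1 show ?thesis unfolding reg'_def by linarith
qed

text \<open>The bound is uniform in the regularisation and integrable against \<open>m\<close> whenever the relative entropy is finite.\<close>

lemma reg_bound:
 assumes d: "0 < d" "d <= 1" and r: "0 < r"
 shows "\<bar>reg d r\<bar> <= 26 + 25 * r + 8 * \<bar>r * ln r\<bar>"
proof -
 have b: "\<bar>(r + t) * ln (r + t)\<bar> <= 13 + 12 * r + 4 * \<bar>r * ln r\<bar>" if t: "0 < t" "t <= 1" for t
 proof -
  have "sqrt (r + t) <= sqrt r + sqrt t" using r t by (intro sqrt_add_le_add_sqrt) auto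
  moreover have "sqrt t <= 1" using t by simp
  ultimately have "sqrt (r + t) <= 1 + sqrt r" by linarith
  then show ?thesis using abs_xlnx_bound[of "sqrt (r + t)" "sqrt r"] r t by simp
 qed
 have l0: "0 <= ln (1 + d * r)" using d r by (intro ln_ge_zero) auto
 have "ln (1 + d * r) <= d * r" using d r by (intro ln_add_one_self_le_self) auto
 then have "1 / d * ln (1 + d * r) <= 1 / d * (d * r)" using d by (intro mult_left_mono) auto
 then have 1: "1 / d * ln (1 + d * r) <= r" using d by simp
 have "1 + d * r <= r + 1" using d r by simp
 then have "ln (1 + d * r) <= ln (r + 1)" using d r by (subst ln_le_cancel_iff) (auto intro: add_pos_pos)
 then have "r * ln (1 + d * r) <= (r + 1) * ln (r + 1)" using r l0 by (intro mult_mono) auto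
 also have "... <= 13 + 12 * r + 4 * \<bar>r * ln r\<bar>" using b[of 1] by simp
 finally have 2: "r * ln (1 + d * r) <= 13 + 12 * r + 4 * \<bar>r * ln r\<bar>" .
 have 3: "0 <= 1 / d * ln (1 + d * r)" "0 <= r * ln (1 + d * r)"
  using d r l0 by (intro mult_nonneg_nonneg; simp)+
 have "reg d r = (r + d) * ln (r + d) - 1 / d * ln (1 + d * r) - r * ln (1 + d * r)"
  by (simp add: reg_def algebra_simps)
 then show ?thesis using b[OF d] 1 2 3 by (simp only: abs_le_iff) linarith
qed

lemma reg_tendsto:
 assumes r: "0 < r"
 shows "(%n. reg (exp (- real n)) r) \<longlonglongrightarrow> r * ln r - r"
proof -
 have d0: "(%n. exp (- real n)) \<longlonglongrightarrow> 0"
  by (rule filterlim_compose[OF exp_at_bot]) (simp add: filterlim_uminus_at_bot filterlim_real_sequentially)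
 have "((%t. ln (1 + r * t)) has_real_derivative (r / (1 + r * 0))) (at 0)"
  by (auto intro!: derivative_eq_intros)
 then have "((%t. ln (1 + r * t) / t) \<longlongrightarrow> r) (at 0)" by (simp add: DERIV_def)
 then have "(%n. ln (1 + r * exp (- real n)) / exp (- real n)) \<longlonglongrightarrow> r"
  by (rule filterlim_compose) (use d0 in \<open>auto simp: filterlim_at\<close>)
 then have 1: "(%n. 1 / exp (- real n) * ln (1 + exp (- real n) * r)) \<longlonglongrightarrow> r"
  by (simp add: mult.commute)
 have 2: "(%n. (r + exp (- real n)) * ln (r + exp (- real n)) - r * ln (1 + exp (- real n) * r)) \<longlonglongrightarrow> (r + 0) * ln (r + 0) - r * ln (1 + 0 * r)"
  using r by (intro tendsto_intros d0) auto
 have "(%n. ((r + exp (- real n)) * ln (r + exp (- real n)) - r * ln (1 + exp (- real n) * r))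
   - 1 / exp (- real n) * ln (1 + exp (- real n) * r)) \<longlonglongrightarrow> ((r + 0) * ln (r + 0) - r * ln (1 + 0 * r)) - r"
  by (intro tendsto_diff 1 2)
 moreover have "((r + exp (- real n)) * ln (r + exp (- real n)) - r * ln (1 + exp (- real n) * r))
   - 1 / exp (- real n) * ln (1 + exp (- real n) * r) = reg (exp (- real n)) r" for n
  by (simp add: reg_def algebra_simps)
 ultimately show ?thesis by simp
qed

text \<open>The slope of \<open>reg'\<close> in logarithmic coordinates; it tends to 1.\<close>

definition slope :: "real => real => real"
 where "slope d s = (1 - d * d) * exp s / ((exp s + d) * (1 + d * exp s))"

lemma slope_derivative:
 assumes d: "0 < d" "d <= 1"
 shows "((%s. reg' d (exp s)) has_real_derivative slope d s) (at s)"
  and "0 <= slope d s" and "slope d s <= 1"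
proof -
 have p: "exp s + d > 0" "1 + d * exp s > 0" using d by (auto intro!: add_pos_pos)
 have pp: "(exp s + d) * (1 + d * exp s) > 0" using p by simp
 have "((%s. reg' d (exp s)) has_real_derivative (exp s / (exp s + d) - d * exp s / (1 + d * exp s))) (at s)"
  unfolding reg'_def using p by (auto intro!: derivative_eq_intros)
 moreover have "exp s / (exp s + d) - d * exp s / (1 + d * exp s) = slope d s"
  unfolding slope_def using p by (subst diff_frac_eq) (auto simp: algebra_simps)
 ultimately show "((%s. reg' d (exp s)) has_real_derivative slope d s) (at s)" by simp
 have dd: "d * d <= 1" using d by (intro mult_le_one) auto
 show "0 <= slope d s" unfolding slope_def using pp dd by (intro divide_nonneg_pos mult_nonneg_nonneg) auto
 have "(1 - d * d) * exp s <= (exp s + d) * (1 + d * exp s)"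
 proof -
  have "(exp s + d) * (1 + d * exp s) - (1 - d * d) * exp s = d + d * (exp s * exp s) + 2 * (d * d * exp s)" by (simp add: algebra_simps)
  moreover have "0 <= d + d * (exp s * exp s) + 2 * (d * d * exp s)" using d by (intro add_nonneg_nonneg mult_nonneg_nonneg) auto
  ultimately show ?thesis by linarith
 qed
 then show "slope d s <= 1" unfolding slope_def using pp by (simp add: divide_le_eq)
qed

lemma slope_tendsto:
 assumes "filterlim N at_top sequentially" "s \<longlonglongrightarrow> s0"
 shows "(%k. slope (exp (- real (N k))) (s k)) \<longlonglongrightarrow> 1"
proof -
 have "filterlim (%k. - real (N k)) at_bot sequentially"
  using filterlim_compose[OF filterlim_real_sequentially assms(1)] by (simp add: filterlim_uminus_at_bot)
 then have d: "(%k. exp (- real (N k))) \<longlonglongrightarrow> 0" by (rule filterlim_compose[OF exp_at_bot])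
 have "(%k. (1 - exp (- real (N k)) * exp (- real (N k))) * exp (s k) / ((exp (s k) + exp (- real (N k))) * (1 + exp (- real (N k)) * exp (s k))))
   \<longlonglongrightarrow> (1 - 0 * 0) * exp s0 / ((exp s0 + 0) * (1 + 0 * exp s0))"
  by (intro tendsto_intros d assms(2)) auto
 then show ?thesis by (simp add: slope_def)
qed

section \<open>Families of densities\<close>

text \<open>A family of densities transported by maps that depend differentiably on a parameter; \<open>v th j\<close>
 is the Eulerian velocity of the \<open>j\<close>-th parameter direction, and \<open>m\<close> is a reference density.\<close>

locale density_family =
 fixes \<Theta> :: "(real^'m) set" and p :: "(real^'d) measure"
  and T :: "real^'m => real^'d => real^'d" and \<rho> :: "real^'m => real^'d => real"
  and v :: "real^'m => 'm => real^'d => real^'d" and m :: "real^'d => real"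
 assumes open_Theta: "open \<Theta>" and prob_p: "prob_space p" and sets_p: "sets p = sets borel"
  and dist: "!!th. th \<in> \<Theta> ==> distributed p lborel (T th) (%y. ennreal (\<rho> th y))"
  and rho_pos: "!!th y. th \<in> \<Theta> ==> \<rho> th y > 0"
  and rho_diff: "!!th y. th \<in> \<Theta> ==> \<rho> th differentiable (at y)"
  and rho_cont: "continuous_on (\<Theta> \<times> UNIV) (%z. \<rho> (fst z) (snd z))"
  and v_cont: "!!j. continuous_on (\<Theta> \<times> UNIV) (%z. v (fst z) j (snd z))"
  and T_deriv: "!!th x. th \<in> \<Theta> ==> ((%th. T th x) has_derivative (%e. \<Sum>j\<in>UNIV. e $ j *\<^sub>R v th j (T th x))) (at th)"
  and dom: "!!th0. th0 \<in> \<Theta> ==> \<exists>r>0. \<exists>L. integrable p L &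
   (\<forall>th\<in>\<Theta>. norm (th - th0) < r --> (\<forall>x j. (norm (v th j (T th x)))\<^sup>2 <= L x))"
  and m_pos: "!!y. m y > 0" and m_int: "integrable lborel m" and m_one: "(LINT y|lborel. m y) = 1"
  and m_diff: "!!y. m differentiable (at y)"
  and lnm_grad: "continuous_on UNIV (grad (%y. ln (m y)))"
begin

definition M where "M th = density lborel (%y. ennreal (\<rho> th y))"

definition f where "f th y = ln (\<rho> th y / m y)"

lemma sets_M: "sets (M th) = sets borel"
 by (simp add: M_def)

lemma rho_c: "th \<in> \<Theta> ==> continuous_on UNIV (\<rho> th)"
 by (rule diff_imp_cont[OF rho_diff])

lemma v_c: "th \<in> \<Theta> ==> continuous_on UNIV (v th j)"
proof -
 assume t: "th \<in> \<Theta>"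
 have "continuous_on UNIV (%y. v (fst (th, y)) j (snd (th, y)))"
  by (rule continuous_on_compose2[OF v_cont]) (use t in \<open>auto intro!: continuous_intros\<close>)
 then show ?thesis by simp
qed

lemma rho_m [measurable (raw)]: "th \<in> \<Theta> ==> \<rho> th \<in> borel_measurable borel"
 by (rule borel_of_cont[OF rho_c])

lemma v_m: "th \<in> \<Theta> ==> v th j \<in> borel_measurable borel"
 by (rule borel_of_cont[OF v_c])

lemma distr_M: "th \<in> \<Theta> ==> distr p lborel (T th) = M th"
 unfolding M_def by (rule distributed_distr_eq_density[OF dist])

lemma T_m: "th \<in> \<Theta> ==> T th \<in> measurable p lborel"
 by (rule distributed_measurable[OF dist])

lemma prob_M: "th \<in> \<Theta> ==> prob_space (M th)"
 using prob_space.prob_space_distr[OF prob_p T_m] distr_M by simp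

lemma integral_M:
 fixes h :: "real^'d => real"
 assumes "th \<in> \<Theta>" "h \<in> borel_measurable borel"
 shows "(LINT y|M th. h y) = (LINT x|p. h (T th x))" "integrable (M th) h \<longleftrightarrow> integrable p (%x. h (T th x))"
 unfolding distr_M[OF assms(1), symmetric]
 using integral_distr[OF T_m[OF assms(1)], of h] integrable_distr_eq[OF T_m[OF assms(1)], of h] assms(2) by simp_all

lemma integral_M_lborel:
 fixes h :: "real^'d => real"
 assumes "th \<in> \<Theta>" "h \<in> borel_measurable borel"
 shows "(LINT y|M th. h y) = (LINT y|lborel. \<rho> th y * h y)" "integrable (M th) h \<longleftrightarrow> integrable lborel (%y. \<rho> th y * h y)"
 unfolding M_def using rho_m[OF assms(1)] rho_pos[OF assms(1)] assms(2)
 by (auto simp: integral_real_density integrable_real_density less_imp_le)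

lemma h_p_m:
 fixes h :: "real^'d => real"
 assumes "th \<in> \<Theta>" "h \<in> borel_measurable borel"
 shows "(%x. h (T th x)) \<in> borel_measurable p"
 using measurable_compose[OF T_m[OF assms(1)], of h borel] assms(2) by simp

lemma f_diff: "th \<in> \<Theta> ==> f th differentiable (at y)"
 and grad_f: "th \<in> \<Theta> ==> grad (\<rho> th) y = \<rho> th y *\<^sub>R (grad (f th) y + grad (%y. ln (m y)) y)"
proof -
 assume t: "th \<in> \<Theta>"
 have l1: "(ln has_real_derivative 1 / \<rho> th y) (at (\<rho> th y))" using rho_pos[OF t, of y] by (auto intro!: derivative_eq_intros)
 have l2: "(ln has_real_derivative 1 / m y) (at (m y))" using m_pos[of y] by (auto intro!: derivative_eq_intros)
 note a = grad_compose_real[OF rho_diff[OF t] l1] and b = grad_compose_real[OF m_diff l2]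
 have e: "f th = (%y. ln (\<rho> th y) - ln (m y))"
  using rho_pos[OF t] m_pos by (simp add: f_def fun_eq_iff ln_divide_pos)
 show "f th differentiable (at y)" unfolding e by (intro differentiable_diff a(3) b(3))
 have "grad (f th) y = grad (%y. ln (\<rho> th y)) y - grad (%y. ln (m y)) y"
  unfolding e
  using has_derivative_diff[OF grad_has_derivative[OF a(3)] grad_has_derivative[OF b(3)]]
  by (intro grad_eqI) (simp add: inner_diff_left)
 then show "grad (\<rho> th) y = \<rho> th y *\<^sub>R (grad (f th) y + grad (%y. ln (m y)) y)"
  using rho_pos[OF t, of y] by (simp add: a(2))
qed

lemma gf_m: "th \<in> \<Theta> ==> grad (f th) \<in> borel_measurable borel"
 by (rule grad_measurable[OF f_diff])

lemma m_c: "continuous_on UNIV m"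
 by (rule diff_imp_cont[OF m_diff])

lemma f_c: "th \<in> \<Theta> ==> continuous_on UNIV (f th)"
 by (rule diff_imp_cont[OF f_diff])

lemma v_sq_int: "th \<in> \<Theta> ==> integrable (M th) (%y. (norm (v th j y))\<^sup>2)"
proof -
 assume t: "th \<in> \<Theta>"
 obtain r L where r: "r > 0" and L: "integrable p L"
  and le: "\<forall>th'\<in>\<Theta>. norm (th' - th) < r --> (\<forall>x j. (norm (v th' j (T th' x)))\<^sup>2 <= L x)"
  using dom[OF t] by blast
 have hm: "(%y. (norm (v th j y))\<^sup>2) \<in> borel_measurable borel" using v_m[OF t] by measurable
 have "integrable p (%x. (norm (v th j (T th x)))\<^sup>2)"
 proof (rule integrable_bd[OF L h_p_m[OF t hm]], rule AE_I2)
  fix x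
  have "(norm (v th j (T th x)))\<^sup>2 <= L x" using le t r by simp
  then show "norm ((norm (v th j (T th x)))\<^sup>2) <= norm (L x)" by simp
 qed
 then show ?thesis using integral_M(2)[OF t hm] by simp
qed

lemma T_tendsto:
 assumes "th0 \<in> \<Theta>" "th \<longlonglongrightarrow> th0"
 shows "(%k. T (th k) x) \<longlonglongrightarrow> T th0 x"
proof -
 have "isCont (%th. T th x) th0" by (rule has_derivative_continuous[OF T_deriv[OF assms(1)]])
 then show ?thesis by (rule isCont_tendsto_compose[OF _ assms(2)])
qed

lemma rho_tendsto:
 assumes "!!k. th k \<in> \<Theta>" "th0 \<in> \<Theta>" "th \<longlonglongrightarrow> th0" "y \<longlonglongrightarrow> y0"
 shows "(%k. \<rho> (th k) (y k)) \<longlonglongrightarrow> \<rho> th0 y0"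
 using continuous_on_tendsto_compose[OF rho_cont tendsto_Pair[OF assms(3,4)]] assms by simp

lemma v_tendsto:
 assumes "!!k. th k \<in> \<Theta>" "th0 \<in> \<Theta>" "th \<longlonglongrightarrow> th0" "y \<longlonglongrightarrow> y0"
 shows "(%k. v (th k) j (y k)) \<longlonglongrightarrow> v th0 j y0"
 using continuous_on_tendsto_compose[OF v_cont tendsto_Pair[OF assms(3,4)]] assms by simp

lemma f_tendsto:
 assumes "!!k. th k \<in> \<Theta>" "th0 \<in> \<Theta>" "th \<longlonglongrightarrow> th0" "y \<longlonglongrightarrow> y0"
 shows "(%k. f (th k) (y k)) \<longlonglongrightarrow> f th0 y0"
proof -
 have mc: "(%k. m (y k)) \<longlonglongrightarrow> m y0"
  using continuous_on_tendsto_compose[OF m_c assms(4)] by simp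
 show ?thesis
  unfolding f_def using rho_pos[OF assms(2), of y0] m_pos[of y0]
  by (intro tendsto_ln tendsto_divide rho_tendsto[OF assms] mc) auto
qed

text \<open>Dominated convergence after pulling everything back to \<open>p\<close>: continuous convergence of the
 integrands in the space variable suffices.\<close>

lemma push_conv:
 assumes th: "!!k. th k \<in> \<Theta>" "th0 \<in> \<Theta>" "th \<longlonglongrightarrow> th0"
  and hm: "!!k. h k \<in> borel_measurable borel" "h0 \<in> borel_measurable borel"
  and conv: "!!y y0. y \<longlonglongrightarrow> y0 ==> (%k. h k (y k)) \<longlonglongrightarrow> (h0 y0 :: real)"
  and bd: "!!k y. \<bar>h k y\<bar> <= B * (1 + (norm (v (th k) j y))\<^sup>2)"
 shows "(%k. LINT y|M (th k). h k y) \<longlonglongrightarrow> (LINT y|M th0. h0 y)"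
proof -
 obtain r L where r: "r > 0" and L: "integrable p L"
  and le: "\<forall>th'\<in>\<Theta>. norm (th' - th0) < r --> (\<forall>x j. (norm (v th' j (T th' x)))\<^sup>2 <= L x)"
  using dom[OF th(2)] by blast
 have "\<forall>\<^sub>F k in sequentially. dist (th k) th0 < r" using th(3) r by (rule tendstoD)
 then obtain K where K: "!!k. k >= K ==> norm (th k - th0) < r"
  by (auto simp: eventually_sequentially dist_norm)
 have B: "B >= 0"
 proof -
  have "0 <= B * (1 + (norm (v (th 0) j 0))\<^sup>2)" using bd[of 0 0] by linarith
  moreover have "1 + (norm (v (th 0) j 0))\<^sup>2 > 0" by (intro add_pos_nonneg) auto
  ultimately show ?thesis by (simp add: zero_le_mult_iff)
 qed
 interpret prob_space p by (rule prob_p)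
 have "(%k. LINT x|p. h (k + K) (T (th (k + K)) x)) \<longlonglongrightarrow> (LINT x|p. h0 (T th0 x))"
 proof (rule integral_dominated_convergence[where w="%x. B * (1 + L x)"])
  show "(%x. h0 (T th0 x)) \<in> borel_measurable p" by (rule h_p_m[OF th(2) hm(2)])
  show "(%x. h (k + K) (T (th (k + K)) x)) \<in> borel_measurable p" for k by (rule h_p_m[OF th(1) hm(1)])
  show "integrable p (%x. B * (1 + L x))" using L by simp
  show "AE x in p. (%k. h (k + K) (T (th (k + K)) x)) \<longlonglongrightarrow> h0 (T th0 x)"
   using LIMSEQ_ignore_initial_segment[OF conv[OF T_tendsto[OF th(2,3)]], of K] by simp
  show "AE x in p. norm (h (k + K) (T (th (k + K)) x)) <= B * (1 + L x)" for k
  proof (rule AE_I2)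
   fix x
   have "(norm (v (th (k + K)) j (T (th (k + K)) x)))\<^sup>2 <= L x"
    using le th(1) K[of "k + K"] by simp
   then have "B * (1 + (norm (v (th (k + K)) j (T (th (k + K)) x)))\<^sup>2) <= B * (1 + L x)"
    using B by (intro mult_left_mono) auto
   then show "norm (h (k + K) (T (th (k + K)) x)) <= B * (1 + L x)"
    using bd[of "k + K" "T (th (k + K)) x"] by simp
  qed
 qed
 then have "(%k. LINT x|p. h k (T (th k) x)) \<longlonglongrightarrow> (LINT x|p. h0 (T th0 x))"
  by (rule LIMSEQ_offset)
 then show ?thesis by (simp add: integral_M(1) th hm)
qed

lemma gf_L1:
 assumes t: "th \<in> \<Theta>" and i: "integrable (M th) (%y. (norm (grad (f th) y))\<^sup>2)"
 shows "integrable lborel (%y. \<rho> th y *\<^sub>R grad (f th) y)"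
proof -
 interpret prob_space "M th" by (rule prob_M[OF t])
 have gm: "grad (f th) \<in> borel_measurable (M th)" using gf_m[OF t] by (simp add: sets_M cong: measurable_cong_sets)
 have "integrable (M th) (grad (f th))"
 proof (rule integrable_bd[OF _ gm])
  show "integrable (M th) (%y. 1 + (norm (grad (f th) y))\<^sup>2)" using i by simp
  show "AE y in M th. norm (grad (f th) y) <= norm (1 + (norm (grad (f th) y))\<^sup>2)"
  proof (rule AE_I2)
   fix y
   have "2 * norm (grad (f th) y) <= 1 + (norm (grad (f th) y))\<^sup>2"
    using sum_squares_bound[of 1 "norm (grad (f th) y)"] by simp
   then have "norm (grad (f th) y) <= 1 + (norm (grad (f th) y))\<^sup>2" using norm_ge_zero[of "grad (f th) y"] by linarith
   then show "norm (grad (f th) y) <= norm (1 + (norm (grad (f th) y))\<^sup>2)" by simp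
  qed
 qed
 then show ?thesis
  unfolding M_def using rho_m[OF t] gf_m[OF t] rho_pos[OF t]
  by (subst (asm) integrable_density) (auto simp: less_imp_le)
qed

text \<open>Moving the derivative to the test function removes the gradient of the density, of which no continuity is known.\<close>

lemma score_by_parts:
 assumes t: "th \<in> \<Theta>" and i: "integrable (M th) (%y. (norm (grad (f th) y))\<^sup>2)"
  and q: "!!x. q differentiable (at x)" "continuous_on UNIV (grad q)" "!!x. norm x > R ==> q x = 0"
 shows "(LINT y|M th. q y * (grad (f th) y \<bullet> b))
  = - (LINT y|M th. grad q y \<bullet> b + q y * (grad (%y. ln (m y)) y \<bullet> b))"
proof -
 note rc = rho_c[OF t] and L1 = gf_L1[OF t i]
 note qc = diff_imp_cont[OF q(1)]
 have q'0: "norm x > R ==> grad q x = 0" for x by (rule grad_zero_outside[OF q(3)])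
 have meas: "q \<in> borel_measurable borel" "grad q \<in> borel_measurable borel" "grad (%y. ln (m y)) \<in> borel_measurable borel"
  by (rule borel_of_cont[OF qc], rule borel_of_cont[OF q(2)],
    rule borel_of_cont[OF lnm_grad])
 have ri: "integrable lborel (%x. indicat_real (cball 0 r) x *\<^sub>R grad (\<rho> th) x)" for r
 proof -
  have 1: "integrable lborel (%x. indicat_real (cball 0 r) x *\<^sub>R (\<rho> th x *\<^sub>R grad (f th) x))"
   by (rule integrable_mult_indicator[OF _ L1]) simp
  have 2: "integrable lborel (%x. indicat_real (cball 0 r) x *\<^sub>R (\<rho> th x *\<^sub>R grad (%y. ln (m y)) x))"
   by (rule borel_integrable_compact[OF compact_cball])
    (intro continuous_intros continuous_on_subset[OF rc] continuous_on_subset[OF lnm_grad]; simp)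
  show ?thesis
   using Bochner_Integration.integrable_add[OF 1 2] by (simp add: grad_f[OF t] scaleR_add_right)
 qed
 note ibp = integral_by_parts_bounded_support[OF rho_diff[OF t] ri q(1,2,3) q'0]
 have i1: "integrable lborel (%x. q x * (grad (\<rho> th) x \<bullet> b))" by (rule ibp(1))
 have i2: "integrable lborel (%x. \<rho> th x * (q x * (grad (%y. ln (m y)) x \<bullet> b)))"
  by (rule integrable_cont_bdd(1)[where R=R], intro continuous_intros rc qc lnm_grad) (simp add: q(3))
 have i3: "integrable lborel (%x. \<rho> th x * (grad q x \<bullet> b))"
  by (rule integrable_cont_bdd(1)[where R=R], intro continuous_intros rc q(2)) (simp add: q'0)
 have hm1: "(%y. q y * (grad (f th) y \<bullet> b)) \<in> borel_measurable borel"
  using meas gf_m[OF t] by measurable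
 have hm2: "(%y. grad q y \<bullet> b + q y * (grad (%y. ln (m y)) y \<bullet> b)) \<in> borel_measurable borel"
  using meas by measurable
 have "(LINT y|M th. q y * (grad (f th) y \<bullet> b)) = (LINT y|lborel. q y * (grad (\<rho> th) y \<bullet> b) - \<rho> th y * (q y * (grad (%y. ln (m y)) y \<bullet> b)))"
  unfolding integral_M_lborel(1)[OF t hm1]
  by (intro integral_cg) (auto simp: grad_f[OF t] inner_add_left algebra_simps)
 also have "... = - (LINT x|lborel. \<rho> th x * (grad q x \<bullet> b)) - (LINT x|lborel. \<rho> th x * (q x * (grad (%y. ln (m y)) x \<bullet> b)))"
  using i1 i2 ibp(2) by simp
 also have "... = - (LINT y|lborel. \<rho> th y * (grad q y \<bullet> b + q y * (grad (%y. ln (m y)) y \<bullet> b)))"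
  using i2 i3 by (simp add: distrib_left)
 finally show ?thesis unfolding integral_M_lborel(1)[OF t hm2] .
qed

lemma score_test_conv:
 assumes th: "!!k. th k \<in> \<Theta>" "th0 \<in> \<Theta>" "th \<longlonglongrightarrow> th0"
  and i: "!!th. th \<in> \<Theta> ==> integrable (M th) (%y. (norm (grad (f th) y))\<^sup>2)"
  and q: "!!x. q differentiable (at x)" "continuous_on UNIV (grad q)" "!!x. norm x > R ==> q x = 0"
 shows "(%k. LINT y|M (th k). q y * (grad (f (th k)) y \<bullet> b)) \<longlonglongrightarrow> (LINT y|M th0. q y * (grad (f th0) y \<bullet> b))"
proof -
 let ?h = "%y. grad q y \<bullet> b + q y * (grad (%y. ln (m y)) y \<bullet> b)"
 have hc: "continuous_on UNIV ?h"
  by (intro continuous_intros q(2) lnm_grad diff_imp_cont[OF q(1)])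
 have "grad q x = 0" if "norm x > R" for x by (rule grad_zero_outside[OF q(3) that])
 then obtain C where C: "!!y. norm (?h y) <= C"
  using integrable_cont_bdd(2)[OF hc, of R] q(3) by auto
 have C0: "C >= 0" using order_trans[OF norm_ge_zero C] .
 have "(%k. LINT y|M (th k). ?h y) \<longlonglongrightarrow> (LINT y|M th0. ?h y)"
 proof (rule push_conv[OF th, where B=C])
  show "?h \<in> borel_measurable borel" by (rule borel_of_cont[OF hc])
  then show "?h \<in> borel_measurable borel" .
  show "(%k. ?h (y k)) \<longlonglongrightarrow> ?h y0" if "y \<longlonglongrightarrow> y0" for y y0
   using continuous_on_tendsto_compose[OF hc that] by simp
  show "\<bar>?h y\<bar> <= C * (1 + (norm (v (th k) j y))\<^sup>2)" for k y j
  proof -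
   have "C * 1 <= C * (1 + (norm (v (th k) j y))\<^sup>2)" using C0 by (intro mult_left_mono) auto
   then show ?thesis using C[of y] by simp
  qed
 qed
 then have "(%k. - (LINT y|M (th k). ?h y)) \<longlonglongrightarrow> - (LINT y|M th0. ?h y)" by (rule tendsto_minus)
 then show ?thesis
  by (simp only: score_by_parts[OF th(1) i[OF th(1)] q] score_by_parts[OF th(2) i[OF th(2)] q])
qed

end

section \<open>Convergence of the score\<close>

lemma two_squares_bound: "(x::real) <= (1 + 1) * a + (1 + 1 / 1) * b ==> a <= A ==> b <= B ==> x <= 2 * A + 2 * B"
 by simp

lemma tendsto_approx:
 fixes x :: "nat => real"
 assumes "!!e. e > 0 ==> \<exists>a a0. a \<longlonglongrightarrow> a0 & (\<forall>\<^sub>F k in sequentially. \<bar>x k - a k\<bar> <= e) & \<bar>x0 - a0\<bar> <= e"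
 shows "x \<longlonglongrightarrow> x0"
proof (rule tendstoI)
 fix e :: real assume e: "e > 0"
 obtain a a0 where a: "a \<longlonglongrightarrow> a0" "\<forall>\<^sub>F k in sequentially. \<bar>x k - a k\<bar> <= e / 4" "\<bar>x0 - a0\<bar> <= e / 4"
  using assms[of "e / 4"] e by auto
 have "\<forall>\<^sub>F k in sequentially. dist (a k) a0 < e / 4" using a(1) e by (intro tendstoD) auto
 with a(2) show "\<forall>\<^sub>F k in sequentially. dist (x k) x0 < e"
 proof eventually_elim
  case (elim k)
  then show ?case using a(3) e unfolding dist_real_def by linarith
 qed
qed

context density_family
begin

lemma cs_M:
 fixes a b :: "real^'d => real^'d"
 assumes "th \<in> \<Theta>" "a \<in> borel_measurable borel" "b \<in> borel_measurable borel"
  and "integrable (M th) (%y. (norm (a y))\<^sup>2)" "integrable (M th) (%y. (norm (b y))\<^sup>2)"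
 shows "integrable (M th) (%y. a y \<bullet> b y)"
  and "\<bar>LINT y|M th. a y \<bullet> b y\<bar> <= sqrt (LINT y|M th. (norm (a y))\<^sup>2) * sqrt (LINT y|M th. (norm (b y))\<^sup>2)"
proof -
 have "a \<in> borel_measurable (M th)" "b \<in> borel_measurable (M th)"
  using assms(2,3) by (simp_all add: sets_M cong: measurable_cong_sets)
 from cauchy_schwarz_integral_inner[OF this assms(4,5)]
 show "integrable (M th) (%y. a y \<bullet> b y)"
  "\<bar>LINT y|M th. a y \<bullet> b y\<bar> <= sqrt (LINT y|M th. (norm (a y))\<^sup>2) * sqrt (LINT y|M th. (norm (b y))\<^sup>2)" .
qed

lemma bounded_factor_L2:
 fixes b :: "real^'d => real^'d"
 assumes t: "th \<in> \<Theta>" and m: "a \<in> borel_measurable borel" "b \<in> borel_measurable borel"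
  and i: "integrable (M th) (%y. (norm (b y))\<^sup>2)" and a: "!!y. \<bar>a y\<bar> <= A"
 shows "integrable (M th) (%y. (norm (a y *\<^sub>R b y))\<^sup>2)"
proof (rule integrable_bd)
 show "integrable (M th) (%y. A\<^sup>2 * (norm (b y))\<^sup>2)" using i by simp
 have "(%y. (norm (a y *\<^sub>R b y))\<^sup>2) \<in> borel_measurable borel" using m by measurable
 then show "(%y. (norm (a y *\<^sub>R b y))\<^sup>2) \<in> borel_measurable (M th)"
  by (simp add: sets_M cong: measurable_cong_sets)
 show "AE y in M th. norm ((norm (a y *\<^sub>R b y))\<^sup>2) <= norm (A\<^sup>2 * (norm (b y))\<^sup>2)"
 proof (rule AE_I2)
  fix y
  have "\<bar>a y\<bar>\<^sup>2 <= A\<^sup>2" using a[of y] by (intro power_mono) auto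
  then have "(a y)\<^sup>2 * (norm (b y))\<^sup>2 <= A\<^sup>2 * (norm (b y))\<^sup>2" by (intro mult_right_mono) auto
  then show "norm ((norm (a y *\<^sub>R b y))\<^sup>2) <= norm (A\<^sup>2 * (norm (b y))\<^sup>2)"
   by (simp add: power_mult_distrib)
 qed
qed

context
 fixes th :: "nat => real^'m" and th0 C
 assumes th: "!!k. th k \<in> \<Theta>" "th0 \<in> \<Theta>" "th \<longlonglongrightarrow> th0"
  and gi: "!!th. th \<in> \<Theta> ==> integrable (M th) (%y. (norm (grad (f th) y))\<^sup>2)"
  and C: "!!k. (LINT y|M (th k). (norm (grad (f (th k)) y))\<^sup>2) <= C"
   "(LINT y|M th0. (norm (grad (f th0) y))\<^sup>2) <= C"
begin

lemma C_nonneg: "C >= 0"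
proof -
 have "0 <= (LINT y|M th0. (norm (grad (f th0) y))\<^sup>2)" by (intro integral_nonneg_AE) simp
 then show ?thesis using C(2) by linarith
qed

text \<open>The bound \<open>C\<close> on the Fisher information turns convergence in square mean of the test fields into convergence of the pairings.\<close>

lemma cs_score:
 fixes z :: "real^'d => real^'d"
 assumes t: "t \<in> \<Theta>" "(LINT y|M t. (norm (grad (f t) y))\<^sup>2) <= C"
  and z: "z \<in> borel_measurable borel" "integrable (M t) (%y. (norm (z y))\<^sup>2)"
 shows "integrable (M t) (%y. grad (f t) y \<bullet> z y)"
  and "\<bar>LINT y|M t. grad (f t) y \<bullet> z y\<bar> <= sqrt C * sqrt (LINT y|M t. (norm (z y))\<^sup>2)"
proof -
 note c = cs_M[OF t(1) gf_m[OF t(1)] z(1) gi[OF t(1)] z(2)]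
 show "integrable (M t) (%y. grad (f t) y \<bullet> z y)" by (rule c(1))
 have "sqrt (LINT y|M t. (norm (grad (f t) y))\<^sup>2) * sqrt (LINT y|M t. (norm (z y))\<^sup>2) <= sqrt C * sqrt (LINT y|M t. (norm (z y))\<^sup>2)"
  using t(2) by (intro mult_right_mono) auto
 then show "\<bar>LINT y|M t. grad (f t) y \<bullet> z y\<bar> <= sqrt C * sqrt (LINT y|M t. (norm (z y))\<^sup>2)"
  using c(2) by linarith
qed

lemma const_L2:
 fixes z :: "real^'d => real^'d"
 assumes t: "t \<in> \<Theta>" and z: "z \<in> borel_measurable borel" "!!y. norm (z y) <= e"
 shows "integrable (M t) (%y. (norm (z y))\<^sup>2)" "sqrt (LINT y|M t. (norm (z y))\<^sup>2) <= e"
proof -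
 interpret prob_space "M t" by (rule prob_M[OF t])
 have e: "e >= 0" using order_trans[OF norm_ge_zero z(2)] .
 have zm: "(%y. (norm (z y))\<^sup>2) \<in> borel_measurable (M t)"
  using z(1) by (simp add: sets_M cong: measurable_cong_sets)
 have le: "(norm (z y))\<^sup>2 <= e\<^sup>2" for y using z(2) by (intro power_mono) auto
 show i: "integrable (M t) (%y. (norm (z y))\<^sup>2)"
  by (rule integrable_const_bound[where B="e\<^sup>2"]) (use le zm in auto)
 have "(LINT y|M t. (norm (z y))\<^sup>2) <= (LINT y|M t. e\<^sup>2)" by (intro integral_mono i le) auto
 then have "(LINT y|M t. (norm (z y))\<^sup>2) <= e\<^sup>2" by (simp add: prob_space)
 then have "sqrt (LINT y|M t. (norm (z y))\<^sup>2) <= sqrt (e\<^sup>2)" by (rule real_sqrt_le_mono)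
 then show "sqrt (LINT y|M t. (norm (z y))\<^sup>2) <= e" using e by simp
qed

text \<open>The scores converge weakly: against smooth fields by integration by parts, against
 continuous ones by the uniform \<open>L\<^sup>2\<close> bound.\<close>

lemma score_conv_continuous:
 assumes q: "continuous_on UNIV q" "!!x. norm x > R ==> q x = 0"
 shows "(%k. LINT y|M (th k). grad (f (th k)) y \<bullet> (q y *\<^sub>R b)) \<longlonglongrightarrow> (LINT y|M th0. grad (f th0) y \<bullet> (q y *\<^sub>R b))"
proof (rule tendsto_approx)
 fix e :: real assume e: "e > 0"
 define K where "K = sqrt C * norm b + 1"
 have K: "K > 0" using C_nonneg by (simp add: K_def add_nonneg_pos)
 have "\<exists>s. test2 (R + 1) s & (\<forall>x. \<bar>s x - q x\<bar> <= e / K)"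
  by (rule approx_continuous_by_test2[where R=R, OF q]) (use e K in auto)
 then obtain s where s: "test2 (R + 1) s" "!!x. \<bar>s x - q x\<bar> <= e / K" by blast
 have sd: "!!x. s differentiable (at x)" "continuous_on UNIV (grad s)" "!!x. norm x > R + 1 ==> s x = 0"
  using s(1) by (auto simp: test2_def)
 have sc: "continuous_on UNIV s" by (rule diff_imp_cont[OF sd(1)])
 have meas: "q \<in> borel_measurable borel" "s \<in> borel_measurable borel"
  by (rule borel_of_cont, fact)+
 obtain B1 where B1: "!!x. norm (q x) <= B1" using integrable_cont_bdd(2)[OF q] by blast
 obtain B2 where B2: "!!x. norm (s x) <= B2" using integrable_cont_bdd(2)[OF sc sd(3)] by blast
 have near: "\<bar>(LINT y|M t. grad (f t) y \<bullet> (q y *\<^sub>R b)) - (LINT y|M t. grad (f t) y \<bullet> (s y *\<^sub>R b))\<bar> <= e"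
  if t: "t \<in> \<Theta>" "(LINT y|M t. (norm (grad (f t) y))\<^sup>2) <= C" for t
 proof -
  have m1: "(%y. q y *\<^sub>R b) \<in> borel_measurable borel" "(%y. s y *\<^sub>R b) \<in> borel_measurable borel"
   "(%y. (q y - s y) *\<^sub>R b) \<in> borel_measurable borel" using meas by measurable
  have b1: "norm (q y *\<^sub>R b) <= B1 * norm b" and b2: "norm (s y *\<^sub>R b) <= B2 * norm b" for y
   using B1 B2 by (auto intro: mult_right_mono)
  have b3: "norm ((q y - s y) *\<^sub>R b) <= e / K * norm b" for y
   using mult_right_mono[OF s(2)[of y] norm_ge_zero[of b]] by (simp add: abs_minus_commute)
  have "(LINT y|M t. grad (f t) y \<bullet> (q y *\<^sub>R b)) - (LINT y|M t. grad (f t) y \<bullet> (s y *\<^sub>R b))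
    = (LINT y|M t. grad (f t) y \<bullet> ((q y - s y) *\<^sub>R b))"
   using cs_score(1)[OF t m1(1) const_L2(1)[OF t(1) m1(1) b1]] cs_score(1)[OF t m1(2) const_L2(1)[OF t(1) m1(2) b2]]
   by (simp add: left_diff_distrib flip: Bochner_Integration.integral_diff)
  also have "\<bar>...\<bar> <= sqrt C * sqrt (LINT y|M t. (norm ((q y - s y) *\<^sub>R b))\<^sup>2)"
   by (rule cs_score(2)[OF t m1(3) const_L2(1)[OF t(1) m1(3) b3]])
  also have "... <= sqrt C * (e / K * norm b)"
   using const_L2(2)[OF t(1) m1(3) b3] C_nonneg by (intro mult_left_mono) auto
  also have "... = e / K * (sqrt C * norm b)" by simp
  also have "... <= e / K * K" using e K by (intro mult_left_mono) (auto simp: K_def)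
  also have "... = e" using K by simp
  finally show ?thesis .
 qed
 have "(%k. LINT y|M (th k). s y * (grad (f (th k)) y \<bullet> b)) \<longlonglongrightarrow> (LINT y|M th0. s y * (grad (f th0) y \<bullet> b))"
  by (rule score_test_conv[OF th gi sd])
 then have "(%k. LINT y|M (th k). grad (f (th k)) y \<bullet> (s y *\<^sub>R b)) \<longlonglongrightarrow> (LINT y|M th0. grad (f th0) y \<bullet> (s y *\<^sub>R b))"
  by simp
 then show "\<exists>a a0. a \<longlonglongrightarrow> a0 &
  (\<forall>\<^sub>F k in sequentially. \<bar>(LINT y|M (th k). grad (f (th k)) y \<bullet> (q y *\<^sub>R b)) - a k\<bar> <= e) &
  \<bar>(LINT y|M th0. grad (f th0) y \<bullet> (q y *\<^sub>R b)) - a0\<bar> <= e"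
  using near[OF th(1) C(1)] near[OF th(2) C(2)] always_eventually by blast
qed

text \<open>On a bounded set \<open>v (th k)\<close> is replaced by its limit at a cost controlled by Cauchy--Schwarz; the limit field is continuous and can be approximated by test functions.\<close>

lemma score_conv_local:
 assumes R: "R > 0"
 shows "(%k. LINT y|M (th k). grad (f (th k)) y \<bullet> (bump R y *\<^sub>R v (th k) j y))
  \<longlonglongrightarrow> (LINT y|M th0. grad (f th0) y \<bullet> (bump R y *\<^sub>R v th0 j y))"
proof -
 let ?w = "%y. bump R y *\<^sub>R v th0 j y"
 have wc: "continuous_on UNIV ?w" by (intro continuous_intros bump_continuous v_c[OF th(2)])
 have w0: "norm x > R ==> ?w x = 0" for x using R by (simp add: bump_outside)
 obtain B where B: "!!x. norm (?w x) <= B" using integrable_cont_bdd(2)[OF wc w0] by blast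
 have bm: "bump R \<in> borel_measurable borel" by (rule borel_of_cont[OF bump_continuous])
 have wm: "?w \<in> borel_measurable borel" by (rule borel_of_cont[OF wc])
 have bb: "\<bar>bump R y\<bar> <= 1" for y using bump_nonneg[of R y] bump_le_1[of R y] by simp
 \<comment> \<open>the limiting velocity, one coordinate at a time\<close>
 have 1: "(%k. LINT y|M (th k). grad (f (th k)) y \<bullet> ?w y) \<longlonglongrightarrow> (LINT y|M th0. grad (f th0) y \<bullet> ?w y)"
 proof -
  have comp: "continuous_on UNIV (%y. ?w y \<bullet> b)" for b by (intro continuous_intros wc)
  have sum: "(LINT y|M t. grad (f t) y \<bullet> ?w y) = (\<Sum>b\<in>Basis. LINT y|M t. grad (f t) y \<bullet> ((?w y \<bullet> b) *\<^sub>R b))"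
   if t: "t \<in> \<Theta>" "(LINT y|M t. (norm (grad (f t) y))\<^sup>2) <= C" for t
  proof -
   have "grad (f t) y \<bullet> ?w y = (\<Sum>b\<in>Basis. grad (f t) y \<bullet> ((?w y \<bullet> b) *\<^sub>R b))" for y
    by (subst euclidean_representation[of "?w y", symmetric]) (simp only: inner_sum_right)
   moreover have "integrable (M t) (%y. grad (f t) y \<bullet> ((?w y \<bullet> b) *\<^sub>R b))" if b: "b \<in> Basis" for b
   proof -
    have m1: "(%y. (?w y \<bullet> b) *\<^sub>R b) \<in> borel_measurable borel" using wm by measurable
    have b1: "norm ((?w y \<bullet> b) *\<^sub>R b) <= B" for y
    using Basis_le_norm[OF b, of "?w y"] B[of y] b by simp
    show ?thesis by (rule cs_score(1)[OF t m1 const_L2(1)[OF t(1) m1 b1]])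
   qed
   ultimately show ?thesis by (simp only: Bochner_Integration.integral_sum)
  qed
  have "(%k. \<Sum>b\<in>Basis. LINT y|M (th k). grad (f (th k)) y \<bullet> ((?w y \<bullet> b) *\<^sub>R b))
    \<longlonglongrightarrow> (\<Sum>b\<in>Basis. LINT y|M th0. grad (f th0) y \<bullet> ((?w y \<bullet> b) *\<^sub>R b))"
   by (intro tendsto_sum score_conv_continuous[where R=R] comp) (simp add: w0)
  then show ?thesis by (simp only: sum[OF th(1) C(1)] sum[OF th(2) C(2)])
 qed
 let ?r = "%k y. bump R y *\<^sub>R (v (th k) j y - v th0 j y)"
 have rm: "?r k \<in> borel_measurable borel" for k using v_m[OF th(1)] v_m[OF th(2)] bm by measurable
 have rn: "(norm (?r k y))\<^sup>2 <= 2 * (norm (v (th k) j y))\<^sup>2 + 2 * B\<^sup>2" for k y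
 proof -
  have "?r k y = bump R y *\<^sub>R v (th k) j y + (- ?w y)" by (simp add: scaleR_diff_right)
  then have "(norm (?r k y))\<^sup>2 <= (1 + 1) * (norm (bump R y *\<^sub>R v (th k) j y))\<^sup>2 + (1 + 1 / 1) * (norm (- ?w y))\<^sup>2"
   by (simp only: norm_add_sq_le[OF zero_less_one])
  moreover have "(norm (bump R y *\<^sub>R v (th k) j y))\<^sup>2 <= (norm (v (th k) j y))\<^sup>2"
   using bb[of y] by (intro power_mono) (auto simp: mult_left_le_one_le)
  moreover have "(norm (- ?w y))\<^sup>2 <= B\<^sup>2" using B[of y] by (intro power_mono) auto
  ultimately show ?thesis by (rule two_squares_bound)
 qed
 have ri: "integrable (M (th k)) (%y. (norm (?r k y))\<^sup>2)" for k
 proof (rule integrable_bd)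
  interpret prob_space "M (th k)" by (rule prob_M[OF th(1)])
  show "integrable (M (th k)) (%y. 2 * (norm (v (th k) j y))\<^sup>2 + 2 * B\<^sup>2)" using v_sq_int[OF th(1)] by simp
  show "(%y. (norm (?r k y))\<^sup>2) \<in> borel_measurable (M (th k))"
   unfolding measurable_cong_sets[OF sets_M refl] using rm[of k] by measurable
  show "AE y in M (th k). norm ((norm (?r k y))\<^sup>2) <= norm (2 * (norm (v (th k) j y))\<^sup>2 + 2 * B\<^sup>2)"
   using rn by (intro AE_I2) (simp del: norm_scaleR)
 qed
 have "(%k. LINT y|M (th k). (norm (?r k y))\<^sup>2) \<longlonglongrightarrow> (LINT y|M th0. 0)"
 proof (rule push_conv[OF th, where B="2 + 2 * B\<^sup>2" and j=j])
  show "(%y. (norm (?r k y))\<^sup>2) \<in> borel_measurable borel" for k using rm[of k] by measurable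
  fix y :: "nat => real^'d" and y0 assume y: "y \<longlonglongrightarrow> y0"
  have v0: "(%k. v th0 j (y k)) \<longlonglongrightarrow> v th0 j y0"
   using continuous_on_tendsto_compose[OF v_c[OF th(2)] y] by simp
  have b0: "(%k. bump R (y k)) \<longlonglongrightarrow> bump R y0"
   using continuous_on_tendsto_compose[OF bump_continuous y] by simp
  have "(%k. (norm (?r k (y k)))\<^sup>2) \<longlonglongrightarrow> (norm (bump R y0 *\<^sub>R (v th0 j y0 - v th0 j y0)))\<^sup>2"
   by (intro tendsto_intros b0 v0 v_tendsto[OF th y])
  then show "(%k. (norm (?r k (y k)))\<^sup>2) \<longlonglongrightarrow> 0" by simp
 next
  fix k y
  have "2 * (norm (v (th k) j y))\<^sup>2 + 2 * B\<^sup>2 <= (2 + 2 * B\<^sup>2) * (1 + (norm (v (th k) j y))\<^sup>2)"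
   by (simp add: algebra_simps)
  then show "\<bar>(norm (?r k y))\<^sup>2\<bar> <= (2 + 2 * B\<^sup>2) * (1 + (norm (v (th k) j y))\<^sup>2)"
   unfolding abs_power2 by (rule order_trans[OF rn])
 qed simp
 then have "(%k. sqrt C * sqrt (LINT y|M (th k). (norm (?r k y))\<^sup>2)) \<longlonglongrightarrow> sqrt C * sqrt 0"
  by (intro tendsto_intros) simp
 then have z: "(%k. sqrt C * sqrt (LINT y|M (th k). (norm (?r k y))\<^sup>2)) \<longlonglongrightarrow> 0" by simp
 have 2: "(%k. LINT y|M (th k). grad (f (th k)) y \<bullet> ?r k y) \<longlonglongrightarrow> 0"
 proof (rule Lim_null_comparison[OF _ z], intro always_eventually allI)
  show "norm (LINT y|M (th k). grad (f (th k)) y \<bullet> ?r k y) <= sqrt C * sqrt (LINT y|M (th k). (norm (?r k y))\<^sup>2)" for k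
   unfolding real_norm_def by (rule cs_score(2)[OF th(1) C(1) rm ri])
 qed
 have eq: "(LINT y|M (th k). grad (f (th k)) y \<bullet> ?w y) + (LINT y|M (th k). grad (f (th k)) y \<bullet> ?r k y)
   = (LINT y|M (th k). grad (f (th k)) y \<bullet> (bump R y *\<^sub>R v (th k) j y))" for k
 proof -
  have "integrable (M (th k)) (%y. grad (f (th k)) y \<bullet> ?w y)"
   by (rule cs_score(1)[OF th(1) C(1) wm const_L2(1)[OF th(1) wm B]])
  moreover have "integrable (M (th k)) (%y. grad (f (th k)) y \<bullet> ?r k y)"
   by (rule cs_score(1)[OF th(1) C(1) rm ri])
  ultimately have "(LINT y|M (th k). grad (f (th k)) y \<bullet> ?w y) + (LINT y|M (th k). grad (f (th k)) y \<bullet> ?r k y)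
   = (LINT y|M (th k). grad (f (th k)) y \<bullet> ?w y + grad (f (th k)) y \<bullet> ?r k y)"
   by (rule Bochner_Integration.integral_add[symmetric])
  also have "... = (LINT y|M (th k). grad (f (th k)) y \<bullet> (bump R y *\<^sub>R v (th k) j y))"
   by (intro integral_cg refl) (simp add: inner_diff_right algebra_simps)
  finally show ?thesis .
 qed
 show ?thesis using tendsto_add[OF 1 2] by (simp only: eq add_0_right)
qed

lemma weighted_velocity_conv:
 fixes a :: "nat => real^'d => real"
 assumes a: "!!k. a k \<in> borel_measurable borel" "a0 \<in> borel_measurable borel" "!!k y. \<bar>a k y\<bar> <= 1"
  and lim: "!!y y0. y \<longlonglongrightarrow> y0 ==> (%k. a k (y k)) \<longlonglongrightarrow> a0 y0"
 shows "(%k. LINT y|M (th k). (norm (a k y *\<^sub>R v (th k) j y))\<^sup>2) \<longlonglongrightarrow> (LINT y|M th0. (norm (a0 y *\<^sub>R v th0 j y))\<^sup>2)"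
proof (rule push_conv[OF th, where B=1 and j=j])
 show "(%y. (norm (a k y *\<^sub>R v (th k) j y))\<^sup>2) \<in> borel_measurable borel" for k using a(1)[of k] v_m[OF th(1)] by measurable
 show "(%y. (norm (a0 y *\<^sub>R v th0 j y))\<^sup>2) \<in> borel_measurable borel" using a(2) v_m[OF th(2)] by measurable
 show "(%k. (norm (a k (y k) *\<^sub>R v (th k) j (y k)))\<^sup>2) \<longlonglongrightarrow> (norm (a0 y0 *\<^sub>R v th0 j y0))\<^sup>2" if "y \<longlonglongrightarrow> y0" for y y0
  by (intro tendsto_intros lim[OF that] v_tendsto[OF th that])
 fix k y
 have "norm (a k y *\<^sub>R v (th k) j y) <= norm (v (th k) j y)"
  using a(3)[of k y] by (simp add: mult_left_le_one_le)
 then have "(norm (a k y *\<^sub>R v (th k) j y))\<^sup>2 <= (norm (v (th k) j y))\<^sup>2" by (intro power_mono) auto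
 then have "(norm (a k y *\<^sub>R v (th k) j y))\<^sup>2 <= 1 * (1 + (norm (v (th k) j y))\<^sup>2)" by (rule order_trans) simp
 then show "\<bar>(norm (a k y *\<^sub>R v (th k) j y))\<^sup>2\<bar> <= 1 * (1 + (norm (v (th k) j y))\<^sup>2)"
  by (simp only: abs_power2)
qed

text \<open>The mass of the velocity outside a large ball is small uniformly along the sequence.\<close>

lemma score_conv:
 "(%k. LINT y|M (th k). grad (f (th k)) y \<bullet> v (th k) j y) \<longlonglongrightarrow> (LINT y|M th0. grad (f th0) y \<bullet> v th0 j y)"
proof (rule tendsto_approx)
 fix e :: real assume e: "e > 0"
 have bm: "bump R \<in> borel_measurable borel" for R by (rule borel_of_cont[OF bump_continuous])
 have bb: "\<bar>1 - bump R y\<bar> <= 1" for R and y :: "real^'d" using bump_nonneg[of R y] bump_le_1[of R y] by simp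
 have bt: "\<bar>bump R y\<bar> <= 1" for R and y :: "real^'d" using bump_nonneg[of R y] bump_le_1[of R y] by simp
 have im: "(%y. 1 - bump R y) \<in> borel_measurable borel" for R using bm[of R] by measurable
 define \<tau> where "\<tau> = (%R. LINT y|M th0. (norm ((1 - bump R y) *\<^sub>R v th0 j y))\<^sup>2)"
 have "(%n. \<tau> (real n)) \<longlonglongrightarrow> (LINT y|M th0. 0)"
  unfolding \<tau>_def
 proof (rule integral_dominated_convergence[where w="%y. (norm (v th0 j y))\<^sup>2"])
  show "(%y. (norm ((1 - bump (real n) y) *\<^sub>R v th0 j y))\<^sup>2) \<in> borel_measurable (M th0)" for n
   unfolding measurable_cong_sets[OF sets_M refl] using im[of "real n"] v_m[OF th(2), of j] by measurable
  show "AE y in M th0. (%n. (norm ((1 - bump (real n) y) *\<^sub>R v th0 j y))\<^sup>2) \<longlonglongrightarrow> 0"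
  proof (rule AE_I2)
   fix y
   have "(%n. (norm ((1 - bump (real n) y) *\<^sub>R v th0 j y))\<^sup>2) \<longlonglongrightarrow> (norm ((1 - 1 :: real) *\<^sub>R v th0 j y))\<^sup>2"
    by (intro tendsto_intros bump_tendsto_1[OF filterlim_real_sequentially tendsto_const])
   then show "(%n. (norm ((1 - bump (real n) y) *\<^sub>R v th0 j y))\<^sup>2) \<longlonglongrightarrow> 0" by simp
  qed
  show "AE y in M th0. norm ((norm ((1 - bump (real n) y) *\<^sub>R v th0 j y))\<^sup>2) <= (norm (v th0 j y))\<^sup>2" for n
   using bb by (intro AE_I2) (auto intro!: power_mono mult_left_le_one_le)
 qed (use v_sq_int[OF th(2)] in auto)
 then have "(%n. sqrt C * sqrt (\<tau> (real n))) \<longlonglongrightarrow> sqrt C * sqrt 0" by (intro tendsto_intros) simp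
 then have "\<forall>\<^sub>F n in sequentially. sqrt C * sqrt (\<tau> (real n)) < e" using e by (intro order_tendstoD) auto
 then obtain N where N: "!!n. n >= N ==> sqrt C * sqrt (\<tau> (real n)) < e"
  by (auto simp: eventually_sequentially)
 define n where "n = Suc N"
 have n: "sqrt C * sqrt (\<tau> (real n)) < e" "n > 0" using N[of n] by (auto simp: n_def)
 define R where "R = real n"
 have R: "R > 0" using n by (simp add: R_def)
 have L: "(%k. sqrt C * sqrt (LINT y|M (th k). (norm ((1 - bump R y) *\<^sub>R v (th k) j y))\<^sup>2)) \<longlonglongrightarrow> sqrt C * sqrt (\<tau> R)"
  unfolding \<tau>_def
 proof (intro tendsto_mult tendsto_const tendsto_real_sqrt)
  have lim: "(%k. 1 - bump R (y k)) \<longlonglongrightarrow> 1 - bump R y0" if "y \<longlonglongrightarrow> y0" for y and y0 :: "real^'d"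
   by (intro tendsto_diff tendsto_const) (use continuous_on_tendsto_compose[OF bump_continuous that] in simp)
  show "(%k. LINT y|M (th k). (norm ((1 - bump R y) *\<^sub>R v (th k) j y))\<^sup>2) \<longlonglongrightarrow> (LINT y|M th0. (norm ((1 - bump R y) *\<^sub>R v th0 j y))\<^sup>2)"
   by (rule weighted_velocity_conv[where a="%_ y. 1 - bump R y", OF im im bb lim])
 qed
 have near: "\<bar>(LINT y|M t. grad (f t) y \<bullet> v t j y) - (LINT y|M t. grad (f t) y \<bullet> (bump R y *\<^sub>R v t j y))\<bar>
   <= sqrt C * sqrt (LINT y|M t. (norm ((1 - bump R y) *\<^sub>R v t j y))\<^sup>2)"
  if t: "t \<in> \<Theta>" "(LINT y|M t. (norm (grad (f t) y))\<^sup>2) <= C" for t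
 proof -
  note vm = v_m[OF t(1), of j] and vi = v_sq_int[OF t(1), of j]
  have m1: "(%y. bump R y *\<^sub>R v t j y) \<in> borel_measurable borel" "(%y. (1 - bump R y) *\<^sub>R v t j y) \<in> borel_measurable borel"
   using vm bm[of R] by measurable
  have "(LINT y|M t. grad (f t) y \<bullet> v t j y) - (LINT y|M t. grad (f t) y \<bullet> (bump R y *\<^sub>R v t j y))
   = (LINT y|M t. grad (f t) y \<bullet> v t j y - grad (f t) y \<bullet> (bump R y *\<^sub>R v t j y))"
   by (rule Bochner_Integration.integral_diff[symmetric, OF cs_score(1)[OF t vm vi]
    cs_score(1)[OF t m1(1) bounded_factor_L2[OF t(1) bm vm vi bt]]])
  also have "... = (LINT y|M t. grad (f t) y \<bullet> ((1 - bump R y) *\<^sub>R v t j y))"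
   by (intro integral_cg refl) (simp add: left_diff_distrib)
  finally have e: "(LINT y|M t. grad (f t) y \<bullet> v t j y) - (LINT y|M t. grad (f t) y \<bullet> (bump R y *\<^sub>R v t j y))
   = (LINT y|M t. grad (f t) y \<bullet> ((1 - bump R y) *\<^sub>R v t j y))" .
  show ?thesis unfolding e by (rule cs_score(2)[OF t m1(2) bounded_factor_L2[OF t(1) im vm vi bb]])
 qed
 have "\<forall>\<^sub>F k in sequentially. sqrt C * sqrt (LINT y|M (th k). (norm ((1 - bump R y) *\<^sub>R v (th k) j y))\<^sup>2) < e"
  by (rule order_tendstoD(2)[OF L]) (use n in \<open>simp add: R_def\<close>)
 then have ev: "\<forall>\<^sub>F k in sequentially. \<bar>(LINT y|M (th k). grad (f (th k)) y \<bullet> v (th k) j y)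
   - (LINT y|M (th k). grad (f (th k)) y \<bullet> (bump R y *\<^sub>R v (th k) j y))\<bar> <= e"
  by (rule eventually_mono) (rule order_trans[OF near[OF th(1) C(1)] less_imp_le])
 have nl: "sqrt C * sqrt (\<tau> R) <= e" using n(1) by (simp add: R_def)
 have n0: "\<bar>(LINT y|M th0. grad (f th0) y \<bullet> v th0 j y) - (LINT y|M th0. grad (f th0) y \<bullet> (bump R y *\<^sub>R v th0 j y))\<bar> <= e"
  by (rule order_trans[OF near[OF th(2) C(2)] nl[unfolded \<tau>_def]])
 show "\<exists>a a0. a \<longlonglongrightarrow> a0 & (\<forall>\<^sub>F k in sequentially. \<bar>(LINT y|M (th k). grad (f (th k)) y \<bullet> v (th k) j y) - a k\<bar> <= e)
   & \<bar>(LINT y|M th0. grad (f th0) y \<bullet> v th0 j y) - a0\<bar> <= e"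
  by (rule exI[where x="%k. LINT y|M (th k). grad (f (th k)) y \<bullet> (bump R y *\<^sub>R v (th k) j y)"],
    rule exI[where x="LINT y|M th0. grad (f th0) y \<bullet> (bump R y *\<^sub>R v th0 j y)"],
    intro conjI score_conv_local[OF R] ev n0)
qed

end

end

context density_family
begin

definition ve where "ve th e y = (\<Sum>j\<in>UNIV. e $ j *\<^sub>R v th j y)"

text \<open>With \<open>d = exp (- n)\<close> the derivative of the regularised entropy is at most \<open>n\<close>, so a bump of
 radius \<open>n\<^sup>2\<close>, with slope of order \<open>1/n\<^sup>2\<close>, localises it at vanishing cost.\<close>

definition G where "G n th y = bump ((real n)\<^sup>2) y * reg' (exp (- real n)) (exp (f th y))"

definition E where "E n th = (LINT y|lborel. bump ((real n)\<^sup>2) y * (reg (exp (- real n)) (\<rho> th y / m y) * m y))"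

lemma exp_f: "th \<in> \<Theta> ==> exp (f th y) = \<rho> th y / m y"
 using rho_pos m_pos by (simp add: f_def)

lemma d_range: "0 < exp (- real n)" "exp (- real n) <= 1"
 by auto

lemma G_props:
 assumes t: "th \<in> \<Theta>" and n: "n > 0"
 shows "G n th differentiable (at y)"
  and "grad (G n th) y = (bump ((real n)\<^sup>2) y * slope (exp (- real n)) (f th y)) *\<^sub>R grad (f th) y
    + reg' (exp (- real n)) (exp (f th y)) *\<^sub>R grad (bump ((real n)\<^sup>2)) y"
  and "norm y > (real n)\<^sup>2 ==> G n th y = 0"
  and "\<bar>reg' (exp (- real n)) (exp (f th y))\<bar> <= real n"
proof -
 note c = grad_compose_real[OF f_diff[OF t] slope_derivative(1)[OF d_range, of n]]
 show "G n th differentiable (at y)"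
  unfolding G_def[abs_def] by (intro differentiable_mult bump_differentiable c(3))
 show "grad (G n th) y = (bump ((real n)\<^sup>2) y * slope (exp (- real n)) (f th y)) *\<^sub>R grad (f th) y
    + reg' (exp (- real n)) (exp (f th y)) *\<^sub>R grad (bump ((real n)\<^sup>2)) y"
  unfolding G_def[abs_def] by (subst grad_mult[OF bump_differentiable c(3)]) (simp add: c(2))
 show "norm y > (real n)\<^sup>2 ==> G n th y = 0" using n by (simp add: G_def bump_outside)
 show "\<bar>reg' (exp (- real n)) (exp (f th y))\<bar> <= real n"
  using reg'_bound[OF d_range exp_gt_zero, of n "f th y"] by simp
qed

text \<open>The slope of the regularised logarithm is at most 1, and the gradient of the bump, of order \<open>1/n\<^sup>2\<close>, compensates the height \<open>n\<close>.\<close>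

lemma G_L2:
 assumes t: "th \<in> \<Theta>" and n: "n > 0" and gi: "integrable (M th) (%y. (norm (grad (f th) y))\<^sup>2)"
 shows "integrable (M th) (%y. (norm (grad (G n th) y))\<^sup>2)"
proof (rule integrable_bd)
 interpret prob_space "M th" by (rule prob_M[OF t])
 show "integrable (M th) (%y. 2 * (norm (grad (f th) y))\<^sup>2 + 2 * 6\<^sup>2)" using gi by simp
 have "(%y. (norm (grad (G n th) y))\<^sup>2) \<in> borel_measurable borel"
  using grad_measurable[OF G_props(1)[OF t n]] by measurable
 then show "(%y. (norm (grad (G n th) y))\<^sup>2) \<in> borel_measurable (M th)" by (simp add: sets_M cong: measurable_cong_sets)
 show "AE y in M th. norm ((norm (grad (G n th) y))\<^sup>2) <= norm (2 * (norm (grad (f th) y))\<^sup>2 + 2 * 6\<^sup>2)"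
 proof (rule AE_I2)
  fix y
  let ?a = "(bump ((real n)\<^sup>2) y * slope (exp (- real n)) (f th y)) *\<^sub>R grad (f th) y"
  let ?b = "reg' (exp (- real n)) (exp (f th y)) *\<^sub>R grad (bump ((real n)\<^sup>2)) y"
  have "bump ((real n)\<^sup>2) y * slope (exp (- real n)) (f th y) <= 1"
   using bump_le_1 bump_nonneg slope_derivative(2,3)[OF d_range] by (intro mult_le_one) auto
  then have a: "norm ?a <= norm (grad (f th) y)"
   using bump_nonneg[of "(real n)\<^sup>2" y] slope_derivative(2)[OF d_range, of n "f th y"]
   by (simp add: mult_left_le_one_le)
  have "norm ?b <= real n * (6 / (real n)\<^sup>2)"
   unfolding norm_scaleR using G_props(4)[OF t n] norm_grad_bump[of "(real n)\<^sup>2" y] n by (intro mult_mono) auto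
  also have "... = 6 / real n" using n by (simp add: power2_eq_square)
  also have "... <= 6" using n by (simp add: divide_le_eq)
  finally have b: "norm ?b <= 6" .
  have "(norm (?a + ?b))\<^sup>2 <= (1 + 1) * (norm ?a)\<^sup>2 + (1 + 1 / 1) * (norm ?b)\<^sup>2"
   by (rule norm_add_sq_le) simp
  moreover have "(norm ?a)\<^sup>2 <= (norm (grad (f th) y))\<^sup>2" using a by (intro power_mono) auto
  moreover have "(norm ?b)\<^sup>2 <= 6\<^sup>2" using b by (intro power_mono) auto
  ultimately have "(norm (?a + ?b))\<^sup>2 <= 2 * (norm (grad (f th) y))\<^sup>2 + 2 * 6\<^sup>2" by (rule two_squares_bound)
  then show "norm ((norm (grad (G n th) y))\<^sup>2) <= norm (2 * (norm (grad (f th) y))\<^sup>2 + 2 * 6\<^sup>2)"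
   unfolding G_props(2)[OF t n] by simp
 qed
qed

text \<open>The test functions \<open>G (N k) (th k)\<close> differ from the score by a factor tending to 1 and a uniformly small field.\<close>

lemma G_conv:
 assumes th: "!!k. th k \<in> \<Theta>" "th0 \<in> \<Theta>" "th \<longlonglongrightarrow> th0"
  and gi: "!!th. th \<in> \<Theta> ==> integrable (M th) (%y. (norm (grad (f th) y))\<^sup>2)"
  and C: "!!k. (LINT y|M (th k). (norm (grad (f (th k)) y))\<^sup>2) <= C"
   "(LINT y|M th0. (norm (grad (f th0) y))\<^sup>2) <= C"
  and N: "filterlim N at_top sequentially" "!!k. N k > 0"
 shows "(%k. LINT y|M (th k). grad (G (N k) (th k)) y \<bullet> v (th k) j y) \<longlonglongrightarrow> (LINT y|M th0. grad (f th0) y \<bullet> v th0 j y)"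
proof -
 note ctx = th gi C
 define s where "s = (%k y. bump ((real (N k))\<^sup>2) y * slope (exp (- real (N k))) (f (th k) y))"
 define w where "w = (%k y. reg' (exp (- real (N k))) (exp (f (th k) y)) *\<^sub>R grad (bump ((real (N k))\<^sup>2)) y)"
 have Nr: "filterlim (%k. real (N k)) at_top sequentially"
  by (rule filterlim_compose[OF filterlim_real_sequentially N(1)])
 have s01: "0 <= s k y" "s k y <= 1" for k y
  unfolding s_def using bump_nonneg bump_le_1 slope_derivative(2,3)[OF d_range]
  by (auto intro!: mult_nonneg_nonneg mult_le_one)
 have bm: "bump R \<in> borel_measurable borel" for R by (rule borel_of_cont[OF bump_continuous])
 have fm: "f (th k) \<in> borel_measurable borel" for k by (rule borel_of_cont[OF f_c[OF th(1)]])
 have sm: "s k \<in> borel_measurable borel" for k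
  unfolding s_def slope_def using bm[of "(real (N k))\<^sup>2"] fm[of k] by measurable
 have gbm: "grad (bump R) \<in> borel_measurable borel" for R by (rule borel_of_cont[OF grad_bump_continuous])
 have wm: "w k \<in> borel_measurable borel" for k
  unfolding w_def reg'_def using gbm[of "(real (N k))\<^sup>2"] fm[of k] by measurable
 have s1: "\<bar>1 - s k y\<bar> <= 1" for k y using s01[of k y] by simp
 have slim: "(%k. s k (y k)) \<longlonglongrightarrow> 1" if "y \<longlonglongrightarrow> y0" for y and y0 :: "real^'d"
 proof -
  have "(%k. s k (y k)) \<longlonglongrightarrow> 1 * 1"
   unfolding s_def
   by (intro tendsto_mult bump_tendsto_1[OF _ that] filterlim_pow_at_top[OF _ Nr] slope_tendsto[OF N(1) f_tendsto[OF th that]]) simp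
  then show ?thesis by simp
 qed
 have mm: "(%y. 1 - s k y) \<in> borel_measurable borel" for k using sm[of k] by measurable
 have lim1: "(%k. LINT y|M (th k). (norm ((1 - s k y) *\<^sub>R v (th k) j y))\<^sup>2) \<longlonglongrightarrow> (LINT y|M th0. (norm ((0 :: real) *\<^sub>R v th0 j y))\<^sup>2)"
 proof (rule weighted_velocity_conv[OF ctx, where a="%k y. 1 - s k y" and ?a0.0="%_. 0"])
  show "(%k. 1 - s k (y k)) \<longlonglongrightarrow> 0" if "y \<longlonglongrightarrow> y0" for y and y0 :: "real^'d"
   using tendsto_diff[OF tendsto_const slim[OF that], of 1] by simp
 qed (use mm s1 in auto)
 have wb: "norm (w k y) <= 6 / real (N k)" for k y
 proof -
  have "norm (w k y) <= real (N k) * (6 / (real (N k))\<^sup>2)"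
   unfolding w_def norm_scaleR using G_props(4)[OF th(1) N(2)] norm_grad_bump[of "(real (N k))\<^sup>2" y] N(2)[of k]
   by (intro mult_mono) auto
  also have "... = 6 / real (N k)" using N(2)[of k] by (simp add: power2_eq_square)
  finally show ?thesis .
 qed
 have lim2: "(%k. LINT y|M (th k). w k y \<bullet> v (th k) j y) \<longlonglongrightarrow> (LINT y|M th0. 0)"
 proof (rule push_conv[OF th, where B=6 and j=j])
  show "(%y. w k y \<bullet> v (th k) j y) \<in> borel_measurable borel" for k using wm[of k] v_m[OF th(1)] by measurable
  show "(%k. w k (y k) \<bullet> v (th k) j (y k)) \<longlonglongrightarrow> 0" if "y \<longlonglongrightarrow> y0" for y y0
  proof -
   have "\<forall>\<^sub>F k in sequentially. norm (w k (y k)) <= 6 / real (N k)" using wb by simp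
   then have "(%k. w k (y k)) \<longlonglongrightarrow> 0"
    by (rule Lim_null_comparison[OF _ real_tendsto_divide_at_top[OF tendsto_const Nr]])
   from tendsto_inner[OF this v_tendsto[OF th that]] show ?thesis by simp
  qed
  fix k y
  have "\<bar>w k y \<bullet> v (th k) j y\<bar> <= norm (w k y) * norm (v (th k) j y)" by (rule Cauchy_Schwarz_ineq2)
  also have "... <= 6 * (1 + (norm (v (th k) j y))\<^sup>2)"
  proof (rule mult_mono)
   have "6 / real (N k) <= 6" using N(2)[of k] by (simp add: divide_le_eq)
   then show "norm (w k y) <= 6" using wb[of k y] by linarith
   have "2 * norm (v (th k) j y) <= 1 + (norm (v (th k) j y))\<^sup>2"
    using sum_squares_bound[of 1 "norm (v (th k) j y)"] by simp
   then show "norm (v (th k) j y) <= 1 + (norm (v (th k) j y))\<^sup>2" using norm_ge_zero[of "v (th k) j y"] by linarith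
  qed auto
  finally show "\<bar>w k y \<bullet> v (th k) j y\<bar> <= 6 * (1 + (norm (v (th k) j y))\<^sup>2)" .
 qed simp
 have lim3: "(%k. LINT y|M (th k). grad (f (th k)) y \<bullet> ((1 - s k y) *\<^sub>R v (th k) j y)) \<longlonglongrightarrow> 0"
 proof (rule Lim_null_comparison)
  have "(%k. sqrt C * sqrt (LINT y|M (th k). (norm ((1 - s k y) *\<^sub>R v (th k) j y))\<^sup>2)) \<longlonglongrightarrow> sqrt C * sqrt 0"
   using lim1 by (intro tendsto_intros) simp
  then show "(%k. sqrt C * sqrt (LINT y|M (th k). (norm ((1 - s k y) *\<^sub>R v (th k) j y))\<^sup>2)) \<longlonglongrightarrow> 0" by simp
  have "\<bar>LINT y|M (th k). grad (f (th k)) y \<bullet> ((1 - s k y) *\<^sub>R v (th k) j y)\<bar>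
    <= sqrt C * sqrt (LINT y|M (th k). (norm ((1 - s k y) *\<^sub>R v (th k) j y))\<^sup>2)" for k
  proof (rule cs_score(2)[OF ctx th(1) C(1)])
   show "(%y. (1 - s k y) *\<^sub>R v (th k) j y) \<in> borel_measurable borel" using mm[of k] v_m[OF th(1)] by measurable
   show "integrable (M (th k)) (%y. (norm ((1 - s k y) *\<^sub>R v (th k) j y))\<^sup>2)"
    by (rule bounded_factor_L2[OF th(1) mm v_m[OF th(1)] v_sq_int[OF th(1)] s1])
  qed
  then show "\<forall>\<^sub>F k in sequentially. norm (LINT y|M (th k). grad (f (th k)) y \<bullet> ((1 - s k y) *\<^sub>R v (th k) j y))
    <= sqrt C * sqrt (LINT y|M (th k). (norm ((1 - s k y) *\<^sub>R v (th k) j y))\<^sup>2)"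
   by (intro always_eventually allI) (simp only: real_norm_def)
 qed
 have eq: "(LINT y|M (th k). grad (G (N k) (th k)) y \<bullet> v (th k) j y)
   = (LINT y|M (th k). grad (f (th k)) y \<bullet> v (th k) j y)
    - (LINT y|M (th k). grad (f (th k)) y \<bullet> ((1 - s k y) *\<^sub>R v (th k) j y))
    + (LINT y|M (th k). w k y \<bullet> v (th k) j y)" for k
 proof -
  have i1: "integrable (M (th k)) (%y. grad (f (th k)) y \<bullet> v (th k) j y)"
   by (rule cs_M(1)[OF th(1) gf_m[OF th(1)] v_m[OF th(1)] gi[OF th(1)] v_sq_int[OF th(1)]])
  have i2: "integrable (M (th k)) (%y. grad (f (th k)) y \<bullet> ((1 - s k y) *\<^sub>R v (th k) j y))"
  proof (rule cs_M(1)[OF th(1) gf_m[OF th(1)] _ gi[OF th(1)]])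
   show "(%y. (1 - s k y) *\<^sub>R v (th k) j y) \<in> borel_measurable borel" using mm[of k] v_m[OF th(1)] by measurable
   show "integrable (M (th k)) (%y. (norm ((1 - s k y) *\<^sub>R v (th k) j y))\<^sup>2)"
    by (rule bounded_factor_L2[OF th(1) mm v_m[OF th(1)] v_sq_int[OF th(1)] s1])
  qed
  have i3: "integrable (M (th k)) (%y. w k y \<bullet> v (th k) j y)"
   by (rule cs_M(1)[OF th(1) wm v_m[OF th(1)] const_L2(1)[OF ctx th(1) wm wb] v_sq_int[OF th(1)]])
  have "grad (G (N k) (th k)) y \<bullet> v (th k) j y = grad (f (th k)) y \<bullet> v (th k) j y
    - grad (f (th k)) y \<bullet> ((1 - s k y) *\<^sub>R v (th k) j y) + w k y \<bullet> v (th k) j y" for y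
   unfolding G_props(2)[OF th(1) N(2)] w_def s_def by (simp add: inner_add_left algebra_simps)
  then show ?thesis using i1 i2 i3 by simp
 qed
 have "(%k. (LINT y|M (th k). grad (f (th k)) y \<bullet> v (th k) j y)
    - (LINT y|M (th k). grad (f (th k)) y \<bullet> ((1 - s k y) *\<^sub>R v (th k) j y))
    + (LINT y|M (th k). w k y \<bullet> v (th k) j y))
   \<longlonglongrightarrow> (LINT y|M th0. grad (f th0) y \<bullet> v th0 j y) - 0 + (LINT y|M th0. 0)"
  by (intro tendsto_add tendsto_diff score_conv[OF ctx] lim3 lim2)
 then show ?thesis by (simp only: eq) simp
qed

end

section \<open>The continuity equation\<close>

context density_family
begin

lemma ve_cont: "continuous_on (\<Theta> \<times> UNIV) (%z. \<rho> (fst z) (snd z) *\<^sub>R ve (fst z) e (snd z))"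
 unfolding ve_def by (intro continuous_intros rho_cont v_cont)

lemma ve_c: "th \<in> \<Theta> ==> continuous_on UNIV (ve th e)"
 unfolding ve_def [abs_def] by (intro continuous_intros v_c)

lemma T_line:
 assumes "th + s *\<^sub>R e \<in> \<Theta>"
 shows "((%s. T (th + s *\<^sub>R e) x) has_derivative (%h. h *\<^sub>R ve (th + s *\<^sub>R e) e (T (th + s *\<^sub>R e) x))) (at s)"
proof -
 have l: "((%s. th + s *\<^sub>R e) has_derivative (%h. h *\<^sub>R e)) (at s)" by (auto intro!: derivative_eq_intros)
 show ?thesis
  using has_derivative_compose[OF l T_deriv[OF assms, of x]]
  by (simp add: ve_def scaleR_sum_right)
qed

lemma test_line:
 assumes "th + s *\<^sub>R e \<in> \<Theta>" and q: "!!x. q differentiable (at x)"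
 shows "((%s. q (T (th + s *\<^sub>R e) x)) has_real_derivative
  grad q (T (th + s *\<^sub>R e) x) \<bullet> ve (th + s *\<^sub>R e) e (T (th + s *\<^sub>R e) x)) (at s)"
 using has_derivative_compose[OF T_line[OF assms(1)] grad_has_derivative[OF q]]
 by (simp add: has_field_derivative_def mult.commute[of _ "grad q _ \<bullet> _"])

lemma segment_in_Theta:
 assumes "th \<in> \<Theta>" "r > 0"
 shows "\<exists>\<delta>>0. \<forall>s. \<bar>s\<bar> <= \<delta> --> th + s *\<^sub>R e \<in> \<Theta> & norm (s *\<^sub>R e) < r"
proof -
 obtain r2 where r2: "r2 > 0" "ball th r2 \<subseteq> \<Theta>" using open_Theta assms(1) by (auto simp: open_contains_ball)
 define \<delta> where "\<delta> = min r r2 / 2 / (norm e + 1)"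
 have n1: "norm e + 1 > 0" by (intro add_nonneg_pos) auto
 have cc: "a / c * c = a" if "c > 0" for a c :: real using that by simp
 have \<delta>: "\<delta> > 0" unfolding \<delta>_def using assms(2) r2(1) n1 by simp
 have "th + s *\<^sub>R e \<in> \<Theta> & norm (s *\<^sub>R e) < r" if s: "\<bar>s\<bar> <= \<delta>" for s
 proof -
  have "norm (s *\<^sub>R e) <= \<delta> * (norm e + 1)" using s \<delta> by (simp, intro mult_mono) auto
  also have "... = min r r2 / 2" unfolding \<delta>_def by (rule cc[OF n1])
  also have "... < min r r2" using assms(2) r2(1) by (simp add: min_def)
  finally have "norm (s *\<^sub>R e) < min r r2" .
  moreover from this have "th + s *\<^sub>R e \<in> ball th r2" by (simp add: dist_norm)
  ultimately show ?thesis using r2(2) by auto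
 qed
 with \<delta> show ?thesis by blast
qed

lemma ve_bound:
 assumes "!!j. (norm (v th j y))\<^sup>2 <= l"
 shows "norm (ve th e y) <= (\<Sum>j\<in>UNIV. \<bar>e $ j\<bar>) * (1 + l)"
proof -
 have b: "norm (v th j y) <= 1 + l" for j
 proof -
  have "2 * norm (v th j y) <= 1 + (norm (v th j y))\<^sup>2" using sum_squares_bound[of 1 "norm (v th j y)"] by simp
  then show ?thesis using norm_ge_zero[of "v th j y"] assms[of j] by linarith
 qed
 have "norm (ve th e y) <= (\<Sum>j\<in>UNIV. norm (e $ j *\<^sub>R v th j y))" unfolding ve_def by (rule norm_sum)
 also have "... <= (\<Sum>j\<in>UNIV. \<bar>e $ j\<bar> * (1 + l))" by (intro sum_mono) (auto intro: mult_left_mono b)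
 finally show ?thesis by (simp add: sum_distrib_right)
qed

text \<open>The continuity equation tested against a continuously differentiable function.\<close>

lemma flow_derivative:
 assumes t: "th \<in> \<Theta>" and q: "!!x. q differentiable (at x)" "continuous_on UNIV (grad q)" "!!x. norm x > R ==> q x = 0"
 shows "((%s. LINT y|M (th + s *\<^sub>R e). q y) has_real_derivative (LINT y|M th. grad q y \<bullet> ve th e y)) (at 0)"
proof -
 interpret prob_space p by (rule prob_p)
 note qc = diff_imp_cont[OF q(1)]
 have qm: "q \<in> borel_measurable borel" by (rule borel_of_cont[OF qc])
 have q'0: "grad q x = 0" if "norm x > R" for x by (rule grad_zero_outside[OF q(3) that])
 obtain B where B: "!!x. norm (grad q x) <= B" using integrable_cont_bdd(2)[OF q(2) q'0] by blast
 obtain B2 where B2: "!!x. norm (q x) <= B2" using integrable_cont_bdd(2)[OF qc q(3)] by blast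
 have B0: "B >= 0" using order_trans[OF norm_ge_zero B] .
 obtain r L where r: "r > 0" and L: "integrable p L"
  and le: "\<forall>th'\<in>\<Theta>. norm (th' - th) < r --> (\<forall>x j. (norm (v th' j (T th' x)))\<^sup>2 <= L x)"
  using dom[OF t] by blast
 obtain \<delta> where \<delta>: "\<delta> > 0" and seg: "!!s. \<bar>s\<bar> <= \<delta> ==> th + s *\<^sub>R e \<in> \<Theta>"
  and near: "!!s. \<bar>s\<bar> <= \<delta> ==> norm (s *\<^sub>R e) < r"
  using segment_in_Theta[OF t r, of e] by blast
 define A where "A = (\<Sum>j\<in>UNIV. \<bar>e $ j\<bar>)"
 define \<phi> where "\<phi> x s = q (T (th + s *\<^sub>R e) x)" for x s
 define \<phi>' where "\<phi>' x s = grad q (T (th + s *\<^sub>R e) x) \<bullet> ve (th + s *\<^sub>R e) e (T (th + s *\<^sub>R e) x)" for x s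
 have d: "(\<phi> x has_real_derivative \<phi>' x s) (at s)" if "\<bar>s\<bar> <= \<delta>" for x s
  unfolding \<phi>_def [abs_def] \<phi>'_def by (rule test_line[OF seg[OF that] q(1)])
 have bd: "\<bar>\<phi>' x s\<bar> <= B * (A * (1 + L x))" if s: "\<bar>s\<bar> <= \<delta>" for x s
 proof -
  have v: "norm (ve (th + s *\<^sub>R e) e (T (th + s *\<^sub>R e) x)) <= A * (1 + L x)"
   unfolding A_def by (rule ve_bound) (use le seg[OF s] near[OF s] in simp)
  have "\<bar>\<phi>' x s\<bar> <= norm (grad q (T (th + s *\<^sub>R e) x)) * norm (ve (th + s *\<^sub>R e) e (T (th + s *\<^sub>R e) x))"
   unfolding \<phi>'_def by (rule Cauchy_Schwarz_ineq2)
  also have "... <= B * (A * (1 + L x))" by (intro mult_mono B v B0) auto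
  finally show ?thesis .
 qed
 have Q: "(LINT y|M (th + s *\<^sub>R e). q y) = (LINT x|p. \<phi> x s)" and Qi: "integrable p (%x. \<phi> x s)"
  if "\<bar>s\<bar> <= \<delta>" for s
 proof -
  show "(LINT y|M (th + s *\<^sub>R e). q y) = (LINT x|p. \<phi> x s)"
   unfolding \<phi>_def by (rule integral_M(1)[OF seg[OF that] qm])
  show "integrable p (%x. \<phi> x s)"
   by (rule integrable_const_bound[where B=B2]) (auto simp: \<phi>_def B2[unfolded real_norm_def] intro!: h_p_m[OF seg[OF that] qm])
 qed
 have lim0: "(LINT y|M th. grad q y \<bullet> ve th e y) = (LINT x|p. \<phi>' x 0)"
 proof -
  have "(%y. grad q y \<bullet> ve th e y) \<in> borel_measurable borel"
   by (intro borel_of_cont continuous_intros q(2) ve_c[OF t])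
  from integral_M(1)[OF t this] show ?thesis by (simp add: \<phi>'_def)
 qed
 show ?thesis
  unfolding has_field_derivative_iff tendsto_at_iff_sequentially comp_def
 proof (intro allI impI)
  fix X :: "nat => real"
  assume X: "\<forall>i. X i \<in> UNIV - {0}" "X \<longlonglongrightarrow> 0"
  have "\<forall>\<^sub>F k in sequentially. dist (X k) 0 < \<delta>" using X(2) \<delta> by (rule tendstoD)
  then obtain K where K: "!!k. k >= K ==> \<bar>X k\<bar> <= \<delta>"
   by (auto simp: eventually_sequentially dist_norm intro: less_imp_le)
  have Xn: "X k ~= 0" for k using X(1) by auto
  have m0: "(%x. \<phi> x s) \<in> borel_measurable p" if "\<bar>s\<bar> <= \<delta>" for s using Qi[OF that] by simp
  have z: "\<bar>0::real\<bar> <= \<delta>" using \<delta> by simp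
  have pw: "(%k. (\<phi> x (X (k + K)) - \<phi> x 0) / (X (k + K) - 0)) \<longlonglongrightarrow> \<phi>' x 0" for x
  proof -
   have "(%k. (\<phi> x (X k) - \<phi> x 0) / (X k - 0)) \<longlonglongrightarrow> \<phi>' x 0"
    using d[OF z, of x] X unfolding has_field_derivative_iff tendsto_at_iff_sequentially comp_def by blast
   then show ?thesis by (rule LIMSEQ_ignore_initial_segment)
  qed
  have "(%k. LINT x|p. (\<phi> x (X (k + K)) - \<phi> x 0) / (X (k + K) - 0)) \<longlonglongrightarrow> (LINT x|p. \<phi>' x 0)"
  proof (rule integral_dominated_convergence[where w="%x. B * (A * (1 + L x))"])
   show mk: "(%x. (\<phi> x (X (k + K)) - \<phi> x 0) / (X (k + K) - 0)) \<in> borel_measurable p" for k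
    using m0[OF K[of "k + K"]] m0[OF z] by simp
   show "(%x. \<phi>' x 0) \<in> borel_measurable p" by (rule borel_measurable_LIMSEQ_real[OF pw mk])
   show "integrable p (%x. B * (A * (1 + L x)))" using L by simp
   show "AE x in p. (%k. (\<phi> x (X (k + K)) - \<phi> x 0) / (X (k + K) - 0)) \<longlonglongrightarrow> \<phi>' x 0" using pw by simp
   show "AE x in p. norm ((\<phi> x (X (k + K)) - \<phi> x 0) / (X (k + K) - 0)) <= B * (A * (1 + L x))" for k
   proof (rule AE_I2)
    fix x
    have "norm (\<phi> x (X (k + K)) - \<phi> x 0) <= B * (A * (1 + L x)) * norm (X (k + K) - 0)"
    proof (rule field_differentiable_bound[where S="{-\<delta>..\<delta>}" and f'="\<phi>' x"])
    show "(\<phi> x has_real_derivative \<phi>' x s) (at s within {-\<delta>..\<delta>})" if "s \<in> {-\<delta>..\<delta>}" for s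
    by (rule has_field_derivative_at_within[OF d]) (use that in auto)
    show "norm (\<phi>' x s) <= B * (A * (1 + L x))" if "s \<in> {-\<delta>..\<delta>}" for s
    unfolding real_norm_def by (rule bd) (use that in auto)
    qed (use K[of "k + K"] \<delta> in auto)
    then show "norm ((\<phi> x (X (k + K)) - \<phi> x 0) / (X (k + K) - 0)) <= B * (A * (1 + L x))"
    using Xn[of "k + K"] by (simp add: divide_le_eq)
   qed
  qed
  moreover have "(LINT x|p. (\<phi> x (X (k + K)) - \<phi> x 0) / (X (k + K) - 0))
   = ((LINT y|M (th + X (k + K) *\<^sub>R e). q y) - (LINT y|M (th + 0 *\<^sub>R e). q y)) / (X (k + K) - 0)" for k
   using Q[OF K[of "k + K"]] Q[OF z] Qi[OF K[of "k + K"]] Qi[OF z] by simp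
  ultimately have "(%k. ((LINT y|M (th + X (k + K) *\<^sub>R e). q y) - (LINT y|M (th + 0 *\<^sub>R e). q y)) / (X (k + K) - 0))
   \<longlonglongrightarrow> (LINT y|M th. grad q y \<bullet> ve th e y)" unfolding lim0 by (simp only:)
  then show "(%k. ((LINT y|M (th + X k *\<^sub>R e). q y) - (LINT y|M (th + 0 *\<^sub>R e). q y)) / (X k - 0))
   \<longlonglongrightarrow> (LINT y|M th. grad q y \<bullet> ve th e y)" by (rule LIMSEQ_offset)
 qed
qed

lemma flow_derivative_at:
 assumes t: "th + \<sigma> *\<^sub>R e \<in> \<Theta>" and q: "!!x. q differentiable (at x)" "continuous_on UNIV (grad q)" "!!x. norm x > R ==> q x = 0"
 shows "((%s. LINT y|M (th + s *\<^sub>R e). q y) has_real_derivative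
  (LINT y|M (th + \<sigma> *\<^sub>R e). grad q y \<bullet> ve (th + \<sigma> *\<^sub>R e) e y)) (at \<sigma>)"
proof -
 have "((%s. (%s. LINT y|M (th + s *\<^sub>R e). q y) (s + \<sigma>)) has_real_derivative
  (LINT y|M (th + \<sigma> *\<^sub>R e). grad q y \<bullet> ve (th + \<sigma> *\<^sub>R e) e y)) (at 0)"
  using flow_derivative[OF t q, where e=e] by (simp add: scaleR_add_left algebra_simps)
 then show ?thesis by (subst (asm) DERIV_shift[symmetric]) simp
qed

lemma integral_M_close:
 assumes t: "th \<in> \<Theta>" and q: "continuous_on UNIV q" "continuous_on UNIV g" "!!x. norm x > R ==> q x = 0" "!!x. norm x > R ==> g x = 0"
  and le: "!!x. \<bar>q x - g x\<bar> <= (\<epsilon>::real)"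
 shows "\<bar>(LINT y|M th. q y) - (LINT y|M th. g y)\<bar> <= \<epsilon>"
proof -
 interpret prob_space "M th" by (rule prob_M[OF t])
 have i: "integrable (M th) h" if h: "continuous_on UNIV h" "!!x. norm x > R ==> h x = 0" for h :: "real^'d => real"
 proof -
  obtain B where "!!x. norm (h x) <= B" using integrable_cont_bdd(2)[OF h] by blast
  then show ?thesis using borel_of_cont[OF h(1)]
   by (intro integrable_const_bound[where B=B]) (auto simp: sets_M cong: measurable_cong_sets)
 qed
 note iq = i[OF q(1,3)] and ig = i[OF q(2,4)]
 have "\<bar>(LINT y|M th. q y) - (LINT y|M th. g y)\<bar> = \<bar>LINT y|M th. q y - g y\<bar>" using iq ig by simp
 also have "... <= (LINT y|M th. \<bar>q y - g y\<bar>)" by (rule integral_abs_bound)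
 also have "... <= (LINT y|M th. \<epsilon>)" using iq ig le by (intro integral_mono) auto
 also have "... = \<epsilon>" by (simp add: prob_space)
 finally show ?thesis .
qed

text \<open>For a merely differentiable \<open>g\<close> the derivative is replaced by a lower bound for the right
 difference quotients.  The function is approximated in energy by test functions, at a rate tied to
 the increment of the parameter.\<close>

lemma right_quotient:
 assumes t: "th \<in> \<Theta>" and g: "!!x. g differentiable (at x)" "!!x. norm x > R ==> g x = 0"
  and g2: "integrable (M th) (%y. (norm (grad g y))\<^sup>2)"
  and c: "c < (LINT y|M th. grad g y \<bullet> ve th e y)"
 shows "\<exists>\<delta>>0. \<forall>h. 0 < h & h < \<delta> --> c * h <= (LINT y|M (th + h *\<^sub>R e). g y) - (LINT y|M th. g y)"
proof (rule ccontr)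
 assume neg: "\<not> ?thesis"
 note gc = diff_imp_cont[OF g(1)] and gm = grad_measurable[OF g(1)]
 have g'0: "grad g x = 0" if "norm x > R" for x by (rule grad_zero_outside[OF g(2) that])
 obtain \<delta> where \<delta>: "\<delta> > 0" and seg: "!!s. \<bar>s\<bar> <= \<delta> ==> th + s *\<^sub>R e \<in> \<Theta>"
  using segment_in_Theta[OF t zero_less_one, of e] by blast
 have g2l: "integrable lborel (%y. (norm (grad g y))\<^sup>2)"
  by (rule integrable_lborel_of_density[OF rho_c[OF t] rho_pos[OF t] _ _ g2[unfolded M_def], where R=R])
    (use gm in measurable, simp add: g'0)
 have g1l: "integrable lborel (grad g)" by (rule integrable_of_L2_bounded_support[OF gm g'0 g2l])
 define w where "w s y = \<rho> (th + s *\<^sub>R e) y *\<^sub>R ve (th + s *\<^sub>R e) e y" for s y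
 have wc: "continuous_on ({-\<delta>..\<delta>} \<times> UNIV) (%z. w (fst z) (snd z))"
 proof -
  have "continuous_on ({-\<delta>..\<delta>} \<times> UNIV) (%z. (%z. \<rho> (fst z) (snd z) *\<^sub>R ve (fst z) e (snd z)) (th + fst z *\<^sub>R e, snd z :: real^'d))"
   by (rule continuous_on_compose2[OF ve_cont]) (auto intro!: continuous_intros seg)
  then show ?thesis by (simp add: w_def)
 qed
 have "compact ((%z. w (fst z) (snd z)) ` ({-\<delta>..\<delta>} \<times> cball 0 (R + 1)))"
  by (rule compact_continuous_image[OF continuous_on_subset[OF wc]]) (auto intro!: compact_Times)
 then obtain B where B: "\<forall>x \<in> (%z. w (fst z) (snd z)) ` ({-\<delta>..\<delta>} \<times> cball 0 (R + 1)). norm x <= B"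
  using compact_imp_bounded bounded_iff by blast
 have wB: "norm (w s y) <= \<bar>B\<bar>" if "\<bar>s\<bar> <= \<delta>" "norm y <= R + 1" for s y
 proof -
  have "w s y \<in> (%z. w (fst z) (snd z)) ` ({-\<delta>..\<delta>} \<times> cball 0 (R + 1))"
   by (rule image_eqI[where x="(s, y)"]) (use that in auto)
  with B have "norm (w s y) <= B" by blast
  then show ?thesis by linarith
 qed
 have wm: "w s \<in> borel_measurable borel" if "\<bar>s\<bar> <= \<delta>" for s
  unfolding w_def [abs_def]
  by (intro borel_of_cont continuous_intros rho_c ve_c seg that)
 have pos: "min \<delta> (1 / (real k + 1)) > 0" for k using \<delta> by simp
 have "\<forall>k. \<exists>h. 0 < h & h < min \<delta> (1 / (real k + 1)) & \<not> c * h <= (LINT y|M (th + h *\<^sub>R e). g y) - (LINT y|M th. g y)"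
  using neg pos by blast
 from choice[OF this] obtain X where X': "\<forall>k. 0 < X k & X k < min \<delta> (1 / (real k + 1)) &
   \<not> c * X k <= (LINT y|M (th + X k *\<^sub>R e). g y) - (LINT y|M th. g y)" by blast
 have X: "0 < X k" "X k < \<delta>" "X k <= 1 / real (Suc k)" and Xc: "(LINT y|M (th + X k *\<^sub>R e). g y) - (LINT y|M th. g y) < c * X k" for k
  using X'[rule_format, of k] by (auto simp: add.commute)
 have X0: "X \<longlonglongrightarrow> 0"
  by (rule tendsto_sandwich[OF _ _ tendsto_const lim_inverse_n'[THEN LIMSEQ_Suc]])
    (use X in \<open>auto intro!: always_eventually less_imp_le\<close>)
 define P where "P k q \<longleftrightarrow> test2 (R + 1) q & (\<forall>x. \<bar>q x - g x\<bar> <= (X k)\<^sup>2) &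
   (\<integral>\<^sup>+x. ennreal ((norm (grad q x - grad g x))\<^sup>2) \<partial>lborel) <= ennreal ((X k)\<^sup>2)" for k q
 have "\<forall>k. \<exists>q. P k q"
  unfolding P_def using approx_by_test2[OF g g2l] X(1) by (meson zero_less_power)
 from choice[OF this] obtain q where q: "\<forall>k. P k (q k)" by blast
 have qd: "q k differentiable (at x)" and qc': "continuous_on UNIV (grad (q k))" and q0: "norm x > R + 1 ==> q k x = 0"
  and qg: "\<bar>q k x - g x\<bar> <= (X k)\<^sup>2"
  and qn: "(\<integral>\<^sup>+x. ennreal ((norm (grad (q k) x - grad g x))\<^sup>2) \<partial>lborel) <= ennreal ((X k)\<^sup>2)" for k x
  using q[rule_format, of k] unfolding P_def test2_def by blast+
 note qcc = diff_imp_cont[OF qd]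
 define \<Lambda> where "\<Lambda> k s = (LINT y|M (th + s *\<^sub>R e). grad (q k) y \<bullet> ve (th + s *\<^sub>R e) e y)" for k s
 have "\<exists>\<sigma>. 0 < \<sigma> & \<sigma> < X k & \<Lambda> k \<sigma> < c + 2 * X k" for k
 proof -
  define Q where "Q s = (LINT y|M (th + s *\<^sub>R e). q k y)" for s
  have "\<exists>\<sigma>. 0 < \<sigma> & \<sigma> < X k & Q (X k) - Q 0 = (X k - 0) * \<Lambda> k \<sigma>"
  proof (rule MVT2[OF X(1)])
   show "(Q has_real_derivative \<Lambda> k s) (at s)" if "0 <= s" "s <= X k" for s
    unfolding Q_def [abs_def] \<Lambda>_def
    by (rule flow_derivative_at[OF seg qd qc' q0]) (use that X(2)[of k] in auto)
  qed
  then obtain \<sigma> where \<sigma>: "0 < \<sigma>" "\<sigma> < X k" "Q (X k) - Q 0 = X k * \<Lambda> k \<sigma>" by auto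
  have cl: "\<bar>Q s - (LINT y|M (th + s *\<^sub>R e). g y)\<bar> <= (X k)\<^sup>2" if "\<bar>s\<bar> <= \<delta>" for s
   unfolding Q_def by (rule integral_M_close[OF seg[OF that] qcc gc q0 _ qg]) (auto intro: g(2))
  have "X k * \<Lambda> k \<sigma> < c * X k + 2 * (X k)\<^sup>2"
   using cl[of "X k"] cl[of 0] X[of k] \<delta> Xc[of k] \<sigma>(3) by simp
  then have "X k * \<Lambda> k \<sigma> < X k * (c + 2 * X k)" by (simp add: algebra_simps power2_eq_square)
  then have "\<Lambda> k \<sigma> < c + 2 * X k" using X(1)[of k] by simp
  with \<sigma> show ?thesis by blast
 qed
 then have "\<forall>k. \<exists>\<sigma>. 0 < \<sigma> & \<sigma> < X k & \<Lambda> k \<sigma> < c + 2 * X k" by blast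
 from choice[OF this] obtain \<sigma> where \<sigma>': "\<forall>k. 0 < \<sigma> k & \<sigma> k < X k & \<Lambda> k (\<sigma> k) < c + 2 * X k" by blast
 have \<sigma>: "0 < \<sigma> k" "\<sigma> k < X k" "\<Lambda> k (\<sigma> k) < c + 2 * X k" for k using \<sigma>' by auto
 have s\<delta>: "\<bar>\<sigma> k\<bar> <= \<delta>" for k using \<sigma>(1,2)[of k] X(2)[of k] by simp
 have s0: "\<sigma> \<longlonglongrightarrow> 0"
  by (rule tendsto_sandwich[OF _ _ tendsto_const X0]) (use \<sigma> in \<open>auto intro!: always_eventually less_imp_le\<close>)
 have z: "\<bar>0::real\<bar> <= \<delta>" using \<delta> by simp
 have lim2: "(%k. LINT y|lborel. grad g y \<bullet> w (\<sigma> k) y) \<longlonglongrightarrow> (LINT y|lborel. grad g y \<bullet> w 0 y)"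
 proof (rule integral_dominated_convergence[where w="%y. \<bar>B\<bar> * norm (grad g y)"])
  show "(%y. grad g y \<bullet> w 0 y) \<in> borel_measurable lborel" using gm wm[OF z] by simp
  show "(%y. grad g y \<bullet> w (\<sigma> k) y) \<in> borel_measurable lborel" for k using gm wm[OF s\<delta>] by simp
  show "integrable lborel (%y. \<bar>B\<bar> * norm (grad g y))" using g1l by simp
  show "AE y in lborel. (%k. grad g y \<bullet> w (\<sigma> k) y) \<longlonglongrightarrow> grad g y \<bullet> w 0 y"
  proof (rule AE_I2)
   fix y :: "real^'d"
   have r: "- \<delta> <= \<sigma> k & \<sigma> k <= \<delta>" for k using s\<delta>[of k] by (auto simp: abs_le_iff)
   have "(%k. w (\<sigma> k) y) \<longlonglongrightarrow> w 0 y"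
    using continuous_on_tendsto_compose[OF wc tendsto_Pair[OF s0 tendsto_const[of y]]] r \<delta> by simp
   then show "(%k. grad g y \<bullet> w (\<sigma> k) y) \<longlonglongrightarrow> grad g y \<bullet> w 0 y" by (intro tendsto_intros) simp
  qed
  show "AE y in lborel. norm (grad g y \<bullet> w (\<sigma> k) y) <= \<bar>B\<bar> * norm (grad g y)" for k
  proof (rule AE_I2)
   fix y :: "real^'d"
   show "norm (grad g y \<bullet> w (\<sigma> k) y) <= \<bar>B\<bar> * norm (grad g y)"
   proof (cases "norm y > R")
    case False
    have "norm (grad g y \<bullet> w (\<sigma> k) y) <= norm (grad g y) * norm (w (\<sigma> k) y)"
    unfolding real_norm_def by (rule Cauchy_Schwarz_ineq2)
    also have "... <= norm (grad g y) * \<bar>B\<bar>" by (intro mult_left_mono wB s\<delta>) (use False in auto)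
    finally show ?thesis by (simp add: mult.commute)
   qed (simp add: g'0)
  qed
 qed
 define I where "I = (%y::real^'d. indicator (cball 0 (R + 1)) y :: real)"
 have Ii: "integrable lborel I"
  using borel_integrable_compact[OF compact_cball, of 0 "R + 1" "%_. 1::real"] by (simp add: I_def)
 define vol where "vol = (LINT y|lborel. I y)"
 define z where "z k y = grad (q k) y - grad g y" for k y
 have zm: "z k \<in> borel_measurable borel" for k
  unfolding z_def [abs_def] using gm borel_of_cont[OF qc'] by measurable
 have z0: "z k y = 0" if "norm y > R + 1" for k y
  using grad_zero_outside[OF q0 that] g'0[of y] that by (simp add: z_def)
 have zi: "integrable lborel (%y. (norm (z k y))\<^sup>2)" "(LINT y|lborel. (norm (z k y))\<^sup>2) <= (X k)\<^sup>2" for k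
  using nn_integral_sq_finite_imp_integrable[of "z k" lborel "(X k)\<^sup>2"] zm[of k] qn[of k] by (simp_all add: z_def)
 have zb: "\<bar>z k y \<bullet> w (\<sigma> k) y\<bar> <= (norm (z k y))\<^sup>2 / X k + B\<^sup>2 * X k * I y" for k y
 proof (cases "norm y > R + 1")
  case False
  have Iy: "I y = 1" using False by (simp add: I_def)
  have "\<bar>z k y \<bullet> w (\<sigma> k) y\<bar> <= norm (z k y) * norm (w (\<sigma> k) y)" by (rule Cauchy_Schwarz_ineq2)
  also have "... <= norm (z k y) * \<bar>B\<bar>" by (intro mult_left_mono wB s\<delta>) (use False in auto)
  also have "... <= (norm (z k y))\<^sup>2 / X k + B\<^sup>2 * X k"
  proof -
   have x: "X k > 0" by (rule X(1))
   define a where "a = norm (z k y) / sqrt (X k)"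
   define b where "b = \<bar>B\<bar> * sqrt (X k)"
   have e: "a * b = norm (z k y) * \<bar>B\<bar>" "a\<^sup>2 = (norm (z k y))\<^sup>2 / X k" "b\<^sup>2 = B\<^sup>2 * X k"
    using x by (simp_all add: a_def b_def power_divide power_mult_distrib)
   have "a >= 0" "b >= 0" using x by (simp_all add: a_def b_def)
   then have "a * b >= 0" by simp
   moreover have "2 * a * b <= a\<^sup>2 + b\<^sup>2" by (rule sum_squares_bound)
   ultimately have "a * b <= a\<^sup>2 + b\<^sup>2" by linarith
   then show ?thesis by (simp only: e)
  qed
  finally show ?thesis by (simp add: Iy)
 qed (use X(1)[of k] in \<open>simp add: z0 I_def\<close>)
 have bi: "integrable lborel (%y. (norm (z k y))\<^sup>2 / X k + B\<^sup>2 * X k * I y)" for k using zi(1) Ii by simp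
 have zwi: "integrable lborel (%y. z k y \<bullet> w (\<sigma> k) y)" for k
 proof (rule integrable_bd[OF bi[of k]])
  show "(%y. z k y \<bullet> w (\<sigma> k) y) \<in> borel_measurable lborel" using zm[of k] wm[OF s\<delta>, of k] by simp
  show "AE y in lborel. norm (z k y \<bullet> w (\<sigma> k) y) <= norm ((norm (z k y))\<^sup>2 / X k + B\<^sup>2 * X k * I y)"
   unfolding real_norm_def by (rule AE_I2, rule order_trans[OF zb abs_ge_self])
 qed
 have zw: "\<bar>LINT y|lborel. z k y \<bullet> w (\<sigma> k) y\<bar> <= X k * (1 + B\<^sup>2 * vol)" for k
 proof -
  have "\<bar>LINT y|lborel. z k y \<bullet> w (\<sigma> k) y\<bar> <= (LINT y|lborel. \<bar>z k y \<bullet> w (\<sigma> k) y\<bar>)" by (rule integral_abs_bound)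
  also have "... <= (LINT y|lborel. (norm (z k y))\<^sup>2 / X k + B\<^sup>2 * X k * I y)"
   by (rule integral_mono[OF _ bi zb]) (use zwi in simp)
  also have "... = (LINT y|lborel. (norm (z k y))\<^sup>2) / X k + B\<^sup>2 * X k * vol"
   using zi(1) Ii by (simp add: vol_def)
  also have "... <= (X k)\<^sup>2 / X k + B\<^sup>2 * X k * vol"
   using divide_right_mono[OF zi(2)[of k] less_imp_le[OF X(1)[of k]]] by simp
  also have "... = X k * (1 + B\<^sup>2 * vol)" using X(1)[of k] by (simp add: power2_eq_square algebra_simps)
  finally show ?thesis .
 qed
 have lim1: "(%k. LINT y|lborel. z k y \<bullet> w (\<sigma> k) y) \<longlonglongrightarrow> 0"
 proof (rule Lim_null_comparison)
  show "\<forall>\<^sub>F k in sequentially. norm (LINT y|lborel. z k y \<bullet> w (\<sigma> k) y) <= X k * (1 + B\<^sup>2 * vol)" using zw by simp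
  show "(%k. X k * (1 + B\<^sup>2 * vol)) \<longlonglongrightarrow> 0" using tendsto_mult_left_zero[OF X0] by simp
 qed
 have gwi: "integrable lborel (%y. grad g y \<bullet> w (\<sigma> k) y)" for k
 proof (rule integrable_bd[where f="%y. \<bar>B\<bar> * norm (grad g y)"])
  show "integrable lborel (%y. \<bar>B\<bar> * norm (grad g y))" using g1l by simp
  show "(%y. grad g y \<bullet> w (\<sigma> k) y) \<in> borel_measurable lborel" using gm wm[OF s\<delta>] by simp
  show "AE y in lborel. norm (grad g y \<bullet> w (\<sigma> k) y) <= norm (\<bar>B\<bar> * norm (grad g y))"
  proof (rule AE_I2)
   fix y :: "real^'d"
   show "norm (grad g y \<bullet> w (\<sigma> k) y) <= norm (\<bar>B\<bar> * norm (grad g y))"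
   proof (cases "norm y > R")
    case False
    have "norm (grad g y \<bullet> w (\<sigma> k) y) <= norm (grad g y) * norm (w (\<sigma> k) y)"
    unfolding real_norm_def by (rule Cauchy_Schwarz_ineq2)
    also have "... <= norm (grad g y) * \<bar>B\<bar>" by (intro mult_left_mono wB s\<delta>) (use False in auto)
    finally show ?thesis by (simp add: mult.commute)
   qed (simp add: g'0)
  qed
 qed
 have \<Lambda>w: "\<Lambda> k (\<sigma> k) = (LINT y|lborel. grad g y \<bullet> w (\<sigma> k) y) + (LINT y|lborel. z k y \<bullet> w (\<sigma> k) y)" for k
 proof -
  have m: "(%y. grad (q k) y \<bullet> ve (th + \<sigma> k *\<^sub>R e) e y) \<in> borel_measurable borel"
   by (intro borel_of_cont continuous_intros qc' ve_c seg s\<delta>)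
  have "\<Lambda> k (\<sigma> k) = (LINT y|lborel. grad g y \<bullet> w (\<sigma> k) y + z k y \<bullet> w (\<sigma> k) y)"
   unfolding \<Lambda>_def integral_M_lborel(1)[OF seg[OF s\<delta>] m]
   by (intro integral_cg) (auto simp: w_def z_def inner_diff_left right_diff_distrib)
  then show ?thesis using gwi zwi by simp
 qed
 have \<Lambda>0: "(LINT y|M th. grad g y \<bullet> ve th e y) = (LINT y|lborel. grad g y \<bullet> w 0 y)"
 proof -
  have m: "(%y. grad g y \<bullet> ve th e y) \<in> borel_measurable borel"
   using gm borel_of_cont[OF ve_c[OF t, of e]] by measurable
  show ?thesis unfolding integral_M_lborel(1)[OF t m] by (simp add: w_def)
 qed
 have "(%k. \<Lambda> k (\<sigma> k)) \<longlonglongrightarrow> (LINT y|M th. grad g y \<bullet> ve th e y)"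
  unfolding \<Lambda>w \<Lambda>0 using tendsto_add[OF lim2 lim1] by simp
 moreover have "(%k. c + 2 * X k) \<longlonglongrightarrow> c + 2 * 0" by (intro tendsto_intros X0)
 ultimately have "(LINT y|M th. grad g y \<bullet> ve th e y) <= c + 2 * 0"
  by (rule LIMSEQ_le) (use \<sigma>(3) in \<open>auto intro: less_imp_le\<close>)
 with c show False by simp
qed

end

section \<open>The gradient of the relative entropy\<close>

lemma reg_continuous: "0 < d ==> continuous_on {0<..} (reg d)"
 by (rule continuous_at_imp_continuous_on) (auto intro!: DERIV_isCont reg_has_derivative)

context density_family
begin

lemma E_integrand_continuous:
 assumes t: "th \<in> \<Theta>"
 shows "continuous_on UNIV (%y. bump ((real n)\<^sup>2) y * (reg (exp (- real n)) (\<rho> th y / m y) * m y))"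
proof -
 have m0: "m y ~= 0" for y using m_pos[of y] by simp
 have r: "continuous_on UNIV (%y. \<rho> th y / m y)" by (intro continuous_intros rho_c[OF t] m_c) (simp add: m0)
 have "continuous_on UNIV (%y. reg (exp (- real n)) (\<rho> th y / m y))"
  by (rule continuous_on_compose2[OF reg_continuous r]) (use rho_pos[OF t] m_pos in auto)
 then show ?thesis by (intro continuous_intros bump_continuous m_c)
qed

text \<open>Convexity of the regularised entropy as a function of the density: the energy lies above its
 tangent, whose slope is the test function \<open>G n th\<close>.\<close>

lemma E_tangent:
 assumes t: "th \<in> \<Theta>" "th' \<in> \<Theta>" and n: "n > 0"
 shows "(LINT y|M th'. G n th y) - (LINT y|M th. G n th y) <= E n th' - E n th"
proof -
 define d where "d = exp (- real n)"
 have d: "0 < d" "d <= 1" using d_range[of n] by (auto simp: d_def)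
 have out: "bump ((real n)\<^sup>2) y = 0" if "norm y > (real n)\<^sup>2" for y :: "real^'d"
  by (rule bump_outside) (use that n in auto)
 have Gc: "continuous_on UNIV (G n th)" by (rule diff_imp_cont[OF G_props(1)[OF t(1) n]])
 have Gm: "G n th \<in> borel_measurable borel" by (rule borel_of_cont[OF Gc])
 have Gi: "integrable lborel (%y. \<rho> th'' y * G n th y)" if "th'' \<in> \<Theta>" for th''
  by (rule integrable_cont_bdd(1)[where R="(real n)\<^sup>2"], intro continuous_intros rho_c that Gc)
    (simp add: G_props(3)[OF t(1) n])
 have Ei: "integrable lborel (%y. bump ((real n)\<^sup>2) y * (reg (exp (- real n)) (\<rho> th'' y / m y) * m y))" if "th'' \<in> \<Theta>" for th''
  by (rule integrable_cont_bdd(1)[OF E_integrand_continuous[OF that], where R="(real n)\<^sup>2"]) (simp add: out)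
 have pw: "\<rho> th' y * G n th y - \<rho> th y * G n th y
   <= bump ((real n)\<^sup>2) y * (reg d (\<rho> th' y / m y) * m y) - bump ((real n)\<^sup>2) y * (reg d (\<rho> th y / m y) * m y)" for y
 proof -
  have "reg' d (\<rho> th y / m y) * (\<rho> th' y / m y - \<rho> th y / m y) <= reg d (\<rho> th' y / m y) - reg d (\<rho> th y / m y)"
   by (rule reg_tangent[OF d]) (use rho_pos t m_pos in auto)
  then have "bump ((real n)\<^sup>2) y * m y * (reg' d (\<rho> th y / m y) * (\<rho> th' y / m y - \<rho> th y / m y))
    <= bump ((real n)\<^sup>2) y * m y * (reg d (\<rho> th' y / m y) - reg d (\<rho> th y / m y))"
   using m_pos[of y] bump_nonneg by (intro mult_left_mono mult_nonneg_nonneg) auto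
  moreover have "bump ((real n)\<^sup>2) y * m y * (reg' d (\<rho> th y / m y) * (\<rho> th' y / m y - \<rho> th y / m y))
    = \<rho> th' y * G n th y - \<rho> th y * G n th y"
  proof -
   have "m y * (\<rho> th' y / m y - \<rho> th y / m y) = \<rho> th' y - \<rho> th y" using m_pos[of y] by (simp add: right_diff_distrib)
   then have "bump ((real n)\<^sup>2) y * m y * (reg' d (\<rho> th y / m y) * (\<rho> th' y / m y - \<rho> th y / m y))
    = bump ((real n)\<^sup>2) y * reg' d (\<rho> th y / m y) * (\<rho> th' y - \<rho> th y)" by (metis (no_types, opaque_lifting) mult.assoc mult.left_commute)
   then show ?thesis by (rule trans) (simp add: G_def exp_f[OF t(1)] d_def algebra_simps)
  qed
  ultimately show ?thesis by (simp add: right_diff_distrib mult.assoc mult.left_commute mult.commute)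
 qed
 have "(LINT y|M th'. G n th y) - (LINT y|M th. G n th y) = (LINT y|lborel. \<rho> th' y * G n th y - \<rho> th y * G n th y)"
  using Gi t by (simp add: integral_M_lborel(1)[OF t(1) Gm] integral_M_lborel(1)[OF t(2) Gm])
 also have "... <= (LINT y|lborel. bump ((real n)\<^sup>2) y * (reg d (\<rho> th' y / m y) * m y) - bump ((real n)\<^sup>2) y * (reg d (\<rho> th y / m y) * m y))"
  by (rule integral_mono[OF _ _ pw]) (use Gi Ei t in \<open>simp_all add: d_def\<close>)
 also have "... = E n th' - E n th" using Ei[OF t(1)] Ei[OF t(2)] by (simp add: E_def d_def)
 finally show ?thesis .
qed

lemma E_continuous:
 assumes n: "n > 0" and seg: "!!s. s \<in> S ==> th + s *\<^sub>R e \<in> \<Theta>"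
 shows "continuous_on S (%s. E n (th + s *\<^sub>R e))"
proof -
 let ?F = "%s y. bump ((real n)\<^sup>2) y * (reg (exp (- real n)) (\<rho> (th + s *\<^sub>R e) y / m y) * m y)"
 have out: "bump ((real n)\<^sup>2) y = 0" if "norm y > (real n)\<^sup>2" for y :: "real^'d"
  by (rule bump_outside) (use that n in auto)
 obtain a :: "real^'d" where a: "cball 0 ((real n)\<^sup>2) \<subseteq> cbox (-a) a"
  using bounded_subset_cbox_symmetric[OF bounded_cball] by blast
 have eq: "E n (th + s *\<^sub>R e) = integral (cbox (-a) a) (?F s)" if "s \<in> S" for s
  unfolding E_def
  by (rule lborel_integral_eq_integral_cbox[OF E_integrand_continuous[OF seg[OF that]] _ a]) (simp add: out)
 have r: "continuous_on (S \<times> cbox (-a) a) (%z. \<rho> (th + fst z *\<^sub>R e) (snd z))"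
 proof -
  have "continuous_on (S \<times> cbox (-a) a) (%z. (%z. \<rho> (fst z) (snd z)) (th + fst z *\<^sub>R e, snd z))"
   by (rule continuous_on_compose2[OF rho_cont]) (auto intro!: continuous_intros seg)
  then show ?thesis by simp
 qed
 have mc: "continuous_on (S \<times> cbox (-a) a) (%z. m (snd z))"
  by (rule continuous_on_compose2[OF m_c]) (auto intro!: continuous_intros)
 have bc: "continuous_on (S \<times> cbox (-a) a) (%z. bump ((real n)\<^sup>2) (snd z))"
  by (rule continuous_on_compose2[OF bump_continuous]) (auto intro!: continuous_intros)
 have m0: "m y ~= 0" for y using m_pos[of y] by simp
 have q: "continuous_on (S \<times> cbox (-a) a) (%z. \<rho> (th + fst z *\<^sub>R e) (snd z) / m (snd z))"
  by (intro continuous_intros r mc) (simp add: m0)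
 have "continuous_on (S \<times> cbox (-a) a) (%z. reg (exp (- real n)) (\<rho> (th + fst z *\<^sub>R e) (snd z) / m (snd z)))"
  by (rule continuous_on_compose2[OF reg_continuous q]) (use rho_pos seg m_pos in auto)
 then have "continuous_on (S \<times> cbox (-a) a) (%(s, y). ?F s y)"
  unfolding case_prod_beta by (intro continuous_intros mc bc)
 then have "continuous_on S (%s. integral (cbox (-a) a) (?F s))" by (rule integral_continuous_on_param)
 then show ?thesis by (simp add: eq cong: continuous_on_cong)
qed

lemma integral_rho:
 assumes t: "th \<in> \<Theta>"
 shows "integrable lborel (\<rho> th)" "(LINT y|lborel. \<rho> th y) = 1"
proof -
 interpret prob_space "M th" by (rule prob_M[OF t])
 have "integrable (M th) (%y. 1::real)" by simp
 then show "integrable lborel (\<rho> th)" using integral_M_lborel(2)[OF t, of "%y. 1"] by simp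
 show "(LINT y|lborel. \<rho> th y) = 1" using integral_M_lborel(1)[OF t, of "%y. 1"] prob_space by simp
qed

text \<open>The regularisation subtracts the mass in the limit, which is the source of the 1.\<close>

lemma E_tendsto:
 assumes t: "th \<in> \<Theta>" and i: "integrable lborel (%y. \<rho> th y * f th y)"
 shows "(%n. E n th) \<longlonglongrightarrow> (LINT y|lborel. \<rho> th y * f th y) - 1"
proof -
 have rm: "m y * (\<rho> th y / m y) = \<rho> th y" for y using m_pos[of y] by simp
 have "(%n. E n th) \<longlonglongrightarrow> (LINT y|lborel. \<rho> th y * f th y - \<rho> th y)"
  unfolding E_def
 proof (rule integral_dominated_convergence[where w="%y. 26 * m y + 25 * \<rho> th y + 8 * \<bar>\<rho> th y * f th y\<bar>"])
  show "(%y. \<rho> th y * f th y - \<rho> th y) \<in> borel_measurable lborel" using i integral_rho(1)[OF t] by simp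
  show "(%y. bump ((real n)\<^sup>2) y * (reg (exp (- real n)) (\<rho> th y / m y) * m y)) \<in> borel_measurable lborel" for n
   using borel_of_cont[OF E_integrand_continuous[OF t, of n]] by simp
  show "integrable lborel (%y. 26 * m y + 25 * \<rho> th y + 8 * \<bar>\<rho> th y * f th y\<bar>)"
   using i integral_rho(1)[OF t] m_int by simp
  show "AE y in lborel. (%n. bump ((real n)\<^sup>2) y * (reg (exp (- real n)) (\<rho> th y / m y) * m y)) \<longlonglongrightarrow> \<rho> th y * f th y - \<rho> th y"
  proof (rule AE_I2)
   fix y :: "real^'d"
   have "\<rho> th y / m y > 0" using rho_pos[OF t] m_pos by simp
   note l = reg_tendsto[OF this]
   have "(%n. bump ((real n)\<^sup>2) y * (reg (exp (- real n)) (\<rho> th y / m y) * m y)) \<longlonglongrightarrow>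
    1 * ((\<rho> th y / m y * ln (\<rho> th y / m y) - \<rho> th y / m y) * m y)"
    by (intro tendsto_mult l tendsto_const bump_tendsto_1[OF square_at_top tendsto_const])
   moreover have "1 * ((\<rho> th y / m y * ln (\<rho> th y / m y) - \<rho> th y / m y) * m y) = \<rho> th y * f th y - \<rho> th y"
    using m_pos[of y] by (simp add: f_def left_diff_distrib)
   ultimately show "(%n. bump ((real n)\<^sup>2) y * (reg (exp (- real n)) (\<rho> th y / m y) * m y)) \<longlonglongrightarrow> \<rho> th y * f th y - \<rho> th y"
    by simp
  qed
  show "AE y in lborel. norm (bump ((real n)\<^sup>2) y * (reg (exp (- real n)) (\<rho> th y / m y) * m y))
    <= 26 * m y + 25 * \<rho> th y + 8 * \<bar>\<rho> th y * f th y\<bar>" for n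
  proof (rule AE_I2)
   fix y :: "real^'d"
   have mp: "m y > 0" by (rule m_pos)
   have "\<bar>reg (exp (- real n)) (\<rho> th y / m y)\<bar> <= 26 + 25 * (\<rho> th y / m y) + 8 * \<bar>\<rho> th y / m y * ln (\<rho> th y / m y)\<bar>"
    by (rule reg_bound[OF d_range]) (use rho_pos[OF t] mp in simp)
   then have "\<bar>reg (exp (- real n)) (\<rho> th y / m y)\<bar> * m y <= (26 + 25 * (\<rho> th y / m y) + 8 * \<bar>\<rho> th y / m y * ln (\<rho> th y / m y)\<bar>) * m y"
    using mp by (intro mult_right_mono) auto
   also have "... = 26 * m y + 25 * \<rho> th y + 8 * \<bar>\<rho> th y * f th y\<bar>"
    using mp by (simp add: f_def distrib_right abs_mult)
   finally have 1: "\<bar>reg (exp (- real n)) (\<rho> th y / m y)\<bar> * m y <= 26 * m y + 25 * \<rho> th y + 8 * \<bar>\<rho> th y * f th y\<bar>" .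
   have "norm (bump ((real n)\<^sup>2) y * (reg (exp (- real n)) (\<rho> th y / m y) * m y))
    = bump ((real n)\<^sup>2) y * (\<bar>reg (exp (- real n)) (\<rho> th y / m y)\<bar> * m y)"
    using mp bump_nonneg[of "(real n)\<^sup>2" y] by (simp add: abs_mult)
   also have "... <= 1 * (\<bar>reg (exp (- real n)) (\<rho> th y / m y)\<bar> * m y)"
    using mp by (intro mult_right_mono bump_le_1) auto
   finally show "norm (bump ((real n)\<^sup>2) y * (reg (exp (- real n)) (\<rho> th y / m y) * m y))
    <= 26 * m y + 25 * \<rho> th y + 8 * \<bar>\<rho> th y * f th y\<bar>" using 1 by simp
  qed
 qed
 then show ?thesis using i integral_rho[OF t] by simp
qed

text \<open>The tangent inequality reduces the growth of the energy to that of integrals of a fixed function, for which the continuity equation applies.\<close>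

lemma E_growth:
 assumes n: "n > 0" and b: "b >= 0" and seg: "!!s. s \<in> {0..b} ==> th + s *\<^sub>R e \<in> \<Theta>"
  and gi: "!!th. th \<in> \<Theta> ==> integrable (M th) (%y. (norm (grad (f th) y))\<^sup>2)"
  and c: "!!s. 0 <= s ==> s < b ==> c < (LINT y|M (th + s *\<^sub>R e). grad (G n (th + s *\<^sub>R e)) y \<bullet> ve (th + s *\<^sub>R e) e y)"
 shows "c * b <= E n (th + b *\<^sub>R e) - E n th"
proof -
 have "c * b <= E n (th + b *\<^sub>R e) - E n (th + 0 *\<^sub>R e)"
 proof (rule growth_of_right_quotients[where f="%s. E n (th + s *\<^sub>R e)", OF E_continuous[OF n seg] b])
  fix s :: real assume s: "0 <= s" "s < b"
  then have t: "th + s *\<^sub>R e \<in> \<Theta>" by (intro seg) simp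
  obtain \<delta> where \<delta>: "\<delta> > 0" and le: "\<forall>h. 0 < h & h < \<delta> --> c * h <=
    (LINT y|M (th + s *\<^sub>R e + h *\<^sub>R e). G n (th + s *\<^sub>R e) y) - (LINT y|M (th + s *\<^sub>R e). G n (th + s *\<^sub>R e) y)"
   using right_quotient[OF t G_props(1)[OF t n] G_props(3)[OF t n] G_L2[OF t n gi[OF t]] c[OF s]] by blast
  have "c * h <= E n (th + (s + h) *\<^sub>R e) - E n (th + s *\<^sub>R e)" if h: "0 < h" "h < \<delta>" "s + h <= b" for h
  proof -
   have e: "th + s *\<^sub>R e + h *\<^sub>R e = th + (s + h) *\<^sub>R e" by (simp add: scaleR_add_left)
   have t': "th + (s + h) *\<^sub>R e \<in> \<Theta>" by (rule seg) (use h s in auto)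
   have "c * h <= (LINT y|M (th + (s + h) *\<^sub>R e). G n (th + s *\<^sub>R e) y) - (LINT y|M (th + s *\<^sub>R e). G n (th + s *\<^sub>R e) y)"
    using le[rule_format, of h] h unfolding e by simp
   also have "... <= E n (th + (s + h) *\<^sub>R e) - E n (th + s *\<^sub>R e)" by (rule E_tangent[OF t t' n])
   finally show ?thesis .
  qed
  with \<delta> show "\<exists>\<delta>>0. \<forall>h. 0 < h & h < \<delta> & s + h <= b --> c * h <= E n (th + (s + h) *\<^sub>R e) - E n (th + s *\<^sub>R e)"
   by blast
 qed
 then show ?thesis by simp
qed

text \<open>Suppose the relative entropy has a gradient at \<open>th0\<close>.  Comparing it with the regularised
 entropies produces parameters \<open>th0 + \<sigma> e\<close> with \<open>\<sigma>\<close> tending to 0 at which the formal slope is at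
 most the difference quotient of the entropy; the formal slopes converge.\<close>

lemma entropy_gradient_ge:
 assumes t: "th0 \<in> \<Theta>"
  and fin: "\<forall>\<^sub>F th in nhds th0. integrable lborel (%y. \<rho> th y * f th y)"
  and der: "GDERIV (%th. LINT y|lborel. \<rho> th y * f th y) th0 :> g"
  and gi: "!!th. th \<in> \<Theta> ==> integrable (M th) (%y. (norm (grad (f th) y))\<^sup>2)"
  and bnd: "!!th. (!!k. th k \<in> \<Theta>) ==> th \<longlonglongrightarrow> th0 ==> \<exists>C. \<forall>k. (LINT y|M (th k). (norm (grad (f (th k)) y))\<^sup>2) <= C"
 shows "(\<Sum>j\<in>UNIV. e $ j * (LINT y|M th0. grad (f th0) y \<bullet> v th0 j y)) <= e \<bullet> g"
proof -
 define u where "u th = (LINT y|lborel. \<rho> th y * f th y)" for th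
 obtain r where r: "r > 0" and ri: "!!th. dist th th0 < r ==> integrable lborel (%y. \<rho> th y * f th y)"
  using fin unfolding eventually_nhds_metric by blast
 obtain \<delta> where \<delta>: "\<delta> > 0" and seg: "!!s. \<bar>s\<bar> <= \<delta> ==> th0 + s *\<^sub>R e \<in> \<Theta>"
  and near: "!!s. \<bar>s\<bar> <= \<delta> ==> norm (s *\<^sub>R e) < r"
  using segment_in_Theta[OF t r, of e] by blast
 have ui: "integrable lborel (%y. \<rho> (th0 + s *\<^sub>R e) y * f (th0 + s *\<^sub>R e) y)" if "\<bar>s\<bar> <= \<delta>" for s
  by (rule ri) (use near[OF that] in \<open>simp add: dist_norm\<close>)
 have du: "((%s. u (th0 + s *\<^sub>R e)) has_real_derivative e \<bullet> g) (at 0)"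
 proof -
  have l: "((%s. th0 + s *\<^sub>R e) has_derivative (%h. h *\<^sub>R e)) (at 0)" by (auto intro!: derivative_eq_intros)
  have d: "(u has_derivative (%h. h \<bullet> g)) (at (th0 + 0 *\<^sub>R e))" using der by (simp add: gderiv_def u_def [abs_def])
  show ?thesis using has_derivative_compose[OF l d]
   by (simp add: has_field_derivative_def mult.commute[of _ "e \<bullet> g"])
 qed
 define s where "s k = \<delta> / real (Suc k)" for k
 have s: "0 < s k" "s k <= \<delta>" "\<bar>s k\<bar> <= \<delta>" for k
 proof -
  show 1: "0 < s k" using \<delta> by (simp add: s_def)
  have "\<delta> / real (Suc k) <= \<delta> / 1" using \<delta> by (intro divide_left_mono) auto
  then show "s k <= \<delta>" by (simp add: s_def)
  with 1 show "\<bar>s k\<bar> <= \<delta>" by simp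
 qed
 have s0: "s \<longlonglongrightarrow> 0"
  unfolding s_def [abs_def] using tendsto_mult_right_zero[OF lim_inverse_n'[THEN LIMSEQ_Suc], of \<delta>] by simp
 define A where "A n th = (LINT y|M th. grad (G n th) y \<bullet> ve th e y)" for n th
 define Q where "Q k = (u (th0 + s k *\<^sub>R e) - u th0) / s k" for k
 have "\<exists>n \<sigma>. n >= Suc k & 0 <= \<sigma> & \<sigma> < s k & A n (th0 + \<sigma> *\<^sub>R e) <= Q k + 3 * s k" for k
 proof -
  have "\<forall>\<^sub>F n in sequentially. dist (E n (th0 + s k *\<^sub>R e)) (u (th0 + s k *\<^sub>R e) - 1) < (s k)\<^sup>2"
   unfolding u_def by (rule tendstoD[OF E_tendsto[OF seg ui]]) (use s[of k] in auto)
  moreover have "\<forall>\<^sub>F n in sequentially. dist (E n th0) (u th0 - 1) < (s k)\<^sup>2"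
   unfolding u_def by (rule tendstoD[OF E_tendsto[OF t]]) (use ui[of 0] \<delta> s(1)[of k] in auto)
  moreover have "\<forall>\<^sub>F n in sequentially. n >= Suc k" by (rule eventually_ge_at_top)
  ultimately have "\<forall>\<^sub>F n in sequentially. dist (E n (th0 + s k *\<^sub>R e)) (u (th0 + s k *\<^sub>R e) - 1) < (s k)\<^sup>2 &
   dist (E n th0) (u th0 - 1) < (s k)\<^sup>2 & n >= Suc k" by (intro eventually_conj)
  then obtain n where n1: "dist (E n (th0 + s k *\<^sub>R e)) (u (th0 + s k *\<^sub>R e) - 1) < (s k)\<^sup>2"
   and n2: "dist (E n th0) (u th0 - 1) < (s k)\<^sup>2" and n: "n >= Suc k"
   using eventually_happens'[OF sequentially_bot] by blast
  have "\<exists>\<sigma>. 0 <= \<sigma> & \<sigma> < s k & A n (th0 + \<sigma> *\<^sub>R e) <= Q k + 3 * s k"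
  proof (rule ccontr)
   assume "\<not> ?thesis"
   then have big: "Q k + 3 * s k < A n (th0 + \<sigma> *\<^sub>R e)" if "0 <= \<sigma>" "\<sigma> < s k" for \<sigma>
    using that not_less by blast
   have np: "n > 0" using n by simp
   have "(Q k + 3 * s k) * s k <= E n (th0 + s k *\<^sub>R e) - E n th0"
    by (rule E_growth[OF np less_imp_le[OF s(1)] _ gi big[unfolded A_def]])
    (use s[of k] in \<open>auto intro!: seg\<close>)
   moreover have "(Q k + 3 * s k) * s k = u (th0 + s k *\<^sub>R e) - u th0 + 3 * (s k)\<^sup>2"
    unfolding Q_def distrib_right power2_eq_square using s(1)[of k] by simp
   moreover have "(s k)\<^sup>2 > 0" using s(1)[of k] by simp
   ultimately show False using n1 n2 unfolding dist_real_def by linarith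
  qed
  with n show ?thesis by blast
 qed
 then have "\<forall>k. \<exists>z. fst z >= Suc k & 0 <= snd z & snd z < s k & A (fst z) (th0 + snd z *\<^sub>R e) <= Q k + 3 * s k"
  by (metis fst_conv snd_conv)
 from choice[OF this] obtain Z where Z: "\<forall>k. fst (Z k) >= Suc k & 0 <= snd (Z k) & snd (Z k) < s k &
   A (fst (Z k)) (th0 + snd (Z k) *\<^sub>R e) <= Q k + 3 * s k" by blast
 define N where "N k = fst (Z k)" for k
 define th where "th k = th0 + snd (Z k) *\<^sub>R e" for k
 have Np: "N k >= Suc k" and Nz: "N k > 0" and le: "A (N k) (th k) <= Q k + 3 * s k" for k
  using Z[rule_format, of k] by (auto simp: N_def th_def)
 have th: "th k \<in> \<Theta>" for k unfolding th_def by (rule seg) (use Z[rule_format, of k] s(2)[of k] in auto)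
 have Nt: "filterlim N at_top sequentially"
 proof (rule filterlim_at_top_mono[OF filterlim_ident], rule always_eventually, rule allI)
  show "k <= N k" for k using Np[of k] by simp
 qed
 have z0: "(%k. snd (Z k)) \<longlonglongrightarrow> 0"
  by (rule tendsto_sandwich[OF _ _ tendsto_const s0]) (use Z in \<open>auto intro!: always_eventually less_imp_le\<close>)
 have tl: "th \<longlonglongrightarrow> th0"
  unfolding th_def [abs_def] using tendsto_add[OF tendsto_const tendsto_scaleR[OF z0 tendsto_const], of th0 e] by simp
 obtain C1 where C1: "!!k. (LINT y|M (th k). (norm (grad (f (th k)) y))\<^sup>2) <= C1" using bnd[OF th tl] by blast
 define C where "C = max C1 (LINT y|M th0. (norm (grad (f th0) y))\<^sup>2)"
 have Ck: "(LINT y|M (th k). (norm (grad (f (th k)) y))\<^sup>2) <= C" for k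
  using C1[of k] unfolding C_def by (rule order_trans) simp
 have C0: "(LINT y|M th0. (norm (grad (f th0) y))\<^sup>2) <= C" by (simp add: C_def)
 have Aeq: "A (N k) (th k) = (\<Sum>j\<in>UNIV. e $ j * (LINT y|M (th k). grad (G (N k) (th k)) y \<bullet> v (th k) j y))" for k
 proof -
  have i: "integrable (M (th k)) (%y. grad (G (N k) (th k)) y \<bullet> v (th k) j y)" for j
   by (rule cs_M(1)[OF th grad_measurable[OF G_props(1)[OF th Nz]] v_m[OF th] G_L2[OF th Nz gi[OF th]] v_sq_int[OF th]])
  have "A (N k) (th k) = (LINT y|M (th k). (\<Sum>j\<in>UNIV. e $ j * (grad (G (N k) (th k)) y \<bullet> v (th k) j y)))"
   unfolding A_def ve_def by (simp add: inner_sum_right)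
  then show ?thesis using i by simp
 qed
 have "(%k. A (N k) (th k)) \<longlonglongrightarrow> (\<Sum>j\<in>UNIV. e $ j * (LINT y|M th0. grad (f th0) y \<bullet> v th0 j y))"
  unfolding Aeq by (intro tendsto_sum tendsto_mult tendsto_const G_conv[OF th t tl gi Ck C0 Nt Nz])
 moreover have "(%k. Q k + 3 * s k) \<longlonglongrightarrow> e \<bullet> g + 3 * 0"
 proof (intro tendsto_intros s0)
  have "(%k. (u (th0 + s k *\<^sub>R e) - u (th0 + 0 *\<^sub>R e)) / (s k - 0)) \<longlonglongrightarrow> e \<bullet> g"
  proof -
   have "\<forall>i. s i \<in> UNIV - {0}" using s(1) by (metis DiffI UNIV_I empty_iff insert_iff less_irrefl)
   then show ?thesis
    using du s0 unfolding has_field_derivative_iff tendsto_at_iff_sequentially comp_def by blast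
  qed
  then show "Q \<longlonglongrightarrow> e \<bullet> g" by (simp add: Q_def [abs_def])
 qed
 ultimately have "(\<Sum>j\<in>UNIV. e $ j * (LINT y|M th0. grad (f th0) y \<bullet> v th0 j y)) <= e \<bullet> g + 3 * 0"
  by (rule LIMSEQ_le) (use le in auto)
 then show ?thesis by simp
qed

text \<open>The bound is applied to \<open>e\<close> and \<open>- e\<close>.\<close>

lemma entropy_gradient:
 assumes t: "th0 \<in> \<Theta>"
  and fin: "\<forall>\<^sub>F th in nhds th0. integrable lborel (%y. \<rho> th y * f th y)"
  and der: "GDERIV (%th. LINT y|lborel. \<rho> th y * f th y) th0 :> g"
  and gi: "!!th. th \<in> \<Theta> ==> integrable (M th) (%y. (norm (grad (f th) y))\<^sup>2)"
  and bnd: "!!th. (!!k. th k \<in> \<Theta>) ==> th \<longlonglongrightarrow> th0 ==> \<exists>C. \<forall>k. (LINT y|M (th k). (norm (grad (f (th k)) y))\<^sup>2) <= C"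
 shows "g $ j = (LINT y|M th0. grad (f th0) y \<bullet> v th0 j y)"
proof -
 let ?a = "%j. LINT y|M th0. grad (f th0) y \<bullet> v th0 j y"
 have ge: "(\<Sum>i\<in>UNIV. e $ i * ?a i) <= e \<bullet> g" for e
 proof (rule entropy_gradient_ge[OF t fin der])
  show "integrable (M th) (%y. (norm (grad (f th) y))\<^sup>2)" if "th \<in> \<Theta>" for th by (rule gi[OF that])
  show "\<exists>C. \<forall>k. (LINT y|M (th k). (norm (grad (f (th k)) y))\<^sup>2) <= C"
   if "!!k. th k \<in> \<Theta>" "th \<longlonglongrightarrow> th0" for th by (rule bnd[OF that])
 qed
 have s: "(\<Sum>i\<in>UNIV. axis j 1 $ i * ?a i) = ?a j"
  by (simp add: axis_def if_distrib[of "%x. x * _"] cong: if_cong)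
 have "?a j <= axis j 1 \<bullet> g" using ge[of "axis j 1"] unfolding s .
 moreover have "- ?a j <= - (axis j 1 \<bullet> g)"
 proof -
  have "(\<Sum>i\<in>UNIV. (- axis j 1 :: real^'m) $ i * ?a i) = - (\<Sum>i\<in>UNIV. axis j 1 $ i * ?a i)"
   by (simp only: vector_uminus_component mult_minus_left sum_negf)
  then have e: "(\<Sum>i\<in>UNIV. (- axis j 1 :: real^'m) $ i * ?a i) = - ?a j" unfolding s .
  show ?thesis using ge[of "- axis j 1"] unfolding e inner_minus_left .
 qed
 moreover have "axis j 1 \<bullet> g = g $ j" by (simp add: inner_axis')
 ultimately show ?thesis by linarith
qed

end

section \<open>Fisher information and the projected gradient\<close>

definition gradient_comb :: "('m::finite => 'p => real^'d => real) => 'p => real^'m => real^'d => real^'d"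
 where "gradient_comb \<psi> th \<xi> y = (\<Sum>k\<in>UNIV. \<xi> $ k *\<^sub>R grad (\<psi> k th) y)"

lemma norm_sum_scaleR_sq_le:
 fixes a :: "'i::finite => 'b::real_inner"
 shows "(norm (\<Sum>j\<in>UNIV. \<xi> $ j *\<^sub>R a j))\<^sup>2 <= (norm (\<xi>::real^'i))\<^sup>2 * (\<Sum>j\<in>UNIV. (norm (a j))\<^sup>2)"
proof -
 have "norm (\<Sum>j\<in>UNIV. \<xi> $ j *\<^sub>R a j) <= (\<Sum>j\<in>UNIV. norm (\<xi> $ j *\<^sub>R a j))" by (rule norm_sum)
 also have "... = (\<Sum>j\<in>UNIV. \<bar>\<xi> $ j\<bar> * norm (a j))" by simp
 finally have "(norm (\<Sum>j\<in>UNIV. \<xi> $ j *\<^sub>R a j))\<^sup>2 <= (\<Sum>j\<in>UNIV. \<bar>\<xi> $ j\<bar> * norm (a j))\<^sup>2" by (intro power_mono) auto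
 also have "... <= (\<Sum>j\<in>UNIV. \<bar>\<xi> $ j\<bar>\<^sup>2) * (\<Sum>j\<in>UNIV. (norm (a j))\<^sup>2)" by (rule Cauchy_Schwarz_ineq_sum)
 also have "(\<Sum>j\<in>UNIV. \<bar>\<xi> $ j\<bar>\<^sup>2) = (norm \<xi>)\<^sup>2"
  unfolding power2_norm_eq_inner inner_vec_def by (simp add: power2_eq_square)
 finally show ?thesis .
qed

lemma double_bound: "(x::real) <= 2 * a + 2 * b ==> a <= A ==> b <= B ==> x <= 2 * A + 2 * B"
 by simp

lemma completing_square_bound: "(i::real) = b + g + 2 * s - 2 * s - e ==> 0 <= b ==> i <= k ==> g <= k + e"
 by simp

context density_family
begin

context
 fixes \<psi> :: "'m => real^'m => real^'d => real" and \<kappa> :: real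
 assumes psi_diff: "!!th j y. th \<in> \<Theta> ==> \<psi> j th differentiable (at y)"
  and psi_weak: "!!th j R q. th \<in> \<Theta> ==> test2 R q ==> (LINT y|M th. (grad (\<psi> j th) y - v th j y) \<bullet> grad q y) = 0"
  and psi_L2: "!!th j. th \<in> \<Theta> ==> integrable (M th) (%y. (norm (grad (\<psi> j th) y))\<^sup>2)"
  and gram: "!!th \<xi>. th \<in> \<Theta> ==> \<xi> ~= 0 ==> 0 < (LINT y|M th. (norm (gradient_comb \<psi> th \<xi> y))\<^sup>2)"
  and defect: "!!th \<epsilon>. th \<in> \<Theta> ==> \<epsilon> > 0 ==> \<exists>\<xi>.
   integrable (M th) (%y. (norm (gradient_comb \<psi> th \<xi> y - grad (f th) y))\<^sup>2) &
   (LINT y|M th. (norm (gradient_comb \<psi> th \<xi> y - grad (f th) y))\<^sup>2) <= \<kappa> + \<epsilon>"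
begin

lemma psi_m: "th \<in> \<Theta> ==> grad (\<psi> j th) \<in> borel_measurable borel"
 by (rule grad_measurable[OF psi_diff])

lemma comb_m: "th \<in> \<Theta> ==> gradient_comb \<psi> th \<xi> \<in> borel_measurable borel"
 unfolding gradient_comb_def [abs_def] using psi_m by measurable

lemma M_m: "h \<in> borel_measurable (M th) \<longleftrightarrow> h \<in> borel_measurable borel"
 by (simp only: measurable_cong_sets[OF sets_M refl])

lemma comb_L2:
 assumes t: "th \<in> \<Theta>"
 shows "integrable (M th) (%y. (norm (gradient_comb \<psi> th \<xi> y))\<^sup>2)"
  and "(LINT y|M th. (norm (gradient_comb \<psi> th \<xi> y))\<^sup>2) <= (norm \<xi>)\<^sup>2 * (\<Sum>j\<in>UNIV. LINT y|M th. (norm (grad (\<psi> j th) y))\<^sup>2)"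
proof -
 have i: "integrable (M th) (%y. (norm \<xi>)\<^sup>2 * (\<Sum>j\<in>UNIV. (norm (grad (\<psi> j th) y))\<^sup>2))" using psi_L2[OF t] by simp
 have le: "(norm (gradient_comb \<psi> th \<xi> y))\<^sup>2 <= (norm \<xi>)\<^sup>2 * (\<Sum>j\<in>UNIV. (norm (grad (\<psi> j th) y))\<^sup>2)" for y
  unfolding gradient_comb_def by (rule norm_sum_scaleR_sq_le)
 have cm: "gradient_comb \<psi> th \<xi> \<in> borel_measurable (M th)" using comb_m[OF t] by (simp add: M_m)
 have nn: "0 <= (norm \<xi>)\<^sup>2 * (\<Sum>j\<in>UNIV. (norm (grad (\<psi> j th) y))\<^sup>2)" for y by (intro mult_nonneg_nonneg sum_nonneg) auto
 show 1: "integrable (M th) (%y. (norm (gradient_comb \<psi> th \<xi> y))\<^sup>2)"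
 proof (rule integrable_bd[OF i])
  show "(%y. (norm (gradient_comb \<psi> th \<xi> y))\<^sup>2) \<in> borel_measurable (M th)" using cm by measurable
  show "AE y in M th. norm ((norm (gradient_comb \<psi> th \<xi> y))\<^sup>2) <= norm ((norm \<xi>)\<^sup>2 * (\<Sum>j\<in>UNIV. (norm (grad (\<psi> j th) y))\<^sup>2))"
   using le nn by (intro AE_I2) (simp only: real_norm_def abs_of_nonneg zero_le_power2)
 qed
 have "(LINT y|M th. (norm (gradient_comb \<psi> th \<xi> y))\<^sup>2) <= (LINT y|M th. (norm \<xi>)\<^sup>2 * (\<Sum>j\<in>UNIV. (norm (grad (\<psi> j th) y))\<^sup>2))"
  by (rule integral_mono[OF 1 i le])
 then show "(LINT y|M th. (norm (gradient_comb \<psi> th \<xi> y))\<^sup>2) <= (norm \<xi>)\<^sup>2 * (\<Sum>j\<in>UNIV. LINT y|M th. (norm (grad (\<psi> j th) y))\<^sup>2)"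
  using psi_L2[OF t] by simp
qed

lemma score_L2_of_defect:
 assumes t: "th \<in> \<Theta>" and i: "integrable (M th) (%y. (norm (gradient_comb \<psi> th \<xi> y - grad (f th) y))\<^sup>2)"
 shows "integrable (M th) (%y. (norm (grad (f th) y))\<^sup>2)"
  and "(LINT y|M th. (norm (grad (f th) y))\<^sup>2) <= 2 * (LINT y|M th. (norm (gradient_comb \<psi> th \<xi> y))\<^sup>2)
   + 2 * (LINT y|M th. (norm (gradient_comb \<psi> th \<xi> y - grad (f th) y))\<^sup>2)"
proof -
 let ?S = "gradient_comb \<psi> th \<xi>"
 have m1: "?S \<in> borel_measurable (M th)" using comb_m[OF t] by (simp add: M_m)
 have m2: "(%y. ?S y - grad (f th) y) \<in> borel_measurable (M th)" using comb_m[OF t] gf_m[OF t] by (simp add: M_m)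
 have "integrable (M th) (%y. (norm (?S y - (?S y - grad (f th) y)))\<^sup>2)"
  by (rule integrable_norm_sq_add(2)[OF m1 m2 comb_L2(1)[OF t] i])
 then show 1: "integrable (M th) (%y. (norm (grad (f th) y))\<^sup>2)" by simp
 have le: "(norm (grad (f th) y))\<^sup>2 <= 2 * (norm (?S y))\<^sup>2 + 2 * (norm (?S y - grad (f th) y))\<^sup>2" for y
  using norm_add_sq_le[of 1 "?S y" "grad (f th) y - ?S y"] by (simp add: norm_minus_commute)
 have "(LINT y|M th. (norm (grad (f th) y))\<^sup>2) <= (LINT y|M th. 2 * (norm (?S y))\<^sup>2 + 2 * (norm (?S y - grad (f th) y))\<^sup>2)"
  by (rule integral_mono[OF 1 _ le]) (use comb_L2(1)[OF t] i in simp)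
 then show "(LINT y|M th. (norm (grad (f th) y))\<^sup>2) <= 2 * (LINT y|M th. (norm (?S y))\<^sup>2)
   + 2 * (LINT y|M th. (norm (?S y - grad (f th) y))\<^sup>2)" using comb_L2(1)[OF t] i by simp
qed

lemma score_L2: "th \<in> \<Theta> ==> integrable (M th) (%y. (norm (grad (f th) y))\<^sup>2)"
proof -
 assume t: "th \<in> \<Theta>"
 obtain \<xi> where "integrable (M th) (%y. (norm (gradient_comb \<psi> th \<xi> y - grad (f th) y))\<^sup>2)"
  using defect[OF t zero_less_one] by blast
 then show ?thesis by (rule score_L2_of_defect(1)[OF t])
qed

text \<open>The difference of the velocity and the potential gradient is weakly free of divergence, hence orthogonal to all gradients of finite energy.\<close>

lemma velocity_orthogonal:
 assumes t: "th \<in> \<Theta>" and h: "!!x. h differentiable (at x)" "integrable (M th) (%y. (norm (grad h y))\<^sup>2)"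
 shows "(LINT y|M th. v th j y \<bullet> grad h y) = (LINT y|M th. grad (\<psi> j th) y \<bullet> grad h y)"
proof -
 let ?z = "%y. grad (\<psi> j th) y - v th j y"
 have zm: "?z \<in> borel_measurable borel" using psi_m[OF t] v_m[OF t] by measurable
 have zi: "integrable (M th) (%y. (norm (?z y))\<^sup>2)"
  by (rule integrable_norm_sq_add(2)[OF _ _ psi_L2[OF t] v_sq_int[OF t]]) (simp_all add: M_m psi_m[OF t] v_m[OF t])
 interpret prob_space "M th" by (rule prob_M[OF t])
 have fm: "finite_measure (M th)" by unfold_locales
 have "(LINT y|M th. ?z y \<bullet> grad h y) = 0"
  unfolding M_def
  by (rule weak_divergence_extends[OF rho_c[OF t] rho_pos[OF t] fm[unfolded M_def] zm zi[unfolded M_def]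
    psi_weak[OF t, unfolded M_def] h(1) h(2)[unfolded M_def]])
 moreover have "integrable (M th) (%y. grad (\<psi> j th) y \<bullet> grad h y)"
  by (rule cs_M(1)[OF t psi_m[OF t] grad_measurable[OF h(1)] psi_L2[OF t] h(2)])
 moreover have "integrable (M th) (%y. v th j y \<bullet> grad h y)"
  by (rule cs_M(1)[OF t v_m[OF t] grad_measurable[OF h(1)] v_sq_int[OF t] h(2)])
 ultimately show ?thesis by (simp add: inner_diff_left)
qed

text \<open>The potential gradient is the orthogonal projection of the velocity to gradients.\<close>

lemma psi_norm_le:
 assumes t: "th \<in> \<Theta>"
 shows "(LINT y|M th. (norm (grad (\<psi> j th) y))\<^sup>2) <= (LINT y|M th. (norm (v th j y))\<^sup>2)"
proof -
 let ?a = "LINT y|M th. (norm (grad (\<psi> j th) y))\<^sup>2" and ?b = "LINT y|M th. (norm (v th j y))\<^sup>2"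
 have a0: "?a >= 0" and b0: "?b >= 0" by simp_all
 have "?a = (LINT y|M th. v th j y \<bullet> grad (\<psi> j th) y)"
  by (simp add: velocity_orthogonal[OF t psi_diff[OF t] psi_L2[OF t]] power2_norm_eq_inner)
 also have "... <= sqrt ?b * sqrt ?a"
  using cs_M(2)[OF t v_m[OF t] psi_m[OF t] v_sq_int[OF t] psi_L2[OF t]] by (meson abs_le_D1)
 finally have le: "sqrt ?a * sqrt ?a <= sqrt ?b * sqrt ?a" using a0 by simp
 have "sqrt ?a <= sqrt ?b"
 proof (cases "sqrt ?a = 0")
  case False
  with a0 have "sqrt ?a > 0" by (simp add: less_le)
  with le show ?thesis by (simp only: mult_le_cancel_right_pos)
 qed (use b0 in simp)
 then show ?thesis by simp
qed

lemma weak_score_conv: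
 assumes th: "!!k. th k \<in> \<Theta>" "th0 \<in> \<Theta>" "th \<longlonglongrightarrow> th0" and q: "test2 R q"
 shows "(%k. LINT y|M (th k). grad (f (th k)) y \<bullet> grad q y) \<longlonglongrightarrow> (LINT y|M th0. grad (f th0) y \<bullet> grad q y)"
  and "(%k. LINT y|M (th k). v (th k) j y \<bullet> grad q y) \<longlonglongrightarrow> (LINT y|M th0. v th0 j y \<bullet> grad q y)"
  and "\<exists>B. \<forall>y. norm (grad q y) <= B"
proof -
 have qd: "!!x. q differentiable (at x)" and qc: "continuous_on UNIV (grad q)"
  and qb: "!!b x. (%y. grad q y \<bullet> b) differentiable (at x)" and qbc: "!!b. continuous_on UNIV (grad (%y. grad q y \<bullet> b))"
  and q0: "!!x. norm x > R ==> q x = 0"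
  using q unfolding test2_def by blast+
 have q'0: "grad q x = 0" if "norm x > R" for x by (rule grad_zero_outside[OF q0 that])
 show B: "\<exists>B. \<forall>y. norm (grad q y) <= B" by (rule integrable_cont_bdd(2)[OF qc q'0])
 then obtain B where B: "!!y. norm (grad q y) <= B" by blast
 have qm: "grad q \<in> borel_measurable borel" by (rule borel_of_cont[OF qc])
 have eq: "(LINT y|M t. grad (f t) y \<bullet> grad q y) = (\<Sum>b\<in>Basis. LINT y|M t. (grad q y \<bullet> b) * (grad (f t) y \<bullet> b))" if t: "t \<in> \<Theta>" for t
 proof -
  interpret prob_space "M t" by (rule prob_M[OF t])
  have i: "integrable (M t) (%y. (grad q y \<bullet> b) * (grad (f t) y \<bullet> b))" if "b \<in> Basis" for b
  proof -
   have "integrable (M t) (%y. ((grad q y \<bullet> b) *\<^sub>R b) \<bullet> grad (f t) y)"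
   proof (rule cs_M(1)[OF t _ gf_m[OF t] _ score_L2[OF t]])
    show bm: "(%y. (grad q y \<bullet> b) *\<^sub>R b) \<in> borel_measurable borel" using qm by measurable
    show "integrable (M t) (%y. (norm ((grad q y \<bullet> b) *\<^sub>R b))\<^sup>2)"
    proof (rule integrable_const_bound[where B="B\<^sup>2"])
    have "norm ((grad q y \<bullet> b) *\<^sub>R b) <= B" for y
    using Basis_le_norm[OF that, of "grad q y"] B[of y] that by simp
    then show "AE y in M t. norm ((norm ((grad q y \<bullet> b) *\<^sub>R b))\<^sup>2) <= B\<^sup>2"
    by (intro AE_I2) (simp del: norm_scaleR add: power_mono)
    show "(%y. (norm ((grad q y \<bullet> b) *\<^sub>R b))\<^sup>2) \<in> borel_measurable (M t)" using bm unfolding M_m by measurable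
    qed
   qed
   then show ?thesis by (simp add: inner_commute mult.commute)
  qed
  have "(LINT y|M t. grad (f t) y \<bullet> grad q y) = (LINT y|M t. (\<Sum>b\<in>Basis. (grad q y \<bullet> b) * (grad (f t) y \<bullet> b)))"
   by (intro integral_cg refl) (subst euclidean_inner, simp add: mult.commute)
  then show ?thesis using i by simp
 qed
 show "(%k. LINT y|M (th k). grad (f (th k)) y \<bullet> grad q y) \<longlonglongrightarrow> (LINT y|M th0. grad (f th0) y \<bullet> grad q y)"
  unfolding eq[OF th(1)] eq[OF th(2)]
  by (intro tendsto_sum score_test_conv[OF th score_L2 qb qbc, where R=R]) (simp_all add: q'0)
 show "(%k. LINT y|M (th k). v (th k) j y \<bullet> grad q y) \<longlonglongrightarrow> (LINT y|M th0. v th0 j y \<bullet> grad q y)"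
 proof (rule push_conv[OF th, where j=j and B="\<bar>B\<bar>"])
  show m: "(%y. v (th k) j y \<bullet> grad q y) \<in> borel_measurable borel" for k using v_m[OF th(1)] qm by measurable
  show "(%y. v th0 j y \<bullet> grad q y) \<in> borel_measurable borel" using v_m[OF th(2)] qm by measurable
  show "(%k. v (th k) j (y k) \<bullet> grad q (y k)) \<longlonglongrightarrow> v th0 j y0 \<bullet> grad q y0" if "y \<longlonglongrightarrow> y0" for y y0
  proof (intro tendsto_inner v_tendsto[OF th that])
   show "(%k. grad q (y k)) \<longlonglongrightarrow> grad q y0" using continuous_on_tendsto_compose[OF qc that] by simp
  qed
  fix k y
  have "\<bar>v (th k) j y \<bullet> grad q y\<bar> <= norm (v (th k) j y) * norm (grad q y)" by (rule Cauchy_Schwarz_ineq2)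
  also have "... <= (1 + (norm (v (th k) j y))\<^sup>2) * \<bar>B\<bar>"
  proof (rule mult_mono)
   have "2 * norm (v (th k) j y) <= 1 + (norm (v (th k) j y))\<^sup>2" using sum_squares_bound[of 1 "norm (v (th k) j y)"] by simp
   then show "norm (v (th k) j y) <= 1 + (norm (v (th k) j y))\<^sup>2" using norm_ge_zero[of "v (th k) j y"] by linarith
   show "norm (grad q y) <= \<bar>B\<bar>" using B[of y] by linarith
  qed auto
  finally show "\<bar>v (th k) j y \<bullet> grad q y\<bar> <= \<bar>B\<bar> * (1 + (norm (v (th k) j y))\<^sup>2)" by (simp add: mult.commute)
 qed
qed

text \<open>Local boundedness of the Fisher information.  The score is a bounded remainder plus a
 combination of the potential gradients; the coefficients stay bounded because a normalised blow-up
 limit would be a combination of velocities that is orthogonal to all gradients, which positivity of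
 the Gram matrix excludes.\<close>

lemma fisher_information_bounded:
 assumes th: "!!k. th k \<in> \<Theta>" "th \<longlonglongrightarrow> th0" and t0: "th0 \<in> \<Theta>"
 shows "\<exists>C. \<forall>k. (LINT y|M (th k). (norm (grad (f (th k)) y))\<^sup>2) <= C"
proof -
 define P where "P k \<xi> \<longleftrightarrow> integrable (M (th k)) (%y. (norm (gradient_comb \<psi> (th k) \<xi> y - grad (f (th k)) y))\<^sup>2) &
   (LINT y|M (th k). (norm (gradient_comb \<psi> (th k) \<xi> y - grad (f (th k)) y))\<^sup>2) <= \<kappa> + 1" for k \<xi>
 have "\<forall>k. \<exists>\<xi>. P k \<xi>" unfolding P_def using defect[OF th(1) zero_less_one] by blast
 from choice[OF this] obtain \<xi> where \<xi>: "\<forall>k. P k (\<xi> k)" by blast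
 have di: "integrable (M (th k)) (%y. (norm (gradient_comb \<psi> (th k) (\<xi> k) y - grad (f (th k)) y))\<^sup>2)"
  and dn: "(LINT y|M (th k). (norm (gradient_comb \<psi> (th k) (\<xi> k) y - grad (f (th k)) y))\<^sup>2) <= \<kappa> + 1" for k
  using \<xi> unfolding P_def by blast+
 have bd: "bounded (range \<xi>)"
 proof (rule ccontr)
  assume nb: "\<not> bounded (range \<xi>)"
  have "\<forall>n. \<exists>k. k >= n & norm (\<xi> k) > real n"
  proof (rule ccontr)
   assume "\<not> ?thesis"
   then obtain n where n: "!!k. k >= n ==> norm (\<xi> k) <= real n" by (meson not_less)
   have "range \<xi> \<subseteq> \<xi> ` {..<n} \<union> cball 0 (real n)"
   proof
    fix x assume "x \<in> range \<xi>"
    then obtain k where "x = \<xi> k" by blast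
    then show "x \<in> \<xi> ` {..<n} \<union> cball 0 (real n)" using n[of k] by (cases "k < n") auto
   qed
   moreover have "bounded (\<xi> ` {..<n} \<union> cball 0 (real n))" by (simp add: finite_imp_bounded)
   ultimately show False using nb bounded_subset by blast
  qed
  from choice[OF this] obtain r where r: "\<forall>n. r n >= n & norm (\<xi> (r n)) > real n" by blast
  define F where "F n = \<xi> (r n) /\<^sub>R norm (\<xi> (r n))" for n
  have FS: "\<forall>n. F n \<in> sphere 0 1"
  proof
   fix n
   have "norm (\<xi> (r n)) > 0" using r[rule_format, of n] by (metis le_less_trans of_nat_0_le_iff)
   then show "F n \<in> sphere 0 1" by (simp add: F_def)
  qed
  have "compact (sphere (0::real^'m) 1)" by (rule compact_sphere)
  from this[unfolded compact_def, THEN spec[where x=F], THEN mp, OF FS] obtain \<zeta> l where \<zeta>: "\<zeta> \<in> sphere 0 1" and l: "strict_mono l"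
   and lim: "(F \<circ> l) \<longlonglongrightarrow> \<zeta>" by blast
  define i where "i n = r (l n)" for n
  have in_: "i n >= n" "norm (\<xi> (i n)) > real n" for n
  proof -
   have ln: "n <= l n" by (rule seq_suble[OF l])
   then show "i n >= n" using r[rule_format, of "l n"] by (simp add: i_def)
   have "real n <= real (l n)" using ln by simp
   then show "norm (\<xi> (i n)) > real n" using r[rule_format, of "l n"] unfolding i_def by linarith
  qed
  have it: "filterlim i at_top sequentially"
   by (rule filterlim_at_top_mono[OF filterlim_ident]) (use in_ in auto)
  have tl: "(%n. th (i n)) \<longlonglongrightarrow> th0" by (rule filterlim_compose[OF th(2) it])
  define \<zeta>' where "\<zeta>' n = \<xi> (i n) /\<^sub>R norm (\<xi> (i n))" for n
  have zl: "\<zeta>' \<longlonglongrightarrow> \<zeta>" using lim by (simp add: \<zeta>'_def [abs_def] i_def comp_def F_def)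
  have inv0: "(%n. inverse (norm (\<xi> (i n)))) \<longlonglongrightarrow> 0"
  proof (rule tendsto_inverse_0_at_top, rule filterlim_at_top_mono[OF filterlim_real_sequentially])
   show "\<forall>\<^sub>F n in sequentially. real n <= norm (\<xi> (i n))" using in_(2) by (auto intro!: always_eventually less_imp_le)
  qed
  have weak0: "(LINT y|M th0. gradient_comb \<psi> th0 \<zeta> y \<bullet> grad q y) = 0" if q: "test2 R q" for R q
  proof -
   have qd: "!!x. q differentiable (at x)" and qc: "continuous_on UNIV (grad q)" using q unfolding test2_def by blast+
   obtain B where B: "!!y. norm (grad q y) <= B" using weak_score_conv(3)[OF th(1) t0 tl q] by blast
   have qm: "grad q \<in> borel_measurable borel" by (rule borel_of_cont[OF qc])
   have q2: "integrable (M t) (%y. (norm (grad q y))\<^sup>2)" and q2B: "(LINT y|M t. (norm (grad q y))\<^sup>2) <= B\<^sup>2" if t: "t \<in> \<Theta>" for t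
   proof -
    interpret prob_space "M t" by (rule prob_M[OF t])
    have le: "(norm (grad q y))\<^sup>2 <= B\<^sup>2" for y by (intro power_mono B) simp
    show 1: "integrable (M t) (%y. (norm (grad q y))\<^sup>2)"
    proof (rule integrable_const_bound[where B="B\<^sup>2"])
    show "AE y in M t. norm ((norm (grad q y))\<^sup>2) <= B\<^sup>2" using le by simp
    show "(%y. (norm (grad q y))\<^sup>2) \<in> borel_measurable (M t)" using qm unfolding M_m by measurable
    qed
    have "(LINT y|M t. (norm (grad q y))\<^sup>2) <= (LINT y|M t. B\<^sup>2)" by (rule integral_mono[OF 1 _ le]) simp
    then show "(LINT y|M t. (norm (grad q y))\<^sup>2) <= B\<^sup>2" by (simp add: prob_space)
   qed
   have comb: "(LINT y|M t. gradient_comb \<psi> t x y \<bullet> grad q y) = (\<Sum>j\<in>UNIV. x $ j * (LINT y|M t. v t j y \<bullet> grad q y))"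
    if t: "t \<in> \<Theta>" for t x
   proof -
    have ji: "integrable (M t) (%y. grad (\<psi> j t) y \<bullet> grad q y)" for j
    by (rule cs_M(1)[OF t psi_m[OF t] qm psi_L2[OF t] q2[OF t]])
    have "(LINT y|M t. gradient_comb \<psi> t x y \<bullet> grad q y) = (LINT y|M t. (\<Sum>j\<in>UNIV. x $ j * (grad (\<psi> j t) y \<bullet> grad q y)))"
    by (simp add: gradient_comb_def inner_sum_left)
    also have "... = (\<Sum>j\<in>UNIV. x $ j * (LINT y|M t. grad (\<psi> j t) y \<bullet> grad q y))" using ji by simp
    finally show ?thesis by (simp add: velocity_orthogonal[OF t qd q2[OF t]])
   qed
   define c where "c n = (LINT y|M (th (i n)). gradient_comb \<psi> (th (i n)) (\<zeta>' n) y \<bullet> grad q y)" for n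
   have c1: "c \<longlonglongrightarrow> (LINT y|M th0. gradient_comb \<psi> th0 \<zeta> y \<bullet> grad q y)"
    unfolding c_def [abs_def] comb[OF th(1)] comb[OF t0]
    by (intro tendsto_sum tendsto_mult tendsto_vec_nth[OF zl] weak_score_conv(2)[OF th(1) t0 tl q])
   define d where "d n = (LINT y|M (th (i n)). (gradient_comb \<psi> (th (i n)) (\<xi> (i n)) y - grad (f (th (i n))) y) \<bullet> grad q y)" for n
   define e where "e n = (LINT y|M (th (i n)). grad (f (th (i n))) y \<bullet> grad q y)" for n
   have ce: "c n = inverse (norm (\<xi> (i n))) * (d n + e n)" for n
   proof -
    let ?t = "th (i n)"
    have m: "(%y. gradient_comb \<psi> ?t (\<xi> (i n)) y - grad (f ?t) y) \<in> borel_measurable borel"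
    using comb_m[OF th(1)] gf_m[OF th(1)] by measurable
    have i1: "integrable (M ?t) (%y. (gradient_comb \<psi> ?t (\<xi> (i n)) y - grad (f ?t) y) \<bullet> grad q y)"
    by (rule cs_M(1)[OF th(1) m qm di q2[OF th(1)]])
    have i2: "integrable (M ?t) (%y. grad (f ?t) y \<bullet> grad q y)"
    by (rule cs_M(1)[OF th(1) gf_m[OF th(1)] qm score_L2[OF th(1)] q2[OF th(1)]])
    have "d n + e n = (LINT y|M ?t. gradient_comb \<psi> ?t (\<xi> (i n)) y \<bullet> grad q y)"
    unfolding d_def e_def Bochner_Integration.integral_add[OF i1 i2, symmetric] by (simp add: inner_diff_left)
    moreover have "gradient_comb \<psi> ?t (\<zeta>' n) y = inverse (norm (\<xi> (i n))) *\<^sub>R gradient_comb \<psi> ?t (\<xi> (i n)) y" for y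
    by (simp add: gradient_comb_def \<zeta>'_def scaleR_sum_right)
    ultimately show ?thesis by (simp add: c_def)
   qed
   have db: "\<bar>d n\<bar> <= sqrt (\<kappa> + 1) * sqrt (B\<^sup>2)" for n
   proof -
    let ?t = "th (i n)"
    have m: "(%y. gradient_comb \<psi> ?t (\<xi> (i n)) y - grad (f ?t) y) \<in> borel_measurable borel"
    using comb_m[OF th(1)] gf_m[OF th(1)] by measurable
    have "\<bar>d n\<bar> <= sqrt (LINT y|M ?t. (norm (gradient_comb \<psi> ?t (\<xi> (i n)) y - grad (f ?t) y))\<^sup>2) * sqrt (LINT y|M ?t. (norm (grad q y))\<^sup>2)"
    unfolding d_def by (rule cs_M(2)[OF th(1) m qm di q2[OF th(1)]])
    also have "... <= sqrt (\<kappa> + 1) * sqrt (B\<^sup>2)"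
    by (intro mult_mono real_sqrt_le_mono dn q2B th(1)) (auto intro: order_trans[OF _ dn])
    finally show ?thesis .
   qed
   have "(%n. inverse (norm (\<xi> (i n))) * e n) \<longlonglongrightarrow> 0 * (LINT y|M th0. grad (f th0) y \<bullet> grad q y)"
    unfolding e_def by (intro tendsto_mult inv0 weak_score_conv(1)[OF th(1) t0 tl q])
   moreover have "(%n. inverse (norm (\<xi> (i n))) * d n) \<longlonglongrightarrow> 0"
   proof (rule Lim_null_comparison)
    show "(%n. inverse (norm (\<xi> (i n))) * (sqrt (\<kappa> + 1) * sqrt (B\<^sup>2))) \<longlonglongrightarrow> 0"
    by (rule tendsto_mult_left_zero[OF inv0])
    have "norm (inverse (norm (\<xi> (i n))) * d n) <= inverse (norm (\<xi> (i n))) * (sqrt (\<kappa> + 1) * sqrt (B\<^sup>2))" for n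
    unfolding real_norm_def abs_mult by (intro mult_mono db) auto
    then show "\<forall>\<^sub>F n in sequentially. norm (inverse (norm (\<xi> (i n))) * d n) <= inverse (norm (\<xi> (i n))) * (sqrt (\<kappa> + 1) * sqrt (B\<^sup>2))"
    by simp
   qed
   ultimately have "(%n. inverse (norm (\<xi> (i n))) * d n + inverse (norm (\<xi> (i n))) * e n) \<longlonglongrightarrow> 0 + 0 * (LINT y|M th0. grad (f th0) y \<bullet> grad q y)"
    by (intro tendsto_add)
   then have "c \<longlonglongrightarrow> 0" by (simp add: ce [abs_def] distrib_left)
   with c1 show ?thesis by (rule LIMSEQ_unique)
  qed
  define h where "h y = (\<Sum>j\<in>UNIV. \<zeta> $ j * \<psi> j th0 y)" for y
  have hder: "(h has_derivative (%e. gradient_comb \<psi> th0 \<zeta> y \<bullet> e)) (at y)" for y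
  proof -
   have "(h has_derivative (%e. \<Sum>j\<in>UNIV. \<zeta> $ j * (grad (\<psi> j th0) y \<bullet> e))) (at y)"
    unfolding h_def [abs_def] by (intro has_derivative_sum has_derivative_mult_right grad_has_derivative psi_diff[OF t0])
   then show ?thesis by (simp add: gradient_comb_def inner_sum_left)
  qed
  have hd: "h differentiable (at y)" for y using hder[of y] by (auto simp: differentiable_def)
  have hg: "grad h = gradient_comb \<psi> th0 \<zeta>" using grad_eqI[OF hder] by (simp add: fun_eq_iff)
  interpret prob_space "M th0" by (rule prob_M[OF t0])
  have fm: "finite_measure (M th0)" by unfold_locales
  have "(LINT y|M th0. gradient_comb \<psi> th0 \<zeta> y \<bullet> grad h y) = 0"
   unfolding M_def
   by (rule weak_divergence_extends[OF rho_c[OF t0] rho_pos[OF t0] fm[unfolded M_def] comb_m[OF t0]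
    comb_L2(1)[OF t0, unfolded M_def] weak0[unfolded M_def] hd])
    (use comb_L2(1)[OF t0, of \<zeta>] in \<open>simp_all add: hg M_def\<close>)
  then have "(LINT y|M th0. (norm (gradient_comb \<psi> th0 \<zeta> y))\<^sup>2) = 0" by (simp add: hg power2_norm_eq_inner)
  moreover have "\<zeta> ~= 0" using \<zeta> by auto
  ultimately show False using gram[OF t0, of \<zeta>] by simp
 qed
 then obtain X where X: "!!k. norm (\<xi> k) <= X" unfolding bounded_iff by blast
 have "\<forall>j. \<exists>C. \<forall>k. (LINT y|M (th k). (norm (v (th k) j y))\<^sup>2) <= C"
 proof
  fix j
  have "(%k. LINT y|M (th k). (norm (v (th k) j y))\<^sup>2) \<longlonglongrightarrow> (LINT y|M th0. (norm (v th0 j y))\<^sup>2)"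
  proof (rule push_conv[OF th(1) t0 th(2), where j=j and B=1])
   show "(%y. (norm (v (th k) j y))\<^sup>2) \<in> borel_measurable borel" for k using v_m[OF th(1)] by measurable
   show "(%y. (norm (v th0 j y))\<^sup>2) \<in> borel_measurable borel" using v_m[OF t0] by measurable
   show "(%k. (norm (v (th k) j (y k)))\<^sup>2) \<longlonglongrightarrow> (norm (v th0 j y0))\<^sup>2" if "y \<longlonglongrightarrow> y0" for y y0
    by (intro tendsto_power tendsto_norm v_tendsto[OF th(1) t0 th(2) that])
  qed simp
  then have "Bseq (%k. LINT y|M (th k). (norm (v (th k) j y))\<^sup>2)" by (intro convergent_imp_Bseq convergentI)
  then obtain C where "\<forall>k. norm (LINT y|M (th k). (norm (v (th k) j y))\<^sup>2) <= C" by (auto simp: Bseq_def)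
  then show "\<exists>C. \<forall>k. (LINT y|M (th k). (norm (v (th k) j y))\<^sup>2) <= C" by (metis abs_le_D1 real_norm_def)
 qed
 from choice[OF this] obtain C where C: "\<forall>j k. (LINT y|M (th k). (norm (v (th k) j y))\<^sup>2) <= C j" by blast
 have "(LINT y|M (th k). (norm (grad (f (th k)) y))\<^sup>2) <= 2 * (X\<^sup>2 * (\<Sum>j\<in>UNIV. C j)) + 2 * (\<kappa> + 1)" for k
 proof -
  have "(LINT y|M (th k). (norm (gradient_comb \<psi> (th k) (\<xi> k) y))\<^sup>2)
    <= (norm (\<xi> k))\<^sup>2 * (\<Sum>j\<in>UNIV. LINT y|M (th k). (norm (grad (\<psi> j (th k)) y))\<^sup>2)" by (rule comb_L2(2)[OF th(1)])
  also have "... <= X\<^sup>2 * (\<Sum>j\<in>UNIV. C j)"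
   by (intro mult_mono power_mono X sum_mono sum_nonneg order_trans[OF psi_norm_le[OF th(1)]] C[rule_format]) auto
  finally have le: "(LINT y|M (th k). (norm (gradient_comb \<psi> (th k) (\<xi> k) y))\<^sup>2) <= X\<^sup>2 * (\<Sum>j\<in>UNIV. C j)" .
  show ?thesis by (rule double_bound[OF score_L2_of_defect(2)[OF th(1) di[of k]] le dn[of k]])
 qed
 then show ?thesis by blast
qed

text \<open>The part of the Fisher information that the projected flow dissipates is its squared norm minus
 the squared distance of the score from the span of the potential gradients.\<close>

lemma fisher_information_le:
 assumes t: "th \<in> \<Theta>"
  and \<eta>: "!!i. (\<Sum>j\<in>UNIV. \<eta> $ j * (LINT y|M th. grad (\<psi> i th) y \<bullet> grad (\<psi> j th) y)) = (LINT y|M th. grad (f th) y \<bullet> v th i y)"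
 shows "(LINT y|M th. (norm (grad (f th) y))\<^sup>2) <= \<kappa> + (\<Sum>i\<in>UNIV. \<eta> $ i * (LINT y|M th. grad (f th) y \<bullet> v th i y))"
proof (rule field_le_epsilon)
 fix \<epsilon> :: real assume "\<epsilon> > 0"
 then obtain \<xi> where di: "integrable (M th) (%y. (norm (gradient_comb \<psi> th \<xi> y - grad (f th) y))\<^sup>2)"
  and dn: "(LINT y|M th. (norm (gradient_comb \<psi> th \<xi> y - grad (f th) y))\<^sup>2) <= \<kappa> + \<epsilon>"
  using defect[OF t] by blast
 define a where "a i = (LINT y|M th. grad (f th) y \<bullet> v th i y)" for i
 let ?S = "gradient_comb \<psi> th" and ?g = "grad (f th)"
 have Sg: "(LINT y|M th. ?S x y \<bullet> ?g y) = (\<Sum>i\<in>UNIV. x $ i * a i)" for x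
 proof -
  have i: "integrable (M th) (%y. grad (\<psi> j th) y \<bullet> ?g y)" for j
   by (rule cs_M(1)[OF t psi_m[OF t] gf_m[OF t] psi_L2[OF t] score_L2[OF t]])
  have "(LINT y|M th. ?S x y \<bullet> ?g y) = (LINT y|M th. (\<Sum>j\<in>UNIV. x $ j * (grad (\<psi> j th) y \<bullet> ?g y)))"
   by (simp add: gradient_comb_def inner_sum_left)
  also have "... = (\<Sum>j\<in>UNIV. x $ j * (LINT y|M th. grad (\<psi> j th) y \<bullet> ?g y))" using i by simp
  finally show ?thesis
   by (simp add: velocity_orthogonal[OF t f_diff[OF t] score_L2[OF t], symmetric] a_def inner_commute)
 qed
 have SS: "(LINT y|M th. ?S x y \<bullet> ?S \<eta> y) = (\<Sum>i\<in>UNIV. x $ i * a i)" for x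
 proof -
  have i: "integrable (M th) (%y. grad (\<psi> i th) y \<bullet> grad (\<psi> j th) y)" for i j
   by (rule cs_M(1)[OF t psi_m[OF t] psi_m[OF t] psi_L2[OF t] psi_L2[OF t]])
  have "(LINT y|M th. ?S x y \<bullet> ?S \<eta> y) = (LINT y|M th. (\<Sum>i\<in>UNIV. x $ i * (\<Sum>j\<in>UNIV. \<eta> $ j * (grad (\<psi> i th) y \<bullet> grad (\<psi> j th) y))))"
   unfolding gradient_comb_def by (simp only: inner_sum_left inner_scaleR_left) (simp add: inner_sum_right)
  also have "... = (\<Sum>i\<in>UNIV. x $ i * (\<Sum>j\<in>UNIV. \<eta> $ j * (LINT y|M th. grad (\<psi> i th) y \<bullet> grad (\<psi> j th) y)))" using i by simp
  finally show ?thesis by (simp add: \<eta> a_def)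
 qed
 have i1: "integrable (M th) (%y. ?S x y \<bullet> ?S x' y)" for x x'
  by (rule cs_M(1)[OF t comb_m[OF t] comb_m[OF t] comb_L2(1)[OF t] comb_L2(1)[OF t]])
 have i2: "integrable (M th) (%y. ?S x y \<bullet> ?g y)" for x
  by (rule cs_M(1)[OF t comb_m[OF t] gf_m[OF t] comb_L2(1)[OF t] score_L2[OF t]])
 have i3: "integrable (M th) (%y. (norm (?g y))\<^sup>2)" by (rule score_L2[OF t])
 \<comment> \<open>\<open>|S \<xi> - g|\<^sup>2 = |S \<xi> - S \<eta>|\<^sup>2 + |g|\<^sup>2 - |S \<eta>|\<^sup>2\<close> after integration\<close>
 have pw: "(norm (?S \<xi> y - ?g y))\<^sup>2 = (norm (?S \<xi> y - ?S \<eta> y))\<^sup>2 + (norm (?g y))\<^sup>2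
   + 2 * (?S \<xi> y \<bullet> ?S \<eta> y) - 2 * (?S \<xi> y \<bullet> ?g y) - ?S \<eta> y \<bullet> ?S \<eta> y" for y
  by (simp add: power2_norm_eq_inner inner_diff_left inner_diff_right inner_commute)
 have i4: "integrable (M th) (%y. (norm (?S \<xi> y - ?S \<eta> y))\<^sup>2)"
  by (rule integrable_norm_sq_add(2)) (simp_all add: M_m comb_m[OF t] comb_L2(1)[OF t])
 have eqI: "(LINT y|M th. (norm (?S \<xi> y - ?g y))\<^sup>2) = (LINT y|M th. (norm (?S \<xi> y - ?S \<eta> y))\<^sup>2) + (LINT y|M th. (norm (?g y))\<^sup>2)
   + 2 * (LINT y|M th. ?S \<xi> y \<bullet> ?S \<eta> y) - 2 * (LINT y|M th. ?S \<xi> y \<bullet> ?g y) - (LINT y|M th. ?S \<eta> y \<bullet> ?S \<eta> y)"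
  unfolding pw using i1 i2 i3 i4 by simp
 have nn: "(LINT y|M th. (norm (?S \<xi> y - ?S \<eta> y))\<^sup>2) >= 0" by simp
 have "(LINT y|M th. (norm (?g y))\<^sup>2) <= \<kappa> + \<epsilon> + (\<Sum>i\<in>UNIV. \<eta> $ i * a i)" 
  by (rule completing_square_bound[OF eqI[unfolded Sg SS] nn dn])
 then show "(LINT y|M th. (norm (?g y))\<^sup>2) <= \<kappa> + (\<Sum>i\<in>UNIV. \<eta> $ i * (LINT y|M th. grad (f th) y \<bullet> v th i y)) + \<epsilon>"
  by (simp add: a_def)
qed

end

end

section \<open>Potentials and transport maps\<close>

lemma C2_real:
 fixes W :: "real^'n => real"
 assumes "C2_on UNIV W"
 shows "W differentiable (at x)" and "continuous_on UNIV (grad W)" and "continuous_on UNIV W"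
  and "(grad W has_derivative (%h. hessian W x *v h)) (at x)"
proof -
 obtain W' W'' where d: "!!x. (W has_derivative blinfun_apply (W' x)) (at x)"
  and d2: "!!x. (W' has_derivative blinfun_apply (W'' x)) (at x)"
  using assms unfolding C2_on_def by auto
 show wd: "W differentiable (at x)" for x using d[of x] by (auto simp: differentiable_def)
 then show "continuous_on UNIV W" by (rule diff_imp_cont)
 define \<Phi> where "\<Phi> B = (\<Sum>i\<in>UNIV. blinfun_apply B (axis i 1) *\<^sub>R (axis i 1 :: real^'n))" for B :: "(real^'n) \<Rightarrow>\<^sub>L real"
 have l: "bounded_linear (\<Phi> :: ((real^'n) \<Rightarrow>\<^sub>L real) => real^'n)"
  unfolding \<Phi>_def [abs_def]
  by (intro bounded_linear_sum bounded_linear_scaleR_const bounded_linear_apply_blinfun)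
 have e: "grad W = (%x. \<Phi> (W' x))"
 proof (rule ext, subst vec_eq_iff, intro allI)
  fix x i
  have "frechet_derivative W (at x) = blinfun_apply (W' x)" by (rule frechet_derivative_at[OF d, symmetric])
  then show "grad W x $ i = \<Phi> (W' x) $ i"
   by (simp add: grad_def \<Phi>_def axis_def if_distrib[of "%x. _ * x"] cong: if_cong)
 qed
 have gd: "(grad W has_derivative (%h. \<Phi> (W'' x h))) (at x)" for x
  unfolding e by (rule bounded_linear.has_derivative[OF l d2])
 have gdf: "grad W differentiable (at x)" for x using gd[of x] by (auto simp: differentiable_def)
 show "continuous_on UNIV (grad W)"
  by (rule continuous_at_imp_continuous_on) (auto intro: differentiable_imp_continuous_within[OF gdf])
 show "(grad W has_derivative (%h. hessian W x *v h)) (at x)"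
  unfolding hessian_def using jacobian_works[of "grad W" "at x"] gdf[of x] by blast
qed

text \<open>Along a line the lower bound on the Hessian is a bound on a second derivative.\<close>

lemma uniformly_convex_line:
 fixes U :: "real^'n => real"
 assumes C2: "C2_on UNIV U" and H: "!!x. loewner_le (K *\<^sub>R mat 1) (hessian U x)"
 shows "convex_on UNIV (%\<tau>. U (y + \<tau> *\<^sub>R h) - K / 2 * (norm h)\<^sup>2 * \<tau>\<^sup>2)"
  and "((%\<tau>. U (y + \<tau> *\<^sub>R h) - K / 2 * (norm h)\<^sup>2 * \<tau>\<^sup>2) has_real_derivative grad U y \<bullet> h) (at 0)"
proof -
 let ?g = "%\<tau>. U (y + \<tau> *\<^sub>R h) - K / 2 * (norm h)\<^sup>2 * \<tau>\<^sup>2"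
 have l: "((%\<tau>. y + \<tau> *\<^sub>R h) has_derivative (%s. s *\<^sub>R h)) (at \<tau>)" for \<tau>
  by (auto intro!: derivative_eq_intros)
 have u1: "((%\<tau>. U (y + \<tau> *\<^sub>R h)) has_real_derivative grad U (y + \<tau> *\<^sub>R h) \<bullet> h) (at \<tau>)" for \<tau>
  using has_derivative_compose[OF l grad_has_derivative[OF C2_real(1)[OF C2]]]
  by (simp add: has_field_derivative_def mult.commute[of _ "grad U _ \<bullet> h"])
 have u2: "((%\<tau>. grad U (y + \<tau> *\<^sub>R h) \<bullet> h) has_real_derivative (hessian U (y + \<tau> *\<^sub>R h) *v h) \<bullet> h) (at \<tau>)" for \<tau>
  using has_derivative_inner_left[OF has_derivative_compose[OF l C2_real(4)[OF C2]], of h]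
  by (simp add: has_field_derivative_def matrix_vector_mult_scaleR mult.commute[of _ "(hessian U _ *v h) \<bullet> h"])
 have g1: "(?g has_real_derivative grad U (y + \<tau> *\<^sub>R h) \<bullet> h - K * (norm h)\<^sup>2 * \<tau>) (at \<tau>)" for \<tau>
  by (rule DERIV_cong[OF DERIV_diff[OF u1]], (rule derivative_eq_intros | simp)+)
 have g2: "((%\<tau>. grad U (y + \<tau> *\<^sub>R h) \<bullet> h - K * (norm h)\<^sup>2 * \<tau>) has_real_derivative
   (hessian U (y + \<tau> *\<^sub>R h) *v h) \<bullet> h - K * (norm h)\<^sup>2) (at \<tau>)" for \<tau>
  by (rule DERIV_diff[OF u2]) (auto intro!: derivative_eq_intros)
 have "(hessian U x *v h) \<bullet> h - K * (norm h)\<^sup>2 >= 0" for x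
  using H[of x] unfolding loewner_le_def
  by (auto simp: scaleR_matrix_vector_assoc[symmetric] power2_norm_eq_inner inner_commute dest: spec[where x=h])
 then show "convex_on UNIV ?g" by (intro f''_ge0_imp_convex[OF convex_UNIV g1 g2])
 show "(?g has_real_derivative grad U y \<bullet> h) (at 0)" using g1[of 0] by simp
qed

lemma uniformly_convex:
 fixes U :: "real^'n => real"
 assumes C2: "C2_on UNIV U" and H: "!!x. loewner_le (K *\<^sub>R mat 1) (hessian U x)"
  and ts: "t > 0" "s > 0" "t + s = 1"
 shows "U (t *\<^sub>R x + s *\<^sub>R y) <= t * U x + s * U y - K / 2 * t * s * (norm (x - y))\<^sup>2"
proof -
 define n where "n = (norm (x - y))\<^sup>2"
 have s: "s = 1 - t" using ts by simp
 have e: "y + t *\<^sub>R (x - y) = t *\<^sub>R x + s *\<^sub>R y" by (simp add: s scaleR_diff_right scaleR_diff_left)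
 have "U (y + t *\<^sub>R (x - y)) - K / 2 * n * t\<^sup>2 <= (1 - t) * U y + t * (U x - K / 2 * n)"
  using convex_onD[OF uniformly_convex_line(1)[OF C2 H, where y=y and h="x - y"], of t 0 1] ts by (simp add: n_def)
 then show ?thesis unfolding e n_def[symmetric] by (simp add: s power2_eq_square algebra_simps diff_divide_distrib add_divide_distrib)
qed

text \<open>The tangent inequality at 0; half of the quadratic term absorbs the linear one.\<close>

lemma uniformly_convex_lower_bound:
 fixes U :: "real^'n => real"
 assumes C2: "C2_on UNIV U" and H: "!!x. loewner_le (K *\<^sub>R mat 1) (hessian U x)" and K: "K > 0"
 shows "U x >= U 0 - (norm (grad U 0))\<^sup>2 / K + K / 4 * (norm x)\<^sup>2"
proof -
 have d: "((%\<tau>. U (0 + \<tau> *\<^sub>R x) - K / 2 * (norm x)\<^sup>2 * \<tau>\<^sup>2) has_real_derivative grad U 0 \<bullet> x) (at 0 within UNIV)"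
  using uniformly_convex_line(2)[OF C2 H, where y=0 and h=x] by simp
 have "grad U 0 \<bullet> x * (1 - 0) <= (U (0 + 1 *\<^sub>R x) - K / 2 * (norm x)\<^sup>2 * 1\<^sup>2) - (U (0 + 0 *\<^sub>R x) - K / 2 * (norm x)\<^sup>2 * 0\<^sup>2)"
  by (rule convex_on_imp_above_tangent[OF uniformly_convex_line(1)[OF C2 H, where y=0 and h=x] _ _ _ d]) auto
 then have 1: "grad U 0 \<bullet> x <= U x - K / 2 * (norm x)\<^sup>2 - U 0" by simp
 have 2: "- (norm (grad U 0) * norm x) <= grad U 0 \<bullet> x"
  using Cauchy_Schwarz_ineq2[of "grad U 0" x] by (simp add: abs_le_iff)
 define a where "a = norm (grad U 0) / sqrt K"
 define b where "b = sqrt K * norm x / 2"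
 have "norm (grad U 0) * norm x = 2 * a * b" "a\<^sup>2 = (norm (grad U 0))\<^sup>2 / K" "b\<^sup>2 = K / 4 * (norm x)\<^sup>2"
  using K by (simp_all add: a_def b_def power_divide power_mult_distrib)
 then have "norm (grad U 0) * norm x <= (norm (grad U 0))\<^sup>2 / K + K / 4 * (norm x)\<^sup>2"
  using sum_squares_bound[of a b] by simp
 with 1 2 show ?thesis by linarith
qed

lemma integrable_gaussian:
 assumes a: "a > 0"
 shows "integrable lborel (%x::'a::euclidean_space. exp (- a * (norm x)\<^sup>2))"
proof -
 define \<sigma> where "\<sigma> = sqrt (1 / (2 * a))"
 have \<sigma>: "\<sigma> > 0" "\<sigma>\<^sup>2 = 1 / (2 * a)" using a by (simp_all add: \<sigma>_def)
 have e1: "exp (- a * t\<^sup>2) = sqrt (2 * pi * \<sigma>\<^sup>2) * normal_density 0 \<sigma> t" for t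
  using a pi_gt_zero by (simp add: normal_density_def \<sigma>(2))
 have "integrable lborel (%t. normal_density 0 \<sigma> t * (t - 0) ^ 0)" by (rule integrable_normal_moment[OF \<sigma>(1)])
 then have i1: "integrable lborel (%t::real. exp (- a * t\<^sup>2))" unfolding e1 by simp
 have f1: "(\<integral>\<^sup>+t. ennreal (exp (- a * t\<^sup>2)) \<partial>lborel) < \<infinity>"
  using i1 by (subst nn_integral_eq_integral) auto
 have pe: "ennreal (exp (- a * (norm x)\<^sup>2)) = (\<Prod>b\<in>Basis. ennreal (exp (- a * (x \<bullet> b)\<^sup>2)))" for x :: 'a
  unfolding norm_sq_eq_sum_Basis by (simp add: sum_distrib_left exp_sum prod_ennreal sum_negf[symmetric])
 have "(\<integral>\<^sup>+x. ennreal (exp (- a * (norm (x::'a))\<^sup>2)) \<partial>lborel) = (\<Prod>b\<in>(Basis::'a set). (\<integral>\<^sup>+t. ennreal (exp (- a * t\<^sup>2)) \<partial>lborel))"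
  unfolding pe by (rule nn_integral_lborel_prod[where f="%_ t. ennreal (exp (- a * t\<^sup>2))"]) auto
 also have "... < \<infinity>" using f1 by (simp add: power_less_top_ennreal)
 finally show ?thesis by (intro integrableI_bounded) auto
qed

lemma integrable_exp_uniformly_convex:
 fixes U :: "real^'n => real"
 assumes C2: "C2_on UNIV U" and H: "!!x. loewner_le (K *\<^sub>R mat 1) (hessian U x)" and K: "K > 0" and D: "D > 0"
 shows "integrable lborel (%x. exp (- U x / D))"
proof -
 define c where "c = U 0 - (norm (grad U 0))\<^sup>2 / K"
 have "integrable lborel (%x::real^'n. exp (- c / D) * exp (- (K / 4 / D) * (norm x)\<^sup>2))"
  using integrable_gaussian[of "K / 4 / D"] K D by simp
 then show ?thesis
 proof (rule integrable_bd)
  have uc: "continuous_on UNIV (%x. exp (- U x / D))" using D by (intro continuous_intros C2_real(3)[OF C2]) auto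
  show "(%x. exp (- U x / D)) \<in> borel_measurable lborel" using borel_of_cont[OF uc] by simp
  show "AE x in lborel. norm (exp (- U x / D)) <= norm (exp (- c / D) * exp (- (K / 4 / D) * (norm x)\<^sup>2))"
  proof (rule AE_I2)
   fix x
   have "c + K / 4 * (norm x)\<^sup>2 <= U x" unfolding c_def by (rule uniformly_convex_lower_bound[OF C2 H K])
   then have "- U x / D <= (- c - K / 4 * (norm x)\<^sup>2) / D" using D by (intro divide_right_mono) auto
   also have "... = - c / D + - (K / 4 / D) * (norm x)\<^sup>2" by (simp add: diff_divide_distrib)
   finally show "norm (exp (- U x / D)) <= norm (exp (- c / D) * exp (- (K / 4 / D) * (norm x)\<^sup>2))"
    by (simp add: exp_add[symmetric])
  qed
 qed
qed

text \<open>The determinant is a polynomial in the matrix entries.\<close>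

lemma jac_continuous:
 fixes B :: "'z::topological_space => real^'n => real^'n"
 assumes "!!h. continuous_on S (%z. B z h)"
 shows "continuous_on S (%z. jac (B z))"
 unfolding jac_def det_def matrix_def reindex_def
 by (simp, intro continuous_intros assms)

lemma norm_column_le: "norm (column j (A :: real^'m^'d)) <= norm A"
proof -
 have "(A $ i $ j)\<^sup>2 <= (norm (A $ i))\<^sup>2" for i
  using power_mono[OF component_le_norm_cart[of "A $ i" j] abs_ge_zero, of 2] by simp
 then have "(norm (column j A))\<^sup>2 <= (norm A)\<^sup>2"
  unfolding power2_norm_eq_inner inner_vec_def by (intro sum_mono) (simp add: column_def power2_eq_square power2_norm_eq_inner inner_vec_def)
 then show ?thesis by (rule power2_le_imp_le) simp
qed

text \<open>The parametrised maps provide a family of densities.  The inverse maps depend continuously on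
 parameter and point by invariance of domain, and the change of variables formula then makes the
 densities positive and jointly continuous.\<close>

lemma density_family_of_transport_maps:
 fixes \<Theta> :: "(real^'m) set" and T :: "real^'m => real^'d => real^'d" and p :: "(real^'d) measure"
 assumes Theta: "open \<Theta>"
  and T_inv: "!!th. th \<in> \<Theta> ==> bij (T th)"
  and T_C2: "C2_on (\<Theta> \<times> UNIV) (%(th, x). T th x)"
  and p: "prob_space p" "p = density lborel (%x. ennreal (p0 x))"
  and p0: "continuous_on UNIV p0" "!!x. p0 x > 0"
  and rho: "!!th. th \<in> \<Theta> ==> distributed p lborel (T th) (%y. ennreal (\<rho> th y))"
  and rho_diff: "!!th y. th \<in> \<Theta> ==> \<rho> th differentiable (at y)"
  and condition2: "!!th0. th0 \<in> \<Theta> ==> \<exists>r>0. \<exists>L. integrable p L &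
    (\<forall>x. \<forall>th\<in>\<Theta>. norm (th - th0) < r --> (norm (param_jacobian T th x))\<^sup>2 <= L x)"
  and m: "!!y. m y > 0" "integrable lborel m" "(LINT y|lborel. m y) = 1" "!!y. m differentiable (at y)"
   "continuous_on UNIV (grad (%y. ln (m y)))"
 shows "density_family \<Theta> p T \<rho> (param_velocity T) m"
proof -
 obtain F' F'' where "\<forall>z\<in>\<Theta> \<times> UNIV. ((%(th, x). T th x) has_derivative blinfun_apply (F' z)) (at z)"
  and "\<forall>z\<in>\<Theta> \<times> UNIV. (F' has_derivative blinfun_apply (F'' z)) (at z)"
  using T_C2 unfolding C2_on_def by auto
 then have F: "((%(th, x). T th x) has_derivative blinfun_apply (F' (th, x))) (at (th, x))"
  and F2: "(F' has_derivative blinfun_apply (F'' (th, x))) (at (th, x))" if "th \<in> \<Theta>" for th x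
  using that by auto
 have opS: "open (\<Theta> \<times> (UNIV :: (real^'d) set))" using Theta by (intro open_Times) auto
 have F'c: "continuous_on (\<Theta> \<times> UNIV) F'"
  by (rule continuous_at_imp_continuous_on) (auto intro: has_derivative_continuous[OF F2])
 have Fc: "continuous_on (\<Theta> \<times> UNIV) (%(th, x). T th x)"
  by (rule continuous_at_imp_continuous_on) (use has_derivative_continuous[OF F] in auto)
 have dT: "((%th. T th x) has_derivative (%e. F' (th, x) (e, 0))) (at th)" if "th \<in> \<Theta>" for th x
 proof -
  have "((%th. (th, x)) has_derivative (%e. (e, 0))) (at th)" by (auto intro!: derivative_eq_intros)
  from has_derivative_compose[OF this F[OF that]] show ?thesis by simp
 qed
 have dX: "(T th has_derivative (%h. F' (th, x) (0, h))) (at x)" if "th \<in> \<Theta>" for th x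
 proof -
  have "((%x. (th, x)) has_derivative (%h. (0, h))) (at x)" by (auto intro!: derivative_eq_intros)
  from has_derivative_compose[OF this F[OF that]] show ?thesis by simp
 qed
 have pj: "param_jacobian T th x = matrix (%e. F' (th, x) (e, 0))" if "th \<in> \<Theta>" for th x
  unfolding param_jacobian_def jacobian_def frechet_derivative_at[OF dT[OF that], symmetric] ..
 have col: "column j (param_jacobian T th x) = F' (th, x) (axis j 1, 0)" if "th \<in> \<Theta>" for th x j
  unfolding pj[OF that] by (simp add: column_def matrix_def vec_eq_iff)
 have vT: "param_velocity T th j (T th x) = column j (param_jacobian T th x)" if "th \<in> \<Theta>" for th x j
  unfolding param_velocity_def using T_inv[OF that] by (simp add: bij_is_inj inv_f_f)
 define \<Phi> where "\<Phi> z = (fst z, T (fst z) (snd z))" for z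
 have \<Phi>c: "continuous_on (\<Theta> \<times> UNIV) \<Phi>"
  unfolding \<Phi>_def [abs_def] using Fc by (intro continuous_intros) (simp add: case_prod_beta')
 have \<Phi>i: "inj_on \<Phi> (\<Theta> \<times> UNIV)"
 proof (rule inj_onI)
  fix z z' :: "(real^'m) \<times> (real^'d)"
  assume z: "z \<in> \<Theta> \<times> UNIV" and e: "\<Phi> z = \<Phi> z'"
  have e1: "fst z = fst z'" using arg_cong[OF e, of fst] by (simp add: \<Phi>_def)
  have e0: "T (fst z) (snd z) = T (fst z') (snd z')" using arg_cong[OF e, of snd] by (simp add: \<Phi>_def)
  have e2: "T (fst z) (snd z) = T (fst z) (snd z')" using e0 unfolding e1 .
  have "inj (T (fst z))" by (rule bij_is_inj[OF T_inv]) (use z in auto)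
  then have "snd z = snd z'" using e2 by (rule injD)
  then show "z = z'" using e1 by (simp add: prod_eq_iff)
 qed
 have im: "\<Phi> ` (\<Theta> \<times> UNIV) = \<Theta> \<times> UNIV"
 proof
  show "\<Phi> ` (\<Theta> \<times> UNIV) \<subseteq> \<Theta> \<times> UNIV" by (auto simp: \<Phi>_def)
  show "\<Theta> \<times> UNIV \<subseteq> \<Phi> ` (\<Theta> \<times> UNIV)"
  proof
   fix z :: "(real^'m) \<times> (real^'d)" assume z: "z \<in> \<Theta> \<times> UNIV"
   then have "T (fst z) (inv (T (fst z)) (snd z)) = snd z"
    using T_inv[of "fst z"] by (auto simp: bij_is_surj surj_f_inv_f)
   then show "z \<in> \<Phi> ` (\<Theta> \<times> UNIV)"
    using z by (intro image_eqI[where x="(fst z, inv (T (fst z)) (snd z))"]) (auto simp: \<Phi>_def)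
  qed
 qed
 obtain g where hom: "homeomorphism (\<Theta> \<times> UNIV) (\<Phi> ` (\<Theta> \<times> UNIV)) \<Phi> g"
  using invariance_of_domain_homeomorphism[OF opS \<Phi>c order_refl \<Phi>i] by blast
 have gc: "continuous_on (\<Theta> \<times> UNIV) g" using hom unfolding homeomorphism_def im by blast
 have ginv: "snd (g (th, y)) = inv (T th) y" if "th \<in> \<Theta>" for th y
 proof -
  have "g (\<Phi> (th, inv (T th) y)) = (th, inv (T th) y)" using hom that unfolding homeomorphism_def by auto
  moreover have "\<Phi> (th, inv (T th) y) = (th, y)" using T_inv[OF that] by (simp add: \<Phi>_def bij_is_surj surj_f_inv_f)
  ultimately show ?thesis by simp
 qed
 define X where "X z = inv (T (fst z)) (snd z)" for z
 have Xc: "continuous_on (\<Theta> \<times> UNIV) X"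
 proof -
  have "continuous_on (\<Theta> \<times> UNIV) (%z. snd (g z))" by (intro continuous_intros gc)
  then show ?thesis by (rule continuous_on_eq) (use ginv in \<open>auto simp: X_def\<close>)
 qed
 have F'X: "continuous_on (\<Theta> \<times> UNIV) (%z. F' (fst z, X z))"
  by (rule continuous_on_compose2[OF F'c]) (auto intro!: continuous_intros Xc)
 have F'Xh: "continuous_on (\<Theta> \<times> UNIV) (%z. F' (fst z, X z) h)" for h
  by (rule bounded_bilinear.continuous_on[OF bounded_bilinear_blinfun_apply F'X continuous_on_const])
 have F'x: "continuous_on UNIV (%x. F' (th, x) h)" if "th \<in> \<Theta>" for th h
 proof -
  have "continuous_on UNIV (%x. F' (th, x))"
   by (rule continuous_on_compose2[OF F'c]) (use that in \<open>auto intro!: continuous_intros\<close>)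
  then show ?thesis by (rule bounded_bilinear.continuous_on[OF bounded_bilinear_blinfun_apply _ continuous_on_const])
 qed
 have J: "\<rho> th (T th x) * jac (%h. F' (th, x) (0, h)) = p0 x" "\<rho> th (T th x) > 0" if t: "th \<in> \<Theta>" for th x
  using pushforward_density_jacobian[OF p p0 T_inv[OF t] dX[OF t] jac_continuous[OF F'x[OF t]] rho[OF t]
    diff_imp_cont[OF rho_diff[OF t]]] by blast+
 have TX: "T th (X (th, y)) = y" if "th \<in> \<Theta>" for th y
  using T_inv[OF that] by (simp add: X_def bij_is_surj surj_f_inv_f)
 have rho_pos: "\<rho> th y > 0" if "th \<in> \<Theta>" for th y using J(2)[OF that, of "X (th, y)"] by (simp add: TX[OF that])
 have jn: "jac (%h. F' (th, x) (0, h)) ~= 0" if "th \<in> \<Theta>" for th x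
  using J(1)[OF that, of x] p0(2)[of x] by auto
 have rho_c: "continuous_on (\<Theta> \<times> UNIV) (%z. \<rho> (fst z) (snd z))"
 proof -
  have "continuous_on (\<Theta> \<times> UNIV) (%z. p0 (X z) / jac (%h. F' (fst z, X z) (0, h)))"
  proof (intro continuous_on_divide jac_continuous F'Xh ballI)
   show "continuous_on (\<Theta> \<times> UNIV) (%z. p0 (X z))" by (rule continuous_on_compose2[OF p0(1) Xc]) simp
   show "jac (%h. F' (fst z, X z) (0, h)) ~= 0" if "z \<in> \<Theta> \<times> UNIV" for z using jn that by auto
  qed
  then show ?thesis
  proof (rule continuous_on_eq)
   fix z :: "(real^'m) \<times> (real^'d)" assume "z \<in> \<Theta> \<times> UNIV"
   then have t: "fst z \<in> \<Theta>" by auto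
   have "\<rho> (fst z) (snd z) * jac (%h. F' (fst z, X z) (0, h)) = p0 (X z)"
    using J(1)[OF t, of "X z"] TX[OF t, of "snd z"] by simp
   then show "p0 (X z) / jac (%h. F' (fst z, X z) (0, h)) = \<rho> (fst z) (snd z)"
    using jn[OF t, of "X z"] by (metis nonzero_mult_div_cancel_right)
  qed
 qed
 show ?thesis
 proof (rule density_family.intro)
  show "open \<Theta>" by (rule Theta)
  show "prob_space p" by (rule p(1))
  show "sets p = sets borel" by (simp add: p(2))
  show "distributed p lborel (T th) (%y. ennreal (\<rho> th y))" if "th \<in> \<Theta>" for th by (rule rho[OF that])
  show "\<rho> th y > 0" if "th \<in> \<Theta>" for th y by (rule rho_pos[OF that])
  show "\<rho> th differentiable (at y)" if "th \<in> \<Theta>" for th y by (rule rho_diff[OF that])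
  show "continuous_on (\<Theta> \<times> UNIV) (%z. \<rho> (fst z) (snd z))" by (rule rho_c)
  show "continuous_on (\<Theta> \<times> UNIV) (%z. param_velocity T (fst z) j (snd z))" for j
   by (rule continuous_on_eq[OF F'Xh[of "(axis j 1, 0)"]]) (auto simp: param_velocity_def col X_def)
  show "((%th. T th x) has_derivative (%e. \<Sum>j\<in>UNIV. e $ j *\<^sub>R param_velocity T th j (T th x))) (at th)"
   if t: "th \<in> \<Theta>" for th x
  proof -
   have lin: "linear (%e. F' (th, x) (e, 0))" using dT[OF t] by (rule has_derivative_linear)
   have "F' (th, x) (e, 0) = (\<Sum>j\<in>UNIV. e $ j *\<^sub>R param_velocity T th j (T th x))" for e
   proof -
    have "F' (th, x) (e, 0) = param_jacobian T th x *v e" unfolding pj[OF t] using matrix_works[of "%e. F' (th, x) (e, 0)" e] lin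
    by (simp add: linear_matrix_vector_mul_eq)
    also have "... = (\<Sum>j\<in>UNIV. e $ j *\<^sub>R param_velocity T th j (T th x))"
    by (simp add: matrix_mult_sum scalar_mult_eq_scaleR vT[OF t])
    finally show ?thesis .
   qed
   then show ?thesis using dT[OF t, of x] by simp
  qed
  show "\<exists>r>0. \<exists>L. integrable p L & (\<forall>th\<in>\<Theta>. norm (th - th0) < r --> (\<forall>x j. (norm (param_velocity T th j (T th x)))\<^sup>2 <= L x))"
   if t0: "th0 \<in> \<Theta>" for th0
  proof -
   obtain r L where r: "r > 0" and L: "integrable p L"
    and le: "\<forall>x. \<forall>th\<in>\<Theta>. norm (th - th0) < r --> (norm (param_jacobian T th x))\<^sup>2 <= L x"
    using condition2[OF t0] by blast
   have "(norm (param_velocity T th j (T th x)))\<^sup>2 <= L x" if t: "th \<in> \<Theta>" "norm (th - th0) < r" for th x j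
   proof -
    have "(norm (param_velocity T th j (T th x)))\<^sup>2 <= (norm (param_jacobian T th x))\<^sup>2"
    unfolding vT[OF t(1)] by (intro power_mono norm_column_le) simp
    also have "... <= L x" using le t by blast
    finally show ?thesis .
   qed
   with r L show ?thesis by blast
  qed
 qed (fact m)+
qed

text \<open>The function \<open>exp (b t) (u t - a / b)\<close> is nonincreasing.\<close>

lemma exponential_relaxation:
 fixes u u' :: "real => real"
 assumes d: "!!t. t >= 0 ==> (u has_real_derivative u' t) (at t within {0..})"
  and le: "!!t. t >= 0 ==> u' t <= a - b * u t" and b: "b > 0" and t: "t >= 0"
 shows "u t <= a / b * (1 - exp (- (b * t))) + u 0 * exp (- (b * t))"
proof -
 define w where "w t = exp (b * t) * (u t - a / b)" for t
 have wd: "(w has_real_derivative exp (b * s) * b * (u s - a / b) + exp (b * s) * u' s) (at s within {0..t})" if "0 <= s" for s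
 proof -
  have us: "(u has_real_derivative u' s) (at s within {0..t})" by (rule DERIV_subset[OF d[OF that]]) auto
  have es: "((%t. exp (b * t)) has_real_derivative exp (b * s) * b) (at s within {0..t})"
   by (auto intro!: derivative_eq_intros)
  have uc: "((%t. u t - a / b) has_real_derivative u' s) (at s within {0..t})"
   using DERIV_diff[OF us DERIV_const[of "a / b"]] by simp
  show ?thesis unfolding w_def [abs_def] using DERIV_mult[OF es uc] by (simp add: mult.commute add.commute)
 qed
 obtain s where s: "s \<in> {0..t}" "w t - w 0 = (exp (b * s) * b * (u s - a / b) + exp (b * s) * u' s) * (t - 0)"
  using mvt_very_simple[OF t, of w "%s. (*) (exp (b * s) * b * (u s - a / b) + exp (b * s) * u' s)"] wd
  unfolding has_field_derivative_def by auto
 have "exp (b * s) * b * (u s - a / b) + exp (b * s) * u' s = exp (b * s) * (b * (u s - a / b) + u' s)"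
  by (simp add: algebra_simps)
 also have "... <= 0"
 proof (rule mult_nonneg_nonpos)
  have "b * (u s - a / b) = b * u s - a" using b by (simp add: right_diff_distrib)
  then show "b * (u s - a / b) + u' s <= 0" using le[of s] s(1) by simp
 qed simp
 finally have "w t - w 0 <= 0" unfolding s(2) using t by (simp add: mult_nonpos_nonneg)
 then have "exp (- (b * t)) * (exp (b * t) * (u t - a / b)) <= exp (- (b * t)) * (u 0 - a / b)"
  by (intro mult_left_mono) (simp_all add: w_def)
 moreover have "exp (- (b * t)) * (exp (b * t) * (u t - a / b)) = u t - a / b"
  by (simp add: mult.assoc[symmetric] exp_add[symmetric])
 ultimately show ?thesis by (simp add: algebra_simps)
qed

section \<open>Exponential relaxation of the relative entropy\<close>

lemma positive_definite_matrix_inv: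
 fixes A :: "real^'n^'n"
 assumes "positive_definite A"
 shows "A *v (matrix_inv A *v x) = x"
proof -
 have "\<forall>x. A *v x = 0 --> x = 0" using assms unfolding positive_definite_def by (metis inner_zero_right less_irrefl)
 then have "invertible A" unfolding invertible_left_inverse matrix_left_invertible_ker .
 then have "\<exists>B. A ** B = mat 1 & B ** A = mat 1" by (simp add: invertible_def)
 then have "A ** matrix_inv A = mat 1 & matrix_inv A ** A = mat 1" unfolding matrix_inv_def by (rule someI_ex)
 then show ?thesis by (simp add: matrix_vector_mul_assoc)
qed

lemma gibbs_density:
 fixes V :: "real^'n => real"
 assumes C2: "C2_on UNIV V" and D: "D > 0" and Z: "integrable lborel (%x. exp (- V x / D))" "(LINT x|lborel. exp (- V x / D)) > 0"
 shows "gibbs V D y > 0" "integrable lborel (gibbs V D)" "(LINT y|lborel. gibbs V D y) = 1"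
  and "gibbs V D differentiable (at y)" "continuous_on UNIV (grad (%y. ln (gibbs V D y)))"
  and "ln (gibbs V D y) = - V y / D - ln (LINT x|lborel. exp (- V x / D))"
proof -
 let ?Z = "LINT x|lborel. exp (- V x / D)"
 show "gibbs V D y > 0" for y using Z(2) by (simp add: gibbs_def)
 show "integrable lborel (gibbs V D)" unfolding gibbs_def [abs_def] using Z(1) by simp
 show "(LINT y|lborel. gibbs V D y) = 1" unfolding gibbs_def using Z by simp
 have eg: "gibbs V D = (%y. (%s. exp (- s / D) / ?Z) (V y))" by (simp add: gibbs_def fun_eq_iff)
 have "((%s. exp (- s / D)) has_real_derivative exp (- s / D) * (- 1 / D)) (at s)" for s
  using D by (auto intro!: derivative_eq_intros)
 from grad_compose_real(3)[OF C2_real(1)[OF C2] DERIV_cdivide[OF this, where c="?Z"]]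
 show "gibbs V D differentiable (at y)" for y unfolding eg by simp
 show ln: "ln (gibbs V D y) = - V y / D - ln ?Z" for y
  unfolding gibbs_def using Z(2) by (simp add: ln_divide_pos)
 have "((%s. - s / D - c) has_real_derivative - 1 / D) (at s)" for s c
  using D by (auto intro!: derivative_eq_intros)
 from grad_compose_real(2)[OF C2_real(1)[OF C2] this[where c="ln ?Z"]]
 have "grad (%y. ln (gibbs V D y)) = (%y. (- 1 / D) *\<^sub>R grad V y)" by (simp add: ln fun_eq_iff)
 then show "continuous_on UNIV (grad (%y. ln (gibbs V D y)))" by (simp, intro continuous_intros C2_real(2)[OF C2])
qed

theorem theorem5p1:
  fixes D K :: real
    and V U \<phi> :: "real^'d \<Rightarrow> real"
    and \<Theta> :: "(real^'m) set"
    and T :: "real^'m \<Rightarrow> real^'d \<Rightarrow> real^'d"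
    and p :: "(real^'d) measure"
    and p0 :: "real^'d \<Rightarrow> real"
    and \<rho> :: "real^'m \<Rightarrow> real^'d \<Rightarrow> real"
    and \<psi> :: "'m \<Rightarrow> real^'m \<Rightarrow> real^'d \<Rightarrow> real"
    and \<gamma> :: "real \<Rightarrow> real^'m"
  assumes D: "D > 0"
    and Theta: "open \<Theta>" "convex \<Theta>"
    and T_inv: "\<And>\<theta>. \<theta> \<in> \<Theta> \<Longrightarrow> bij (T \<theta>)"
    and T_C2: "C2_on (\<Theta> \<times> UNIV) (\<lambda>(\<theta>, x). T \<theta> x)"
    and p: "prob_space p" "p = density lborel (\<lambda>x. ennreal (p0 x))"
    and p0: "continuous_on UNIV p0" "\<And>x. p0 x > 0"
    and p_moment: "integrable p (\<lambda>x. (norm x)\<^sup>2)"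
    and rho: "\<And>\<theta>. \<theta> \<in> \<Theta> \<Longrightarrow> distributed p lborel (T \<theta>) (\<lambda>y. ennreal (\<rho> \<theta> y))"
    and rho_diff: "\<And>\<theta> y. \<theta> \<in> \<Theta> \<Longrightarrow> \<rho> \<theta> differentiable (at y)"
    and condition1: "\<And>\<theta>. \<theta> \<in> \<Theta> \<Longrightarrow> integrable p (\<lambda>x. (norm (T \<theta> x))\<^sup>2)"
    and condition2: "\<And>\<theta>\<^sub>0. \<theta>\<^sub>0 \<in> \<Theta> \<Longrightarrow>
      \<exists>r>0. \<exists>L1 L2. integrable p L1 \<and> integrable p L2 \<and>
        (\<forall>x. \<forall>\<theta>\<in>\<Theta>. norm (\<theta> - \<theta>\<^sub>0) < r \<longrightarrow>
          norm (param_jacobian T \<theta> x) \<le> L1 x \<and> (norm (param_jacobian T \<theta> x))\<^sup>2 \<le> L2 x)"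
    and psi: "\<And>\<theta> j. \<theta> \<in> \<Theta> \<Longrightarrow> solves_potential_eq (\<rho> \<theta>) (param_velocity T \<theta> j) (\<psi> j \<theta>)"
    and G_pos: "\<And>\<theta>. \<theta> \<in> \<Theta> \<Longrightarrow> positive_definite (metric_tensor p T \<psi> \<theta>)"
    and V: "\<And>x. V x = U x + \<phi> x"
    and V_C2: "C2_on UNIV V"
    and U_C2: "C2_on UNIV U"
    and phi_C2: "C2_on UNIV \<phi>"
    and K: "K > 0" "\<And>x. loewner_le (K *\<^sub>R mat 1) (hessian U x)"
    and phi_bounded: "bounded (range \<phi>)"
    and flow: "solves_parametric_FP \<Theta> (metric_tensor p T \<psi>) (free_energy V D \<rho>) \<gamma>"
  shows "lsi_const K D \<phi> > 0 \<and> (\<forall>t\<ge>0. KL (\<rho> (\<gamma> t)) (gibbs V D)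
      \<le> enn2ereal (delta0 \<Theta> V D \<rho> \<psi>) / ereal (lsi_const K D \<phi> * D\<^sup>2)
            * ereal (1 - exp (- (D * lsi_const K D \<phi> * t)))
          + KL (\<rho> (\<gamma> 0)) (gibbs V D) * ereal (exp (- (D * lsi_const K D \<phi> * t))))"
proof -
 define \<Lambda> where "\<Lambda> = lsi_const K D \<phi>"
 define m where "m = gibbs V D"
 have \<Lambda>: "\<Lambda> > 0" using K(1) D by (simp add: \<Lambda>_def lsi_const_def)
 note Uc = C2_real(3)[OF U_C2]
 note Ui = integrable_exp_uniformly_convex[OF U_C2 K(2) K(1) D]
 have cv: "U (t *\<^sub>R x + s *\<^sub>R y) <= t * U x + s * U y - K / 2 * t * s * (norm (x - y))\<^sup>2"
  if "t > 0" "s > 0" "t + s = 1" for x y t s by (rule uniformly_convex[OF U_C2 K(2) that])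
 note gibbs_lsi = log_sobolev_gibbs[where U=U and \<phi>=\<phi> and V=V and D=D and K=K, OF D K(1) Uc Ui _ C2_real(3)[OF phi_C2] phi_bounded V]
 have lsi: "integrable lborel (%x. exp (- V x / D))" "(LINT x|lborel. exp (- V x / D)) > 0"
  "log_sobolev (gibbs V D) (1 / lsi_const K D \<phi>)"
 proof -
  show "integrable lborel (%x. exp (- V x / D))" by (rule gibbs_lsi(1), rule cv)
  show "(LINT x|lborel. exp (- V x / D)) > 0" by (rule gibbs_lsi(2), rule cv)
  show "log_sobolev (gibbs V D) (1 / lsi_const K D \<phi>)" by (rule gibbs_lsi(3), rule cv)
 qed
 note gd = gibbs_density[OF V_C2 D lsi(1,2), folded m_def]
 have LS: "log_sobolev m (1 / \<Lambda>)" using lsi(3) by (simp add: m_def \<Lambda>_def)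
 have c2: "\<exists>r>0. \<exists>L. integrable p L & (\<forall>x. \<forall>th\<in>\<Theta>. norm (th - th0) < r --> (norm (param_jacobian T th x))\<^sup>2 <= L x)"
  if "th0 \<in> \<Theta>" for th0 using condition2[OF that] by blast
 interpret df: density_family \<Theta> p T \<rho> "param_velocity T" m
  by (rule density_family_of_transport_maps[where \<Theta>=\<Theta> and T=T and p=p and \<rho>=\<rho> and m=m, OF Theta(1) T_inv T_C2 p p0 rho rho_diff c2 gd(1-5)])
 have psi_d: "\<psi> j th differentiable (at y)" if "th \<in> \<Theta>" for th j y
  using psi[OF that] unfolding solves_potential_eq_def by blast
 have psi_m: "grad (\<psi> j th) \<in> borel_measurable borel" if "th \<in> \<Theta>" for th j by (rule grad_measurable[OF psi_d[OF that]])
 have Gij: "metric_tensor p T \<psi> th $ i $ j = (LINT y|df.M th. grad (\<psi> i th) y \<bullet> grad (\<psi> j th) y)" if t: "th \<in> \<Theta>" for th i j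
 proof -
  have "(%y. grad (\<psi> i th) y \<bullet> grad (\<psi> j th) y) \<in> borel_measurable borel" using psi_m[OF t] by measurable
  from df.integral_M(1)[OF t this] show ?thesis by (simp add: metric_tensor_def)
 qed
 have psi_L2: "integrable (df.M th) (%y. (norm (grad (\<psi> j th) y))\<^sup>2)" if t: "th \<in> \<Theta>" for th j
 proof (rule ccontr)
  assume "\<not> ?thesis"
  then have "metric_tensor p T \<psi> th $ j $ j = 0"
   unfolding Gij[OF t] by (simp add: power2_norm_eq_inner not_integrable_integral_eq)
  moreover have "0 < axis j 1 \<bullet> (metric_tensor p T \<psi> th *v axis j 1)"
   using G_pos[OF t] unfolding positive_definite_def by (simp add: axis_eq_0_iff)
  ultimately show False by (simp add: inner_axis' matrix_vector_mult_basis column_def)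
 qed
 have psi_weak: "(LINT y|df.M th. (grad (\<psi> j th) y - param_velocity T th j y) \<bullet> grad q y) = 0"
  if t: "th \<in> \<Theta>" and q: "test2 R q" for th j R q
 proof -
  have qc: "continuous_on UNIV (grad q)" using q by (simp add: test2_def)
  have "{x. q x ~= 0} \<subseteq> cball 0 R" using q by (force simp: test2_def not_le)
  then have "test_function q" using q bounded_subset[OF bounded_cball] by (auto simp: test_function_def test2_def)
  then have i: "integrable lborel (%x. (\<rho> th x *\<^sub>R grad (\<psi> j th) x) \<bullet> grad q x)"
    "integrable lborel (%x. (\<rho> th x *\<^sub>R param_velocity T th j x) \<bullet> grad q x)"
   and e: "(LINT x|lborel. (\<rho> th x *\<^sub>R grad (\<psi> j th) x) \<bullet> grad q x) = (LINT x|lborel. (\<rho> th x *\<^sub>R param_velocity T th j x) \<bullet> grad q x)"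
   using psi[OF t, of j] unfolding solves_potential_eq_def same_divergence_def by blast+
  have hm: "(%y. (grad (\<psi> j th) y - param_velocity T th j y) \<bullet> grad q y) \<in> borel_measurable borel"
   using psi_m[OF t] df.v_m[OF t] borel_of_cont[OF qc] by measurable
  have "(LINT y|df.M th. (grad (\<psi> j th) y - param_velocity T th j y) \<bullet> grad q y)
    = (LINT x|lborel. (\<rho> th x *\<^sub>R grad (\<psi> j th) x) \<bullet> grad q x - (\<rho> th x *\<^sub>R param_velocity T th j x) \<bullet> grad q x)"
   unfolding df.integral_M_lborel(1)[OF t hm] by (simp add: inner_diff_left right_diff_distrib)
  also have "... = 0" unfolding Bochner_Integration.integral_diff[OF i] using e by simp
  finally show ?thesis .
 qed
 have gram: "0 < (LINT y|df.M th. (norm (gradient_comb \<psi> th \<xi> y))\<^sup>2)" if t: "th \<in> \<Theta>" and x: "\<xi> ~= 0" for th \<xi>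
 proof -
  have i: "integrable (df.M th) (%y. grad (\<psi> i th) y \<bullet> grad (\<psi> j th) y)" for i j
   by (rule df.cs_M(1)[OF t psi_m[OF t] psi_m[OF t] psi_L2[OF t] psi_L2[OF t]])
  have "(LINT y|df.M th. (norm (gradient_comb \<psi> th \<xi> y))\<^sup>2)
    = (LINT y|df.M th. (\<Sum>i\<in>UNIV. \<xi> $ i * (\<Sum>j\<in>UNIV. \<xi> $ j * (grad (\<psi> i th) y \<bullet> grad (\<psi> j th) y))))"
   unfolding gradient_comb_def power2_norm_eq_inner by (simp only: inner_sum_left inner_scaleR_left) (simp add: inner_sum_right)
  also have "... = (\<Sum>i\<in>UNIV. \<xi> $ i * (\<Sum>j\<in>UNIV. \<xi> $ j * metric_tensor p T \<psi> th $ i $ j))"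
   using i by (simp add: Gij[OF t])
  also have "... = \<xi> \<bullet> (metric_tensor p T \<psi> th *v \<xi>)"
   by (simp add: inner_vec_def matrix_vector_mult_def mult.commute)
  also have "... > 0" using G_pos[OF t] x unfolding positive_definite_def by blast
  finally show ?thesis .
 qed
 have "KL (\<rho> (\<gamma> t)) m <= enn2ereal (delta0 \<Theta> V D \<rho> \<psi>) / ereal (\<Lambda> * D\<^sup>2) * ereal (1 - exp (- (D * \<Lambda> * t)))
   + KL (\<rho> (\<gamma> 0)) m * ereal (exp (- (D * \<Lambda> * t)))" if t0: "t >= 0" for t
 proof -
  define u where "u th = (LINT y|lborel. \<rho> th y * df.f th y)" for th
  have KLi: "KL (\<rho> th) m = (if integrable lborel (%y. \<rho> th y * df.f th y) then ereal (u th) else \<infinity>)" for th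
   by (simp add: KL_def u_def df.f_def)
  have Hu: "real_of_ereal (free_energy V D \<rho> th) = D * u th" for th
   unfolding free_energy_def m_def[symmetric] KLi using D by (auto simp: u_def not_integrable_integral_eq)
  have fin_iff: "integrable lborel (%y. \<rho> th y * df.f th y)" if "\<bar>free_energy V D \<rho> th\<bar> ~= \<infinity>" for th
   using that D unfolding free_energy_def m_def[symmetric] KLi by (auto split: if_splits)
  define good where "good s g \<longleftrightarrow> has_gradient (free_energy V D \<rho>) g (\<gamma> s) &
   (\<gamma> has_vector_derivative - (matrix_inv (metric_tensor p T \<psi> (\<gamma> s)) *v g)) (at s within {0..})" for s g
  have in\<Theta>: "\<gamma> s \<in> \<Theta>" and ex: "\<exists>g. good s g" if "s >= 0" for s
   using flow that unfolding solves_parametric_FP_def good_def by blast+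
  have fin: "\<forall>\<^sub>F th in nhds (\<gamma> s). integrable lborel (%y. \<rho> th y * df.f th y)" if s: "s >= 0" for s
  proof -
   obtain g where "good s g" using ex[OF s] by blast
   then have "\<forall>\<^sub>F th in nhds (\<gamma> s). \<bar>free_energy V D \<rho> th\<bar> ~= \<infinity>" unfolding good_def has_gradient_def by blast
   then show ?thesis by (rule eventually_mono) (rule fin_iff)
  qed
  have KLu: "KL (\<rho> (\<gamma> s)) m = ereal (u (\<gamma> s))" if "s >= 0" for s
   using eventually_nhds_x_imp_x[OF fin[OF that]] by (simp add: KLi)
  show ?thesis
  proof (cases "delta0 \<Theta> V D \<rho> \<psi> = \<top>")
   case True
   show ?thesis
   proof (cases "t = 0")
    case False
    with t0 have "0 < D * \<Lambda> * t" using D \<Lambda> by simp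
    then have "1 - exp (- (D * \<Lambda> * t)) > 0" by simp
    then show ?thesis using True \<Lambda> D by (simp add: KLu)
   qed (use True in \<open>simp add: zero_ereal_def[symmetric] one_ereal_def[symmetric]\<close>)
  next
   case False
   define \<delta> where "\<delta> = enn2real (delta0 \<Theta> V D \<rho> \<psi>)"
   have \<delta>: "delta0 \<Theta> V D \<rho> \<psi> = ennreal \<delta>" "\<delta> >= 0" using False by (simp_all add: \<delta>_def less_top)
   define \<kappa> where "\<kappa> = \<delta> / D\<^sup>2"
   have D2: "D\<^sup>2 > 0" using D by simp
   have defect: "\<exists>\<xi>. integrable (df.M th) (%y. (norm (gradient_comb \<psi> th \<xi> y - grad (df.f th) y))\<^sup>2) &
    (LINT y|df.M th. (norm (gradient_comb \<psi> th \<xi> y - grad (df.f th) y))\<^sup>2) <= \<kappa> + \<epsilon>" if t: "th \<in> \<Theta>" and e: "\<epsilon> > 0" for th \<epsilon>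
   proof -
    let ?Z = "LINT x|lborel. exp (- V x / D)"
    let ?F = "%y. V y + D * ln (\<rho> th y)"
    have "?F = (%y. D * df.f th y - D * ln ?Z)"
    proof
    fix y
    have "df.f th y = ln (\<rho> th y) - ln (m y)"
    unfolding df.f_def by (rule ln_divide_pos) (use df.rho_pos[OF t] df.m_pos in auto)
    then have "df.f th y = ln (\<rho> th y) + V y / D + ln ?Z" using gd(6)[of y] by simp
    then show "?F y = D * df.f th y - D * ln ?Z" using D by (simp add: distrib_left)
    qed
    then have gF: "grad ?F y = D *\<^sub>R grad (df.f th) y" for y
    using has_derivative_diff[OF has_derivative_mult_right[OF grad_has_derivative[OF df.f_diff[OF t]], of D] has_derivative_const[of "D * ln ?Z"]]
    by (intro grad_eqI) simp
    define \<Phi> where "\<Phi> \<xi> y = (\<Sum>k\<in>UNIV. \<xi> $ k *\<^sub>R grad (\<psi> k th) y) - grad ?F y" for \<xi> y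
    have "(INF \<xi>. \<integral>\<^sup>+y. ennreal ((norm (\<Phi> \<xi> y))\<^sup>2 * \<rho> th y) \<partial>lborel) <= ennreal \<delta>"
    unfolding \<delta>(1)[symmetric] delta0_def \<Phi>_def by (rule SUP_upper[OF t])
    also have "... < ennreal (\<delta> + D\<^sup>2 * \<epsilon>)" using \<delta>(2) e D2 by (simp add: ennreal_less_iff)
    finally obtain \<xi> where x: "(\<integral>\<^sup>+y. ennreal ((norm (\<Phi> \<xi> y))\<^sup>2 * \<rho> th y) \<partial>lborel) < ennreal (\<delta> + D\<^sup>2 * \<epsilon>)"
    unfolding INF_less_iff by blast
    define \<xi>' where "\<xi>' = (1 / D) *\<^sub>R \<xi>"
    have \<Phi>e: "\<Phi> \<xi> y = D *\<^sub>R (gradient_comb \<psi> th \<xi>' y - grad (df.f th) y)" for y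
    unfolding \<Phi>_def gF gradient_comb_def \<xi>'_def using D by (simp add: scaleR_diff_right scaleR_sum_right)
    have \<Phi>m: "\<Phi> \<xi> \<in> borel_measurable borel"
    unfolding \<Phi>_def [abs_def] gF using psi_m[OF t] df.gf_m[OF t] by measurable
    have "(\<integral>\<^sup>+y. ennreal ((norm (\<Phi> \<xi> y))\<^sup>2) \<partial>df.M th) = (\<integral>\<^sup>+y. ennreal ((norm (\<Phi> \<xi> y))\<^sup>2 * \<rho> th y) \<partial>lborel)"
    unfolding df.M_def using \<Phi>m df.rho_m[OF t] df.rho_pos[OF t]
    by (subst nn_integral_density) (auto simp: ennreal_mult[symmetric] less_imp_le mult.commute)
    then have le: "(\<integral>\<^sup>+y. ennreal ((norm (\<Phi> \<xi> y))\<^sup>2) \<partial>df.M th) <= ennreal (\<delta> + D\<^sup>2 * \<epsilon>)" using x by simp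
    have \<Phi>m': "\<Phi> \<xi> \<in> borel_measurable (df.M th)" using \<Phi>m by (simp add: df.sets_M cong: measurable_cong_sets)
    have nn: "\<delta> + D\<^sup>2 * \<epsilon> >= 0" using \<delta>(2) e by simp
    note sq = nn_integral_sq_finite_imp_integrable[OF \<Phi>m' le nn]
    have ne: "(norm (gradient_comb \<psi> th \<xi>' y - grad (df.f th) y))\<^sup>2 = (norm (\<Phi> \<xi> y))\<^sup>2 / D\<^sup>2" for y
    using D by (simp add: \<Phi>e power_mult_distrib)
    have "(LINT y|df.M th. (norm (gradient_comb \<psi> th \<xi>' y - grad (df.f th) y))\<^sup>2) = (LINT y|df.M th. (norm (\<Phi> \<xi> y))\<^sup>2) / D\<^sup>2"
    unfolding ne by simp
    also have "... <= (\<delta> + D\<^sup>2 * \<epsilon>) / D\<^sup>2" using sq(2) D2 by (intro divide_right_mono) auto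
    also have "... = \<kappa> + \<epsilon>" using D by (simp add: \<kappa>_def add_divide_distrib)
    finally have "(LINT y|df.M th. (norm (gradient_comb \<psi> th \<xi>' y - grad (df.f th) y))\<^sup>2) <= \<kappa> + \<epsilon>" .
    moreover have "integrable (df.M th) (%y. (norm (gradient_comb \<psi> th \<xi>' y - grad (df.f th) y))\<^sup>2)"
    unfolding ne using sq(1) by simp
    ultimately show ?thesis by blast
   qed
   note pf = psi_d psi_weak psi_L2 gram defect
   have gi: "integrable (df.M th) (%y. (norm (grad (df.f th) y))\<^sup>2)" if "th \<in> \<Theta>" for th
    by (rule df.score_L2[OF pf that])
   have bnd: "\<exists>C. \<forall>k. (LINT y|df.M (tk k). (norm (grad (df.f (tk k)) y))\<^sup>2) <= C"
    if "!!k. tk k \<in> \<Theta>" "tk \<longlonglongrightarrow> th0" "th0 \<in> \<Theta>" for tk th0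
    by (rule df.fisher_information_bounded[OF pf that])
   have step: "\<exists>w. ((%s. u (\<gamma> s)) has_real_derivative w) (at s within {0..}) & w <= \<delta> / D - D * \<Lambda> * u (\<gamma> s)" if s: "s >= 0" for s
   proof -
    obtain g where hg: "has_gradient (free_energy V D \<rho>) g (\<gamma> s)"
    and hv: "(\<gamma> has_vector_derivative - (matrix_inv (metric_tensor p T \<psi> (\<gamma> s)) *v g)) (at s within {0..})"
    using ex[OF s] unfolding good_def by blast
    note t = in\<Theta>[OF s]
    have dH: "((%th. D * u th) has_derivative (%h. h \<bullet> g)) (at (\<gamma> s))"
    using hg unfolding has_gradient_def gderiv_def Hu by blast
    have du: "(u has_derivative (%h. h \<bullet> ((1 / D) *\<^sub>R g))) (at (\<gamma> s))"
    using has_derivative_mult_right[OF dH, of "1 / D"] D by simp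
    define a where "a = (\<chi> j. LINT y|df.M (\<gamma> s). grad (df.f (\<gamma> s)) y \<bullet> param_velocity T (\<gamma> s) j y)"
    have der: "GDERIV (%th. LINT y|lborel. \<rho> th y * df.f th y) (\<gamma> s) :> (1 / D) *\<^sub>R g"
    using du unfolding gderiv_def u_def [abs_def] .
    have "((1 / D) *\<^sub>R g) $ j = (LINT y|df.M (\<gamma> s). grad (df.f (\<gamma> s)) y \<bullet> param_velocity T (\<gamma> s) j y)" for j
    proof (rule df.entropy_gradient[OF t fin[OF s] der])
    show "integrable (df.M th) (%y. (norm (grad (df.f th) y))\<^sup>2)" if "th \<in> \<Theta>" for th by (rule gi[OF that])
    show "\<exists>C. \<forall>k. (LINT y|df.M (tk k). (norm (grad (df.f (tk k)) y))\<^sup>2) <= C"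
    if "!!k. tk k \<in> \<Theta>" "tk \<longlonglongrightarrow> \<gamma> s" for tk by (rule bnd[OF that t])
    qed
    then have "((1 / D) *\<^sub>R g) $ j = a $ j" for j by (simp only: a_def vec_lambda_beta)
    then have ga: "(1 / D) *\<^sub>R g = a" by (simp add: vec_eq_iff)
    then have g: "g = D *\<^sub>R a" using D by auto
    define \<eta> where "\<eta> = matrix_inv (metric_tensor p T \<psi> (\<gamma> s)) *v a"
    have G\<eta>: "metric_tensor p T \<psi> (\<gamma> s) *v \<eta> = a" unfolding \<eta>_def by (rule positive_definite_matrix_inv[OF G_pos[OF t]])
    have comp: "(\<Sum>j\<in>UNIV. \<eta> $ j * (LINT y|df.M (\<gamma> s). grad (\<psi> i (\<gamma> s)) y \<bullet> grad (\<psi> j (\<gamma> s)) y))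
    = (LINT y|df.M (\<gamma> s). grad (df.f (\<gamma> s)) y \<bullet> param_velocity T (\<gamma> s) i y)" for i
    proof -
    have "(metric_tensor p T \<psi> (\<gamma> s) *v \<eta>) $ i = a $ i" by (simp add: G\<eta>)
    then show ?thesis by (simp add: a_def matrix_vector_mult_def Gij[OF t] mult.commute)
    qed
    let ?I = "LINT y|df.M (\<gamma> s). (norm (grad (df.f (\<gamma> s)) y))\<^sup>2"
    have "?I <= \<kappa> + (\<Sum>i\<in>UNIV. \<eta> $ i * (LINT y|df.M (\<gamma> s). grad (df.f (\<gamma> s)) y \<bullet> param_velocity T (\<gamma> s) i y))"
    by (rule df.fisher_information_le[OF pf t comp])
    then have I1: "?I <= \<kappa> + \<eta> \<bullet> a" by (simp add: inner_vec_def a_def)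
    have fm: "(%y. (norm (grad (df.f (\<gamma> s)) y))\<^sup>2) \<in> borel_measurable borel" using df.gf_m[OF t] by measurable
    have "u (\<gamma> s) <= 1 / \<Lambda> * (LINT y|lborel. \<rho> (\<gamma> s) y * (norm (grad (df.f (\<gamma> s)) y))\<^sup>2)"
    proof -
    have ff: "df.f (\<gamma> s) = (%x. ln (\<rho> (\<gamma> s) x / m x))" by (simp add: df.f_def fun_eq_iff)
    have Ci: "1 / \<Lambda> >= 0" using \<Lambda> by simp
    have ui: "integrable lborel (%y. \<rho> (\<gamma> s) y * df.f (\<gamma> s) y)" by (rule eventually_nhds_x_imp_x[OF fin[OF s]])
    have Ii: "integrable lborel (%y. \<rho> (\<gamma> s) y * (norm (grad (df.f (\<gamma> s)) y))\<^sup>2)"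
    using gi[OF t] df.integral_M_lborel(2)[OF t fm] by simp
    show ?thesis
    unfolding u_def ff
    by (rule log_sobolev_density[OF LS Ci df.m_c df.m_pos df.m_int df.m_one df.rho_c[OF t] df.rho_pos[OF t] df.integral_rho[OF t]
    df.f_diff[OF t, unfolded ff] ui[unfolded ff] Ii[unfolded ff]])
    qed
    then have "u (\<gamma> s) <= 1 / \<Lambda> * ?I" by (simp only: df.integral_M_lborel(1)[OF t fm])
    then have I2: "\<Lambda> * u (\<gamma> s) <= ?I" using \<Lambda> by (simp add: field_simps)
    have "((%s. u (\<gamma> s)) has_derivative (%h. (h *\<^sub>R - (matrix_inv (metric_tensor p T \<psi> (\<gamma> s)) *v g)) \<bullet> ((1 / D) *\<^sub>R g))) (at s within {0..})"
    by (rule has_derivative_compose[OF hv[unfolded has_vector_derivative_def] du])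
    then have dw: "((%s. u (\<gamma> s)) has_real_derivative - (matrix_inv (metric_tensor p T \<psi> (\<gamma> s)) *v g) \<bullet> ((1 / D) *\<^sub>R g)) (at s within {0..})"
    by (rule has_derivative_imp_has_field_derivative) (simp add: mult.commute)
    have "- (matrix_inv (metric_tensor p T \<psi> (\<gamma> s)) *v g) \<bullet> ((1 / D) *\<^sub>R g) = - D * (\<eta> \<bullet> a)"
    unfolding ga unfolding g matrix_vector_mult_scaleR \<eta>_def by simp
    also have "... <= D * (\<kappa> - \<Lambda> * u (\<gamma> s))"
    proof -
    have "D * (\<Lambda> * u (\<gamma> s) - \<kappa>) <= D * (\<eta> \<bullet> a)" using I1 I2 D by (intro mult_left_mono) auto
    then show ?thesis by (simp add: right_diff_distrib)
    qed
    also have "... = \<delta> / D - D * \<Lambda> * u (\<gamma> s)" using D by (simp add: \<kappa>_def power2_eq_square right_diff_distrib)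
    finally show ?thesis using dw by blast
   qed
   have "\<forall>s. \<exists>w. s >= 0 --> ((%s. u (\<gamma> s)) has_real_derivative w) (at s within {0..}) & w <= \<delta> / D - D * \<Lambda> * u (\<gamma> s)"
    using step by blast
   from choice[OF this] obtain w where w: "\<forall>s. s >= 0 --> ((%s. u (\<gamma> s)) has_real_derivative w s) (at s within {0..}) &
    w s <= \<delta> / D - D * \<Lambda> * u (\<gamma> s)" by blast
   have "u (\<gamma> t) <= \<delta> / D / (D * \<Lambda>) * (1 - exp (- (D * \<Lambda> * t))) + u (\<gamma> 0) * exp (- (D * \<Lambda> * t))"
    by (rule exponential_relaxation[where u="%s. u (\<gamma> s)" and u'=w]) (use w D \<Lambda> t0 in auto)
   also have "\<delta> / D / (D * \<Lambda>) = \<delta> / (\<Lambda> * D\<^sup>2)" by (simp add: power2_eq_square mult.commute mult.left_commute)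
   finally have fin: "u (\<gamma> t) <= \<delta> / (\<Lambda> * D\<^sup>2) * (1 - exp (- (D * \<Lambda> * t))) + u (\<gamma> 0) * exp (- (D * \<Lambda> * t))" .
   have e: "enn2ereal (delta0 \<Theta> V D \<rho> \<psi>) = ereal \<delta>" using \<delta> by (simp add: enn2ereal_ennreal)
   have n: "\<Lambda> * D\<^sup>2 ~= 0" using \<Lambda> D by simp
   have "ereal (u (\<gamma> t)) <= ereal (\<delta> / (\<Lambda> * D\<^sup>2) * (1 - exp (- (D * \<Lambda> * t))) + u (\<gamma> 0) * exp (- (D * \<Lambda> * t)))"
    using fin by (simp only: ereal_less_eq)
   then show ?thesis unfolding KLu[OF t0] KLu[OF order_refl] e ereal_divide using n by simp
  qed
 qed
 then show ?thesis using \<Lambda> unfolding \<Lambda>_def m_def by blast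
qed

end
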